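(* There exists a universal constant $\mathbf{k}>0$ such that the following holds. Fix $0<r_0<3/4$ such that $\Omega^{4r_0}$ is nonempty, let $0<r<r_0$ and $x_0\in\Omega^{4r}$. For all $V\in\mathscr{V}$ and all $u\in W^{2,p}(\Omega)\setminus\{0\}$ satisfying $(-\Delta+V)u=0$ in $\Omega$, $$\|u\|_{L^2(B(x_0,2\rho))}\le\rho^{-\bar{\lambda}_{n/2}}\,\mathbf{M}_{n/2}\,\|u\|_{L^2(B(x_0,\rho))},\qquad 0<\rho<r/8,$$ where $$\tilde{\lambda}:=\frac{1}{\ln(9/4)}\ln\left(1+4r^{-1}\mathbf{k}\,\vartheta_V(1+\kappa_V^{(1)})\,\frac{\|u(x_0+\cdot)\|_{L^2([\![r,13r/4]\!])}}{\|u(x_0+\cdot)\|_{L^2([\![r/4,r/2]\!])}}\right),$$ $$\bar{\lambda}_{n/2}:=2+\max\left(\tilde{\lambda}+1,\;8+\tfrac12+\tfrac{n-2}{2}\right),\qquad \mathbf{M}_{n/2}:=\mathbf{k}\,\vartheta_V(1+\kappa_V^{(1)})\,\bar{\lambda}_{n/2}^2 .$$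
   Context: $n\ge 3$ is an integer, $\Omega\subset\mathbb{R}^n$ is a bounded Lipschitz domain, $p:=2n/(n+2)$, $p':=2n/(n-2)$. For $r>0$, $\Omega^r:=\{x\in\Omega:\ \mathrm{dist}(x,\mathbb{R}^n\setminus\Omega)>r\}$. For $0\le a<b$, $[\![a,b]\!]:=\{x\in\mathbb{R}^n:\ a<|x|<b\}$. A universal constant depends on none of the data. $\sigma:=\sup\{\|w\|_{L^{p'}(\Omega)}:\ w\in H^1_0(\Omega),\ \|\nabla w\|_{L^2(\Omega)}=1\}$. Let $\Lambda:=\{\lambda>0:\ \mathrm{dist}(\lambda,\mathbb{N}+(n-2)/2)=1/2\}$. The constant $\vartheta=\vartheta(n)\ge 1$ is a fixed constant for which the (known, Jerison–Kenig) Carleman inequality $\||x|^{-\lambda}u\|_{L^{p'}(B)}\le\vartheta\||x|^{-\lambda}\Delta u\|_{L^p(B)}$ holds for every ball $B$ centered at $0$, every $\lambda\in\Lambda$ and every $u\in W^{2,p}(B)$ with $\mathrm{supp}(u)\subset B\setminus\{0\}$. For $V\in L^{n/2}(\Omega)$ put $\kappa_V:=\|V\|_{L^{n/2}(\Omega)}$, and $\mathscr{V}:=\{V\in L^{n/2}(\Omega):\ 2\sigma^2\kappa_V<1\ \text{and}\ \vartheta\kappa_V<1\}$. For $V\in\mathscr{V}$: $\mathbf{I}_V:=(1-2\sigma^2\kappa_V)^{-1/2}$, $\kappa_V^{(1)}:=2(1+\sigma)\mathbf{I}_V^2+2\sigma\sqrt{\kappa_V}\,\mathbf{I}_V+\sigma/\sqrt{1+\sigma^2}$,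 and $\vartheta_V:=\vartheta(1-\vartheta\kappa_V)^{-1}$. (The denominator in $\tilde\lambda$ is nonzero by unique continuation.) *)

theory Defs
  imports "HOL-Analysis.Analysis"
begin

section \<open>Euclidean space of variable dimension\<close>

text \<open>
  The constant in the theorem is uniform in the dimension, so the dimension is a number \<open>n\<close> and
  not a type.  A point of \<open>n\<close>-space is an extensional function in \<open>{..<n} \<rightarrow>\<^sub>E UNIV\<close>; this set is
  both the carrier of the product topology \<open>powertop_real {..<n}\<close> and the space of the product
  Lebesgue-Borel measure.  Values of functions outside of this set are irrelevant throughout.
\<close>

type_synonym point = "nat \<Rightarrow> real"

abbreviation euc :: "nat \<Rightarrow> point topology" where
  "euc n \<equiv> powertop_real {..<n}"

abbreviation pts :: "nat \<Rightarrow> point set" where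
  "pts n \<equiv> {..<n} \<rightarrow>\<^sub>E UNIV"

abbreviation leb :: "nat \<Rightarrow> point measure" where
  "leb n \<equiv> Pi\<^sub>M {..<n} (\<lambda>_. lborel)"

definition origin :: "nat \<Rightarrow> point" where
  "origin n = (\<lambda>i\<in>{..<n}. 0)"

definition nnorm :: "nat \<Rightarrow> point \<Rightarrow> real" where
  "nnorm n x = L2_set x {..<n}"

definition ndist :: "nat \<Rightarrow> point \<Rightarrow> point \<Rightarrow> real" where
  "ndist n x y = L2_set (\<lambda>i. x i - y i) {..<n}"

definition nball :: "nat \<Rightarrow> point \<Rightarrow> real \<Rightarrow> point set" where
  "nball n x r = {y \<in> pts n. ndist n x y < r}"

definition annulus :: "nat \<Rightarrow> real \<Rightarrow> real \<Rightarrow> point set" where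
  "annulus n a b = {x \<in> pts n. a < nnorm n x \<and> nnorm n x < b}"

definition translate :: "nat \<Rightarrow> point \<Rightarrow> (point \<Rightarrow> real) \<Rightarrow> point \<Rightarrow> real" where
  "translate n x0 u = (\<lambda>x. u (\<lambda>i\<in>{..<n}. x0 i + x i))"

text \<open>The set \<open>\<Omega>\<^sup>r\<close>.  It is only used for bounded \<open>\<Omega>\<close> and \<open>n > 0\<close>, so that the infimum is over a
  nonempty set.\<close>

definition inner_set :: "nat \<Rightarrow> point set \<Rightarrow> real \<Rightarrow> point set" where
  "inner_set n \<Omega> r = {x \<in> \<Omega>. (INF y\<in>pts n - \<Omega>. ndist n x y) > r}"

text \<open>Near each boundary point, \<open>\<Omega>\<close> is the region strictly above the graph of a Lipschitz function
  of the first \<open>n - 1\<close> coordinates with respect to a suitable orthonormal basis \<open>e\<close>.\<close>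

definition orthonormal_basis :: "nat \<Rightarrow> (nat \<Rightarrow> point) \<Rightarrow> bool" where
  "orthonormal_basis n e \<longleftrightarrow>
     (\<forall>j<n. \<forall>k<n. (\<Sum>i<n. e j i * e k i) = (if j = k then 1 else 0))"

definition coords :: "nat \<Rightarrow> (nat \<Rightarrow> point) \<Rightarrow> point \<Rightarrow> point" where
  "coords n e y = (\<lambda>j\<in>{..<n}. \<Sum>i<n. y i * e j i)"

definition lipschitz_boundary :: "nat \<Rightarrow> point set \<Rightarrow> bool" where
  "lipschitz_boundary n \<Omega> \<longleftrightarrow>
     (\<forall>x \<in> euc n frontier_of \<Omega>. \<exists>r>0. \<exists>e \<gamma> L. orthonormal_basis n e \<and>
        (\<forall>a\<in>pts (n - 1). \<forall>b\<in>pts (n - 1). \<bar>\<gamma> a - \<gamma> b\<bar> \<le> L * ndist (n - 1) a b) \<and>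
        \<Omega> \<inter> nball n x r =
          {y \<in> nball n x r. \<gamma> (restrict (coords n e y) {..<n - 1}) < coords n e y (n - 1)})"

definition bounded_lipschitz_domain :: "nat \<Rightarrow> point set \<Rightarrow> bool" where
  "bounded_lipschitz_domain n \<Omega> \<longleftrightarrow>
     \<Omega> \<noteq> {} \<and> openin (euc n) \<Omega> \<and> connectedin (euc n) \<Omega> \<and>
     (\<exists>R. \<Omega> \<subseteq> nball n (origin n) R) \<and> lipschitz_boundary n \<Omega>"

section \<open>Lebesgue spaces\<close>

text \<open>The \<open>L\<^sup>q(S)\<close> norm of an arbitrary measurable function; it may be infinite.  Elements of
  \<open>L\<^sup>q(S)\<close> are represented by Borel functions, which exist in every class of almost everywhere equal
  Lebesgue measurable functions.\<close>

definition eLnorm :: "nat \<Rightarrow> real \<Rightarrow> point set \<Rightarrow> (point \<Rightarrow> real) \<Rightarrow> ennreal" where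
  "eLnorm n q S f =
     (let I = (\<integral>\<^sup>+x\<in>S. ennreal (\<bar>f x\<bar> powr q) \<partial>leb n)
      in if I = \<infinity> then \<infinity> else ennreal (enn2real I powr (1 / q)))"

abbreviation Lnorm :: "nat \<Rightarrow> real \<Rightarrow> point set \<Rightarrow> (point \<Rightarrow> real) \<Rightarrow> real" where
  "Lnorm n q S f \<equiv> enn2real (eLnorm n q S f)"

definition Lspace :: "nat \<Rightarrow> real \<Rightarrow> point set \<Rightarrow> (point \<Rightarrow> real) set" where
  "Lspace n q S = {f. set_borel_measurable (leb n) S f \<and> eLnorm n q S f < \<infinity>}"

section \<open>Test functions, weak derivatives and Sobolev spaces\<close>

definition pderiv_at :: "nat \<Rightarrow> (point \<Rightarrow> real) \<Rightarrow> point \<Rightarrow> real" where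
  "pderiv_at i f x = deriv (\<lambda>t. f (x(i := t))) (x i)"

text \<open>Iterated classical partial derivative along a list of coordinate indices.\<close>

fun iter_pderiv :: "nat list \<Rightarrow> (point \<Rightarrow> real) \<Rightarrow> point \<Rightarrow> real" where
  "iter_pderiv [] f = f"
| "iter_pderiv (i # is) f = pderiv_at i (iter_pderiv is f)"

definition smooth :: "nat \<Rightarrow> (point \<Rightarrow> real) \<Rightarrow> bool" where
  "smooth n f \<longleftrightarrow>
     (\<forall>is. set is \<subseteq> {..<n} \<longrightarrow>
        continuous_map (euc n) euclideanreal (iter_pderiv is f) \<and>
        (\<forall>i<n. \<forall>x\<in>pts n. (\<lambda>t. iter_pderiv is f (x(i := t))) differentiable at (x i)))"

definition test_fun :: "nat \<Rightarrow> point set \<Rightarrow> (point \<Rightarrow> real) set" where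
  "test_fun n \<Omega> =
     {f. smooth n f \<and> (\<exists>K. compactin (euc n) K \<and> K \<subseteq> \<Omega> \<and> (\<forall>x\<in>pts n - K. f x = 0))}"

definition loc_integrable :: "nat \<Rightarrow> point set \<Rightarrow> (point \<Rightarrow> real) \<Rightarrow> bool" where
  "loc_integrable n \<Omega> f \<longleftrightarrow>
     set_borel_measurable (leb n) \<Omega> f \<and>
     (\<forall>K. compactin (euc n) K \<and> K \<subseteq> \<Omega> \<longrightarrow> set_integrable (leb n) K f)"

definition has_weak_deriv ::
  "nat \<Rightarrow> point set \<Rightarrow> nat list \<Rightarrow> (point \<Rightarrow> real) \<Rightarrow> (point \<Rightarrow> real) \<Rightarrow> bool" where
  "has_weak_deriv n \<Omega> is f g \<longleftrightarrow>
     loc_integrable n \<Omega> f \<and> loc_integrable n \<Omega> g \<and>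
     (\<forall>\<phi>\<in>test_fun n \<Omega>.
        (LINT x:\<Omega>|leb n. f x * iter_pderiv is \<phi> x) =
        (-1) ^ length is * (LINT x:\<Omega>|leb n. g x * \<phi> x))"

text \<open>Weak derivatives are determined up to a null set, so the choice of a representative is
  immaterial in all uses below.\<close>

definition weak_deriv :: "nat \<Rightarrow> point set \<Rightarrow> nat list \<Rightarrow> (point \<Rightarrow> real) \<Rightarrow> point \<Rightarrow> real" where
  "weak_deriv n \<Omega> is f = (SOME g. has_weak_deriv n \<Omega> is f g)"

definition sobolev :: "nat \<Rightarrow> nat \<Rightarrow> real \<Rightarrow> point set \<Rightarrow> (point \<Rightarrow> real) set" where
  "sobolev n k q \<Omega> =
     {f \<in> Lspace n q \<Omega>. \<forall>is. set is \<subseteq> {..<n} \<and> length is \<le> k \<longrightarrow>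
        (\<exists>g\<in>Lspace n q \<Omega>. has_weak_deriv n \<Omega> is f g)}"

definition laplacian :: "nat \<Rightarrow> point set \<Rightarrow> (point \<Rightarrow> real) \<Rightarrow> point \<Rightarrow> real" where
  "laplacian n \<Omega> u = (\<lambda>x. \<Sum>i<n. weak_deriv n \<Omega> [i, i] u x)"

definition grad_norm :: "nat \<Rightarrow> point set \<Rightarrow> (point \<Rightarrow> real) \<Rightarrow> point \<Rightarrow> real" where
  "grad_norm n \<Omega> w = (\<lambda>x. L2_set (\<lambda>i. weak_deriv n \<Omega> [i] w x) {..<n})"

text \<open>The closure of the test functions in \<open>H\<^sup>1(\<Omega>)\<close>.\<close>

definition H1_0 :: "nat \<Rightarrow> point set \<Rightarrow> (point \<Rightarrow> real) set" where
  "H1_0 n \<Omega> =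
     {w \<in> sobolev n 1 2 \<Omega>. \<exists>\<phi>. (\<forall>k::nat. \<phi> k \<in> test_fun n \<Omega>) \<and>
        (\<lambda>k. eLnorm n 2 \<Omega> (\<lambda>x. \<phi> k x - w x)) \<longlonglongrightarrow> 0 \<and>
        (\<forall>i<n. (\<lambda>k. eLnorm n 2 \<Omega>
                  (\<lambda>x. pderiv_at i (\<phi> k) x - weak_deriv n \<Omega> [i] w x)) \<longlonglongrightarrow> 0)}"

text \<open>The (essential) support of the class of \<open>u\<close> on \<open>S\<close>, taken in the whole space: the complement
  of the largest open set on which \<open>u\<close> vanishes almost everywhere.\<close>

definition ess_support :: "nat \<Rightarrow> point set \<Rightarrow> (point \<Rightarrow> real) \<Rightarrow> point set" where
  "ess_support n S u =
     {x \<in> pts n. \<forall>U. openin (euc n) U \<and> x \<in> U \<longrightarrow> \<not> (AE y in leb n. y \<in> U \<inter> S \<longrightarrow> u y = 0)}"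

section \<open>The constants\<close>

definition exp_p :: "nat \<Rightarrow> real" where
  "exp_p n = 2 * real n / (real n + 2)"

definition exp_p' :: "nat \<Rightarrow> real" where
  "exp_p' n = 2 * real n / (real n - 2)"

text \<open>The supremum is finite by the Sobolev inequality.\<close>

definition sob_const :: "nat \<Rightarrow> point set \<Rightarrow> real" where
  "sob_const n \<Omega> =
     enn2real (SUP w\<in>{w \<in> H1_0 n \<Omega>. eLnorm n 2 \<Omega> (grad_norm n \<Omega> w) = 1}.
                 eLnorm n (exp_p' n) \<Omega> w)"

definition carleman_exps :: "nat \<Rightarrow> real set" where
  "carleman_exps n = {l. l > 0 \<and> infdist l (range (\<lambda>m::nat. real m + (real n - 2) / 2)) = 1 / 2}"

definition carleman_const :: "nat \<Rightarrow> real \<Rightarrow> bool" where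
  "carleman_const n \<theta> \<longleftrightarrow> \<theta> \<ge> 1 \<and>
     (\<forall>R>0. \<forall>l\<in>carleman_exps n. \<forall>u\<in>sobolev n 2 (exp_p n) (nball n (origin n) R).
        ess_support n (nball n (origin n) R) u \<subseteq> nball n (origin n) R - {origin n} \<longrightarrow>
        eLnorm n (exp_p' n) (nball n (origin n) R) (\<lambda>x. nnorm n x powr (- l) * u x)
        \<le> ennreal \<theta> * eLnorm n (exp_p n) (nball n (origin n) R)
             (\<lambda>x. nnorm n x powr (- l) * laplacian n (nball n (origin n) R) u x))"

definition kap :: "nat \<Rightarrow> point set \<Rightarrow> (point \<Rightarrow> real) \<Rightarrow> real" where
  "kap n \<Omega> V = Lnorm n (real n / 2) \<Omega> V"

definition potentials :: "nat \<Rightarrow> point set \<Rightarrow> real \<Rightarrow> (point \<Rightarrow> real) set" where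
  "potentials n \<Omega> \<theta> =
     {V \<in> Lspace n (real n / 2) \<Omega>. 2 * (sob_const n \<Omega>)\<^sup>2 * kap n \<Omega> V < 1 \<and> \<theta> * kap n \<Omega> V < 1}"

definition I_V :: "nat \<Rightarrow> point set \<Rightarrow> (point \<Rightarrow> real) \<Rightarrow> real" where
  "I_V n \<Omega> V = (1 - 2 * (sob_const n \<Omega>)\<^sup>2 * kap n \<Omega> V) powr (- 1 / 2)"

definition kap1 :: "nat \<Rightarrow> point set \<Rightarrow> (point \<Rightarrow> real) \<Rightarrow> real" where
  "kap1 n \<Omega> V =
     2 * (1 + sob_const n \<Omega>) * (I_V n \<Omega> V)\<^sup>2
     + 2 * sob_const n \<Omega> * sqrt (kap n \<Omega> V) * I_V n \<Omega> V
     + sob_const n \<Omega> / sqrt (1 + (sob_const n \<Omega>)\<^sup>2)"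

definition theta_V :: "nat \<Rightarrow> point set \<Rightarrow> real \<Rightarrow> (point \<Rightarrow> real) \<Rightarrow> real" where
  "theta_V n \<Omega> \<theta> V = \<theta> / (1 - \<theta> * kap n \<Omega> V)"

text \<open>In the arguments below, \<open>k\<close> is the universal constant.\<close>

definition lambda_tilde ::
  "real \<Rightarrow> nat \<Rightarrow> point set \<Rightarrow> real \<Rightarrow> (point \<Rightarrow> real) \<Rightarrow> real \<Rightarrow> point \<Rightarrow> (point \<Rightarrow> real) \<Rightarrow> real" where
  "lambda_tilde k n \<Omega> \<theta> V r x0 u =
     1 / ln (9 / 4) *
     ln (1 + 4 * inverse r * k * theta_V n \<Omega> \<theta> V * (1 + kap1 n \<Omega> V)
             * (Lnorm n 2 (annulus n r (13 * r / 4)) (translate n x0 u)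
                / Lnorm n 2 (annulus n (r / 4) (r / 2)) (translate n x0 u)))"

definition lambda_bar ::
  "real \<Rightarrow> nat \<Rightarrow> point set \<Rightarrow> real \<Rightarrow> (point \<Rightarrow> real) \<Rightarrow> real \<Rightarrow> point \<Rightarrow> (point \<Rightarrow> real) \<Rightarrow> real" where
  "lambda_bar k n \<Omega> \<theta> V r x0 u =
     2 + max (lambda_tilde k n \<Omega> \<theta> V r x0 u + 1) (8 + 1 / 2 + (real n - 2) / 2)"

definition M_const ::
  "real \<Rightarrow> nat \<Rightarrow> point set \<Rightarrow> real \<Rightarrow> (point \<Rightarrow> real) \<Rightarrow> real \<Rightarrow> point \<Rightarrow> (point \<Rightarrow> real) \<Rightarrow> real" where
  "M_const k n \<Omega> \<theta> V r x0 u =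
     k * theta_V n \<Omega> \<theta> V * (1 + kap1 n \<Omega> V) * (lambda_bar k n \<Omega> \<theta> V r x0 u)\<^sup>2"

end

theory Submission
  imports Defs "HOL-Computational_Algebra.Polynomial"
begin

text \<open>
  Move \<open>x0\<close> to the origin, let \<open>\<psi>\<close> be a cutoff equal to one between an inner annulus of size
  comparable to \<open>\<rho>\<close> and an outer one of size comparable to \<open>r\<close>, and apply the Carleman inequality to
  \<open>\<psi> u\<close> (more precisely to \<open>\<psi>\<close> times mollifications of \<open>u\<close>).  The term with \<open>V\<close> is absorbed because
  \<open>\<theta> \<kappa> < 1\<close>.  What remains are the terms with derivatives of \<open>\<psi>\<close>, supported in the two annuli; the
  gradient of \<open>u\<close> in them is controlled by the Caccioppoli inequality, where \<open>V\<close> is absorbed because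
  \<open>2 \<sigma>\<^sup>2 \<kappa> < 1\<close>.  If \<open>4 powr l\<close> exceeds a multiple of the ratio of the norms in \<open>lambda_tilde\<close>, the
  outer term is at most half of the left-hand side, which leaves a bound by the norm on the ball of
  radius \<open>\<rho>\<close>.  The factor \<open>n\<close> lost through the Laplacian of \<open>\<psi>\<close> is recovered from the gap between
  \<open>9 / 4\<close> in the definition of \<open>lambda_tilde\<close> and \<open>4\<close>.
\<close>

section \<open>Integral norms\<close>

text \<open>Subtracting the term with \<open>V\<close> from the left-hand side presupposes that this
  side is finite, while \<open>u\<close> and its derivatives are only known to lie in
  \<open>L^p\<close>. Bounds for the mollifications that are uniform in the scale, again from the
  Carleman inequality, together with Fatou's lemma give the exponent \<open>p'\<close> away from
  \<open>x0\<close>. The commutator terms are then measured in \<open>L^2\<close> on shells;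
  lowering the exponent there costs only the factor \<open>2 * b\<close> for the outer radius
  \<open>b\<close>, whatever the dimension. The powers of four are quotients of weights. The outer
  cutoff begins at radius \<open>2 * r\<close>, whereas the denominator in
  \<open>lambda_tilde\<close> lives below \<open>r / 2\<close>; the inner cutoff begins at
  \<open>\<rho> / 2\<close>, whereas the doubled ball ends at \<open>2 * \<rho>\<close>. The first
  quotient absorbs the outer term, the second is a loss, paid by the negative power of \<rho>, as
  \<open>\<rho> < 3 / 32 < 1 / 4\<close>. The inequalities of Loomis-Whitney and Gagliardo-Nirenberg
  enter only because \<open>sob_const\<close> is meaningful for a finite supremum alone.\<close>

abbreviation powr_integral :: "nat \<Rightarrow> real \<Rightarrow> point set \<Rightarrow> (point \<Rightarrow> real) \<Rightarrow> ennreal" where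
  "powr_integral n q S f \<equiv> (\<integral>\<^sup>+x\<in>S. ennreal (\<bar>f x\<bar> powr q) \<partial>leb n)"

lemma eLnorm_eq:
  assumes "powr_integral n q S f = ennreal I" "0 \<le> I"
  shows "eLnorm n q S f = ennreal (I powr (1 / q))"
  using assms by (simp add: eLnorm_def Let_def)

text \<open>Comparison with a finite constant is where norms are exchanged for integrals: no power
  of an extended real has to be formed, and an infinite integral falsifies both sides.\<close>

lemma eLnorm_le_iff:
  assumes "q > 0" "c \<ge> 0"
  shows "eLnorm n q S f \<le> ennreal c \<longleftrightarrow> powr_integral n q S f \<le> ennreal (c powr q)"
proof (cases "powr_integral n q S f")
  case (real I)
  have "I powr (1/q) \<le> c \<longleftrightarrow> I \<le> c powr q"
  proof
    assume "I powr (1/q) \<le> c"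
    then have "(I powr (1/q)) powr q \<le> c powr q" using assms by (intro powr_mono2) auto
    then show "I \<le> c powr q" using assms real by (simp add: powr_powr)
  next
    assume "I \<le> c powr q"
    then have "I powr (1/q) \<le> (c powr q) powr (1/q)" using assms real by (intro powr_mono2) auto
    then show "I powr (1/q) \<le> c" using assms by (simp add: powr_powr)
  qed
  then show ?thesis using assms eLnorm_eq[OF real(2,1)] real by simp
next
  case top
  then show ?thesis by (simp add: eLnorm_def top_unique)
qed

lemma eLnorm_finite_iff: "eLnorm n q S f < \<infinity> \<longleftrightarrow> powr_integral n q S f < \<infinity>"
  by (simp add: eLnorm_def Let_def less_top)

lemma eLnorm_powr:
  assumes "q > 0" "eLnorm n q S f < \<infinity>"
  shows "powr_integral n q S f = ennreal (Lnorm n q S f powr q)"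
proof -
  obtain I where I: "powr_integral n q S f = ennreal I" "0 \<le> I"
    using assms(2) unfolding eLnorm_finite_iff by (cases "powr_integral n q S f") auto
  then show ?thesis using eLnorm_eq[OF I] assms by (simp add: powr_powr)
qed

text \<open>Reduces a comparison of two possibly infinite norms to finite upper bounds, the form
  that \<open>eLnorm_le_iff\<close> handles.\<close>

lemma ennreal_le_if_le_all_ennreal:
  assumes "\<And>c. 0 \<le> c \<Longrightarrow> b \<le> ennreal c \<Longrightarrow> a \<le> ennreal c"
  shows "a \<le> b"
  by (cases b) (use assms in auto)

lemma eLnorm_mono_powr_integral:
  assumes "q > 0" "powr_integral n q S f \<le> powr_integral n q T g"
  shows "eLnorm n q S f \<le> eLnorm n q T g"
  by (rule ennreal_le_if_le_all_ennreal) (use assms in \<open>auto simp: eLnorm_le_iff\<close>)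

lemma eLnorm_mono_AE:
  assumes "q > 0" "AE x in leb n. x \<in> S \<longrightarrow> x \<in> T \<and> \<bar>f x\<bar> \<le> \<bar>g x\<bar>"
  shows "eLnorm n q S f \<le> eLnorm n q T g"
proof (rule eLnorm_mono_powr_integral[OF assms(1)], rule nn_integral_mono_AE)
  show "AE x in leb n. ennreal (\<bar>f x\<bar> powr q) * indicator S x \<le> ennreal (\<bar>g x\<bar> powr q) * indicator T x"
    using assms(2) by eventually_elim (use assms(1) in \<open>auto simp: indicator_def intro!: ennreal_leI powr_mono2\<close>)
qed

lemma eLnorm_mono:
  assumes "q > 0" "\<And>x. x \<in> pts n \<Longrightarrow> x \<in> S \<Longrightarrow> x \<in> T \<and> \<bar>f x\<bar> \<le> \<bar>g x\<bar>"
  shows "eLnorm n q S f \<le> eLnorm n q T g"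
  by (rule eLnorm_mono_AE) (use assms in \<open>auto intro!: AE_I2 simp: space_PiM\<close>)

lemma eLnorm_cong_AE:
  assumes "AE x in leb n. x \<in> S \<longrightarrow> \<bar>f x\<bar> = \<bar>g x\<bar>"
  shows "eLnorm n q S f = eLnorm n q S g"
proof -
  have "powr_integral n q S f = powr_integral n q S g"
    by (rule nn_integral_cong_AE) (use assms in \<open>eventually_elim, auto simp: indicator_def\<close>)
  then show ?thesis by (simp add: eLnorm_def)
qed

lemma eLnorm_cong:
  assumes "\<And>x. x \<in> pts n \<Longrightarrow> x \<in> S \<Longrightarrow> \<bar>f x\<bar> = \<bar>g x\<bar>"
  shows "eLnorm n q S f = eLnorm n q S g"
  by (rule eLnorm_cong_AE) (use assms in \<open>auto intro!: AE_I2 simp: space_PiM\<close>)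

lemma eLnorm_indicator:
  assumes "q > 0" "S \<subseteq> T"
  shows "eLnorm n q T (\<lambda>x. indicator S x * f x) = eLnorm n q S f"
proof -
  have "powr_integral n q T (\<lambda>x. indicator S x * f x) = powr_integral n q S f"
    by (rule nn_integral_cong) (use assms in \<open>auto simp: indicator_def\<close>)
  then show ?thesis by (simp add: eLnorm_def)
qed

lemma eLnorm_eq_0_AE:
  assumes "q > 0" "AE x in leb n. x \<in> S \<longrightarrow> f x = 0"
  shows "eLnorm n q S f = 0"
proof -
  have "powr_integral n q S f = powr_integral n q S (\<lambda>_. 0)"
    by (rule nn_integral_cong_AE) (use assms(2) in \<open>eventually_elim, auto simp: indicator_def\<close>)
  then have "powr_integral n q S f = 0" using assms by simp
  then show ?thesis by (simp add: eLnorm_def)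
qed

lemma eLnorm_cmult_le:
  assumes "q > 0" "f \<in> borel_measurable (leb n)" "S \<in> sets (leb n)"
  shows "eLnorm n q S (\<lambda>x. c * f x) \<le> ennreal \<bar>c\<bar> * eLnorm n q S f"
proof (cases "eLnorm n q S f")
  case (real A)
  have "powr_integral n q S (\<lambda>x. c * f x) = (\<integral>\<^sup>+x. ennreal (\<bar>c\<bar> powr q) * (ennreal (\<bar>f x\<bar> powr q) * indicator S x) \<partial>leb n)"
    by (rule nn_integral_cong) (auto simp: indicator_def abs_mult powr_mult ennreal_mult)
  also have "\<dots> = ennreal (\<bar>c\<bar> powr q) * powr_integral n q S f"
    using assms by (intro nn_integral_cmult) auto
  also have "\<dots> \<le> ennreal (\<bar>c\<bar> powr q) * ennreal (A powr q)"
    using eLnorm_le_iff[of q A n S f] assms real by (intro mult_left_mono) auto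
  also have "\<dots> = ennreal ((\<bar>c\<bar> * A) powr q)" using real by (simp add: powr_mult ennreal_mult)
  finally have "eLnorm n q S (\<lambda>x. c * f x) \<le> ennreal (\<bar>c\<bar> * A)"
    using eLnorm_le_iff[of q "\<bar>c\<bar> * A" n S "\<lambda>x. c * f x"] assms real by simp
  then show ?thesis using real by (simp add: ennreal_mult)
next
  case top
  show ?thesis
  proof (cases "c = 0")
    case True
    then show ?thesis using eLnorm_eq_0_AE[OF assms(1), where f = "\<lambda>x. 0"] by simp
  next
    case False
    then show ?thesis using top by (simp add: ennreal_mult_top)
  qed
qed

text \<open>The converse of \<open>eLnorm_cmult_le\<close> is that lemma for the function
  \<open>c * f\<close> and the factor \<open>inverse c\<close>; for \<open>c = 0\<close> the product
  vanishes even if the norm of \<open>f\<close> is infinite.\<close>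

lemma eLnorm_cmult:
  assumes "q > 0" "f \<in> borel_measurable (leb n)" "S \<in> sets (leb n)"
  shows "eLnorm n q S (\<lambda>x. c * f x) = ennreal \<bar>c\<bar> * eLnorm n q S f"
proof (rule antisym[OF eLnorm_cmult_le[OF assms]])
  show "ennreal \<bar>c\<bar> * eLnorm n q S f \<le> eLnorm n q S (\<lambda>x. c * f x)"
  proof (cases "c = 0")
    case False
    have "eLnorm n q S f = eLnorm n q S (\<lambda>x. inverse c * (c * f x))"
      using False by (intro eLnorm_cong) (simp add: mult.assoc[symmetric])
    also have "\<dots> \<le> ennreal \<bar>inverse c\<bar> * eLnorm n q S (\<lambda>x. c * f x)"
      by (rule eLnorm_cmult_le) (use assms in auto)
    finally have "ennreal \<bar>c\<bar> * eLnorm n q S f \<le> ennreal \<bar>c\<bar> * (ennreal \<bar>inverse c\<bar> * eLnorm n q S (\<lambda>x. c * f x))"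
      by (rule mult_left_mono) simp
    also have "\<dots> = ennreal (\<bar>c\<bar> * \<bar>inverse c\<bar>) * eLnorm n q S (\<lambda>x. c * f x)"
      by (simp only: mult.assoc[symmetric] ennreal_mult abs_ge_zero)
    also have "\<bar>c\<bar> * \<bar>inverse c\<bar> = 1" using False by (simp add: abs_inverse)
    also have "ennreal 1 * eLnorm n q S (\<lambda>x. c * f x) = eLnorm n q S (\<lambda>x. c * f x)" by simp
    finally show ?thesis .
  qed simp
qed

lemma eLnorm_bound_mult:
  assumes "q > 0" "f \<in> borel_measurable (leb n)" "S \<in> sets (leb n)"
    and "\<And>x. x \<in> pts n \<Longrightarrow> x \<in> S \<Longrightarrow> \<bar>g x\<bar> \<le> c * \<bar>f x\<bar>" "c \<ge> 0"
  shows "eLnorm n q S g \<le> ennreal c * eLnorm n q S f"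
proof -
  have "eLnorm n q S g \<le> eLnorm n q S (\<lambda>x. c * f x)"
    by (rule eLnorm_mono) (use assms in \<open>auto simp: abs_mult\<close>)
  also have "\<dots> \<le> ennreal \<bar>c\<bar> * eLnorm n q S f" by (rule eLnorm_cmult_le) (use assms in auto)
  finally show ?thesis using assms by simp
qed

section \<open>Minkowski's and Hoelder's inequalities\<close>

lemma convex_on_powr_nonneg:
  assumes "q \<ge> 1"
  shows "convex_on {0::real..} (\<lambda>x. x powr q)"
proof (rule convex_onI)
  fix t x y :: real
  assume t: "0 < t" "t < 1" and xy: "x \<in> {0..}" "y \<in> {0..}"
  \<comment> \<open>Takes care of end points at zero, where the power of a multiple has to be
    compared with the multiple of the power.\<close>
  have small: "(c * z) powr q \<le> c * z powr q" if "0 < c" "c < 1" "z \<ge> 0" for c z :: real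
  proof -
    have "c powr q \<le> c powr 1" using that assms by (intro powr_mono') auto
    then show ?thesis using that by (auto simp: powr_mult intro: mult_right_mono)
  qed
  show "((1 - t) *\<^sub>R x + t *\<^sub>R y) powr q \<le> (1 - t) * x powr q + t * y powr q"
  proof (cases "x = 0 \<or> y = 0")
    case True
    then show ?thesis using small[of t y] small[of "1 - t" x] t xy by auto
  next
    case False
    then show ?thesis using convex_onD[OF powr_convex[OF assms], of t x y] t xy by auto
  qed
qed simp

text \<open>Convexity of the power at the points \<open>s / A\<close> and \<open>t / B\<close> with
  weights proportional to \<open>A\<close> and \<open>B\<close>. When \<open>A\<close> and
  \<open>B\<close> are the norms of two functions, integration turns the bracket into one, and
  \<open>(A + B) powr q\<close> is what Minkowski's inequality claims.\<close>

lemma powr_convex_combination: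
  fixes s t A B q :: real
  assumes "s \<ge> 0" "t \<ge> 0" "A > 0" "B > 0" "q \<ge> 1"
  shows "(s + t) powr q \<le> (A + B) powr q * (A / (A + B) * (s powr q / A powr q) + B / (A + B) * (t powr q / B powr q))"
proof -
  note cx = convex_on_powr_nonneg[OF assms(5)]
  have "(A / (A + B) * (s / A) + B / (A + B) * (t / B)) powr q
      \<le> A / (A + B) * (s / A) powr q + B / (A + B) * (t / B) powr q"
    using convex_onD[OF cx, of "B / (A + B)" "s / A" "t / B"] assms
    by (auto simp: field_simps)
  also have "A / (A + B) * (s / A) + B / (A + B) * (t / B) = (s + t) / (A + B)"
    using assms by (simp add: add_divide_distrib)
  finally have le: "((s + t) / (A + B)) powr q \<le> A / (A + B) * (s / A) powr q + B / (A + B) * (t / B) powr q" .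
  have "(s + t) powr q = (A + B) powr q * ((s + t) / (A + B)) powr q"
    using assms by (simp add: powr_divide)
  also have "\<dots> \<le> (A + B) powr q * (A / (A + B) * (s / A) powr q + B / (A + B) * (t / B) powr q)"
    by (intro mult_left_mono le) auto
  finally show ?thesis using assms by (simp add: powr_divide)
qed

text \<open>The proof of Minkowski's inequality divides by the two norms; enlarging them by
  \<open>e\<close> keeps the divisors positive when a norm is zero, and the limit removes
  \<open>e\<close>.\<close>

lemma le_ennreal_add_epsilonI:
  assumes "\<And>e::real. e > 0 \<Longrightarrow> X \<le> ennreal ((A + e) + (B + e))" "A \<ge> 0" "B \<ge> 0"
  shows "X \<le> ennreal (A + B)"
proof (rule tendsto_lowerbound)
  show "((\<lambda>e. ennreal ((A + e) + (B + e))) \<longlongrightarrow> ennreal (A + B)) (at_right 0)"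
    by (rule tendsto_ennrealI) (auto intro!: tendsto_eq_intros)
  show "\<forall>\<^sub>F e in at_right 0. X \<le> ennreal ((A + e) + (B + e))"
    using assms(1) by (auto simp: eventually_at_right_less intro: eventually_mono[OF eventually_at_right_less])
qed simp

lemma le_ennreal_mult_epsilonI:
  assumes "\<And>e::real. e > 0 \<Longrightarrow> X \<le> ennreal ((A + e) * (B + e))" "A \<ge> 0" "B \<ge> 0"
  shows "X \<le> ennreal (A * B)"
proof (rule tendsto_lowerbound)
  show "((\<lambda>e. ennreal ((A + e) * (B + e))) \<longlongrightarrow> ennreal (A * B)) (at_right 0)"
    by (rule tendsto_ennrealI) (auto intro!: tendsto_eq_intros)
  show "\<forall>\<^sub>F e in at_right 0. X \<le> ennreal ((A + e) * (B + e))"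
    using assms(1) by (auto intro: eventually_mono[OF eventually_at_right_less])
qed simp

lemma eLnorm_triangle:
  assumes q: "q \<ge> 1" and [measurable]: "f \<in> borel_measurable (leb n)" "g \<in> borel_measurable (leb n)"
    and [measurable]: "S \<in> sets (leb n)"
  shows "eLnorm n q S (\<lambda>x. f x + g x) \<le> eLnorm n q S f + eLnorm n q S g"
proof (cases "eLnorm n q S f = \<infinity> \<or> eLnorm n q S g = \<infinity>")
  case False
  then obtain A0 B0 where A0: "eLnorm n q S f = ennreal A0" "A0 \<ge> 0" and B0: "eLnorm n q S g = ennreal B0" "B0 \<ge> 0"
    by (metis ennreal_cases infinity_ennreal_def)
  have "eLnorm n q S (\<lambda>x. f x + g x) \<le> ennreal ((A0 + e) + (B0 + e))" if e: "e > 0" for e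
  proof -
    define A where "A = A0 + e"
    define B where "B = B0 + e"
    have AB: "A > 0" "B > 0" using A0 B0 e by (auto simp: A_def B_def)
    have Af: "powr_integral n q S f \<le> ennreal (A powr q)" using A0 e q
      by (subst eLnorm_le_iff[symmetric]) (auto simp: A_def)
    have Bg: "powr_integral n q S g \<le> ennreal (B powr q)" using B0 e q
      by (subst eLnorm_le_iff[symmetric]) (auto simp: B_def)
    \<comment> \<open>\<open>kdiff\<close> and \<open>c2\<close> are the coefficients of the two
      powers in \<open>powr_convex_combination\<close>; the factors \<open>A powr q\<close> and
      \<open>B powr q\<close> in their denominators cancel against the bounds on the
      integrals.\<close>
    define kdiff where "kdiff = (A + B) powr q * (A / (A + B)) / A powr q"
    define c2 where "c2 = (A + B) powr q * (B / (A + B)) / B powr q"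
    have c: "kdiff \<ge> 0" "c2 \<ge> 0" using AB by (auto simp: kdiff_def c2_def)
    have "powr_integral n q S (\<lambda>x. f x + g x) \<le> (\<integral>\<^sup>+x. ennreal kdiff * (ennreal (\<bar>f x\<bar> powr q) * indicator S x) + ennreal c2 * (ennreal (\<bar>g x\<bar> powr q) * indicator S x) \<partial>leb n)"
    proof (rule nn_integral_mono)
      fix x
      have "\<bar>f x + g x\<bar> powr q \<le> (\<bar>f x\<bar> + \<bar>g x\<bar>) powr q" using q by (intro powr_mono2) auto
      also have "\<dots> \<le> (A + B) powr q * (A / (A + B) * (\<bar>f x\<bar> powr q / A powr q) + B / (A + B) * (\<bar>g x\<bar> powr q / B powr q))"
        by (rule powr_convex_combination) (use AB q in auto)
      also have "\<dots> = kdiff * \<bar>f x\<bar> powr q + c2 * \<bar>g x\<bar> powr q" by (simp add: kdiff_def c2_def algebra_simps)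
      finally show "ennreal (\<bar>f x + g x\<bar> powr q) * indicator S x \<le> ennreal kdiff * (ennreal (\<bar>f x\<bar> powr q) * indicator S x) + ennreal c2 * (ennreal (\<bar>g x\<bar> powr q) * indicator S x)"
        using c by (auto simp: indicator_def ennreal_mult[symmetric] ennreal_plus[symmetric] simp del: ennreal_plus intro!: ennreal_leI)
    qed
    also have "\<dots> = ennreal kdiff * powr_integral n q S f + ennreal c2 * powr_integral n q S g"
      by (subst nn_integral_add) (auto simp: nn_integral_cmult)
    also have "\<dots> \<le> ennreal kdiff * ennreal (A powr q) + ennreal c2 * ennreal (B powr q)"
      by (intro add_mono mult_left_mono Af Bg) auto
    also have "\<dots> = ennreal (kdiff * A powr q + c2 * B powr q)" using c
      by (simp add: ennreal_mult[symmetric] ennreal_plus[symmetric] del: ennreal_plus)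
    also have "kdiff * A powr q + c2 * B powr q = (A + B) powr q * (A / (A + B) + B / (A + B))"
    proof -
      have "kdiff * A powr q = (A + B) powr q * (A / (A + B))" "c2 * B powr q = (A + B) powr q * (B / (A + B))"
        using AB by (simp_all add: kdiff_def c2_def)
      then show ?thesis by (simp add: distrib_left)
    qed
    also have "A / (A + B) + B / (A + B) = 1" using AB by (simp add: add_divide_distrib[symmetric])
    finally show ?thesis unfolding A_def[symmetric] B_def[symmetric]
      using AB q by (subst eLnorm_le_iff) auto
  qed
  then have "eLnorm n q S (\<lambda>x. f x + g x) \<le> ennreal (A0 + B0)"
    by (rule le_ennreal_add_epsilonI) (use A0 B0 in auto)
  then show ?thesis using A0 B0 by simp
qed auto

lemma eLnorm_triangle_diff:
  assumes q: "q \<ge> 1" and [measurable]: "f \<in> borel_measurable (leb n)" "g \<in> borel_measurable (leb n)"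
    and [measurable]: "S \<in> sets (leb n)"
  shows "eLnorm n q S f \<le> eLnorm n q S g + eLnorm n q S (\<lambda>x. g x - f x)"
proof -
  have "eLnorm n q S f = eLnorm n q S (\<lambda>x. g x + (f x - g x))" by simp
  also have "\<dots> \<le> eLnorm n q S g + eLnorm n q S (\<lambda>x. f x - g x)"
    by (rule eLnorm_triangle) (use assms in auto)
  also have "eLnorm n q S (\<lambda>x. f x - g x) = eLnorm n q S (\<lambda>x. g x - f x)"
    by (rule eLnorm_cong) auto
  finally show ?thesis .
qed

lemma eLnorm_sum_le:
  assumes q: "q \<ge> 1" and "finite I" and [measurable]: "\<And>i. i \<in> I \<Longrightarrow> f i \<in> borel_measurable (leb n)"
    and [measurable]: "S \<in> sets (leb n)"
  shows "eLnorm n q S (\<lambda>x. \<Sum>i\<in>I. f i x) \<le> (\<Sum>i\<in>I. eLnorm n q S (f i))"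
  using assms(2,3)
proof (induction I rule: finite_induct)
  case empty
  then show ?case using q by (simp add: eLnorm_eq_0_AE)
next
  case (insert i I)
  have "eLnorm n q S (\<lambda>x. f i x + (\<Sum>i\<in>I. f i x)) \<le> eLnorm n q S (f i) + eLnorm n q S (\<lambda>x. \<Sum>i\<in>I. f i x)"
    using insert by (intro eLnorm_triangle q borel_measurable_sum) auto
  also have "\<dots> \<le> eLnorm n q S (f i) + (\<Sum>i\<in>I. eLnorm n q S (f i))"
    using insert by (intro add_left_mono) auto
  finally show ?case using insert by simp
qed

text \<open>Young's inequality for \<open>s powr q\<close> and \<open>t powr q\<close> with the
  conjugate exponents \<open>a / q\<close> and \<open>b / q\<close>, which exceed one because the
  reciprocals of \<open>a\<close> and \<open>b\<close> add up to that of \<open>q\<close>.\<close>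

lemma Young_powr:
  fixes s t q a b :: real
  assumes "s \<ge> 0" "t \<ge> 0" "q > 0" "a > 0" "b > 0" "1 / q = 1 / a + 1 / b"
  shows "(s * t) powr q \<le> q / a * s powr a + q / b * t powr b"
proof -
  have ab: "q < a" "q < b"
  proof -
    have "1 / q > 1 / a" "1 / q > 1 / b" using assms by auto
    then show "q < a" "q < b" using assms frac_le[of 1 1 a q] frac_le[of 1 1 b q]
      by (auto simp: not_less[symmetric])
  qed
  have "q / a + q / b = q * (1 / a + 1 / b)" by (simp add: field_simps)
  also have "\<dots> = 1" using assms(3,6) by (metis nonzero_mult_div_cancel_left less_irrefl times_divide_eq_right mult.right_neutral)
  finally have e: "q / a + q / b = 1" .
  have "s powr q * t powr q \<le> (s powr q) powr (a / q) / (a / q) + (t powr q) powr (b / q) / (b / q)"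
    by (rule Youngs_inequality) (use assms ab e in auto)
  then show ?thesis using assms by (simp add: powr_mult powr_powr mult.commute)
qed

text \<open>The target exponent \<open>q\<close> is free, so that one lemma covers the pairing of
  \<open>p\<close> with \<open>p'\<close>, the product with a potential of exponent
  \<open>n / 2\<close> and the passage to a smaller exponent on a set of finite measure.\<close>

lemma eLnorm_Holder:
  assumes q: "q > 0" "a > 0" "b > 0" "1 / q = 1 / a + 1 / b"
    and [measurable]: "f \<in> borel_measurable (leb n)" "g \<in> borel_measurable (leb n)" "S \<in> sets (leb n)"
    and fin: "eLnorm n a S f < \<infinity>" "eLnorm n b S g < \<infinity>"
  shows "eLnorm n q S (\<lambda>x. f x * g x) \<le> eLnorm n a S f * eLnorm n b S g"
proof -
  obtain A0 B0 where A0: "eLnorm n a S f = ennreal A0" "A0 \<ge> 0" and B0: "eLnorm n b S g = ennreal B0" "B0 \<ge> 0"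
    using fin by (metis ennreal_cases infinity_ennreal_def less_irrefl)
  have "eLnorm n q S (\<lambda>x. f x * g x) \<le> ennreal ((A0 + e) * (B0 + e))" if e: "e > 0" for e
  proof -
    define A where "A = A0 + e"
    define B where "B = B0 + e"
    have AB: "A > 0" "B > 0" using A0 B0 e by (auto simp: A_def B_def)
    have Af: "powr_integral n a S f \<le> ennreal (A powr a)" using A0 e q
      by (subst eLnorm_le_iff[symmetric]) (auto simp: A_def)
    have Bg: "powr_integral n b S g \<le> ennreal (B powr b)" using B0 e q
      by (subst eLnorm_le_iff[symmetric]) (auto simp: B_def)
    define kdiff where "kdiff = (A * B) powr q * (q / a) / A powr a"
    define c2 where "c2 = (A * B) powr q * (q / b) / B powr b"
    have c: "kdiff \<ge> 0" "c2 \<ge> 0" using AB q by (auto simp: kdiff_def c2_def)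
    have "powr_integral n q S (\<lambda>x. f x * g x) \<le> (\<integral>\<^sup>+x. ennreal kdiff * (ennreal (\<bar>f x\<bar> powr a) * indicator S x) + ennreal c2 * (ennreal (\<bar>g x\<bar> powr b) * indicator S x) \<partial>leb n)"
    proof (rule nn_integral_mono)
      fix x
      have "\<bar>f x * g x\<bar> powr q = (A * B) powr q * ((\<bar>f x\<bar> / A) * (\<bar>g x\<bar> / B)) powr q"
        using AB by (simp add: powr_mult[symmetric] abs_mult)
      also have "\<dots> \<le> (A * B) powr q * (q / a * (\<bar>f x\<bar> / A) powr a + q / b * (\<bar>g x\<bar> / B) powr b)"
        by (intro mult_left_mono Young_powr) (use AB q in auto)
      also have "\<dots> = kdiff * \<bar>f x\<bar> powr a + c2 * \<bar>g x\<bar> powr b" using AB by (simp add: kdiff_def c2_def algebra_simps powr_divide)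
      finally show "ennreal (\<bar>f x * g x\<bar> powr q) * indicator S x \<le> ennreal kdiff * (ennreal (\<bar>f x\<bar> powr a) * indicator S x) + ennreal c2 * (ennreal (\<bar>g x\<bar> powr b) * indicator S x)"
        using c by (auto simp: indicator_def ennreal_mult[symmetric] ennreal_plus[symmetric] simp del: ennreal_plus intro!: ennreal_leI)
    qed
    also have "\<dots> = ennreal kdiff * powr_integral n a S f + ennreal c2 * powr_integral n b S g"
      by (subst nn_integral_add) (auto simp: nn_integral_cmult)
    also have "\<dots> \<le> ennreal kdiff * ennreal (A powr a) + ennreal c2 * ennreal (B powr b)"
      by (intro add_mono mult_left_mono Af Bg) auto
    also have "\<dots> = ennreal (kdiff * A powr a + c2 * B powr b)" using c
      by (simp add: ennreal_mult[symmetric] ennreal_plus[symmetric] del: ennreal_plus)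
    also have "kdiff * A powr a + c2 * B powr b = (A * B) powr q * (q / a + q / b)"
      using AB by (simp add: kdiff_def c2_def algebra_simps)
    also have "q / a + q / b = q * (1 / a + 1 / b)" by (simp add: field_simps)
    also have "\<dots> = 1" using q(1,4) by (metis nonzero_mult_div_cancel_left less_irrefl times_divide_eq_right mult.right_neutral)
    finally show ?thesis unfolding A_def[symmetric] B_def[symmetric]
      using AB q by (subst eLnorm_le_iff) auto
  qed
  then have "eLnorm n q S (\<lambda>x. f x * g x) \<le> ennreal (A0 * B0)"
    by (rule le_ennreal_mult_epsilonI) (use A0 B0 in auto)
  then show ?thesis using A0 B0 by (simp add: ennreal_mult)
qed

section \<open>Limits in Lebesgue norms\<close>

lemma eLnorm_Fatou:
  assumes q: "q > 0" and c: "c \<ge> 0" and [measurable]: "\<And>k. f k \<in> borel_measurable (leb n)" "S \<in> sets (leb n)"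
    and lim: "AE x in leb n. x \<in> S \<longrightarrow> (\<lambda>k. f k x) \<longlonglongrightarrow> g x"
    and le: "\<And>k. eLnorm n q S (f k) \<le> ennreal c"
  shows "eLnorm n q S g \<le> ennreal c"
proof -
  have "powr_integral n q S g = (\<integral>\<^sup>+x. liminf (\<lambda>k. ennreal (\<bar>f k x\<bar> powr q) * indicator S x) \<partial>leb n)"
  proof (rule nn_integral_cong_AE)
    show "AE x in leb n. ennreal (\<bar>g x\<bar> powr q) * indicator S x = liminf (\<lambda>k. ennreal (\<bar>f k x\<bar> powr q) * indicator S x)"
      using lim
    proof eventually_elim
      case (elim x)
      show ?case
      proof (cases "x \<in> S")
        case True
        have "(\<lambda>k. \<bar>f k x\<bar> powr q) \<longlonglongrightarrow> \<bar>g x\<bar> powr q"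
          using True elim q by (intro tendsto_powr') (auto intro!: tendsto_intros)
        then have "(\<lambda>k. ennreal (\<bar>f k x\<bar> powr q)) \<longlonglongrightarrow> ennreal (\<bar>g x\<bar> powr q)" by (rule tendsto_ennrealI)
        then show ?thesis using True by (simp add: lim_imp_Liminf[symmetric])
      next
        case False
        then show ?thesis by (simp add: Liminf_const)
      qed
    qed
  qed
  also have "\<dots> \<le> liminf (\<lambda>k. powr_integral n q S (f k))"
    by (rule nn_integral_liminf) auto
  also have "\<dots> \<le> ennreal (c powr q)"
  proof -
    have "powr_integral n q S (f k) \<le> ennreal (c powr q)" for k
      using le[of k] q c by (simp add: eLnorm_le_iff)
    then have "liminf (\<lambda>k. powr_integral n q S (f k)) \<le> liminf (\<lambda>k::nat. ennreal (c powr q))"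
      by (intro Liminf_mono) auto
    then show ?thesis by (simp add: Liminf_const)
  qed
  finally show ?thesis using q c by (simp add: eLnorm_le_iff)
qed

lemma eLnorm_tendsto_0_iff:
  assumes q: "q > 0"
  shows "(\<lambda>k. eLnorm n q S (f k)) \<longlonglongrightarrow> 0 \<longleftrightarrow> (\<lambda>k. powr_integral n q S (f k)) \<longlonglongrightarrow> 0"
proof
  assume L: "(\<lambda>k. eLnorm n q S (f k)) \<longlonglongrightarrow> 0"
  show "(\<lambda>k. powr_integral n q S (f k)) \<longlonglongrightarrow> 0"
  proof (rule tendsto_zero_ennreal)
    fix e :: real assume e: "e > 0"
    then have "0 < ennreal ((e / 2) powr (1/q))" by simp
    then have "\<forall>\<^sub>F k in sequentially. eLnorm n q S (f k) < ennreal ((e / 2) powr (1/q))"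
      using L by (rule order_tendstoD(2)[rotated])
    then show "\<forall>\<^sub>F k in sequentially. powr_integral n q S (f k) < ennreal e"
    proof eventually_elim
      case (elim k)
      then have "powr_integral n q S (f k) \<le> ennreal (((e / 2) powr (1/q)) powr q)"
        using q e by (subst eLnorm_le_iff[symmetric]) auto
      also have "\<dots> < ennreal e" using q e by (simp add: powr_powr ennreal_less_iff)
      finally show ?case .
    qed
  qed
next
  assume L: "(\<lambda>k. powr_integral n q S (f k)) \<longlonglongrightarrow> 0"
  show "(\<lambda>k. eLnorm n q S (f k)) \<longlonglongrightarrow> 0"
  proof (rule tendsto_zero_ennreal)
    fix e :: real assume e: "e > 0"
    then have "0 < ennreal ((e / 2) powr q)" by simp
    then have "\<forall>\<^sub>F k in sequentially. powr_integral n q S (f k) < ennreal ((e / 2) powr q)"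
      using L by (rule order_tendstoD(2)[rotated])
    then show "\<forall>\<^sub>F k in sequentially. eLnorm n q S (f k) < ennreal e"
    proof eventually_elim
      case (elim k)
      then have "eLnorm n q S (f k) \<le> ennreal (e / 2)"
        using q e by (subst eLnorm_le_iff) auto
      also have "\<dots> < ennreal e" using q e by (simp add: ennreal_less_iff)
      finally show ?case .
    qed
  qed
qed

lemma eLnorm_AE_subseq:
  assumes q: "q > 0" and m[measurable]: "\<And>k. f k \<in> borel_measurable (leb n)" "g \<in> borel_measurable (leb n)" "S \<in> sets (leb n)"
    and L: "(\<lambda>k. eLnorm n q S (\<lambda>x. f k x - g x)) \<longlonglongrightarrow> 0"
  shows "\<exists>r::nat\<Rightarrow>nat. strict_mono r \<and> (AE x in leb n. x \<in> S \<longrightarrow> (\<lambda>k. f (r k) x) \<longlonglongrightarrow> g x)"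
proof -
  have "\<forall>\<^sub>F k in sequentially. eLnorm n q S (\<lambda>x. f k x - g x) < 1"
    using L by (rule order_tendstoD(2)) simp
  \<comment> \<open>From \<open>N\<close> on the norms are finite, hence the powers of the
    differences integrable, as needed for convergence in \<open>L^1\<close> along a
    subsequence.\<close>
  then obtain N where N: "\<And>k. k \<ge> N \<Longrightarrow> eLnorm n q S (\<lambda>x. f k x - g x) < 1"
    by (auto simp: eventually_sequentially)
  define u where "u k x = \<bar>f (k + N) x - g x\<bar> powr q * indicator S x" for k x
  have um[measurable]: "u k \<in> borel_measurable (leb n)" for k unfolding u_def by measurable
  have pe: "(\<integral>\<^sup>+x. ennreal (u k x) \<partial>leb n) = powr_integral n q S (\<lambda>x. f (k + N) x - g x)" for k
    by (rule nn_integral_cong) (auto simp: u_def indicator_def)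
  have int: "integrable (leb n) (u k)" for k
  proof (rule integrableI_nonneg)
    have "eLnorm n q S (\<lambda>x. f (k + N) x - g x) < 1" using N by simp
    then have "eLnorm n q S (\<lambda>x. f (k + N) x - g x) < \<infinity>" using less_trans ennreal_one_less_top by fastforce
    then show "(\<integral>\<^sup>+x. ennreal (u k x) \<partial>leb n) < \<infinity>" unfolding pe eLnorm_finite_iff .
  qed (auto simp: u_def)
  have "(\<lambda>k. powr_integral n q S (\<lambda>x. f k x - g x)) \<longlonglongrightarrow> 0" using L q by (simp add: eLnorm_tendsto_0_iff)
  then have "(\<lambda>k. \<integral>\<^sup>+x. ennreal (u k x) \<partial>leb n) \<longlonglongrightarrow> 0" unfolding pe by (rule LIMSEQ_ignore_initial_segment)
  then have "(\<lambda>k. enn2real (\<integral>\<^sup>+x. ennreal (u k x) \<partial>leb n)) \<longlonglongrightarrow> enn2real 0"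
    by (intro tendsto_enn2real) auto
  moreover have "(\<integral>x. norm (u k x) \<partial>leb n) = enn2real (\<integral>\<^sup>+x. ennreal (u k x) \<partial>leb n)" for k
    by (subst integral_eq_nn_integral) (auto simp: u_def)
  ultimately have "(\<lambda>k. \<integral>x. norm (u k x) \<partial>leb n) \<longlonglongrightarrow> 0" by simp
  from tendsto_L1_AE_subseq[OF int this] obtain r :: "nat \<Rightarrow> nat" where r: "strict_mono r"
    "AE x in leb n. (\<lambda>k. u (r k) x) \<longlonglongrightarrow> 0" by blast
  have "AE x in leb n. x \<in> S \<longrightarrow> (\<lambda>k. f (r k + N) x) \<longlonglongrightarrow> g x"
    using r(2)
  proof (eventually_elim, intro impI)
    fix x assume l: "(\<lambda>k. u (r k) x) \<longlonglongrightarrow> 0" and x: "x \<in> S"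
    have "(\<lambda>k. (u (r k) x) powr (1 / q)) \<longlonglongrightarrow> 0 powr (1 / q)"
      by (rule tendsto_powr'[OF l tendsto_const]) (use q in \<open>auto simp: u_def\<close>)
    then have "(\<lambda>k. \<bar>f (r k + N) x - g x\<bar>) \<longlonglongrightarrow> 0" using q x by (simp add: u_def powr_powr)
    then show "(\<lambda>k. f (r k + N) x) \<longlonglongrightarrow> g x"
      using LIM_zero_cancel tendsto_rabs_zero_iff by blast
  qed
  moreover have "strict_mono (\<lambda>k. r k + N)" using r(1) by (simp add: strict_mono_def)
  ultimately show ?thesis by (intro exI[of _ "\<lambda>k. r k + N"]) auto
qed

lemma eLnorm_subset_le: "q > 0 \<Longrightarrow> S \<subseteq> T \<Longrightarrow> eLnorm n q S f \<le> eLnorm n q T f"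
  by (rule eLnorm_mono) auto

lemma eLnorm_union_le:
  assumes q: "q \<ge> 1" and [measurable]: "f \<in> borel_measurable (leb n)" "S \<in> sets (leb n)" "T \<in> sets (leb n)"
  shows "eLnorm n q (S \<union> T) f \<le> eLnorm n q S f + eLnorm n q T f"
proof -
  have "eLnorm n q (S \<union> T) f \<le> eLnorm n q (S \<union> T) (\<lambda>x. indicator S x * \<bar>f x\<bar> + indicator T x * \<bar>f x\<bar>)"
    by (rule eLnorm_mono) (use q in \<open>auto simp: indicator_def\<close>)
  also have "\<dots> \<le> eLnorm n q (S \<union> T) (\<lambda>x. indicator S x * \<bar>f x\<bar>) + eLnorm n q (S \<union> T) (\<lambda>x. indicator T x * \<bar>f x\<bar>)"
    by (rule eLnorm_triangle) (use q in auto)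
  also have "eLnorm n q (S \<union> T) (\<lambda>x. indicator S x * \<bar>f x\<bar>) = eLnorm n q S (\<lambda>x. \<bar>f x\<bar>)"
    by (rule eLnorm_indicator) (use q in auto)
  also have "eLnorm n q (S \<union> T) (\<lambda>x. indicator T x * \<bar>f x\<bar>) = eLnorm n q T (\<lambda>x. \<bar>f x\<bar>)"
    by (rule eLnorm_indicator) (use q in auto)
  also have "eLnorm n q S (\<lambda>x. \<bar>f x\<bar>) = eLnorm n q S f" by (rule eLnorm_cong) auto
  also have "eLnorm n q T (\<lambda>x. \<bar>f x\<bar>) = eLnorm n q T f" by (rule eLnorm_cong) auto
  finally show ?thesis .
qed

section \<open>Lebesgue measure and topology of n-space\<close>

interpretation leb: product_sigma_finite "\<lambda>_::nat. lborel :: real measure"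
  by standard

lemma space_leb [simp]: "space (leb n) = pts n"
  by (simp add: space_PiM)

lemma sigma_finite_leb: "sigma_finite_measure (leb n)"
  by (rule leb.sigma_finite) simp

lemma pair_sigma_finite_leb: "pair_sigma_finite (leb n) (leb n)"
  by (simp add: pair_sigma_finite_def sigma_finite_leb)

section \<open>Translations, reflections and the invariance of the measure\<close>

definition shift :: "nat \<Rightarrow> point \<Rightarrow> point \<Rightarrow> point" where
  "shift n a x = (\<lambda>i\<in>{..<n}. a i + x i)"

text \<open>As a function of \<open>x\<close> this is a point reflection, as a function of
  \<open>a\<close> a translation. Convolutions use it in both ways.\<close>

definition reflect :: "nat \<Rightarrow> point \<Rightarrow> point \<Rightarrow> point" where
  "reflect n a x = (\<lambda>i\<in>{..<n}. a i - x i)"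

lemma shift_in_pts [simp]: "shift n a x \<in> pts n" and reflect_in_pts [simp]: "reflect n a x \<in> pts n"
  by (auto simp: shift_def reflect_def)

lemma shift_apply [simp]: "i < n \<Longrightarrow> shift n a x i = a i + x i"
  and reflect_apply [simp]: "i < n \<Longrightarrow> reflect n a x i = a i - x i"
  by (auto simp: shift_def reflect_def)

lemma pts_eqI: "x \<in> pts n \<Longrightarrow> y \<in> pts n \<Longrightarrow> (\<And>i. i < n \<Longrightarrow> x i = y i) \<Longrightarrow> x = y"
  by (rule PiE_ext) auto

lemma upd_in_pts [simp]: "x \<in> pts n \<Longrightarrow> i < n \<Longrightarrow> x(i := t) \<in> pts n"
  by (auto simp: PiE_iff extensional_def)

lemma origin_in_pts [simp]: "origin n \<in> pts n"
  by (auto simp: origin_def)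

lemma origin_apply [simp]: "i < n \<Longrightarrow> origin n i = 0"
  by (auto simp: origin_def)

lemma measurable_shift [measurable]: "shift n a \<in> measurable (leb n) (leb n)"
  unfolding shift_def by measurable

lemma measurable_reflect [measurable]: "reflect n a \<in> measurable (leb n) (leb n)"
  unfolding reflect_def by measurable

lemma measurable_reflect_pair [measurable]: "(\<lambda>z. reflect n (fst z) (snd z)) \<in> measurable (leb n \<Otimes>\<^sub>M leb n) (leb n)"
  unfolding reflect_def by measurable

lemma measurable_coord: "i < n \<Longrightarrow> (\<lambda>x. x i) \<in> borel_measurable (leb n)"
  using measurable_component_singleton[of i "{..<n}" "\<lambda>_. lborel :: real measure"] by simp

text \<open>The product measure is determined by its values on boxes, and preimages of boxes under a
  map that acts on each coordinate separately are products again. Translations and reflections are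
  both of this kind.\<close>

lemma distr_leb_coordinatewise:
  assumes m: "\<And>i. i < n \<Longrightarrow> T i \<in> borel_measurable borel"
    and d: "\<And>i. i < n \<Longrightarrow> distr lborel borel (T i) = (lborel :: real measure)"
  shows "distr (leb n) (leb n) (\<lambda>x. \<lambda>i\<in>{..<n}. T i (x i)) = leb n"
proof (rule leb.PiM_eqI)
  have meas: "(\<lambda>x. \<lambda>i\<in>{..<n}. T i (x i)) \<in> measurable (leb n) (leb n)"
    by (rule measurable_restrict) (use m in \<open>auto intro!: measurable_compose[OF measurable_component_singleton]\<close>)
  fix A :: "nat \<Rightarrow> real set" assume A: "\<And>i. i \<in> {..<n} \<Longrightarrow> A i \<in> sets lborel"
  have "emeasure (distr (leb n) (leb n) (\<lambda>x. \<lambda>i\<in>{..<n}. T i (x i))) (PiE {..<n} A)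
     = emeasure (leb n) ((\<lambda>x. \<lambda>i\<in>{..<n}. T i (x i)) -` (PiE {..<n} A) \<inter> pts n)"
    using A by (subst emeasure_distr[OF meas]) (auto intro!: sets_PiM_I_finite)
  also have "(\<lambda>x. \<lambda>i\<in>{..<n}. T i (x i)) -` (PiE {..<n} A) \<inter> pts n = PiE {..<n} (\<lambda>i. T i -` A i)"
    by (auto simp: PiE_iff)
  also have "emeasure (leb n) \<dots> = (\<Prod>i<n. emeasure lborel (T i -` A i))"
  proof (rule leb.emeasure_PiM)
    fix i assume i: "i \<in> {..<n}"
    then have "T i -` A i \<inter> space borel \<in> sets borel"
      using A m by (intro measurable_sets[of "T i" borel borel]) auto
    then show "T i -` A i \<in> sets lborel" by simp
  qed simp
  also have "\<dots> = (\<Prod>i<n. emeasure lborel (A i))"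
  proof (rule prod.cong)
    fix i assume i: "i \<in> {..<n}"
    have "emeasure lborel (A i) = emeasure (distr lborel borel (T i)) (A i)" using d i by simp
    also have "\<dots> = emeasure lborel (T i -` A i)" using A i m by (subst emeasure_distr) auto
    finally show "emeasure lborel (T i -` A i) = emeasure lborel (A i)" by simp
  qed simp
  finally show "emeasure (distr (leb n) (leb n) (\<lambda>x. \<lambda>i\<in>{..<n}. T i (x i))) (PiE {..<n} A) = (\<Prod>i<n. emeasure lborel (A i))" .
qed auto

lemma distr_shift: "distr (leb n) (leb n) (shift n a) = leb n"
  unfolding shift_def by (rule distr_leb_coordinatewise) (auto intro!: lborel_distr_plus[unfolded ])

lemma distr_reflect: "distr (leb n) (leb n) (reflect n a) = leb n"
  unfolding reflect_def
proof (rule distr_leb_coordinatewise)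
  fix i
  show "distr lborel borel ((-) (a i)) = (lborel :: real measure)"
    by (subst lborel_real_affine[of "-1" "a i"]) (auto simp: density_1 one_ennreal_def[symmetric])
qed auto

lemma nn_integral_shift: "f \<in> borel_measurable (leb n) \<Longrightarrow> (\<integral>\<^sup>+x. f (shift n a x) \<partial>leb n) = (\<integral>\<^sup>+x. f x \<partial>leb n)"
  using nn_integral_distr[of "shift n a" "leb n" "leb n" f] by (simp add: distr_shift)

lemma integral_shift:
  fixes f :: "point \<Rightarrow> real"
  shows "f \<in> borel_measurable (leb n) \<Longrightarrow> (LINT x|leb n. f (shift n a x)) = (LINT x|leb n. f x)"
  using integral_distr[of "shift n a" "leb n" "leb n" f] by (simp add: distr_shift)

lemma integral_reflect:
  fixes f :: "point \<Rightarrow> real"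
  shows "f \<in> borel_measurable (leb n) \<Longrightarrow> (LINT x|leb n. f (reflect n a x)) = (LINT x|leb n. f x)"
  using integral_distr[of "reflect n a" "leb n" "leb n" f] by (simp add: distr_reflect)

lemma AE_shift:
  assumes "AE x in leb n. P x"
  shows "AE x in leb n. P (shift n a x)"
  by (rule AE_distrD[OF measurable_shift]) (unfold distr_shift, rule assms)

section \<open>Cubes, which link the product topology with the product measure\<close>

definition open_box :: "nat \<Rightarrow> point \<Rightarrow> real \<Rightarrow> point set" where
  "open_box n a m = PiE {..<n} (\<lambda>i. {a i - m<..<a i + m})"

definition closed_box :: "nat \<Rightarrow> point \<Rightarrow> real \<Rightarrow> point set" where
  "closed_box n a m = PiE {..<n} (\<lambda>i. {a i - m..a i + m})"

lemma open_box_iff: "y \<in> open_box n a m \<longleftrightarrow> y \<in> pts n \<and> (\<forall>i<n. \<bar>y i - a i\<bar> < m)"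
proof -
  have "y i \<in> {a i - m<..<a i + m} \<longleftrightarrow> \<bar>y i - a i\<bar> < m" for i by (simp add: abs_less_iff) linarith
  then show ?thesis unfolding open_box_def PiE_iff by auto
qed

lemma closed_box_iff: "y \<in> closed_box n a m \<longleftrightarrow> y \<in> pts n \<and> (\<forall>i<n. \<bar>y i - a i\<bar> \<le> m)"
proof -
  have "y i \<in> {a i - m..a i + m} \<longleftrightarrow> \<bar>y i - a i\<bar> \<le> m" for i by (simp add: abs_le_iff) linarith
  then show ?thesis unfolding closed_box_def PiE_iff by auto
qed

lemma open_box_sets [measurable]: "open_box n a m \<in> sets (leb n)"
  unfolding open_box_def by (rule sets_PiM_I_finite) auto

lemma closed_box_sets [measurable]: "closed_box n a m \<in> sets (leb n)"
  unfolding closed_box_def by (rule sets_PiM_I_finite) auto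

lemma emeasure_closed_box: "m \<ge> 0 \<Longrightarrow> emeasure (leb n) (closed_box n a m) = ennreal ((2 * m) ^ n)"
  unfolding closed_box_def by (subst leb.emeasure_PiM) (auto simp: ennreal_power)

lemma openin_euc_iff: "openin (euc n) U \<longleftrightarrow> U \<subseteq> pts n \<and> (\<forall>x\<in>U. \<exists>e>0. open_box n x e \<subseteq> U)"
proof
  assume U: "openin (euc n) U"
  have "\<exists>e>0. open_box n x e \<subseteq> U" if x: "x \<in> U" for x
  proof -
    obtain W where W: "\<And>i. i < n \<Longrightarrow> open (W i)" "x \<in> PiE {..<n} W" "PiE {..<n} W \<subseteq> U"
      using U x unfolding openin_product_topology_alt by (metis lessThan_iff open_openin)
    have "\<exists>e>0. \<forall>y. \<bar>y - x i\<bar> < e \<longrightarrow> y \<in> W i" if "i < n" for i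
      using W(1)[OF that] W(2) that unfolding open_dist by (auto simp: dist_real_def PiE_iff)
    then obtain e where e: "\<And>i. i < n \<Longrightarrow> e i > 0" "\<And>i y. i < n \<Longrightarrow> \<bar>y - x i\<bar> < e i \<Longrightarrow> y \<in> W i" by metis
    \<comment> \<open>The inserted \<open>1\<close> keeps the minimum defined for
      \<open>n = 0\<close>.\<close>
    define d where "d = Min (insert 1 (e ` {..<n}))"
    have "d > 0" "\<And>i. i < n \<Longrightarrow> d \<le> e i" using e(1) by (auto simp: d_def)
    then have "open_box n x d \<subseteq> PiE {..<n} W" using e(2) by (force simp: open_box_iff PiE_iff)
    then show ?thesis using W(3) \<open>d > 0\<close> by blast
  qed
  moreover have "U \<subseteq> pts n" using openin_subset[OF U] by simp
  ultimately show "U \<subseteq> pts n \<and> (\<forall>x\<in>U. \<exists>e>0. open_box n x e \<subseteq> U)" by blast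
next
  assume U: "U \<subseteq> pts n \<and> (\<forall>x\<in>U. \<exists>e>0. open_box n x e \<subseteq> U)"
  show "openin (euc n) U"
    unfolding openin_product_topology_alt
  proof
    fix x assume x: "x \<in> U"
    then obtain e where e: "e > 0" "open_box n x e \<subseteq> U" using U by blast
    have "x \<in> open_box n x e" using x U e by (auto simp: open_box_iff)
    then show "\<exists>W. finite {i \<in> {..<n}. W i \<noteq> topspace euclideanreal} \<and> (\<forall>i\<in>{..<n}. openin euclideanreal (W i)) \<and> x \<in> PiE {..<n} W \<and> PiE {..<n} W \<subseteq> U"
      using e(2) unfolding open_box_def
      by (intro exI[of _ "\<lambda>i. {x i - e<..<x i + e}"]) (auto simp: open_openin[symmetric])
  qed
qed

text \<open>Cubes with rational centre and half-width; this makes open sets measurable. The closed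
  cubes stay inside \<open>U\<close> as well, so that locally integrable functions can be truncated
  to each member of the cover.\<close>

lemma openin_countable_cover:
  assumes "openin (euc n) U"
  shows "\<exists>C. countable C \<and> C \<subseteq> pts n \<times> {0<..} \<and> (\<forall>(a, m)\<in>C. closed_box n a m \<subseteq> U) \<and> U = (\<Union>(a, m)\<in>C. open_box n a m)"
proof -
  define Q where "Q = (PiE {..<n} (\<lambda>_. \<rat> :: real set)) \<times> (\<rat> \<inter> {0<..} :: real set)"
  define C where "C = {(a, m) \<in> Q. closed_box n a m \<subseteq> U}"
  have "countable (PiE {..<n} (\<lambda>_. \<rat> :: real set))" by (rule countable_PiE) (auto simp: countable_rat)
  then have "countable Q" unfolding Q_def by (auto simp: countable_rat)
  then have "countable C" by (rule countable_subset[rotated]) (auto simp: C_def)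
  moreover have "C \<subseteq> pts n \<times> {0<..}" by (auto simp: C_def Q_def PiE_iff extensional_def)
  moreover have "U \<subseteq> (\<Union>(a, m)\<in>C. open_box n a m)"
  proof
    fix x assume x: "x \<in> U"
    then obtain e where e: "e > 0" "open_box n x e \<subseteq> U" using assms unfolding openin_euc_iff by blast
    have xp: "x \<in> pts n" using x assms unfolding openin_euc_iff by blast
    \<comment> \<open>With \<open>m < e / 2\<close>, a closed cube of half-width \<open>m\<close>
      around a centre closer than \<open>m\<close> to \<open>x\<close> has all its points at
      coordinate distance less than \<open>e\<close> from \<open>x\<close>.\<close>
    obtain m where m: "m \<in> \<rat>" "0 < m" "m < e / 2" using Rats_dense_in_real[of 0 "e / 2"] e by auto
    have "\<exists>a\<in>\<rat>. \<bar>x i - a\<bar> < m" for i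
      using Rats_dense_in_real[of "x i - m" "x i + m"] m(2) by (auto simp: abs_less_iff intro!: bexI)
    then obtain a where a: "\<And>i. a i \<in> \<rat>" "\<And>i. \<bar>x i - a i\<bar> < m" by metis
    define a' where "a' = restrict a {..<n}"
    have "closed_box n a' m \<subseteq> open_box n x e"
    proof
      fix y assume "y \<in> closed_box n a' m"
      then show "y \<in> open_box n x e" using a(2) m(3) unfolding closed_box_iff open_box_iff a'_def
        by (auto; smt (verit) field_sum_of_halves lessThan_iff restrict_apply)
    qed
    moreover have "x \<in> open_box n a' m" using a(2) xp by (auto simp: open_box_iff a'_def)
    moreover have "(a', m) \<in> Q" using a m by (auto simp: Q_def a'_def)
    ultimately show "x \<in> (\<Union>(a, m)\<in>C. open_box n a m)" using e(2) by (auto simp: C_def)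
  qed
  moreover have "(\<Union>(a, m)\<in>C. open_box n a m) \<subseteq> U"
    by (auto simp: C_def open_box_iff closed_box_iff subset_iff less_imp_le)
  ultimately show ?thesis by (intro exI[of _ C]) (auto simp: C_def)
qed

lemma openin_sets: "openin (euc n) U \<Longrightarrow> U \<in> sets (leb n)"
  using openin_countable_cover[of n U] by (auto intro!: sets.countable_UN'')

lemma closedin_sets: "closedin (euc n) K \<Longrightarrow> K \<in> sets (leb n)"
proof -
  assume K: "closedin (euc n) K"
  then have "openin (euc n) (pts n - K)" by (auto simp: closedin_def)
  then have "pts n - (pts n - K) \<in> sets (leb n)" using openin_sets[of n] sets.compl_sets[of _ "leb n"] by simp
  moreover have "pts n - (pts n - K) = K" using closedin_subset[OF K] by auto
  ultimately show ?thesis by simp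
qed

lemma Hausdorff_euc: "Hausdorff_space (euc n)"
  by (simp add: Hausdorff_space_product_topology)

lemma compactin_sets: "compactin (euc n) K \<Longrightarrow> K \<in> sets (leb n)"
  by (rule closedin_sets[OF compactin_imp_closedin[OF Hausdorff_euc]])

lemma compactin_closed_box: "compactin (euc n) (closed_box n a m)"
  unfolding closed_box_def by (subst compactin_PiE) auto

lemma compactin_bounded:
  assumes "compactin (euc n) K"
  shows "\<exists>m>0. K \<subseteq> closed_box n (origin n) m"
proof -
  have "\<exists>m. \<forall>x\<in>K. \<bar>x i\<bar> \<le> m" if "i < n" for i
  proof -
    have "compactin euclideanreal ((\<lambda>x. x i) ` K)"
      by (rule image_compactin[OF assms]) (use that in \<open>auto intro!: continuous_map_product_projection\<close>)
    then have "bounded ((\<lambda>x. x i) ` K)" by (simp add: compact_imp_bounded)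
    then show ?thesis by (auto simp: bounded_iff)
  qed
  then obtain m where m: "\<And>i x. i < n \<Longrightarrow> x \<in> K \<Longrightarrow> \<bar>x i\<bar> \<le> m i" by metis
  define M where "M = Max (insert 1 (m ` {..<n}))"
  have "M \<ge> 1" "\<And>i. i < n \<Longrightarrow> m i \<le> M" by (auto simp: M_def)
  moreover have "K \<subseteq> pts n" using compactin_subset_topspace[OF assms] by simp
  ultimately have "K \<subseteq> closed_box n (origin n) M" using m by (fastforce simp: closed_box_iff subset_iff)
  then show ?thesis using \<open>M \<ge> 1\<close> by (intro exI[of _ M]) auto
qed

lemma compactin_emeasure_finite: "compactin (euc n) K \<Longrightarrow> emeasure (leb n) K < \<infinity>"
proof -
  assume "compactin (euc n) K"
  then obtain m where m: "m > 0" "K \<subseteq> closed_box n (origin n) m" using compactin_bounded by blast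
  have "emeasure (leb n) K \<le> emeasure (leb n) (closed_box n (origin n) m)" using m by (intro emeasure_mono) auto
  also have "\<dots> < \<infinity>" using m by (simp add: emeasure_closed_box)
  finally show ?thesis .
qed

lemma continuous_map_measurable:
  assumes "continuous_map (euc n) euclideanreal f"
  shows "f \<in> borel_measurable (leb n)"
proof (rule borel_measurableI)
  fix S :: "real set" assume "open S"
  then have "openin (euc n) {x \<in> topspace (euc n). f x \<in> S}"
    using assms by (intro openin_continuous_map_preimage[OF assms]) auto
  moreover have "{x \<in> topspace (euc n). f x \<in> S} = f -` S \<inter> space (leb n)" by auto
  ultimately show "f -` S \<inter> space (leb n) \<in> sets (leb n)" using openin_sets by metis
qed

section \<open>The Euclidean norm, balls and shells\<close>

lemma nnorm_nonneg [simp]: "nnorm n x \<ge> 0" by (simp add: nnorm_def L2_set_nonneg)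

lemma nnorm_square: "(nnorm n x)\<^sup>2 = (\<Sum>i<n. (x i)\<^sup>2)"
  by (simp add: nnorm_def L2_set_def sum_nonneg)

lemma abs_coord_le_nnorm: "i < n \<Longrightarrow> \<bar>x i\<bar> \<le> nnorm n x"
  unfolding nnorm_def L2_set_def
  by (rule real_le_rsqrt) (auto intro!: member_le_sum[of i "{..<n}" "\<lambda>i. (x i)\<^sup>2"])

lemma ndist_nnorm: "ndist n x y = nnorm n (reflect n x y)"
  by (auto simp: ndist_def nnorm_def L2_set_def reflect_def)

lemma ndist_origin: "ndist n x (origin n) = nnorm n x" "ndist n (origin n) x = nnorm n x"
  by (auto simp: ndist_def nnorm_def L2_set_def)

lemma nball_origin: "nball n (origin n) R = {y \<in> pts n. nnorm n y < R}"
  by (auto simp: nball_def ndist_origin)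

lemma continuous_coord: "i < n \<Longrightarrow> continuous_map (euc n) euclideanreal (\<lambda>x. x i)"
  by (rule continuous_map_product_projection) simp

lemma continuous_nnorm: "continuous_map (euc n) euclideanreal (nnorm n)"
proof -
  have "continuous_map (euc n) euclideanreal (\<lambda>x. \<Sum>i<n. (x i)\<^sup>2)"
    by (intro continuous_map_sum continuous_map_real_pow continuous_coord) auto
  moreover have "continuous_map euclideanreal euclideanreal sqrt"
    by (simp add: continuous_on_real_sqrt)
  ultimately have "continuous_map (euc n) euclideanreal (sqrt \<circ> (\<lambda>x. \<Sum>i<n. (x i)\<^sup>2))"
    by (rule continuous_map_compose)
  then show ?thesis by (simp add: o_def nnorm_def[abs_def] L2_set_def)
qed

lemma measurable_nnorm [measurable]: "nnorm n \<in> borel_measurable (leb n)"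
  by (rule continuous_map_measurable[OF continuous_nnorm])

lemma openin_nball_origin: "openin (euc n) (nball n (origin n) R)"
  using openin_continuous_map_preimage[OF continuous_nnorm, of "{..<R}" n] by (simp add: nball_origin)

lemma openin_nnorm_less: "openin (euc n) {x \<in> pts n. a < nnorm n x \<and> nnorm n x < b}"
  using openin_continuous_map_preimage[OF continuous_nnorm, of "{a<..<b}" n] by simp

text \<open>Closed in contrast to \<open>annulus\<close>, hence compact: shells carry the supports
  of test functions, while the norms in the theorem are taken on open annuli.\<close>

definition shell :: "nat \<Rightarrow> real \<Rightarrow> real \<Rightarrow> point set" where
  "shell n a b = {x \<in> pts n. a \<le> nnorm n x \<and> nnorm n x \<le> b}"

lemma compactin_shell: "compactin (euc n) (shell n a b)"
proof (rule closed_compactin[OF compactin_closed_box[of n "origin n" b]])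
  show "shell n a b \<subseteq> closed_box n (origin n) b"
    using abs_coord_le_nnorm by (fastforce simp: shell_def closed_box_iff intro: order_trans)
  show "closedin (euc n) (shell n a b)"
    using closedin_continuous_map_preimage[OF continuous_nnorm, of "{a..b}" n] by (simp add: shell_def)
qed

lemma shell_sets [measurable]: "shell n a b \<in> sets (leb n)"
  by (rule compactin_sets[OF compactin_shell])

text \<open>The circumscribed cube is wasteful in volume, but \<open>Holder_shell\<close> takes the
  \<open>n\<close>-th root, which is \<open>2 * b\<close> without any factor depending on
  \<open>n\<close>.\<close>

lemma emeasure_shell_le: "b \<ge> 0 \<Longrightarrow> emeasure (leb n) (shell n a b) \<le> ennreal ((2 * b) ^ n)"
proof -
  assume "b \<ge> 0"
  have "shell n a b \<subseteq> closed_box n (origin n) b"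
    using abs_coord_le_nnorm by (fastforce simp: shell_def closed_box_iff intro: order_trans)
  then have "emeasure (leb n) (shell n a b) \<le> emeasure (leb n) (closed_box n (origin n) b)"
    by (intro emeasure_mono) auto
  then show ?thesis using \<open>b \<ge> 0\<close> by (simp add: emeasure_closed_box)
qed

lemma annulus_sets [measurable]: "annulus n a b \<in> sets (leb n)"
  unfolding annulus_def by (rule openin_sets[OF openin_nnorm_less])

lemma nball_origin_sets [measurable]: "nball n (origin n) r \<in> sets (leb n)"
  by (rule openin_sets[OF openin_nball_origin])

section \<open>Smooth functions and cutoffs\<close>

text \<open>Recursion on the order of differentiation instead of the list of indices: closure under
  products and compositions then goes by induction.\<close>

fun Ck :: "nat \<Rightarrow> nat \<Rightarrow> (point \<Rightarrow> real) \<Rightarrow> bool" where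
  "Ck n 0 f = continuous_map (euc n) euclideanreal f"
| "Ck n (Suc k) f = (continuous_map (euc n) euclideanreal f \<and>
     (\<forall>i<n. (\<forall>x\<in>pts n. (\<lambda>t. f (x(i := t))) differentiable at (x i)) \<and> Ck n k (pderiv_at i f)))"

lemma pderiv_cong:
  assumes "\<And>x. x \<in> pts n \<Longrightarrow> f x = g x" "i < n" "x \<in> pts n"
  shows "pderiv_at i f x = pderiv_at i g x"
proof -
  have "(\<lambda>t. f (x(i := t))) = (\<lambda>t. g (x(i := t)))" using assms by auto
  then show ?thesis by (simp add: pderiv_at_def)
qed

lemma continuous_map_cong_pts:
  assumes "\<And>x. x \<in> pts n \<Longrightarrow> f x = g x"
  shows "continuous_map (euc n) euclideanreal f = continuous_map (euc n) euclideanreal g"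
  using continuous_map_eq[of "euc n" euclideanreal f g] continuous_map_eq[of "euc n" euclideanreal g f] assms by auto

lemma Ck_cong:
  assumes "\<And>x. x \<in> pts n \<Longrightarrow> f x = g x"
  shows "Ck n k f = Ck n k g"
  using assms
proof (induction k arbitrary: f g)
  case 0
  then show ?case using continuous_map_cong_pts[of n f g] by simp
next
  case (Suc k)
  have "continuous_map (euc n) euclideanreal f = continuous_map (euc n) euclideanreal g"
    by (rule continuous_map_cong_pts) (use Suc in auto)
  moreover have "(\<lambda>t. f (x(i := t))) = (\<lambda>t. g (x(i := t)))" if "i < n" "x \<in> pts n" for i x
    by (rule ext, rule Suc.prems, rule upd_in_pts) (use that in auto)
  moreover have "Ck n k (pderiv_at i f) = Ck n k (pderiv_at i g)" if "i < n" for i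
    by (rule Suc.IH) (use Suc.prems pderiv_cong[of n f g i] that in auto)
  ultimately show ?case by (simp cong: conj_cong)
qed

lemma iter_pderiv_append: "iter_pderiv (is @ js) f = iter_pderiv is (iter_pderiv js f)"
  by (induction "is") auto

lemma smooth_pderiv:
  assumes "smooth n f" "i < n"
  shows "smooth n (pderiv_at i f)"
  unfolding smooth_def
proof (intro allI impI)
  fix js :: "nat list" assume "set js \<subseteq> {..<n}"
  then have "set (js @ [i]) \<subseteq> {..<n}" using assms by auto
  then show "continuous_map (euc n) euclideanreal (iter_pderiv js (pderiv_at i f)) \<and>
     (\<forall>j<n. \<forall>x\<in>pts n. (\<lambda>t. iter_pderiv js (pderiv_at i f) (x(j := t))) differentiable at (x j))"
    using assms(1) unfolding smooth_def by (metis iter_pderiv.simps iter_pderiv_append)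
qed

lemma smooth_basic:
  assumes "smooth n f"
  shows "continuous_map (euc n) euclideanreal f"
    "\<And>i x. i < n \<Longrightarrow> x \<in> pts n \<Longrightarrow> (\<lambda>t. f (x(i := t))) differentiable at (x i)"
  using assms[unfolded smooth_def, rule_format, of "[]"] by auto

lemma smooth_iff: "smooth n f \<longleftrightarrow> (\<forall>k. Ck n k f)"
proof
  show "smooth n f \<Longrightarrow> \<forall>k. Ck n k f"
  proof
    fix k show "smooth n f \<Longrightarrow> Ck n k f"
      by (induction k arbitrary: f) (auto simp: smooth_basic smooth_pderiv)
  qed
next
  assume *: "\<forall>k. Ck n k f"
  have A: "set js \<subseteq> {..<n} \<Longrightarrow> \<forall>k. Ck n k g \<Longrightarrow>
    continuous_map (euc n) euclideanreal (iter_pderiv js g) \<and>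
     (\<forall>j<n. \<forall>x\<in>pts n. (\<lambda>t. iter_pderiv js g (x(j := t))) differentiable at (x j))" for js g
  proof (induction js arbitrary: g rule: rev_induct)
    case Nil
    have "Ck n (Suc 0) g" using Nil by blast
    then show ?case unfolding Ck.simps iter_pderiv.simps by blast
  next
    case (snoc i js)
    have "\<forall>k. Ck n k (pderiv_at i g)"
    proof
      fix k
      have "Ck n (Suc k) g" using snoc by blast
      then show "Ck n k (pderiv_at i g)" using snoc by simp
    qed
    then show ?case using snoc by (simp add: iter_pderiv_append)
  qed
  show "smooth n f" unfolding smooth_def using A * by blast
qed

abbreviation has_pd :: "nat \<Rightarrow> (point \<Rightarrow> real) \<Rightarrow> point \<Rightarrow> real \<Rightarrow> bool" where
  "has_pd i f x d \<equiv> ((\<lambda>t. f (x(i := t))) has_real_derivative d) (at (x i))"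

lemma has_pd_eq: "has_pd i f x d \<Longrightarrow> pderiv_at i f x = d"
  unfolding pderiv_at_def by (rule DERIV_imp_deriv)

lemma smooth_has_pd:
  assumes "smooth n f" "i < n" "x \<in> pts n"
  shows "has_pd i f x (pderiv_at i f x)"
  using smooth_basic(2)[OF assms] unfolding pderiv_at_def
  by (simp only: DERIV_deriv_iff_real_differentiable)

lemma Ck_mono: "Ck n (Suc k) f \<Longrightarrow> Ck n k f"
  by (induction k arbitrary: f) auto

lemma Ck_continuous: "Ck n k f \<Longrightarrow> continuous_map (euc n) euclideanreal f"
  by (cases k) auto

text \<open>A candidate for each derivative is enough; it is exchanged for \<open>pderiv_at\<close>
  by \<open>Ck_cong\<close>, as only values on \<open>pts n\<close> matter.\<close>

lemma Ck_SucI: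
  assumes "continuous_map (euc n) euclideanreal f"
    and "\<And>i. i < n \<Longrightarrow> \<exists>g. Ck n k g \<and> (\<forall>x\<in>pts n. has_pd i f x (g x))"
  shows "Ck n (Suc k) f"
proof -
  have "(\<forall>x\<in>pts n. (\<lambda>t. f (x(i := t))) differentiable at (x i)) \<and> Ck n k (pderiv_at i f)" if i: "i < n" for i
  proof -
    obtain g where g: "Ck n k g" "\<And>x. x \<in> pts n \<Longrightarrow> has_pd i f x (g x)" using assms(2)[OF i] by blast
    then have "Ck n k (pderiv_at i f)" using Ck_cong[of n "pderiv_at i f" g k] has_pd_eq by metis
    then show ?thesis using g(2) real_differentiable_def by blast
  qed
  then show ?thesis using assms(1) by simp
qed

lemma Ck_SucD:
  assumes "Ck n (Suc k) f" "i < n"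
  shows "Ck n k (pderiv_at i f)" "\<And>x. x \<in> pts n \<Longrightarrow> has_pd i f x (pderiv_at i f x)"
proof -
  show "Ck n k (pderiv_at i f)" using assms by simp
  fix x assume "x \<in> pts n"
  then have "(\<lambda>t. f (x(i := t))) differentiable at (x i)" using assms by auto
  then show "has_pd i f x (pderiv_at i f x)" unfolding pderiv_at_def
    by (simp only: DERIV_deriv_iff_real_differentiable)
qed

lemma Ck_const: "Ck n k (\<lambda>_. c)"
proof (induction k arbitrary: c)
  case (Suc k)
  show ?case
    by (rule Ck_SucI) (use Suc in \<open>auto intro!: exI[of _ "\<lambda>_. 0"]\<close>)
qed auto

lemma Ck_coord: "j < n \<Longrightarrow> Ck n k (\<lambda>x. x j)"
proof (cases k)
  case (Suc k')
  assume j: "j < n"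
  show ?thesis unfolding Suc
  proof (rule Ck_SucI)
    fix i assume i: "i < n"
    show "\<exists>g. Ck n k' g \<and> (\<forall>x\<in>pts n. has_pd i (\<lambda>x. x j) x (g x))"
      by (rule exI[of _ "\<lambda>_. if i = j then 1 else 0"]) (auto simp: Ck_const intro!: derivative_eq_intros)
  qed (use j in \<open>auto intro: continuous_coord\<close>)
qed (auto intro: continuous_coord)

lemma Ck_add: "Ck n k f \<Longrightarrow> Ck n k g \<Longrightarrow> Ck n k (\<lambda>x. f x + g x)"
proof (induction k arbitrary: f g)
  case 0
  then show ?case by (auto intro: continuous_map_add)
next
  case (Suc k)
  show ?case
  proof (rule Ck_SucI)
    show "continuous_map (euc n) euclideanreal (\<lambda>x. f x + g x)"
      using Suc.prems by (intro continuous_map_add Ck_continuous)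
    fix i assume i: "i < n"
    show "\<exists>h. Ck n k h \<and> (\<forall>x\<in>pts n. has_pd i (\<lambda>x. f x + g x) x (h x))"
      by (rule exI[of _ "\<lambda>x. pderiv_at i f x + pderiv_at i g x"])
        (intro conjI ballI Suc.IH DERIV_add Ck_SucD[OF Suc.prems(1) i] Ck_SucD[OF Suc.prems(2) i])
  qed
qed

lemma has_pd_mult:
  assumes "has_pd i f x a" "has_pd i g x b"
  shows "has_pd i (\<lambda>x. f x * g x) x (a * g x + f x * b)"
  using DERIV_mult'[OF assms] by (simp add: add.commute)

lemma Ck_mult: "Ck n k f \<Longrightarrow> Ck n k g \<Longrightarrow> Ck n k (\<lambda>x. f x * g x)"
proof (induction k arbitrary: f g)
  case 0
  then show ?case by (auto intro: continuous_map_real_mult)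
next
  case (Suc k)
  show ?case
  proof (rule Ck_SucI)
    show "continuous_map (euc n) euclideanreal (\<lambda>x. f x * g x)"
      using Suc.prems by (intro continuous_map_real_mult Ck_continuous)
    fix i assume i: "i < n"
    show "\<exists>h. Ck n k h \<and> (\<forall>x\<in>pts n. has_pd i (\<lambda>x. f x * g x) x (h x))"
    proof (intro exI[of _ "\<lambda>x. pderiv_at i f x * g x + f x * pderiv_at i g x"] conjI ballI)
      show "Ck n k (\<lambda>x. pderiv_at i f x * g x + f x * pderiv_at i g x)"
        by (intro Ck_add Suc.IH Ck_SucD(1)[OF _ i] Suc.prems Ck_mono[OF Suc.prems(1)] Ck_mono[OF Suc.prems(2)])
      fix x assume x: "x \<in> pts n"
      show "has_pd i (\<lambda>x. f x * g x) x (pderiv_at i f x * g x + f x * pderiv_at i g x)"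
        by (rule has_pd_mult[OF Ck_SucD(2)[OF Suc.prems(1) i x] Ck_SucD(2)[OF Suc.prems(2) i x]])
    qed
  qed
qed

section \<open>Smooth functions of one real variable\<close>

fun kdiff :: "nat \<Rightarrow> (real \<Rightarrow> real) \<Rightarrow> bool" where
  "kdiff 0 g = True"
| "kdiff (Suc k) g = (\<exists>g'. (\<forall>t. (g has_real_derivative g' t) (at t)) \<and> kdiff k g')"

text \<open>\<open>kdiff\<close> asks for some derivative rather than for \<open>deriv\<close>,
  since sums, products and reciprocals come with a formula for theirs; \<open>smooth1_deriv\<close>
  recovers \<open>deriv\<close> afterwards.\<close>

definition smooth1 :: "(real \<Rightarrow> real) \<Rightarrow> bool" where "smooth1 g \<longleftrightarrow> (\<forall>k. kdiff k g)"

lemma kdiff_mono: "kdiff (Suc k) g \<Longrightarrow> kdiff k g"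
  by (induction k arbitrary: g) auto

lemma kdiff_SucI: "(\<And>t. (g has_real_derivative g' t) (at t)) \<Longrightarrow> kdiff k g' \<Longrightarrow> kdiff (Suc k) g"
  by auto

lemma kdiff_add: "kdiff k f \<Longrightarrow> kdiff k g \<Longrightarrow> kdiff k (\<lambda>t. f t + g t)"
proof (induction k arbitrary: f g)
  case (Suc k)
  then obtain f' g' where "\<And>t. (f has_real_derivative f' t) (at t)" "kdiff k f'"
    "\<And>t. (g has_real_derivative g' t) (at t)" "kdiff k g'" by auto
  then show ?case by (intro kdiff_SucI[of _ "\<lambda>t. f' t + g' t" k, OF DERIV_add Suc.IH])
qed simp

lemma kdiff_mult: "kdiff k f \<Longrightarrow> kdiff k g \<Longrightarrow> kdiff k (\<lambda>t. f t * g t)"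
proof (induction k arbitrary: f g)
  case (Suc k)
  then obtain f' g' where *: "\<And>t. (f has_real_derivative f' t) (at t)" "kdiff k f'"
    "\<And>t. (g has_real_derivative g' t) (at t)" "kdiff k g'" by auto
  have "kdiff k (\<lambda>t. f t * g' t + f' t * g t)"
    by (intro kdiff_add Suc.IH * kdiff_mono[OF Suc.prems(1)] kdiff_mono[OF Suc.prems(2)])
  then show ?case by (rule kdiff_SucI[OF DERIV_mult'[OF *(1) *(3)]])
qed simp

lemma kdiff_const: "kdiff k (\<lambda>_. c)"
proof (induction k arbitrary: c)
  case (Suc k)
  show ?case by (rule kdiff_SucI[where g' = "\<lambda>_. 0"]) (auto simp: Suc)
qed simp

lemma kdiff_affine: "kdiff k g \<Longrightarrow> kdiff k (\<lambda>t. g (a * t + b))"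
proof (induction k arbitrary: g)
  case (Suc k)
  then obtain g' where *: "\<And>t. (g has_real_derivative g' t) (at t)" "kdiff k g'" by auto
  have "((\<lambda>t. g (a * t + b)) has_real_derivative g' (a * t + b) * a) (at t)" for t
    by (rule DERIV_chain2[OF *(1)]) (auto intro!: derivative_eq_intros)
  moreover have "kdiff k (\<lambda>t. g' (a * t + b) * a)" by (rule kdiff_mult[OF Suc.IH[OF *(2)] kdiff_const])
  ultimately show ?case by (rule kdiff_SucI)
qed simp

lemma kdiff_inverse:
  assumes "\<And>t. g t \<noteq> 0"
  shows "kdiff k g \<Longrightarrow> kdiff k (\<lambda>t. inverse (g t))"
  using assms
proof (induction k)
  case (Suc k)
  then obtain g' where *: "\<And>t. (g has_real_derivative g' t) (at t)" "kdiff k g'" by auto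
  have "((\<lambda>t. inverse (g t)) has_real_derivative (-1) * (g' t * (inverse (g t) * inverse (g t)))) (at t)" for t
    using DERIV_inverse_fun[OF *(1)[of t] Suc.prems(2)] by (simp add: power2_eq_square mult_ac)
  moreover have "kdiff k (\<lambda>t. (-1) * (g' t * (inverse (g t) * inverse (g t))))"
  proof -
    have "kdiff k (\<lambda>t. inverse (g t))" by (rule Suc.IH[OF kdiff_mono[OF Suc.prems(1)] Suc.prems(2)])
    then show ?thesis by (intro kdiff_mult kdiff_const *(2))
  qed
  ultimately show ?case by (rule kdiff_SucI)
qed simp

lemma smooth1_has_derivative: "smooth1 g \<Longrightarrow> (g has_real_derivative deriv g t) (at t)"
  and smooth1_deriv: "smooth1 g \<Longrightarrow> smooth1 (deriv g)"
proof -
  assume g: "smooth1 g"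
  show "(g has_real_derivative deriv g t) (at t)" for t
  proof -
    obtain g' where "\<And>t. (g has_real_derivative g' t) (at t)"
      using g[unfolded smooth1_def, rule_format, of "Suc 0"] by auto
    then show ?thesis using DERIV_imp_deriv by metis
  qed
  show "smooth1 (deriv g)" unfolding smooth1_def
  proof
    fix k
    obtain g' where *: "\<And>t. (g has_real_derivative g' t) (at t)" "kdiff k g'"
      using g[unfolded smooth1_def, rule_format, of "Suc k"] by auto
    then have "deriv g = g'" using DERIV_imp_deriv by blast
    then show "kdiff k (deriv g)" using * by simp
  qed
qed

lemma smooth1_continuous: "smooth1 g \<Longrightarrow> continuous_on A g"
  using smooth1_has_derivative by (meson DERIV_continuous_on DERIV_isCont continuous_at_imp_continuous_on)

lemma smooth1_mult: "smooth1 f \<Longrightarrow> smooth1 g \<Longrightarrow> smooth1 (\<lambda>t. f t * g t)" by (simp add: smooth1_def kdiff_mult)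
lemma smooth1_add: "smooth1 f \<Longrightarrow> smooth1 g \<Longrightarrow> smooth1 (\<lambda>t. f t + g t)" by (simp add: smooth1_def kdiff_add)
lemma smooth1_const: "smooth1 (\<lambda>t. c)" by (simp add: smooth1_def kdiff_const)
lemma smooth1_affine: "smooth1 g \<Longrightarrow> smooth1 (\<lambda>t. g (a * t + b))" by (simp add: smooth1_def kdiff_affine)
lemma smooth1_inverse: "smooth1 g \<Longrightarrow> (\<And>t. g t \<noteq> 0) \<Longrightarrow> smooth1 (\<lambda>t. inverse (g t))" by (simp add: smooth1_def kdiff_inverse)

text \<open>The outer function is generalised in the induction because the derivative brings in
  \<open>deriv g\<close>, while the inner function stays the same.\<close>

lemma Ck_compose: "smooth1 g \<Longrightarrow> Ck n k f \<Longrightarrow> Ck n k (\<lambda>x. g (f x))"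
proof (induction k arbitrary: g)
  case 0
  have "continuous_map (euc n) euclideanreal (g \<circ> f)"
    by (rule continuous_map_compose[of _ euclideanreal]) (use 0 smooth1_continuous in auto)
  then show ?case by (simp add: o_def)
next
  case (Suc k)
  have "continuous_map (euc n) euclideanreal (g \<circ> f)"
    by (rule continuous_map_compose[of _ euclideanreal]) (use Suc smooth1_continuous Ck_continuous in auto)
  then have co: "continuous_map (euc n) euclideanreal (\<lambda>x. g (f x))" by (simp add: o_def)
  show ?case
  proof (rule Ck_SucI[OF co])
    fix i assume i: "i < n"
    show "\<exists>h. Ck n k h \<and> (\<forall>x\<in>pts n. has_pd i (\<lambda>x. g (f x)) x (h x))"
    proof (intro exI[of _ "\<lambda>x. deriv g (f x) * pderiv_at i f x"] conjI ballI)
      show "Ck n k (\<lambda>x. deriv g (f x) * pderiv_at i f x)"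
        by (rule Ck_mult[OF Suc.IH[OF smooth1_deriv[OF Suc.prems(1)] Ck_mono[OF Suc.prems(2)]] Ck_SucD(1)[OF Suc.prems(2) i]])
      fix x assume x: "x \<in> pts n"
      have *: "has_pd i f x (pderiv_at i f x)" using Suc.prems i x Ck_SucD(2) by blast
      have "(g has_real_derivative deriv g (f x)) (at (f (x(i := x i))))" using smooth1_has_derivative[OF Suc.prems(1)] by simp
      from DERIV_chain2[OF this *]
      show "has_pd i (\<lambda>x. g (f x)) x (deriv g (f x) * pderiv_at i f x)" .
    qed
  qed
qed

lemma smooth_const: "smooth n (\<lambda>_. c)" by (simp add: smooth_iff Ck_const)
lemma smooth_coord: "i < n \<Longrightarrow> smooth n (\<lambda>x. x i)" by (simp add: smooth_iff Ck_coord)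
lemma smooth_add: "smooth n f \<Longrightarrow> smooth n g \<Longrightarrow> smooth n (\<lambda>x. f x + g x)" by (simp add: smooth_iff Ck_add)
lemma smooth_mult: "smooth n f \<Longrightarrow> smooth n g \<Longrightarrow> smooth n (\<lambda>x. f x * g x)" by (simp add: smooth_iff Ck_mult)
lemma smooth_compose: "smooth1 g \<Longrightarrow> smooth n f \<Longrightarrow> smooth n (\<lambda>x. g (f x))" by (simp add: smooth_iff Ck_compose)
lemma smooth_diff: "smooth n f \<Longrightarrow> smooth n g \<Longrightarrow> smooth n (\<lambda>x. f x - g x)"
  using smooth_add[of n f "\<lambda>x. (-1) * g x"] smooth_mult[OF smooth_const, of n g "-1"] by simp
lemma smooth_sum: "finite I \<Longrightarrow> (\<And>i. i \<in> I \<Longrightarrow> smooth n (f i)) \<Longrightarrow> smooth n (\<lambda>x. \<Sum>i\<in>I. f i x)"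
proof (induction I rule: finite_induct)
  case (insert i I)
  have "smooth n (\<lambda>x. f i x + (\<Sum>i\<in>I. f i x))" by (rule smooth_add) (use insert in auto)
  then show ?case using insert by simp
qed (simp add: smooth_const)
lemma smooth_prod: "finite I \<Longrightarrow> (\<And>i. i \<in> I \<Longrightarrow> smooth n (f i)) \<Longrightarrow> smooth n (\<lambda>x. \<Prod>i\<in>I. f i x)"
proof (induction I rule: finite_induct)
  case (insert i I)
  have "smooth n (\<lambda>x. f i x * (\<Prod>i\<in>I. f i x))" by (rule smooth_mult) (use insert in auto)
  then show ?case using insert by simp
qed (simp add: smooth_const)
lemma smooth_measurable: "smooth n f \<Longrightarrow> f \<in> borel_measurable (leb n)"
  by (rule continuous_map_measurable[OF smooth_basic(1)])

lemma pderiv_mult: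
  assumes "smooth n f" "smooth n g" "i < n" "x \<in> pts n"
  shows "pderiv_at i (\<lambda>x. f x * g x) x = pderiv_at i f x * g x + f x * pderiv_at i g x"
  by (rule has_pd_eq[OF has_pd_mult[OF smooth_has_pd[OF assms(1,3,4)] smooth_has_pd[OF assms(2,3,4)]]])

lemma pderiv_add:
  assumes "smooth n f" "smooth n g" "i < n" "x \<in> pts n"
  shows "pderiv_at i (\<lambda>x. f x + g x) x = pderiv_at i f x + pderiv_at i g x"
  by (rule has_pd_eq[OF DERIV_add[OF smooth_has_pd[OF assms(1,3,4)] smooth_has_pd[OF assms(2,3,4)]]])

lemma pderiv_diff:
  assumes "smooth n f" "smooth n g" "i < n" "x \<in> pts n"
  shows "pderiv_at i (\<lambda>x. f x - g x) x = pderiv_at i f x - pderiv_at i g x"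
  by (rule has_pd_eq[OF DERIV_diff[OF smooth_has_pd[OF assms(1,3,4)] smooth_has_pd[OF assms(2,3,4)]]])

lemma pderiv_compose:
  assumes "smooth1 g" "smooth n f" "i < n" "x \<in> pts n"
  shows "pderiv_at i (\<lambda>x. g (f x)) x = deriv g (f x) * pderiv_at i f x"
proof (rule has_pd_eq)
  have "(g has_real_derivative deriv g (f x)) (at (f (x(i := x i))))" using smooth1_has_derivative[OF assms(1)] by simp
  from DERIV_chain2[OF this smooth_has_pd[OF assms(2-4)]]
  show "has_pd i (\<lambda>x. g (f x)) x (deriv g (f x) * pderiv_at i f x)" .
qed

lemma pderiv2_mult:
  assumes s: "smooth n f" "smooth n g" and i: "i < n" and x: "x \<in> pts n"
  shows "pderiv_at i (pderiv_at i (\<lambda>x. f x * g x)) x =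
    pderiv_at i (pderiv_at i f) x * g x + 2 * (pderiv_at i f x * pderiv_at i g x) + f x * pderiv_at i (pderiv_at i g) x"
proof -
  have "pderiv_at i (pderiv_at i (\<lambda>x. f x * g x)) x = pderiv_at i (\<lambda>x. pderiv_at i f x * g x + f x * pderiv_at i g x) x"
    by (rule pderiv_cong[OF _ i x]) (use pderiv_mult s i in auto)
  also have "\<dots> = pderiv_at i (\<lambda>x. pderiv_at i f x * g x) x + pderiv_at i (\<lambda>x. f x * pderiv_at i g x) x"
    by (rule pderiv_add) (use s i x smooth_mult smooth_pderiv in auto)
  also have "\<dots> = (pderiv_at i (pderiv_at i f) x * g x + pderiv_at i f x * pderiv_at i g x)
       + (pderiv_at i f x * pderiv_at i g x + f x * pderiv_at i (pderiv_at i g) x)"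
    unfolding pderiv_mult[OF smooth_pderiv[OF s(1) i] s(2) i x] pderiv_mult[OF s(1) smooth_pderiv[OF s(2) i] i x] ..
  finally show ?thesis by simp
qed

section \<open>Laplacian, gradient and the product rule\<close>

definition lap :: "nat \<Rightarrow> (point \<Rightarrow> real) \<Rightarrow> point \<Rightarrow> real" where
  "lap n f x = (\<Sum>i<n. pderiv_at i (pderiv_at i f) x)"

definition grad_inner :: "nat \<Rightarrow> (point \<Rightarrow> real) \<Rightarrow> (point \<Rightarrow> real) \<Rightarrow> point \<Rightarrow> real" where
  "grad_inner n f g x = (\<Sum>i<n. pderiv_at i f x * pderiv_at i g x)"

definition grad_len :: "nat \<Rightarrow> (point \<Rightarrow> real) \<Rightarrow> point \<Rightarrow> real" where
  "grad_len n f x = L2_set (\<lambda>i. pderiv_at i f x) {..<n}"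

lemma grad_len_nonneg [simp]: "grad_len n f x \<ge> 0" by (simp add: grad_len_def L2_set_nonneg)

lemma grad_len_square: "(grad_len n f x)\<^sup>2 = grad_inner n f f x"
  by (simp add: grad_len_def L2_set_def grad_inner_def sum_nonneg power2_eq_square)

lemma abs_grad_inner_le: "\<bar>grad_inner n f g x\<bar> \<le> grad_len n f x * grad_len n g x"
proof -
  have "\<bar>grad_inner n f g x\<bar> \<le> (\<Sum>i<n. \<bar>pderiv_at i f x\<bar> * \<bar>pderiv_at i g x\<bar>)"
    unfolding grad_inner_def by (rule order_trans[OF sum_abs]) (simp add: abs_mult)
  also have "\<dots> \<le> grad_len n f x * grad_len n g x" unfolding grad_len_def by (rule L2_set_mult_ineq)
  finally show ?thesis .
qed

lemma lap_mult:
  assumes "smooth n f" "smooth n g" "x \<in> pts n"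
  shows "lap n (\<lambda>x. f x * g x) x = f x * lap n g x + 2 * grad_inner n f g x + g x * lap n f x"
  unfolding lap_def grad_inner_def using assms
  by (simp add: pderiv2_mult sum.distrib sum_distrib_left sum_distrib_right algebra_simps)

lemma smooth_lap: "smooth n f \<Longrightarrow> smooth n (lap n f)"
  unfolding lap_def[abs_def] by (intro smooth_sum smooth_pderiv) auto

lemma smooth_grad_inner: "smooth n f \<Longrightarrow> smooth n g \<Longrightarrow> smooth n (grad_inner n f g)"
  unfolding grad_inner_def[abs_def] by (intro smooth_sum smooth_pderiv smooth_mult) auto

lemma measurable_grad_len:
  assumes "smooth n f"
  shows "grad_len n f \<in> borel_measurable (leb n)"
proof -
  have "pderiv_at i f \<in> borel_measurable (leb n)" if "i \<in> {..<n}" for i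
    using smooth_measurable[OF smooth_pderiv[OF assms]] that by simp
  then have "(\<lambda>x. sqrt (\<Sum>i<n. (pderiv_at i f x)\<^sup>2)) \<in> borel_measurable (leb n)"
    by measurable
  then show ?thesis by (simp add: grad_len_def[abs_def] L2_set_def)
qed

text \<open>With the polynomial as a parameter the class of these functions is closed under derivation.\<close>

definition flat :: "real poly \<Rightarrow> real \<Rightarrow> real" where
  "flat p t = (if t > 0 then poly p (inverse t) * exp (- inverse t) else 0)"

lemma tendsto_poly_exp_0: "((\<lambda>x::real. poly p x * exp (- x)) \<longlongrightarrow> 0) at_top"
proof -
  have "((\<lambda>x::real. \<Sum>i\<le>degree p. coeff p i * (x ^ i / exp x)) \<longlongrightarrow> (\<Sum>i\<le>degree p. coeff p i * 0)) at_top"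
    by (intro tendsto_sum tendsto_mult tendsto_const tendsto_power_div_exp_0)
  then show ?thesis by (simp add: poly_altdef sum_distrib_right exp_minus divide_inverse mult.assoc)
qed

text \<open>With \<open>s = inverse t\<close> and \<open>q\<close> the derivative of the polynomial
  \<open>p\<close>, the derivative of \<open>p(s) exp(-s)\<close> in \<open>t\<close> is
  \<open>s^2 (p(s) - q(s)) exp(-s)\<close>, and \<open>[:0, 0, 1:]\<close> is the polynomial
  \<open>s^2\<close>. At zero the difference quotient from the right is
  \<open>s p(s) exp(-s)\<close>, which tends to zero as \<open>s\<close> grows.\<close>

lemma flat_has_derivative:
  "(flat p has_real_derivative flat ([:0, 0, 1:] * (p - pderiv p)) t) (at t)"
proof (cases t "0::real" rule: linorder_cases)
  case less
  have "(flat p has_real_derivative 0) (at t) \<longleftrightarrow> ((\<lambda>_. 0) has_real_derivative 0) (at t)"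
    by (rule DERIV_cong_ev[OF refl _ refl]) (use less in \<open>auto simp: flat_def intro!: eventually_mono[OF order_tendstoD(2)[OF tendsto_ident_at less]] eventually_nhds_in_open[of "{..<0}" t, THEN eventually_mono]\<close>)
  then show ?thesis using less by (simp add: flat_def)
next
  case greater
  have ev: "\<forall>\<^sub>F s in nhds t. s > 0" using eventually_nhds_in_open[of "{0<..}" t] greater by simp
  have "(flat p has_real_derivative d) (at t) \<longleftrightarrow> ((\<lambda>t. poly p (inverse t) * exp (- inverse t)) has_real_derivative d) (at t)" for d
    by (rule DERIV_cong_ev[OF refl _ refl]) (use ev in \<open>eventually_elim, simp add: flat_def\<close>)
  moreover have "((\<lambda>t. poly p (inverse t) * exp (- inverse t)) has_real_derivative flat ([:0, 0, 1:] * (p - pderiv p)) t) (at t)"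
  proof -
    have d1: "(inverse has_real_derivative - (inverse t * inverse t)) (at t)"
      using DERIV_inverse[of t UNIV] greater by (simp add: power2_eq_square power_inverse)
    have "((\<lambda>t. poly p (inverse t)) has_real_derivative poly (pderiv p) (inverse t) * - (inverse t * inverse t)) (at t)"
      by (rule DERIV_chain2[OF poly_DERIV d1])
    moreover have "((\<lambda>t. exp (- inverse t)) has_real_derivative exp (- inverse t) * - (- (inverse t * inverse t))) (at t)"
      by (rule DERIV_chain2[OF DERIV_exp DERIV_minus[OF d1]])
    ultimately have "((\<lambda>t. poly p (inverse t) * exp (- inverse t)) has_real_derivative
        poly p (inverse t) * (exp (- inverse t) * - (- (inverse t * inverse t))) + poly (pderiv p) (inverse t) * - (inverse t * inverse t) * exp (- inverse t)) (at t)"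
      by (rule DERIV_mult')
    then show ?thesis using greater by (simp add: flat_def algebra_simps)
  qed
  ultimately show ?thesis by blast
next
  case equal
  have "((\<lambda>h. flat p h / h) \<longlongrightarrow> 0) (at_left 0)"
    by (rule tendsto_eventually) (auto simp: flat_def eventually_at_filter)
  moreover have "((\<lambda>h. flat p h / h) \<longlongrightarrow> 0) (at_right 0)"
  proof (rule Lim_transform_eventually)
    show "((\<lambda>h. poly ([:0, 1:] * p) (inverse h) * exp (- inverse h)) \<longlongrightarrow> 0) (at_right 0)"
      by (rule filterlim_compose[OF tendsto_poly_exp_0 filterlim_inverse_at_top_right])
    show "\<forall>\<^sub>F h in at_right 0. poly ([:0, 1:] * p) (inverse h) * exp (- inverse h) = flat p h / h"
      by (auto simp: flat_def eventually_at_filter field_simps)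
  qed
  ultimately have "((\<lambda>h. flat p h / h) \<longlongrightarrow> 0) (at 0)" by (simp add: filterlim_split_at)
  then show ?thesis using equal by (simp add: has_field_derivative_iff flat_def)
qed

lemma smooth1_flat: "smooth1 (flat p)"
proof -
  have "kdiff k (flat p)" for k p
  proof (induction k arbitrary: p)
    case (Suc k)
    show ?case by (rule kdiff_SucI[OF flat_has_derivative Suc.IH])
  qed simp
  then show ?thesis by (simp add: smooth1_def)
qed

section \<open>The smooth step and the radial cutoffs\<close>

definition flat1 :: "real \<Rightarrow> real" where "flat1 = flat 1"

lemma flat1_pos: "t > 0 \<Longrightarrow> flat1 t > 0" and flat1_nonneg: "flat1 t \<ge> 0" and flat1_zero: "t \<le> 0 \<Longrightarrow> flat1 t = 0"
  by (auto simp: flat1_def flat_def)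

lemma smooth1_flat1: "smooth1 flat1" by (simp add: flat1_def smooth1_flat)

text \<open>The denominator is positive because \<open>t\<close> or \<open>1 - t\<close> is; the
  latter is written \<open>(-1) * t + 1\<close> to match \<open>smooth1_affine\<close>.\<close>

definition step :: "real \<Rightarrow> real" where "step t = flat1 t * inverse (flat1 t + flat1 ((-1) * t + 1))"

lemma step_denom_pos: "flat1 t + flat1 ((-1) * t + 1) > 0"
  using flat1_pos[of t] flat1_pos[of "(-1) * t + 1"] flat1_nonneg[of t] flat1_nonneg[of "(-1) * t + 1"]
  by (cases "t > 0") auto

lemma smooth1_step: "smooth1 step"
  unfolding step_def[abs_def] using step_denom_pos
  by (intro smooth1_mult[OF smooth1_flat1 smooth1_inverse[OF smooth1_add[OF smooth1_flat1 smooth1_affine[OF smooth1_flat1]]]]) (metis less_irrefl)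

lemma step_0: "t \<le> 0 \<Longrightarrow> step t = 0" by (simp add: step_def flat1_zero)

lemma step_1: "t \<ge> 1 \<Longrightarrow> step t = 1"
  using step_denom_pos[of t] by (simp add: step_def flat1_zero)

lemma step_range: "0 \<le> step t" "step t \<le> 1"
  using flat1_nonneg[of t] flat1_nonneg[of "(-1) * t + 1"] step_denom_pos[of t]
  by (auto simp: step_def field_simps)

text \<open>The closure matters: continuity of the derivative carries the value zero to the end
  points of the intervals where \<open>step\<close> is constant.\<close>

lemma deriv_eq_0_of_const:
  assumes "smooth1 g" "open S" "\<And>t. t \<in> S \<Longrightarrow> g t = c" "t \<in> closure S"
  shows "deriv g t = 0"
proof -
  have "deriv g s = 0" if "s \<in> S" for s
  proof (rule DERIV_imp_deriv)
    have ev: "\<forall>\<^sub>F r in nhds s. r \<in> S" using eventually_nhds_in_open assms(2) that by blast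
    have "(g has_real_derivative 0) (at s) \<longleftrightarrow> ((\<lambda>_. c) has_real_derivative 0) (at s)"
      by (rule DERIV_cong_ev[OF refl _ refl]) (use ev in \<open>eventually_elim, simp add: assms(3)\<close>)
    then show "(g has_real_derivative 0) (at s)" by simp
  qed
  then show ?thesis
    using continuous_constant_on_closure[of S "deriv g" 0 t] assms(4) smooth1_continuous[OF smooth1_deriv[OF assms(1)]] by blast
qed

lemma deriv_step_0: "t \<le> 0 \<or> t \<ge> 1 \<Longrightarrow> deriv step t = 0"
  using deriv_eq_0_of_const[OF smooth1_step, of "{..<0}" 0 t] deriv_eq_0_of_const[OF smooth1_step, of "{1<..}" 1 t]
  by (auto simp: step_0 step_1)

lemma deriv2_step_0: "t \<le> 0 \<or> t \<ge> 1 \<Longrightarrow> deriv (deriv step) t = 0"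
  using deriv_eq_0_of_const[OF smooth1_deriv[OF smooth1_step], of "{..<0}" 0 t]
    deriv_eq_0_of_const[OF smooth1_deriv[OF smooth1_step], of "{1<..}" 0 t]
  by (auto simp: deriv_step_0)

lemma smooth1_bounded_of_support:
  assumes "smooth1 g" "\<And>t. t \<le> a \<or> t \<ge> b \<Longrightarrow> g t = 0"
  shows "\<exists>C>0. \<forall>t. \<bar>g t\<bar> \<le> C"
proof -
  have "compact (g ` {a..b})" by (intro compact_continuous_image smooth1_continuous assms) auto
  then have "bounded (g ` {a..b})" by (rule compact_imp_bounded)
  then obtain C where "\<forall>y\<in>g ` {a..b}. norm y \<le> C" unfolding bounded_iff by blast
  then have C: "\<bar>g t\<bar> \<le> C" if "t \<in> {a..b}" for t using that by auto
  have "\<bar>g t\<bar> \<le> max 1 C" for t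
    using C[of t] assms(2)[of t] by (cases "t \<in> {a..b}") auto
  then show ?thesis by (intro exI[of _ "max 1 C"]) auto
qed

lemma step_bound_ex: "\<exists>C>0. \<forall>t. \<bar>deriv step t\<bar> \<le> C \<and> \<bar>deriv (deriv step) t\<bar> \<le> C"
proof -
  obtain C1 where C1: "C1 > 0" "\<And>t. \<bar>deriv step t\<bar> \<le> C1"
    using smooth1_bounded_of_support[OF smooth1_deriv[OF smooth1_step], of 0 1] deriv_step_0 by auto
  obtain C2 where C2: "C2 > 0" "\<And>t. \<bar>deriv (deriv step) t\<bar> \<le> C2"
    using smooth1_bounded_of_support[OF smooth1_deriv[OF smooth1_deriv[OF smooth1_step]], of 0 1] deriv2_step_0 by auto
  show ?thesis using C1 C2 by (intro exI[of _ "max C1 C2"]) (auto simp: le_max_iff_disj)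
qed

text \<open>The universal constant of the theorem goes back to this bound for one fixed function of
  one variable, in which the dimension does not occur.\<close>

definition step_bound :: real where
  "step_bound = (SOME C. C > 0 \<and> (\<forall>t. \<bar>deriv step t\<bar> \<le> C \<and> \<bar>deriv (deriv step) t\<bar> \<le> C))"

lemma step_bound: "step_bound > 0" "\<bar>deriv step t\<bar> \<le> step_bound" "\<bar>deriv (deriv step) t\<bar> \<le> step_bound"
  using someI_ex[OF step_bound_ex, folded step_bound_def] by auto

text \<open>The step is applied to the squared norm, a polynomial in the coordinates, so that the
  cutoff is smooth at the origin too and its derivatives are explicit.\<close>

definition cut :: "nat \<Rightarrow> real \<Rightarrow> real \<Rightarrow> point \<Rightarrow> real" where
  "cut n a b x = step (((nnorm n x)\<^sup>2 - a\<^sup>2) / (b\<^sup>2 - a\<^sup>2))"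

lemma smooth_nnorm2: "smooth n (\<lambda>x. ((nnorm n x)\<^sup>2 - a) / c)"
proof -
  have "smooth n (\<lambda>x. ((\<Sum>i<n. (x i)\<^sup>2) - a) * inverse c)"
    unfolding power2_eq_square by (intro smooth_mult smooth_diff smooth_sum smooth_coord smooth_const) auto
  then show ?thesis by (simp add: nnorm_square divide_inverse)
qed

lemma pderiv_nnorm2:
  assumes "i < n" "x \<in> pts n"
  shows "pderiv_at i (\<lambda>x. ((nnorm n x)\<^sup>2 - a) / c) x = 2 * x i / c"
proof (rule has_pd_eq)
  have "(\<lambda>t. ((nnorm n (x(i := t)))\<^sup>2 - a) / c) = (\<lambda>t. (t\<^sup>2 + (\<Sum>j\<in>{..<n} - {i}. (x j)\<^sup>2) - a) / c)"
    using assms by (auto simp: nnorm_square sum.remove[of "{..<n}" i] intro!: ext sum.cong)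
  moreover have "((\<lambda>t. (t\<^sup>2 + (\<Sum>j\<in>{..<n} - {i}. (x j)\<^sup>2) - a) / c) has_real_derivative 2 * x i / c) (at (x i))"
    by (rule DERIV_cdivide) (auto intro!: derivative_eq_intros)
  ultimately show "has_pd i (\<lambda>x. ((nnorm n x)\<^sup>2 - a) / c) x (2 * x i / c)" by simp
qed

lemma smooth_cut: "smooth n (cut n a b)"
  unfolding cut_def[abs_def] by (rule smooth_compose[OF smooth1_step smooth_nnorm2])

lemma cut_range: "0 \<le> cut n a b x" "cut n a b x \<le> 1"
  by (simp_all add: cut_def step_range)

lemma cut_arg:
  assumes "0 \<le> a" "a < b"
  shows "nnorm n x \<le> a \<Longrightarrow> ((nnorm n x)\<^sup>2 - a\<^sup>2) / (b\<^sup>2 - a\<^sup>2) \<le> 0"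
    "nnorm n x \<ge> b \<Longrightarrow> ((nnorm n x)\<^sup>2 - a\<^sup>2) / (b\<^sup>2 - a\<^sup>2) \<ge> 1"
proof -
  have p: "b\<^sup>2 - a\<^sup>2 > 0" using assms by (simp add: power_strict_mono)
  show "nnorm n x \<le> a \<Longrightarrow> ((nnorm n x)\<^sup>2 - a\<^sup>2) / (b\<^sup>2 - a\<^sup>2) \<le> 0"
    using p by (simp add: divide_le_0_iff power_mono)
  show "nnorm n x \<ge> b \<Longrightarrow> ((nnorm n x)\<^sup>2 - a\<^sup>2) / (b\<^sup>2 - a\<^sup>2) \<ge> 1"
    using p assms by (simp add: power_mono)
qed

lemma cut_0: "0 \<le> a \<Longrightarrow> a < b \<Longrightarrow> nnorm n x \<le> a \<Longrightarrow> cut n a b x = 0"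
  unfolding cut_def by (rule step_0) (rule cut_arg)

lemma cut_1: "0 \<le> a \<Longrightarrow> a < b \<Longrightarrow> nnorm n x \<ge> b \<Longrightarrow> cut n a b x = 1"
  unfolding cut_def by (rule step_1) (rule cut_arg)

lemma pderiv_cut:
  assumes "i < n" "x \<in> pts n"
  shows "pderiv_at i (cut n a b) x = deriv step (((nnorm n x)\<^sup>2 - a\<^sup>2) / (b\<^sup>2 - a\<^sup>2)) * (2 * x i / (b\<^sup>2 - a\<^sup>2))"
  unfolding cut_def[abs_def]
  by (subst pderiv_compose[OF smooth1_step smooth_nnorm2 assms]) (simp add: pderiv_nnorm2[OF assms])

lemma pderiv_cmult_coord: "pderiv_at i (\<lambda>x. c * x i) x = c"
  by (rule has_pd_eq) (auto intro!: derivative_eq_intros)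

lemma pderiv2_cut:
  assumes i: "i < n" and x: "x \<in> pts n"
  shows "pderiv_at i (pderiv_at i (cut n a b)) x =
    deriv (deriv step) (((nnorm n x)\<^sup>2 - a\<^sup>2) / (b\<^sup>2 - a\<^sup>2)) * (2 * x i / (b\<^sup>2 - a\<^sup>2))\<^sup>2
    + deriv step (((nnorm n x)\<^sup>2 - a\<^sup>2) / (b\<^sup>2 - a\<^sup>2)) * (2 / (b\<^sup>2 - a\<^sup>2))"
proof -
  let ?s = "\<lambda>x. ((nnorm n x)\<^sup>2 - a\<^sup>2) / (b\<^sup>2 - a\<^sup>2)"
  let ?g = "\<lambda>x::point. (2 / (b\<^sup>2 - a\<^sup>2)) * x i"
  have g: "smooth n ?g" by (intro smooth_mult smooth_const smooth_coord i)
  have f: "smooth n (\<lambda>x. deriv step (?s x))" by (rule smooth_compose[OF smooth1_deriv[OF smooth1_step] smooth_nnorm2])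
  have "pderiv_at i (pderiv_at i (cut n a b)) x = pderiv_at i (\<lambda>x. deriv step (?s x) * ?g x) x"
    by (rule pderiv_cong[OF _ i x]) (simp add: pderiv_cut i)
  also have "\<dots> = pderiv_at i (\<lambda>x. deriv step (?s x)) x * ?g x + deriv step (?s x) * pderiv_at i ?g x"
    by (rule pderiv_mult[OF f g i x])
  also have "pderiv_at i ?g x = 2 / (b\<^sup>2 - a\<^sup>2)"
    by (rule pderiv_cmult_coord)
  also have "pderiv_at i (\<lambda>x. deriv step (?s x)) x = deriv (deriv step) (?s x) * (2 * x i / (b\<^sup>2 - a\<^sup>2))"
    by (subst pderiv_compose[OF smooth1_deriv[OF smooth1_step] smooth_nnorm2 i x]) (simp add: pderiv_nnorm2[OF i x])
  finally show ?thesis by (simp add: power2_eq_square)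
qed

text \<open>The bounding spheres are included, since \<open>deriv step\<close> vanishes at
  \<open>0\<close> and \<open>1\<close>; the gradient is thus confined to an open annulus, as in the
  norms of the theorem.\<close>

lemma grad_len_cut_outside:
  assumes "0 \<le> a" "a < b" "x \<in> pts n" "\<not> (a < nnorm n x \<and> nnorm n x < b)"
  shows "grad_len n (cut n a b) x = 0" "lap n (cut n a b) x = 0" "i < n \<Longrightarrow> pderiv_at i (cut n a b) x = 0"
proof -
  have "((nnorm n x)\<^sup>2 - a\<^sup>2) / (b\<^sup>2 - a\<^sup>2) \<le> 0 \<or> ((nnorm n x)\<^sup>2 - a\<^sup>2) / (b\<^sup>2 - a\<^sup>2) \<ge> 1"
    using assms cut_arg[of a b n x] by linarith
  then have z: "deriv step (((nnorm n x)\<^sup>2 - a\<^sup>2) / (b\<^sup>2 - a\<^sup>2)) = 0" "deriv (deriv step) (((nnorm n x)\<^sup>2 - a\<^sup>2) / (b\<^sup>2 - a\<^sup>2)) = 0"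
    by (auto simp: deriv_step_0 deriv2_step_0)
  show "grad_len n (cut n a b) x = 0" using assms z by (simp add: grad_len_def pderiv_cut L2_set_def)
  show "lap n (cut n a b) x = 0" using assms z by (simp add: lap_def pderiv2_cut)
  show "i < n \<Longrightarrow> pderiv_at i (cut n a b) x = 0" using assms z by (simp add: pderiv_cut)
qed

lemma grad_len_cut_le:
  assumes ab: "0 \<le> a" "a < b" and x: "x \<in> pts n"
  shows "grad_len n (cut n a b) x \<le> 2 * step_bound * b / (b\<^sup>2 - a\<^sup>2)"
proof (cases "a < nnorm n x \<and> nnorm n x < b")
  case True
  have p: "b\<^sup>2 - a\<^sup>2 > 0" using assms by (simp add: power_strict_mono)
  let ?d = "deriv step (((nnorm n x)\<^sup>2 - a\<^sup>2) / (b\<^sup>2 - a\<^sup>2))"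
  have "grad_len n (cut n a b) x = L2_set (\<lambda>i. (?d * (2 / (b\<^sup>2 - a\<^sup>2))) * x i) {..<n}"
    unfolding grad_len_def by (rule L2_set_cong) (auto simp: pderiv_cut x)
  also have "\<dots> = L2_set (\<lambda>i. \<bar>?d * (2 / (b\<^sup>2 - a\<^sup>2))\<bar> * \<bar>x i\<bar>) {..<n}"
    by (simp only: L2_set_def power_mult_distrib power2_abs)
  also have "\<dots> = \<bar>?d * (2 / (b\<^sup>2 - a\<^sup>2))\<bar> * L2_set (\<lambda>i. \<bar>x i\<bar>) {..<n}"
    by (rule L2_set_right_distrib[symmetric]) simp
  also have "L2_set (\<lambda>i. \<bar>x i\<bar>) {..<n} = nnorm n x" by (simp add: nnorm_def L2_set_def)
  also have "\<bar>?d * (2 / (b\<^sup>2 - a\<^sup>2))\<bar> * nnorm n x \<le> (step_bound * (2 / (b\<^sup>2 - a\<^sup>2))) * b"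
  proof (rule mult_mono)
    show "\<bar>?d * (2 / (b\<^sup>2 - a\<^sup>2))\<bar> \<le> step_bound * (2 / (b\<^sup>2 - a\<^sup>2))"
      unfolding abs_mult using p step_bound by (intro mult_mono) auto
  qed (use True p step_bound in auto)
  finally show ?thesis by (simp add: mult.commute)
next
  case False
  have p: "b\<^sup>2 - a\<^sup>2 > 0" using assms by (simp add: power_strict_mono)
  show ?thesis using grad_len_cut_outside(1)[OF ab x False] p step_bound(1) ab by simp
qed

text \<open>Only the term with the first derivative of \<open>step\<close> carries the factor
  \<open>n\<close>: there the second derivatives of the squared norm are summed over the
  coordinates. In the other term the squared coordinates sum to at most \<open>b^2\<close>. The
  dimension enters \<open>cutoff_error_const\<close> through this bound alone.\<close>

lemma lap_cut_le:
  assumes ab: "0 \<le> a" "a < b" and x: "x \<in> pts n"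
  shows "\<bar>lap n (cut n a b) x\<bar> \<le> 4 * step_bound * b\<^sup>2 / (b\<^sup>2 - a\<^sup>2)\<^sup>2 + 2 * n * step_bound / (b\<^sup>2 - a\<^sup>2)"
proof (cases "a < nnorm n x \<and> nnorm n x < b")
  case True
  have p: "b\<^sup>2 - a\<^sup>2 > 0" using assms by (simp add: power_strict_mono)
  let ?d = "deriv step (((nnorm n x)\<^sup>2 - a\<^sup>2) / (b\<^sup>2 - a\<^sup>2))"
  let ?e = "deriv (deriv step) (((nnorm n x)\<^sup>2 - a\<^sup>2) / (b\<^sup>2 - a\<^sup>2))"
  have "lap n (cut n a b) x = (\<Sum>i<n. ?e * (2 * x i / (b\<^sup>2 - a\<^sup>2))\<^sup>2 + ?d * (2 / (b\<^sup>2 - a\<^sup>2)))"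
    unfolding lap_def by (rule sum.cong) (auto simp: pderiv2_cut x)
  also have "\<dots> = ?e * (4 / (b\<^sup>2 - a\<^sup>2)\<^sup>2) * (\<Sum>i<n. (x i)\<^sup>2) + n * (?d * (2 / (b\<^sup>2 - a\<^sup>2)))"
    unfolding sum.distrib sum_distrib_left by (simp add: power_divide power_mult_distrib mult_ac)
  also have "\<dots> = ?e * (4 / (b\<^sup>2 - a\<^sup>2)\<^sup>2) * (nnorm n x)\<^sup>2 + n * (?d * (2 / (b\<^sup>2 - a\<^sup>2)))"
    by (simp add: nnorm_square)
  finally have eq: "lap n (cut n a b) x = ?e * (4 / (b\<^sup>2 - a\<^sup>2)\<^sup>2) * (nnorm n x)\<^sup>2 + n * (?d * (2 / (b\<^sup>2 - a\<^sup>2)))" .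
  have "\<bar>lap n (cut n a b) x\<bar> \<le> \<bar>?e * (4 / (b\<^sup>2 - a\<^sup>2)\<^sup>2) * (nnorm n x)\<^sup>2\<bar> + \<bar>n * (?d * (2 / (b\<^sup>2 - a\<^sup>2)))\<bar>"
    unfolding eq by (rule abs_triangle_ineq)
  also have "\<dots> \<le> step_bound * (4 / (b\<^sup>2 - a\<^sup>2)\<^sup>2) * b\<^sup>2 + n * (step_bound * (2 / (b\<^sup>2 - a\<^sup>2)))"
    unfolding abs_mult using p step_bound True by (intro add_mono mult_mono) (auto simp: power_mono)
  finally show ?thesis by (simp add: algebra_simps)
next
  case False
  have p: "b\<^sup>2 - a\<^sup>2 > 0" using assms by (simp add: power_strict_mono)
  show ?thesis using grad_len_cut_outside(2)[OF ab x False] p step_bound(1) ab by simp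
qed

lemma bump_ex:
  assumes "e > 0"
  shows "\<exists>b. smooth1 b \<and> (\<forall>t. b t \<ge> 0) \<and> (\<forall>t. \<bar>t\<bar> \<ge> e \<longrightarrow> b t = 0) \<and> (\<integral>\<^sup>+t. ennreal (b t) \<partial>lborel) = 1"
proof -
  \<comment> \<open>One factor vanishes beyond each end point; the product is positive exactly on
    the open interval, which also makes the integral nonzero.\<close>
  define g where "g t = flat1 (1 * t + e) * flat1 ((-1) * t + e)" for t
  have g: "smooth1 g" unfolding g_def[abs_def] by (rule smooth1_mult[OF smooth1_affine[OF smooth1_flat1] smooth1_affine[OF smooth1_flat1]])
  have grad_len: "g t \<ge> 0" for t by (simp add: g_def flat1_nonneg)
  have g0: "g t = 0" if "\<bar>t\<bar> \<ge> e" for t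
  proof (cases "t \<ge> e")
    case True
    then show ?thesis using flat1_zero[of "(-1) * t + e"] by (simp add: g_def)
  next
    case False
    then show ?thesis using flat1_zero[of "1 * t + e"] that by (simp add: g_def)
  qed
  have gp: "g t > 0" if "\<bar>t\<bar> < e" for t
    using that flat1_pos[of "t + e"] flat1_pos[of "-t + e"] by (auto simp: g_def)
  obtain C where C: "C > 0" "\<And>t. \<bar>g t\<bar> \<le> C"
  proof -
    have "\<exists>C>0. \<forall>t. \<bar>g t\<bar> \<le> C"
      by (rule smooth1_bounded_of_support[OF g, of "-e" e]) (use g0 assms in auto)
    then show ?thesis using that by blast
  qed
  have [measurable]: "g \<in> borel_measurable borel"
    by (rule borel_measurable_continuous_onI) (rule smooth1_continuous[OF g])
  let ?I = "\<integral>\<^sup>+t. ennreal (g t) \<partial>lborel"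
  have "?I \<le> (\<integral>\<^sup>+t. ennreal C * indicator {-e..e} t \<partial>lborel)"
    by (rule nn_integral_mono) (use C g0 in \<open>auto simp: indicator_def intro!: ennreal_leI; smt (verit)\<close>)
  also have "\<dots> < \<infinity>" using assms by (simp add: nn_integral_cmult_indicator ennreal_mult_less_top)
  finally have fin: "?I < \<infinity>" .
  have "?I \<noteq> 0"
  proof
    assume "?I = 0"
    then have "AE t in lborel. g t = 0" using grad_len by (subst (asm) nn_integral_0_iff_AE) (auto simp: order.antisym)
    then have "AE t in lborel. t \<notin> {-e<..<e}" by eventually_elim (use gp in \<open>force simp: abs_less_iff\<close>)
    then have "emeasure lborel {-e<..<e} = 0"
      by (subst (asm) AE_iff_measurable[of "{-e<..<e}"]) auto
    then show False using assms by simp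
  qed
  then obtain I where I: "?I = ennreal I" "I > 0" using fin
    by (cases "?I") (auto simp: zero_less_iff_neq_zero[symmetric])
  have s: "smooth1 (\<lambda>t. inverse I * g t)" by (rule smooth1_mult[OF smooth1_const g])
  have "(\<integral>\<^sup>+t. ennreal (inverse I * g t) \<partial>lborel) = (\<integral>\<^sup>+t. ennreal (inverse I) * ennreal (g t) \<partial>lborel)"
    using I grad_len by (simp add: ennreal_mult)
  also have "\<dots> = ennreal (inverse I) * ?I" by (simp add: nn_integral_cmult)
  also have "\<dots> = 1" using I by (simp add: ennreal_mult[symmetric])
  finally show ?thesis using s grad_len g0 I by (intro exI[of _ "\<lambda>t. inverse I * g t"]) auto
qed

section \<open>Convolution with product kernels\<close>

definition compact_smooth :: "(real \<Rightarrow> real) \<Rightarrow> bool" where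
  "compact_smooth g \<longleftrightarrow> smooth1 g \<and> (\<exists>e>0. \<forall>t. \<bar>t\<bar> \<ge> e \<longrightarrow> g t = 0)"

lemma compact_smooth_support_deriv:
  assumes "smooth1 g" "e > 0" "\<And>t. \<bar>t\<bar> \<ge> e \<Longrightarrow> g t = 0" "\<bar>t\<bar> \<ge> e"
  shows "deriv g t = 0"
proof -
  have "t \<in> closure {e<..} \<or> t \<in> closure {..<- e}" using assms by auto
  then show ?thesis
    using deriv_eq_0_of_const[OF assms(1), of "{e<..}" 0 t] deriv_eq_0_of_const[OF assms(1), of "{..<-e}" 0 t] assms(2,3)
    by auto
qed

lemma compact_smooth_deriv: "compact_smooth g \<Longrightarrow> compact_smooth (deriv g)"
  unfolding compact_smooth_def using compact_smooth_support_deriv smooth1_deriv by metis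

lemma compact_smooth_bounded: "compact_smooth g \<Longrightarrow> \<exists>C>0. \<forall>t. \<bar>g t\<bar> \<le> C"
proof -
  assume g: "compact_smooth g"
  then obtain e where e: "e > 0" "\<And>t. \<bar>t\<bar> \<ge> e \<Longrightarrow> g t = 0" unfolding compact_smooth_def by blast
  show ?thesis by (rule smooth1_bounded_of_support[of g "-e" e]) (use g e in \<open>auto simp: compact_smooth_def\<close>)
qed

lemma compact_smooth_measurable: "compact_smooth g \<Longrightarrow> g \<in> borel_measurable borel"
  unfolding compact_smooth_def by (auto intro: borel_measurable_continuous_onI smooth1_continuous)

lemma finite_common_bound:
  assumes "finite I" "\<And>i. i \<in> I \<Longrightarrow> \<exists>C>0. \<forall>t. \<bar>g i t\<bar> \<le> (C::real)"
  shows "\<exists>C\<ge>1. \<forall>i\<in>I. \<forall>t. \<bar>g i t\<bar> \<le> C"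
  using assms
proof (induction I rule: finite_induct)
  case empty
  then show ?case by (intro exI[of _ 1]) auto
next
  case (insert i I)
  then obtain C where C: "C \<ge> 1" "\<And>i t. i \<in> I \<Longrightarrow> \<bar>g i t\<bar> \<le> C" by auto
  obtain D where D: "\<And>t. \<bar>g i t\<bar> \<le> D" using insert.prems[of i] by auto
  show ?case
    by (rule exI[of _ "max C D"]) (use C D in \<open>auto simp: le_max_iff_disj\<close>)
qed

lemma compact_smooth_common_bound:
  fixes n :: nat
  assumes "\<forall>i<n. compact_smooth (\<beta> i)"
  shows "\<exists>C\<ge>1. \<forall>i<n. \<forall>t. \<bar>\<beta> i t\<bar> \<le> C \<and> \<bar>deriv (\<beta> i) t\<bar> \<le> C"
proof -
  obtain C where C: "C \<ge> 1" "\<forall>i\<in>{..<n}. \<forall>t. \<bar>\<beta> i t\<bar> \<le> C"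
  proof -
    have "\<exists>C\<ge>1. \<forall>i\<in>{..<n}. \<forall>t. \<bar>\<beta> i t\<bar> \<le> C"
      by (rule finite_common_bound[OF finite_lessThan]) (use assms compact_smooth_bounded in auto)
    then show ?thesis using that by blast
  qed
  obtain D where D: "D \<ge> 1" "\<forall>i\<in>{..<n}. \<forall>t. \<bar>deriv (\<beta> i) t\<bar> \<le> D"
  proof -
    have "\<exists>C\<ge>1. \<forall>i\<in>{..<n}. \<forall>t. \<bar>deriv (\<beta> i) t\<bar> \<le> C"
      by (rule finite_common_bound[OF finite_lessThan]) (use assms compact_smooth_bounded compact_smooth_deriv in auto)
    then show ?thesis using that by blast
  qed
  show ?thesis by (rule exI[of _ "max C D"]) (use C D in \<open>auto simp: le_max_iff_disj\<close>)
qed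

text \<open>One factor is exchanged at a time while the others are bounded by \<open>C\<close>; as
  \<open>C\<close> is at least one, the power with the full number of factors dominates.\<close>

lemma abs_prod_diff_le:
  fixes a b :: "nat \<Rightarrow> real"
  assumes "finite I" "C \<ge> 1" "\<And>i. i \<in> I \<Longrightarrow> \<bar>a i\<bar> \<le> C" "\<And>i. i \<in> I \<Longrightarrow> \<bar>b i\<bar> \<le> C"
  shows "\<bar>prod a I - prod b I\<bar> \<le> C ^ card I * (\<Sum>i\<in>I. \<bar>a i - b i\<bar>)"
  using assms(1,3,4)
proof (induction I rule: finite_induct)
  case (insert i I)
  have pb: "\<bar>prod b I\<bar> \<le> C ^ card I"
  proof -
    have "\<bar>prod b I\<bar> \<le> (\<Prod>j\<in>I. C)" unfolding abs_prod by (rule prod_mono) (use insert in auto)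
    then show ?thesis by simp
  qed
  have "a i * prod a I - b i * prod b I = a i * (prod a I - prod b I) + (a i - b i) * prod b I"
    by (simp add: algebra_simps)
  then have "\<bar>a i * prod a I - b i * prod b I\<bar> \<le> \<bar>a i\<bar> * \<bar>prod a I - prod b I\<bar> + \<bar>a i - b i\<bar> * \<bar>prod b I\<bar>"
    by (metis abs_mult abs_triangle_ineq)
  also have "\<dots> \<le> C * (C ^ card I * (\<Sum>i\<in>I. \<bar>a i - b i\<bar>)) + \<bar>a i - b i\<bar> * C ^ card I"
    using insert pb assms(2) by (intro add_mono mult_mono) auto
  also have "\<dots> \<le> C * (C ^ card I * (\<Sum>i\<in>I. \<bar>a i - b i\<bar>)) + \<bar>a i - b i\<bar> * (C * C ^ card I)"
    using assms(2) by (intro add_left_mono mult_left_mono) auto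
  finally show ?case using insert by (simp add: algebra_simps)
qed simp

lemma abs_integral_le:
  fixes f g :: "'a \<Rightarrow> real"
  assumes "integrable M f" "integrable M g" "\<And>x. x \<in> space M \<Longrightarrow> \<bar>f x\<bar> \<le> g x"
  shows "\<bar>LINT x|M. f x\<bar> \<le> (LINT x|M. g x)"
proof -
  have "\<bar>LINT x|M. f x\<bar> \<le> (LINT x|M. \<bar>f x\<bar>)" using integral_norm_bound[of M f] by simp
  also have "\<dots> \<le> (LINT x|M. g x)" by (rule integral_mono) (use assms in auto)
  finally show ?thesis .
qed

text \<open>Dominated convergence along sequences: by the mean value theorem the difference
  quotients are bounded by \<open>h\<close>, just as the derivatives are.\<close>

lemma has_derivative_lebesgue_integral:
  fixes g :: "real \<Rightarrow> 'a \<Rightarrow> real"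
  assumes d: "\<And>t y. y \<in> space M \<Longrightarrow> ((\<lambda>t. g t y) has_real_derivative g' t y) (at t)"
    and b: "\<And>t y. y \<in> space M \<Longrightarrow> \<bar>g' t y\<bar> \<le> h y" and h: "integrable M h"
    and g: "\<And>t. integrable M (g t)" and g': "g' t0 \<in> borel_measurable M"
  shows "((\<lambda>t. LINT y|M. g t y) has_real_derivative (LINT y|M. g' t0 y)) (at t0)"
  unfolding has_field_derivative_iff tendsto_at_iff_sequentially o_def
proof (intro allI impI)
  fix X :: "nat \<Rightarrow> real" assume X: "\<forall>i. X i \<in> UNIV - {t0}" "X \<longlonglongrightarrow> t0"
  have "(\<lambda>k. LINT y|M. (g (X k) y - g t0 y) / (X k - t0)) \<longlonglongrightarrow> (LINT y|M. g' t0 y)"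
  proof (rule integral_dominated_convergence[where w = h])
    show "AE y in M. (\<lambda>k. (g (X k) y - g t0 y) / (X k - t0)) \<longlonglongrightarrow> g' t0 y"
    proof (rule AE_I2)
      fix y assume "y \<in> space M"
      from d[OF this, of t0] X show "(\<lambda>k. (g (X k) y - g t0 y) / (X k - t0)) \<longlonglongrightarrow> g' t0 y"
        unfolding has_field_derivative_iff tendsto_at_iff_sequentially o_def by blast
    qed
    fix k
    show "AE y in M. norm ((g (X k) y - g t0 y) / (X k - t0)) \<le> h y"
    proof (rule AE_I2)
      fix y assume y: "y \<in> space M"
      have "norm (g (X k) y - g t0 y) \<le> h y * norm (X k - t0)"
        by (rule field_differentiable_bound[of UNIV "\<lambda>t. g t y" "\<lambda>t. g' t y"]) (use d b y in auto)
      moreover have "X k - t0 \<noteq> 0" using X by auto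
      ultimately show "norm ((g (X k) y - g t0 y) / (X k - t0)) \<le> h y"
        by (simp add: divide_le_eq abs_mult)
    qed
    show "(\<lambda>y. (g (X k) y - g t0 y) / (X k - t0)) \<in> borel_measurable M"
      using g[of "X k"] g[of t0] by measurable
  qed (use g' h in auto)
  then show "(\<lambda>k. ((LINT y|M. g (X k) y) - (LINT y|M. g t0 y)) / (X k - t0)) \<longlonglongrightarrow> (LINT y|M. g' t0 y)"
    using g by simp
qed

text \<open>With a separate factor for each coordinate, a partial derivative replaces one factor by
  its derivative, so that the derivative of a convolution is a convolution of the same kind.\<close>

definition kern :: "nat \<Rightarrow> (nat \<Rightarrow> real \<Rightarrow> real) \<Rightarrow> point \<Rightarrow> point \<Rightarrow> real" where
  "kern n \<beta> x y = (\<Prod>i<n. \<beta> i (x i - y i))"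

definition conv :: "nat \<Rightarrow> (point \<Rightarrow> real) \<Rightarrow> (nat \<Rightarrow> real \<Rightarrow> real) \<Rightarrow> point \<Rightarrow> real" where
  "conv n f \<beta> x = (LINT y|leb n. f y * kern n \<beta> x y)"

lemma kern_measurable:
  assumes "\<forall>i<n. compact_smooth (\<beta> i)"
  shows "kern n \<beta> x \<in> borel_measurable (leb n)"
  unfolding kern_def[abs_def]
proof (rule borel_measurable_prod)
  fix i assume i: "i \<in> {..<n}"
  then have [measurable]: "\<beta> i \<in> borel_measurable borel" using assms compact_smooth_measurable by auto
  have [measurable]: "(\<lambda>y. y i) \<in> borel_measurable (leb n)" using i by (simp add: measurable_coord)
  show "(\<lambda>y. \<beta> i (x i - y i)) \<in> borel_measurable (leb n)" by measurable
qed

lemma kern_bound: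
  assumes "\<And>i t. i < n \<Longrightarrow> \<bar>\<beta> i t\<bar> \<le> C"
  shows "\<bar>kern n \<beta> x y\<bar> \<le> C ^ n"
proof -
  have "\<bar>kern n \<beta> x y\<bar> \<le> (\<Prod>i<n. C)" unfolding kern_def abs_prod by (rule prod_mono) (use assms in auto)
  then show ?thesis by simp
qed

lemma kern_integrable:
  assumes f: "integrable (leb n) f" and \<beta>: "\<forall>i<n. compact_smooth (\<beta> i)"
  shows "integrable (leb n) (\<lambda>y. f y * kern n \<beta> x y)"
proof -
  have "\<exists>C\<ge>1. \<forall>i<n. \<forall>t. \<bar>\<beta> i t\<bar> \<le> C \<and> \<bar>deriv (\<beta> i) t\<bar> \<le> C"
    by (rule compact_smooth_common_bound) (rule \<beta>)
  then obtain C where "C \<ge> 1" "\<forall>i<n. \<forall>t. \<bar>\<beta> i t\<bar> \<le> C \<and> \<bar>deriv (\<beta> i) t\<bar> \<le> C" by auto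
  then have C: "C \<ge> 1" "\<And>i t. i < n \<Longrightarrow> \<bar>\<beta> i t\<bar> \<le> C" by simp_all
  show ?thesis
  proof (rule Bochner_Integration.integrable_bound)
    show "integrable (leb n) (\<lambda>y. C ^ n * f y)" using f by simp
    show "(\<lambda>y. f y * kern n \<beta> x y) \<in> borel_measurable (leb n)"
      using f kern_measurable[OF \<beta>] by measurable
    show "AE y in leb n. norm (f y * kern n \<beta> x y) \<le> norm (C ^ n * f y)"
      using kern_bound[of n \<beta> C x, OF C(2)] C(1)
      by (intro AE_I2) (auto simp: abs_mult mult.commute intro!: mult_left_mono)
  qed
qed

lemma compact_smooth_upd_deriv: "\<forall>i<n. compact_smooth (\<beta> i) \<Longrightarrow> i < n \<Longrightarrow> \<forall>j<n. compact_smooth ((\<beta>(i := deriv (\<beta> i))) j)"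
  by (auto intro: compact_smooth_deriv)

lemma kern_upd:
  assumes "i < n"
  shows "kern n \<beta> (x(i := t)) y = \<beta> i (t - y i) * (\<Prod>j\<in>{..<n} - {i}. \<beta> j (x j - y j))"
    "kern n (\<beta>(i := \<gamma>)) (x(i := t)) y = \<gamma> (t - y i) * (\<Prod>j\<in>{..<n} - {i}. \<beta> j (x j - y j))"
    "kern n \<beta> x (y(i := t)) = \<beta> i (x i - t) * (\<Prod>j\<in>{..<n} - {i}. \<beta> j (x j - y j))"
    "kern n (\<beta>(i := \<gamma>)) x (y(i := t)) = \<gamma> (x i - t) * (\<Prod>j\<in>{..<n} - {i}. \<beta> j (x j - y j))"
  using assms by (auto simp: kern_def prod.remove[of "{..<n}" i] intro!: prod.cong)

lemma conv_has_pd: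
  assumes f: "integrable (leb n) f" and \<beta>: "\<forall>i<n. compact_smooth (\<beta> i)" and i: "i < n"
  shows "has_pd i (conv n f \<beta>) x (conv n f (\<beta>(i := deriv (\<beta> i))) x)"
proof -
  let ?b = "\<beta>(i := deriv (\<beta> i))"
  have \<beta>': "\<forall>j<n. compact_smooth (?b j)" by (rule compact_smooth_upd_deriv[OF \<beta> i])
  have "\<exists>C\<ge>1. \<forall>i<n. \<forall>t. \<bar>?b i t\<bar> \<le> C \<and> \<bar>deriv (?b i) t\<bar> \<le> C"
    by (rule compact_smooth_common_bound) (rule \<beta>')
  then obtain C where "C \<ge> 1" "\<forall>i<n. \<forall>t. \<bar>?b i t\<bar> \<le> C \<and> \<bar>deriv (?b i) t\<bar> \<le> C" by (elim exE conjE) (rule that)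
  then have C: "C \<ge> 1" "\<And>i t. i < n \<Longrightarrow> \<bar>?b i t\<bar> \<le> C" by blast+
  have "((\<lambda>t. LINT y|leb n. f y * kern n \<beta> (x(i := t)) y) has_real_derivative
      (LINT y|leb n. f y * kern n ?b (x(i := x i)) y)) (at (x i))"
  proof (rule has_derivative_lebesgue_integral[where h = "\<lambda>y. C ^ n * \<bar>f y\<bar>"])
    fix t y
    have s: "smooth1 (\<beta> i)" using \<beta>[rule_format, OF i] by (simp add: compact_smooth_def)
    have "((\<lambda>t. \<beta> i (t - y i)) has_real_derivative deriv (\<beta> i) (t - y i)) (at t)"
    proof -
      have "((\<lambda>t. \<beta> i (t - y i)) has_real_derivative deriv (\<beta> i) (t - y i) * 1) (at t)"
        by (rule DERIV_chain2[OF smooth1_has_derivative[OF s]]) (auto intro!: derivative_eq_intros)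
      then show ?thesis by simp
    qed
    then have "((\<lambda>t. f y * (\<beta> i (t - y i) * (\<Prod>j\<in>{..<n} - {i}. \<beta> j (x j - y j)))) has_real_derivative
       f y * (deriv (\<beta> i) (t - y i) * (\<Prod>j\<in>{..<n} - {i}. \<beta> j (x j - y j)))) (at t)"
      by (intro DERIV_cmult DERIV_cmult_right)
    then show "((\<lambda>t. f y * kern n \<beta> (x(i := t)) y) has_real_derivative f y * kern n ?b (x(i := t)) y) (at t)"
      unfolding kern_upd(2)[OF i] unfolding kern_upd(1)[OF i, of \<beta>] .
    show "\<bar>f y * kern n ?b (x(i := t)) y\<bar> \<le> C ^ n * \<bar>f y\<bar>"
    proof -
      have "\<bar>kern n ?b (x(i := t)) y\<bar> \<le> C ^ n" by (rule kern_bound) (rule C(2))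
      then have "\<bar>kern n ?b (x(i := t)) y\<bar> * \<bar>f y\<bar> \<le> C ^ n * \<bar>f y\<bar>" by (rule mult_right_mono) simp
      then show ?thesis by (simp only: abs_mult mult.commute)
    qed
  next
    show "integrable (leb n) (\<lambda>y. C ^ n * \<bar>f y\<bar>)" using f by simp
    show "integrable (leb n) (\<lambda>y. f y * kern n \<beta> (x(i := t)) y)" for t by (rule kern_integrable[OF f \<beta>])
    show "(\<lambda>y. f y * kern n ?b (x(i := x i)) y) \<in> borel_measurable (leb n)"
      using kern_integrable[OF f \<beta>'] by blast
  qed
  then show ?thesis by (simp add: conv_def)
qed

lemma continuous_map_box:
  assumes "\<And>x e. x \<in> pts n \<Longrightarrow> e > 0 \<Longrightarrow> \<exists>d>0. \<forall>y\<in>open_box n x d. \<bar>f y - f x\<bar> < e"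
  shows "continuous_map (euc n) euclideanreal f"
  unfolding continuous_map_def
proof (intro conjI allI impI)
  fix U assume "openin euclideanreal U"
  then have U: "open U" by simp
  show "openin (euc n) {x \<in> topspace (euc n). f x \<in> U}"
    unfolding openin_euc_iff
  proof (intro conjI ballI)
    fix x assume x: "x \<in> {x \<in> topspace (euc n). f x \<in> U}"
    then obtain e where e: "e > 0" "\<And>z. \<bar>z - f x\<bar> < e \<Longrightarrow> z \<in> U"
      using U unfolding open_dist dist_real_def by blast
    obtain d where "d > 0" "\<forall>y\<in>open_box n x d. \<bar>f y - f x\<bar> < e" using assms[of x e] x e by auto
    then show "\<exists>d>0. open_box n x d \<subseteq> {x \<in> topspace (euc n). f x \<in> U}"
      using e(2) by (intro exI[of _ d]) (auto simp: open_box_iff)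
  qed auto
qed auto

text \<open>The factors are bounded and Lipschitz, hence the kernel is Lipschitz in \<open>x\<close>
  uniformly in \<open>y\<close>; integration against an integrable \<open>f\<close> preserves
  this.\<close>

lemma continuous_conv:
  assumes f: "integrable (leb n) f" and \<beta>: "\<forall>i<n. compact_smooth (\<beta> i)"
  shows "continuous_map (euc n) euclideanreal (conv n f \<beta>)"
proof (rule continuous_map_box)
  have "\<exists>C\<ge>1. \<forall>i<n. \<forall>t. \<bar>\<beta> i t\<bar> \<le> C \<and> \<bar>deriv (\<beta> i) t\<bar> \<le> C"
    by (rule compact_smooth_common_bound) (rule \<beta>)
  then obtain C where "C \<ge> 1" "\<forall>i<n. \<forall>t. \<bar>\<beta> i t\<bar> \<le> C \<and> \<bar>deriv (\<beta> i) t\<bar> \<le> C" by auto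
  then have C: "C \<ge> 1" "\<And>i t. i < n \<Longrightarrow> \<bar>\<beta> i t\<bar> \<le> C" "\<And>i t. i < n \<Longrightarrow> \<bar>deriv (\<beta> i) t\<bar> \<le> C" by simp_all
  define F where "F = (LINT y|leb n. \<bar>f y\<bar>)"
  have F: "F \<ge> 0" by (simp add: F_def)
  define K where "K = C ^ n * (n * C)"
  have K: "K \<ge> 0" using C(1) by (simp add: K_def)
  have lip: "\<bar>\<beta> i s - \<beta> i t\<bar> \<le> C * \<bar>s - t\<bar>" if i: "i < n" for i s t
    using field_differentiable_bound[of UNIV "\<beta> i" "deriv (\<beta> i)" C s t] smooth1_has_derivative[of "\<beta> i"] \<beta>[rule_format, OF i] C(3)[OF i]
    by (auto simp: compact_smooth_def)
  have main: "\<bar>conv n f \<beta> z - conv n f \<beta> x\<bar> \<le> F * (K * d)" if z: "z \<in> open_box n x d" for x z d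
  proof -
    have k: "\<bar>kern n \<beta> z y - kern n \<beta> x y\<bar> \<le> K * d" for y
    proof -
      have "\<bar>kern n \<beta> z y - kern n \<beta> x y\<bar> \<le> C ^ card {..<n} * (\<Sum>i<n. \<bar>\<beta> i (z i - y i) - \<beta> i (x i - y i)\<bar>)"
        unfolding kern_def by (rule abs_prod_diff_le) (use C in auto)
      also have "\<dots> \<le> C ^ card {..<n} * (\<Sum>i<n. C * d)"
      proof (intro mult_left_mono sum_mono)
        fix i assume i: "i \<in> {..<n}"
        have "\<bar>\<beta> i (z i - y i) - \<beta> i (x i - y i)\<bar> \<le> C * \<bar>(z i - y i) - (x i - y i)\<bar>" using lip i by blast
        also have "\<dots> \<le> C * d" using z i C(1) by (intro mult_left_mono) (auto simp: open_box_iff less_imp_le)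
        finally show "\<bar>\<beta> i (z i - y i) - \<beta> i (x i - y i)\<bar> \<le> C * d" .
      qed (use C in auto)
      finally show ?thesis by (simp add: K_def algebra_simps)
    qed
    have "conv n f \<beta> z - conv n f \<beta> x = (LINT y|leb n. f y * kern n \<beta> z y - f y * kern n \<beta> x y)"
      unfolding conv_def by (rule Bochner_Integration.integral_diff[symmetric]) (rule kern_integrable[OF f \<beta>])+
    also have "\<bar>\<dots>\<bar> \<le> (LINT y|leb n. \<bar>f y\<bar> * (K * d))"
    proof (rule abs_integral_le)
      show "integrable (leb n) (\<lambda>y. f y * kern n \<beta> z y - f y * kern n \<beta> x y)"
        by (intro Bochner_Integration.integrable_diff kern_integrable[OF f \<beta>])
      show "integrable (leb n) (\<lambda>y. \<bar>f y\<bar> * (K * d))" using f by simp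
      fix y
      show "\<bar>f y * kern n \<beta> z y - f y * kern n \<beta> x y\<bar> \<le> \<bar>f y\<bar> * (K * d)"
        using mult_left_mono[OF k[of y], of "\<bar>f y\<bar>"] by (simp add: abs_mult[symmetric] right_diff_distrib)
    qed
    finally show ?thesis by (simp add: F_def)
  qed
  fix x e assume "(e::real) > 0"
  define d where "d = e / (F * K + 1)"
  have p: "F * K + 1 > 0" using F K by (simp add: add_nonneg_pos)
  have d: "d > 0" using p \<open>e > 0\<close> by (simp add: d_def)
  have "F * (K * d) < e"
  proof -
    have "F * (K * d) < (F * K + 1) * d" using d by (simp add: algebra_simps)
    also have "\<dots> = e" using p by (simp add: d_def)
    finally show ?thesis .
  qed
  then show "\<exists>d>0. \<forall>y\<in>open_box n x d. \<bar>conv n f \<beta> y - conv n f \<beta> x\<bar> < e"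
    using main d by (intro exI[of _ d]) (auto intro: le_less_trans)
qed

lemma smooth_conv:
  assumes f: "integrable (leb n) f" and \<beta>: "\<forall>i<n. compact_smooth (\<beta> i)"
  shows "smooth n (conv n f \<beta>)"
proof -
  have "Ck n k (conv n f \<beta>)" if "\<forall>i<n. compact_smooth (\<beta> i)" for k \<beta>
    using that
  proof (induction k arbitrary: \<beta>)
    case 0
    then show ?case using continuous_conv[OF f] by simp
  next
    case (Suc k)
    show ?case
    proof (rule Ck_SucI[OF continuous_conv[OF f Suc.prems]])
      fix i assume i: "i < n"
      have "Ck n k (conv n f (\<beta>(i := deriv (\<beta> i))))"
        by (rule Suc.IH) (rule compact_smooth_upd_deriv[OF Suc.prems i])
      then show "\<exists>g. Ck n k g \<and> (\<forall>x\<in>pts n. has_pd i (conv n f \<beta>) x (g x))"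
        using conv_has_pd[OF f Suc.prems i] by (intro exI[of _ "conv n f (\<beta>(i := deriv (\<beta> i)))"] conjI ballI)
    qed
  qed
  then show ?thesis using \<beta> by (simp add: smooth_iff)
qed

lemma pderiv_conv:
  assumes f: "integrable (leb n) f" and \<beta>: "\<forall>i<n. compact_smooth (\<beta> i)" and i: "i < n"
  shows "pderiv_at i (conv n f \<beta>) = conv n f (\<beta>(i := deriv (\<beta> i)))"
  by (rule ext, rule has_pd_eq, rule conv_has_pd[OF assms])

lemma smooth_kern:
  assumes \<beta>: "\<forall>i<n. compact_smooth (\<beta> i)"
  shows "smooth n (kern n \<beta> x)"
  unfolding kern_def[abs_def]
proof (rule smooth_prod)
  fix i assume i: "i \<in> {..<n}"
  show "smooth n (\<lambda>y. \<beta> i (x i - y i))"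
    by (rule smooth_compose[of "\<beta> i" n "\<lambda>y. x i - y i"])
      (use \<beta> i in \<open>auto simp: compact_smooth_def intro!: smooth_diff smooth_const smooth_coord\<close>)
qed simp

lemma pderiv_kern:
  assumes \<beta>: "\<forall>i<n. compact_smooth (\<beta> i)" and i: "i < n"
  shows "pderiv_at i (kern n \<beta> x) y = - kern n (\<beta>(i := deriv (\<beta> i))) x y"
proof (rule has_pd_eq)
  let ?P = "\<Prod>j\<in>{..<n} - {i}. \<beta> j (x j - y j)"
  have s: "smooth1 (\<beta> i)" using \<beta>[rule_format, OF i] by (simp add: compact_smooth_def)
  have "((\<lambda>t. \<beta> i (x i - t)) has_real_derivative deriv (\<beta> i) (x i - y i) * (-1)) (at (y i))"
    by (rule DERIV_chain2[OF smooth1_has_derivative[OF s]]) (auto intro!: derivative_eq_intros)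
  then have "((\<lambda>t. \<beta> i (x i - t) * ?P) has_real_derivative deriv (\<beta> i) (x i - y i) * (-1) * ?P) (at (y i))"
    by (rule DERIV_cmult_right)
  moreover have "deriv (\<beta> i) (x i - y i) * (-1) * ?P = - kern n (\<beta>(i := deriv (\<beta> i))) x (y(i := y i))"
    by (simp only: kern_upd[OF i]) simp
  ultimately show "has_pd i (kern n \<beta> x) y (- kern n (\<beta>(i := deriv (\<beta> i))) x y)"
    by (simp only: kern_upd[OF i] fun_upd_triv)
qed

lemma kern_support:
  assumes "\<And>i t. i < n \<Longrightarrow> \<bar>t\<bar> \<ge> e \<Longrightarrow> \<beta> i t = 0" "y \<in> pts n" "y \<notin> closed_box n x e"
  shows "kern n \<beta> x y = 0"
proof -
  obtain i where "i < n" "\<bar>y i - x i\<bar> > e" using assms(2,3) unfolding closed_box_iff by force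
  then have "i \<in> {..<n}" "\<beta> i (x i - y i) = 0" using assms(1)[of i "x i - y i"] by (auto simp: abs_minus_commute)
  then show ?thesis unfolding kern_def by (meson finite_lessThan prod_zero)
qed

lemma kern_test_fun:
  assumes "\<forall>i<n. compact_smooth (\<beta> i)" "\<And>i t. i < n \<Longrightarrow> \<bar>t\<bar> \<ge> e \<Longrightarrow> \<beta> i t = 0" "closed_box n x e \<subseteq> \<Omega>"
  shows "kern n \<beta> x \<in> test_fun n \<Omega>"
  unfolding test_fun_def
proof (intro CollectI conjI exI ballI)
  show "smooth n (kern n \<beta> x)" by (rule smooth_kern[OF assms(1)])
  show "compactin (euc n) (closed_box n x e)" by (rule compactin_closed_box)
  show "kern n \<beta> x y = 0" if "y \<in> pts n - closed_box n x e" for y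
    by (rule kern_support[of n e \<beta>]) (use assms(2) that in auto)
qed (rule assms(3))

lemma set_integral_kern:
  assumes "\<And>i t. i < n \<Longrightarrow> \<bar>t\<bar> \<ge> e \<Longrightarrow> \<beta> i t = 0" "closed_box n x e \<subseteq> K" "K \<subseteq> \<Omega>"
  shows "(LINT y:\<Omega>|leb n. f y * kern n \<beta> x y) = conv n (\<lambda>y. indicator K y * f y) \<beta> x"
  unfolding set_lebesgue_integral_def conv_def
proof (rule Bochner_Integration.integral_cong[OF refl])
  fix y assume y: "y \<in> space (leb n)"
  show "indicator \<Omega> y *\<^sub>R (f y * kern n \<beta> x y) = indicator K y * f y * kern n \<beta> x y"
  proof (cases "y \<in> K")
    case False
    then have "kern n \<beta> x y = 0" using kern_support[of n e \<beta> y x, OF assms(1)] assms(2) y by auto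
    then show ?thesis by simp
  qed (use assms in auto)
qed

lemma loc_integrable_indicator:
  assumes "loc_integrable n \<Omega> f" "compactin (euc n) K" "K \<subseteq> \<Omega>"
  shows "integrable (leb n) (\<lambda>y. indicator K y * f y)"
  using assms unfolding loc_integrable_def set_integrable_def by auto

text \<open>For fixed \<open>x\<close> the kernel is a test function of \<open>y\<close>.
  Differentiating it in \<open>y\<close> instead of \<open>x\<close> gives a sign, which the sign in
  the weak derivative cancels. Truncation to the compact set \<open>K\<close> makes \<open>u\<close>
  integrable and is invisible at \<open>x\<close>, whose averaging cube lies in
  \<open>K\<close>.\<close>

lemma conv_weak_deriv1:
  assumes w: "has_weak_deriv n \<Omega> [i] u g" and i: "i < n" and K: "compactin (euc n) K" "K \<subseteq> \<Omega>"
    and \<beta>: "\<forall>i<n. compact_smooth (\<beta> i)" and s: "e > 0" "\<And>i t. i < n \<Longrightarrow> \<bar>t\<bar> \<ge> e \<Longrightarrow> \<beta> i t = 0" "closed_box n x e \<subseteq> K"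
  shows "pderiv_at i (conv n (\<lambda>y. indicator K y * u y) \<beta>) x = conv n (\<lambda>y. indicator K y * g y) \<beta> x"
proof -
  let ?b = "\<beta>(i := deriv (\<beta> i))"
  have s': "?b j t = 0" if "j < n" "\<bar>t\<bar> \<ge> e" for j t
    using s(2)[OF that] compact_smooth_support_deriv[of "\<beta> i" e t] s(1,2) \<beta>[rule_format, OF i] i that by (auto simp: compact_smooth_def)
  have int: "integrable (leb n) (\<lambda>y. indicator K y * u y)"
    using loc_integrable_indicator[OF _ K] w by (simp add: has_weak_deriv_def)
  have "kern n \<beta> x \<in> test_fun n \<Omega>" by (rule kern_test_fun[of n \<beta> e]) (use \<beta> s K in auto)
  then have "(LINT y:\<Omega>|leb n. u y * iter_pderiv [i] (kern n \<beta> x) y) = (-1) ^ length [i] * (LINT y:\<Omega>|leb n. g y * kern n \<beta> x y)"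
    using w unfolding has_weak_deriv_def by blast
  then have "(LINT y:\<Omega>|leb n. u y * kern n ?b x y) = (LINT y:\<Omega>|leb n. g y * kern n \<beta> x y)"
    by (simp add: pderiv_kern[OF \<beta> i] set_lebesgue_integral_def)
  then have "conv n (\<lambda>y. indicator K y * u y) ?b x = conv n (\<lambda>y. indicator K y * g y) \<beta> x"
    using set_integral_kern[of n e ?b x K \<Omega> u, OF s' s(3) K(2)] set_integral_kern[of n e \<beta> x K \<Omega> g, OF s(2,3) K(2)] by simp
  then show ?thesis by (simp add: pderiv_conv[OF int \<beta> i])
qed

text \<open>Each of the two differentiations in \<open>y\<close> contributes a sign, so none
  remains; \<open>?c\<close> is the kernel family whose \<open>i\<close>-th factor has been
  differentiated twice.\<close>

lemma conv_weak_deriv2: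
  assumes w: "has_weak_deriv n \<Omega> [i, i] u g" and i: "i < n" and K: "compactin (euc n) K" "K \<subseteq> \<Omega>"
    and \<beta>: "\<forall>i<n. compact_smooth (\<beta> i)" and s: "e > 0" "\<And>i t. i < n \<Longrightarrow> \<bar>t\<bar> \<ge> e \<Longrightarrow> \<beta> i t = 0" "closed_box n x e \<subseteq> K"
  shows "pderiv_at i (pderiv_at i (conv n (\<lambda>y. indicator K y * u y) \<beta>)) x = conv n (\<lambda>y. indicator K y * g y) \<beta> x"
proof -
  let ?b = "\<beta>(i := deriv (\<beta> i))"
  let ?c = "?b(i := deriv (?b i))"
  have s': "?b j t = 0" if "j < n" "\<bar>t\<bar> \<ge> e" for j t
    using s(2)[OF that] compact_smooth_support_deriv[of "\<beta> i" e t] s(1,2) \<beta>[rule_format, OF i] i that by (auto simp: compact_smooth_def)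
  have \<beta>': "\<forall>j<n. compact_smooth (?b j)" by (rule compact_smooth_upd_deriv[OF \<beta> i])
  have s'': "?c j t = 0" if "j < n" "\<bar>t\<bar> \<ge> e" for j t
  proof (cases "j = i")
    case True
    have "deriv (?b i) t = 0"
      by (rule compact_smooth_support_deriv[of _ e]) (use \<beta>'[rule_format, OF i] s(1) s'[OF i] that in \<open>auto simp: compact_smooth_def\<close>)
    then show ?thesis using True by simp
  next
    case False
    then show ?thesis using s'[OF that] by simp
  qed
  have int: "integrable (leb n) (\<lambda>y. indicator K y * u y)"
    using loc_integrable_indicator[OF _ K] w by (simp add: has_weak_deriv_def)
  have "kern n \<beta> x \<in> test_fun n \<Omega>" by (rule kern_test_fun[of n \<beta> e]) (use \<beta> s K in auto)
  then have *: "(LINT y:\<Omega>|leb n. u y * iter_pderiv [i, i] (kern n \<beta> x) y) = (-1) ^ length [i, i] * (LINT y:\<Omega>|leb n. g y * kern n \<beta> x y)"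
    using w unfolding has_weak_deriv_def by blast
  have "pderiv_at i (\<lambda>y. - kern n ?b x y) y = kern n ?c x y" if "y \<in> pts n" for y
  proof (rule has_pd_eq)
    have "has_pd i (kern n ?b x) y (pderiv_at i (kern n ?b x) y)"
      by (rule smooth_has_pd[OF smooth_kern[OF \<beta>'] i that])
    moreover have "pderiv_at i (kern n ?b x) y = - kern n ?c x y"
      by (rule pderiv_kern[of n ?b i x y]) (rule \<beta>', rule i)
    ultimately have "has_pd i (kern n ?b x) y (- kern n ?c x y)" by metis
    from DERIV_minus[OF this] show "has_pd i (\<lambda>y. - kern n ?b x y) y (kern n ?c x y)" by simp
  qed
  moreover have "pderiv_at i (kern n \<beta> x) = (\<lambda>y. - kern n ?b x y)" by (rule ext, rule pderiv_kern) (rule \<beta>, rule i)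
  ultimately have "(LINT y:\<Omega>|leb n. u y * iter_pderiv [i, i] (kern n \<beta> x) y) = (LINT y:\<Omega>|leb n. u y * kern n ?c x y)"
    unfolding set_lebesgue_integral_def by (intro Bochner_Integration.integral_cong) auto
  with * have "(LINT y:\<Omega>|leb n. u y * kern n ?c x y) = (LINT y:\<Omega>|leb n. g y * kern n \<beta> x y)" by simp
  then have "conv n (\<lambda>y. indicator K y * u y) ?c x = conv n (\<lambda>y. indicator K y * g y) \<beta> x"
    using set_integral_kern[of n e ?c x K \<Omega> u, OF s'' s(3) K(2)] set_integral_kern[of n e \<beta> x K \<Omega> g, OF s(2,3) K(2)] by simp
  then show ?thesis unfolding pderiv_conv[OF int \<beta> i] pderiv_conv[OF int \<beta>' i] .
qed

section \<open>Continuity of translations\<close>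

text \<open>\<open>reflect n x y\<close> is the difference \<open>x - y\<close>, the argument at
  which a convolution evaluates \<open>f\<close>. Smallness of \<open>y\<close> is measured
  coordinatewise because the kernels are supported in cubes.\<close>

definition shift_continuous :: "nat \<Rightarrow> (point \<Rightarrow> real) \<Rightarrow> bool" where
  "shift_continuous n f \<longleftrightarrow> f \<in> borel_measurable (leb n) \<and>
     (\<forall>\<delta>>0. \<exists>\<epsilon>>0. \<forall>y\<in>pts n. (\<forall>i<n. \<bar>y i\<bar> \<le> \<epsilon>) \<longrightarrow>
        (\<integral>\<^sup>+x. ennreal \<bar>f (reflect n x y) - f x\<bar> \<partial>leb n) \<le> ennreal \<delta>)"

lemma reflect_eq_shift: "reflect n x y = shift n (\<lambda>i. - y i) x"
  by (auto simp: reflect_def shift_def)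

lemma measurable_reflect_left [measurable]: "(\<lambda>x. reflect n x y) \<in> measurable (leb n) (leb n)"
  unfolding reflect_eq_shift by measurable

lemma nn_integral_reflect_left: "f \<in> borel_measurable (leb n) \<Longrightarrow> (\<integral>\<^sup>+x. f (reflect n x y) \<partial>leb n) = (\<integral>\<^sup>+x. f x \<partial>leb n)"
  unfolding reflect_eq_shift by (rule nn_integral_shift)

text \<open>The class is closed under limits in \<open>L^1\<close>: the approximation error enters
  twice, once translated, and translation preserves it; hence the division of \<delta> by
  three.\<close>

lemma shift_continuous_approx:
  assumes f[measurable]: "f \<in> borel_measurable (leb n)"
    and a: "\<And>\<delta>. \<delta> > 0 \<Longrightarrow> \<exists>g. shift_continuous n g \<and> (\<integral>\<^sup>+x. ennreal \<bar>f x - g x\<bar> \<partial>leb n) \<le> ennreal \<delta>"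
  shows "shift_continuous n f"
  unfolding shift_continuous_def
proof (intro conjI f allI impI)
  fix \<delta> :: real assume "\<delta> > 0"
  then obtain g where g: "shift_continuous n g" "(\<integral>\<^sup>+x. ennreal \<bar>f x - g x\<bar> \<partial>leb n) \<le> ennreal (\<delta> / 3)" using a[of "\<delta> / 3"] by auto
  have [measurable]: "g \<in> borel_measurable (leb n)" using g by (simp add: shift_continuous_def)
  have "\<exists>\<epsilon>>0. \<forall>y\<in>pts n. (\<forall>i<n. \<bar>y i\<bar> \<le> \<epsilon>) \<longrightarrow> (\<integral>\<^sup>+x. ennreal \<bar>g (reflect n x y) - g x\<bar> \<partial>leb n) \<le> ennreal (\<delta> / 3)"
    using g(1) \<open>\<delta> > 0\<close> unfolding shift_continuous_def by simp
  then obtain \<epsilon> where e: "\<epsilon> > 0" "\<And>y. y \<in> pts n \<Longrightarrow> (\<forall>i<n. \<bar>y i\<bar> \<le> \<epsilon>) \<Longrightarrow>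
      (\<integral>\<^sup>+x. ennreal \<bar>g (reflect n x y) - g x\<bar> \<partial>leb n) \<le> ennreal (\<delta> / 3)"
    by blast
  show "\<exists>\<epsilon>>0. \<forall>y\<in>pts n. (\<forall>i<n. \<bar>y i\<bar> \<le> \<epsilon>) \<longrightarrow>
        (\<integral>\<^sup>+x. ennreal \<bar>f (reflect n x y) - f x\<bar> \<partial>leb n) \<le> ennreal \<delta>"
  proof (intro exI[of _ \<epsilon>] conjI e(1) ballI impI)
    fix y assume y: "y \<in> pts n" "\<forall>i<n. \<bar>y i\<bar> \<le> \<epsilon>"
    have "(\<integral>\<^sup>+x. ennreal \<bar>f (reflect n x y) - f x\<bar> \<partial>leb n) \<le>
      (\<integral>\<^sup>+x. ennreal \<bar>f (reflect n x y) - g (reflect n x y)\<bar> + (ennreal \<bar>g (reflect n x y) - g x\<bar> + ennreal \<bar>f x - g x\<bar>) \<partial>leb n)"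
      by (rule nn_integral_mono) (auto simp: ennreal_plus[symmetric] simp del: ennreal_plus intro!: ennreal_leI)
    also have "\<dots> = (\<integral>\<^sup>+x. ennreal \<bar>f (reflect n x y) - g (reflect n x y)\<bar> \<partial>leb n) + ((\<integral>\<^sup>+x. ennreal \<bar>g (reflect n x y) - g x\<bar> \<partial>leb n) + (\<integral>\<^sup>+x. ennreal \<bar>f x - g x\<bar> \<partial>leb n))"
      by (subst nn_integral_add; (subst nn_integral_add)?) auto
    also have "(\<integral>\<^sup>+x. ennreal \<bar>f (reflect n x y) - g (reflect n x y)\<bar> \<partial>leb n) = (\<integral>\<^sup>+x. ennreal \<bar>f x - g x\<bar> \<partial>leb n)"
      by (rule nn_integral_reflect_left[of "\<lambda>x. ennreal \<bar>f x - g x\<bar>"]) simp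
    also have "(\<integral>\<^sup>+x. ennreal \<bar>f x - g x\<bar> \<partial>leb n) + ((\<integral>\<^sup>+x. ennreal \<bar>g (reflect n x y) - g x\<bar> \<partial>leb n) + (\<integral>\<^sup>+x. ennreal \<bar>f x - g x\<bar> \<partial>leb n))
      \<le> ennreal (\<delta> / 3) + (ennreal (\<delta> / 3) + ennreal (\<delta> / 3))"
      by (intro add_mono g(2) e(2) y)
    also have "\<dots> = ennreal \<delta>" using \<open>\<delta> > 0\<close> by (simp add: ennreal_plus[symmetric] del: ennreal_plus)
    finally show "(\<integral>\<^sup>+x. ennreal \<bar>f (reflect n x y) - f x\<bar> \<partial>leb n) \<le> ennreal \<delta>" .
  qed
qed

lemma shift_continuousD:
  assumes "shift_continuous n f" "\<delta> > 0"
  obtains \<epsilon> where "\<epsilon> > 0" "\<And>y. y \<in> pts n \<Longrightarrow> (\<And>i. i < n \<Longrightarrow> \<bar>y i\<bar> \<le> \<epsilon>) \<Longrightarrow>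
      (\<integral>\<^sup>+x. ennreal \<bar>f (reflect n x y) - f x\<bar> \<partial>leb n) \<le> ennreal \<delta>"
proof -
  have "\<exists>\<epsilon>>0. \<forall>y\<in>pts n. (\<forall>i<n. \<bar>y i\<bar> \<le> \<epsilon>) \<longrightarrow> (\<integral>\<^sup>+x. ennreal \<bar>f (reflect n x y) - f x\<bar> \<partial>leb n) \<le> ennreal \<delta>"
    using assms unfolding shift_continuous_def by simp
  then show ?thesis using that by blast
qed

lemma shift_continuous_zero: "shift_continuous n (\<lambda>_. 0)"
  unfolding shift_continuous_def by (auto intro!: exI[of _ 1])

lemma shift_continuous_add:
  assumes f: "shift_continuous n f" and g: "shift_continuous n g"
  shows "shift_continuous n (\<lambda>x. f x + g x)"
  unfolding shift_continuous_def
proof (intro conjI allI impI)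
  have [measurable]: "f \<in> borel_measurable (leb n)" "g \<in> borel_measurable (leb n)" using f g by (auto simp: shift_continuous_def)
  show "(\<lambda>x. f x + g x) \<in> borel_measurable (leb n)" by measurable
  fix \<delta> :: real assume d: "\<delta> > 0"
  then have d2: "\<delta> / 2 > 0" by simp
  obtain e1 where e1: "e1 > 0" "\<And>y. y \<in> pts n \<Longrightarrow> (\<And>i. i < n \<Longrightarrow> \<bar>y i\<bar> \<le> e1) \<Longrightarrow>
      (\<integral>\<^sup>+x. ennreal \<bar>f (reflect n x y) - f x\<bar> \<partial>leb n) \<le> ennreal (\<delta> / 2)" using shift_continuousD[OF f d2] by blast
  obtain e2 where e2: "e2 > 0" "\<And>y. y \<in> pts n \<Longrightarrow> (\<And>i. i < n \<Longrightarrow> \<bar>y i\<bar> \<le> e2) \<Longrightarrow>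
      (\<integral>\<^sup>+x. ennreal \<bar>g (reflect n x y) - g x\<bar> \<partial>leb n) \<le> ennreal (\<delta> / 2)" using shift_continuousD[OF g d2] by blast
  show "\<exists>\<epsilon>>0. \<forall>y\<in>pts n. (\<forall>i<n. \<bar>y i\<bar> \<le> \<epsilon>) \<longrightarrow>
        (\<integral>\<^sup>+x. ennreal \<bar>f (reflect n x y) + g (reflect n x y) - (f x + g x)\<bar> \<partial>leb n) \<le> ennreal \<delta>"
  proof (intro exI[of _ "min e1 e2"] conjI ballI impI)
    fix y assume y: "y \<in> pts n" "\<forall>i<n. \<bar>y i\<bar> \<le> min e1 e2"
    have "(\<integral>\<^sup>+x. ennreal \<bar>f (reflect n x y) + g (reflect n x y) - (f x + g x)\<bar> \<partial>leb n) \<le>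
      (\<integral>\<^sup>+x. ennreal \<bar>f (reflect n x y) - f x\<bar> + ennreal \<bar>g (reflect n x y) - g x\<bar> \<partial>leb n)"
      by (rule nn_integral_mono) (auto simp: ennreal_plus[symmetric] simp del: ennreal_plus intro!: ennreal_leI)
    also have "\<dots> = (\<integral>\<^sup>+x. ennreal \<bar>f (reflect n x y) - f x\<bar> \<partial>leb n) + (\<integral>\<^sup>+x. ennreal \<bar>g (reflect n x y) - g x\<bar> \<partial>leb n)"
      by (subst nn_integral_add) auto
    also have "\<dots> \<le> ennreal (\<delta> / 2) + ennreal (\<delta> / 2)"
      by (intro add_mono e1(2) e2(2) y(1)) (use y(2) in auto)
    also have "\<dots> = ennreal \<delta>" using d by (simp add: ennreal_plus[symmetric] del: ennreal_plus)
    finally show "(\<integral>\<^sup>+x. ennreal \<bar>f (reflect n x y) + g (reflect n x y) - (f x + g x)\<bar> \<partial>leb n) \<le> ennreal \<delta>" .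
  qed (use e1 e2 in auto)
qed

lemma shift_continuous_cmult:
  assumes f: "shift_continuous n f"
  shows "shift_continuous n (\<lambda>x. c * f x)"
  unfolding shift_continuous_def
proof (intro conjI allI impI)
  have [measurable]: "f \<in> borel_measurable (leb n)" using f by (auto simp: shift_continuous_def)
  show "(\<lambda>x. c * f x) \<in> borel_measurable (leb n)" by measurable
  fix \<delta> :: real assume d: "\<delta> > 0"
  then have d2: "\<delta> / (\<bar>c\<bar> + 1) > 0" by (simp add: add_nonneg_pos)
  obtain e1 where e1: "e1 > 0" "\<And>y. y \<in> pts n \<Longrightarrow> (\<And>i. i < n \<Longrightarrow> \<bar>y i\<bar> \<le> e1) \<Longrightarrow>
      (\<integral>\<^sup>+x. ennreal \<bar>f (reflect n x y) - f x\<bar> \<partial>leb n) \<le> ennreal (\<delta> / (\<bar>c\<bar> + 1))" using shift_continuousD[OF f d2] by blast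
  show "\<exists>\<epsilon>>0. \<forall>y\<in>pts n. (\<forall>i<n. \<bar>y i\<bar> \<le> \<epsilon>) \<longrightarrow>
        (\<integral>\<^sup>+x. ennreal \<bar>c * f (reflect n x y) - c * f x\<bar> \<partial>leb n) \<le> ennreal \<delta>"
  proof (intro exI[of _ e1] conjI ballI impI)
    fix y assume y: "y \<in> pts n" "\<forall>i<n. \<bar>y i\<bar> \<le> e1"
    have "(\<integral>\<^sup>+x. ennreal \<bar>c * f (reflect n x y) - c * f x\<bar> \<partial>leb n) = (\<integral>\<^sup>+x. ennreal \<bar>c\<bar> * ennreal \<bar>f (reflect n x y) - f x\<bar> \<partial>leb n)"
      by (rule nn_integral_cong) (simp add: ennreal_mult[symmetric] abs_mult[symmetric] right_diff_distrib)
    also have "\<dots> = ennreal \<bar>c\<bar> * (\<integral>\<^sup>+x. ennreal \<bar>f (reflect n x y) - f x\<bar> \<partial>leb n)"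
      by (rule nn_integral_cmult) simp
    also have "\<dots> \<le> ennreal \<bar>c\<bar> * ennreal (\<delta> / (\<bar>c\<bar> + 1))"
      by (intro mult_left_mono e1(2) y(1)) (use y(2) in auto)
    also have "\<dots> = ennreal (\<bar>c\<bar> * (\<delta> / (\<bar>c\<bar> + 1)))" using d2 by (simp only: ennreal_mult abs_ge_zero less_imp_le)
    also have "\<dots> \<le> ennreal \<delta>" using d by (intro ennreal_leI) (simp add: field_simps)
    finally show "(\<integral>\<^sup>+x. ennreal \<bar>c * f (reflect n x y) - c * f x\<bar> \<partial>leb n) \<le> ennreal \<delta>" .
  qed (use e1 in auto)
qed

lemma shift_continuous_diff: "shift_continuous n f \<Longrightarrow> shift_continuous n g \<Longrightarrow> shift_continuous n (\<lambda>x. f x - g x)"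
  using shift_continuous_add[OF _ shift_continuous_cmult[of n g "-1"], of f] by simp

lemma shift_continuous_sum: "finite I \<Longrightarrow> (\<And>i. i \<in> I \<Longrightarrow> shift_continuous n (f i)) \<Longrightarrow> shift_continuous n (\<lambda>x. \<Sum>i\<in>I. f i x)"
proof (induction I rule: finite_induct)
  case (insert i I)
  have "shift_continuous n (\<lambda>x. f i x + (\<Sum>i\<in>I. f i x))" by (rule shift_continuous_add) (use insert in auto)
  then show ?case using insert by simp
qed (simp add: shift_continuous_zero)

lemma shift_continuous_cong: "(\<And>x. x \<in> pts n \<Longrightarrow> f x = g x) \<Longrightarrow> shift_continuous n f \<Longrightarrow> shift_continuous n g"
proof -
  assume e: "\<And>x. x \<in> pts n \<Longrightarrow> f x = g x" and t: "shift_continuous n f"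
  have "g \<in> borel_measurable (leb n)"
    using t e measurable_cong[of "leb n" f g borel] by (auto simp: shift_continuous_def)
  moreover have "(\<integral>\<^sup>+x. ennreal \<bar>g (reflect n x y) - g x\<bar> \<partial>leb n) = (\<integral>\<^sup>+x. ennreal \<bar>f (reflect n x y) - f x\<bar> \<partial>leb n)" for y
    by (rule nn_integral_cong) (use e in auto)
  ultimately show ?thesis using t by (simp add: shift_continuous_def)
qed

text \<open>A translate of the box by at most \<epsilon> in each coordinate still contains the box
  shrunk by \<epsilon> on every side. The symmetric difference is thus covered by two sets of volume
  \<open>P 0 - P \<epsilon>\<close>, which is small by continuity of the product
  \<open>P\<close>.\<close>

lemma shift_continuous_open_box: "shift_continuous n (indicator (PiE {..<n} (\<lambda>i. {a i<..<b i})))"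
proof (cases "\<forall>i<n. a i < b i")
  case False
  then have "PiE {..<n} (\<lambda>i. {a i<..<b i}) = {}" by (force simp: PiE_eq_empty_iff not_less)
  then show ?thesis by (intro shift_continuous_cong[of n "\<lambda>_. 0", OF _ shift_continuous_zero]) simp
next
  case True
  define B where "B \<epsilon> = PiE {..<n} (\<lambda>i. {a i + \<epsilon><..<b i - \<epsilon>})" for \<epsilon>
  define P where "P \<epsilon> = (\<Prod>i<n. b i - a i - 2 * \<epsilon>)" for \<epsilon>
  have Bs[measurable]: "B \<epsilon> \<in> sets (leb n)" for \<epsilon> unfolding B_def by (rule sets_PiM_I_finite) auto
  have vol: "emeasure (leb n) (B \<epsilon>) = ennreal (P \<epsilon>)" if "\<And>i. i < n \<Longrightarrow> 2 * \<epsilon> < b i - a i" for \<epsilon>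
  proof -
    have "emeasure (leb n) (B \<epsilon>) = (\<Prod>i<n. emeasure lborel {a i + \<epsilon><..<b i - \<epsilon>})"
      unfolding B_def by (rule leb.emeasure_PiM) auto
    also have "\<dots> = (\<Prod>i<n. ennreal (b i - a i - 2 * \<epsilon>))"
    proof (rule prod.cong)
      fix i assume "i \<in> {..<n}"
      then have "a i + \<epsilon> \<le> b i - \<epsilon>" using that[of i] by simp
      then show "emeasure lborel {a i + \<epsilon><..<b i - \<epsilon>} = ennreal (b i - a i - 2 * \<epsilon>)" by (simp add: algebra_simps)
    qed simp
    also have "\<dots> = ennreal (P \<epsilon>)" unfolding P_def using that by (intro prod_ennreal) (auto simp: less_imp_le)
    finally show ?thesis .
  qed
  have "((\<lambda>\<epsilon>. P \<epsilon>) \<longlongrightarrow> (\<Prod>i<n. b i - a i - 2 * 0)) (at_right 0)"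
    unfolding P_def by (intro tendsto_intros)
  then have Pl: "(P \<longlongrightarrow> P 0) (at_right 0)" by (simp add: P_def[abs_def])
  have "shift_continuous n (indicator (B 0))"
    unfolding shift_continuous_def
  proof (intro conjI allI impI)
    fix \<delta> :: real assume d: "\<delta> > 0"
    have "\<forall>\<^sub>F \<epsilon> in at_right 0. \<forall>i\<in>{..<n}. \<epsilon> < (b i - a i) / 2"
    proof (intro eventually_ball_finite ballI)
      fix i assume "i \<in> {..<n}"
      then have "0 < (b i - a i) / 2" using True by simp
      from eventually_at_right_real[OF this] show "\<forall>\<^sub>F \<epsilon> in at_right 0. \<epsilon> < (b i - a i) / 2"
        by eventually_elim simp
    qed simp
    moreover have "\<forall>\<^sub>F \<epsilon> in at_right 0. P \<epsilon> > P 0 - \<delta> / 2" using Pl d by (intro order_tendstoD(1)) auto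
    moreover have "\<forall>\<^sub>F \<epsilon> in at_right 0. \<epsilon> > (0::real)" by (rule eventually_at_right_less)
    ultimately have "\<forall>\<^sub>F \<epsilon> in at_right (0::real). (\<forall>i\<in>{..<n}. \<epsilon> < (b i - a i) / 2) \<and> P \<epsilon> > P 0 - \<delta> / 2 \<and> \<epsilon> > 0"
      by eventually_elim auto
    then obtain \<epsilon> where e: "\<And>i. i < n \<Longrightarrow> \<epsilon> < (b i - a i) / 2" "P \<epsilon> > P 0 - \<delta> / 2" "\<epsilon> > 0"
      using eventually_happens'[OF trivial_limit_at_right_real] by (metis (no_types, lifting) lessThan_iff)
    show "\<exists>\<epsilon>>0. \<forall>y\<in>pts n. (\<forall>i<n. \<bar>y i\<bar> \<le> \<epsilon>) \<longrightarrow>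
        (\<integral>\<^sup>+x. ennreal \<bar>indicator (B 0) (reflect n x y) - indicator (B 0) x\<bar> \<partial>leb n) \<le> ennreal \<delta>"
    proof (intro exI[of _ \<epsilon>] conjI e(3) ballI impI)
      fix y assume y: "y \<in> pts n" "\<forall>i<n. \<bar>y i\<bar> \<le> \<epsilon>"
      define B' where "B' = {x \<in> space (leb n). reflect n x y \<in> B 0}"
      have B's[measurable]: "B' \<in> sets (leb n)" unfolding B'_def by measurable
      have sub: "B \<epsilon> \<subseteq> B 0" unfolding B_def using e(3) by (intro PiE_mono) auto
      have sub': "B \<epsilon> \<subseteq> B'"
      proof
        fix x assume x: "x \<in> B \<epsilon>"
        then have xp: "x \<in> pts n" by (auto simp: B_def PiE_iff)
        have "a i < x i - y i \<and> x i - y i < b i" if i: "i < n" for i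
        proof -
          have "a i + \<epsilon> < x i" "x i < b i - \<epsilon>" using x i by (auto simp: B_def PiE_iff)
          moreover have "\<bar>y i\<bar> \<le> \<epsilon>" using y(2) i by blast
          ultimately show ?thesis by linarith
        qed
        then have "reflect n x y \<in> B 0" by (auto simp: B_def PiE_iff reflect_def)
        then show "x \<in> B'" using xp by (simp add: B'_def)
      qed
      have mB': "emeasure (leb n) B' = ennreal (P 0)"
      proof -
        have "emeasure (leb n) B' = (\<integral>\<^sup>+x. indicator B' x \<partial>leb n)" by simp
        also have "\<dots> = (\<integral>\<^sup>+x. indicator (B 0) (reflect n x y) \<partial>leb n)"
          by (rule nn_integral_cong) (auto simp: B'_def indicator_def)
        also have "\<dots> = (\<integral>\<^sup>+x. indicator (B 0) x \<partial>leb n)" by (rule nn_integral_reflect_left) simp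
        also have "\<dots> = ennreal (P 0)" using vol[of 0] True by simp
        finally show ?thesis .
      qed
      have Pe: "P \<epsilon> \<ge> 0" unfolding P_def using e(1) by (intro prod_nonneg) (force simp: field_simps)
      have mBe: "emeasure (leb n) (B \<epsilon>) = ennreal (P \<epsilon>)" using e(1) by (intro vol) (force simp: field_simps)
      have "(\<integral>\<^sup>+x. ennreal \<bar>indicator (B 0) (reflect n x y) - indicator (B 0) x\<bar> \<partial>leb n)
          \<le> (\<integral>\<^sup>+x. indicator (B' - B \<epsilon>) x + indicator (B 0 - B \<epsilon>) x \<partial>leb n)"
      proof (rule nn_integral_mono)
        fix x assume x: "x \<in> space (leb n)"
        have "x \<in> B' \<longleftrightarrow> reflect n x y \<in> B 0" using x by (simp add: B'_def)
        then show "ennreal \<bar>indicator (B 0) (reflect n x y) - indicator (B 0) x\<bar> \<le> indicator (B' - B \<epsilon>) x + indicator (B 0 - B \<epsilon>) x"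
          using sub sub' by (auto simp: indicator_def)
      qed
      also have "\<dots> = emeasure (leb n) (B' - B \<epsilon>) + emeasure (leb n) (B 0 - B \<epsilon>)"
        by (subst nn_integral_add) auto
      also have "emeasure (leb n) (B' - B \<epsilon>) = ennreal (P 0) - ennreal (P \<epsilon>)"
        using mB' mBe sub' by (subst emeasure_Diff) auto
      also have "emeasure (leb n) (B 0 - B \<epsilon>) = ennreal (P 0) - ennreal (P \<epsilon>)"
        using vol[of 0] True mBe sub by (subst emeasure_Diff) auto
      also have "ennreal (P 0) - ennreal (P \<epsilon>) + (ennreal (P 0) - ennreal (P \<epsilon>)) \<le> ennreal (\<delta> / 2) + ennreal (\<delta> / 2)"
        using e(2) Pe by (intro add_mono) (simp_all add: ennreal_minus ennreal_leI)
      also have "\<dots> = ennreal \<delta>" using d by (simp add: ennreal_plus[symmetric] del: ennreal_plus)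
      finally show "(\<integral>\<^sup>+x. ennreal \<bar>indicator (B 0) (reflect n x y) - indicator (B 0) x\<bar> \<partial>leb n) \<le> ennreal \<delta>" .
    qed
  qed simp
  then show ?thesis by (simp add: B_def)
qed

text \<open>Dynkin's theorem needs a generator stable under intersections, and open boxes are one
  for which the continuity of translations can be computed.\<close>

lemma sets_leb_generated:
  "sets (leb n) = sigma_sets (pts n) {PiE {..<n} (\<lambda>i. {a i<..<b i}) |a b. True}"
proof -
  let ?E = "range (\<lambda>(a, b). {a <..< b :: real})"
  have "sets (leb n) = sets (PiM {..<n} (\<lambda>_. sigma UNIV ?E))"
    proof (rule sets_PiM_cong)
    have "?E = range (\<lambda>(a, b). box a b)" by (simp add: box_real)
    then show "sets lborel = sets (sigma UNIV ?E)" by (simp only: sets_lborel borel_eq_box)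
  qed simp
  also have "\<dots> = sets (sigma (PiE {..<n} (\<lambda>_. UNIV)) {{f \<in> (PiE {..<n} (\<lambda>_. UNIV)). \<forall>i\<in>j. f i \<in> A i} | A j. j \<in> {{..<n}} \<and> A \<in> Pi j (\<lambda>_. ?E)})"
  proof (rule sets_PiM_sigma)
    show "\<exists>S\<subseteq>?E. countable S \<and> UNIV = \<Union>S" if "i \<in> {..<n}" for i
    proof (intro exI conjI)
      show "range (\<lambda>k::nat. {- real k<..<real k}) \<subseteq> ?E" by auto
      show "UNIV = \<Union> (range (\<lambda>k::nat. {- real k<..<real k}))"
      proof -
        have "\<exists>k::nat. - real k < x \<and> x < real k" for x
        proof -
          obtain k :: nat where "\<bar>x\<bar> < real k" using reals_Archimedean2 by blast
          then show ?thesis by (intro exI[of _ k]) linarith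
        qed
        then show ?thesis by (fastforce)
      qed
    qed simp
  qed auto
  also have "{{f \<in> (PiE {..<n} (\<lambda>_. UNIV)). \<forall>i\<in>j. f i \<in> A i} | A j. j \<in> {{..<n}} \<and> A \<in> Pi j (\<lambda>_. ?E)}
     = {PiE {..<n} (\<lambda>i. {a i<..<b i}) |a b. True}" (is "?L = ?R")
  proof
    show "?R \<subseteq> ?L"
    proof
      fix X assume "X \<in> ?R"
      then obtain a b where X: "X = PiE {..<n} (\<lambda>i. {a i<..<b i})" by auto
      have "X = {f \<in> (PiE {..<n} (\<lambda>_. UNIV)). \<forall>i\<in>{..<n}. f i \<in> {a i<..<b i}}"
        unfolding X by (rule set_eqI) (unfold PiE_iff mem_Collect_eq, blast)
      then show "X \<in> ?L"
        by (intro CollectI exI[of _ "\<lambda>i. {a i<..<b i}"] exI[of _ "{..<n}"] conjI) auto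
    qed
    show "?L \<subseteq> ?R"
    proof
      fix X assume "X \<in> ?L"
      then obtain A where A: "X = {f \<in> (PiE {..<n} (\<lambda>_. UNIV)). \<forall>i\<in>{..<n}. f i \<in> A i}" "A \<in> Pi {..<n} (\<lambda>_. ?E)" by auto
      have "\<exists>p. A i = {fst p<..<snd p}" if "i < n" for i
      proof -
        have "A i \<in> ?E" using A(2) that by (auto simp: Pi_iff)
        then obtain z where "A i = (case z of (a, b) \<Rightarrow> {a<..<b})" by (rule rangeE)
        then show ?thesis by (intro exI[of _ z]) (simp add: case_prod_beta)
      qed
      then obtain p where p: "\<And>i. i < n \<Longrightarrow> A i = {fst (p i)<..<snd (p i)}" by metis
      have "X = PiE {..<n} (\<lambda>i. {fst (p i)<..<snd (p i)})"
      proof (rule set_eqI)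
        fix x
        have "(\<forall>i\<in>{..<n}. x i \<in> A i) = (\<forall>i\<in>{..<n}. x i \<in> {fst (p i)<..<snd (p i)})" by (simp add: p)
        then show "x \<in> X \<longleftrightarrow> x \<in> PiE {..<n} (\<lambda>i. {fst (p i)<..<snd (p i)})"
          unfolding A(1) PiE_iff mem_Collect_eq by blast
      qed
      then show "X \<in> ?R"
        by (intro CollectI exI[of _ "\<lambda>i. fst (p i)"] exI[of _ "\<lambda>i. snd (p i)"] conjI TrueI)
    qed
  qed
  also have "sets (sigma (PiE {..<n} (\<lambda>_. UNIV)) ?R) = sigma_sets (pts n) ?R"
    by (rule sets_measure_of) (auto simp: PiE_iff)
  finally show ?thesis .
qed

text \<open>Induction over the measurable sets by Dynkin's theorem. The intersection with a fixed
  cube keeps all measures finite, so that complements become differences of integrable indicators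
  and tails of disjoint unions become small.\<close>

lemma shift_continuous_indicator_bounded:
  assumes "A \<in> sets (leb n)"
  shows "shift_continuous n (indicator (A \<inter> open_box n (origin n) m))"
proof -
  let ?Q = "open_box n (origin n) m"
  let ?G = "{PiE {..<n} (\<lambda>i. {a i<..<b i :: real}) |a b. True}"
  have fin: "emeasure (leb n) ?Q < \<infinity>"
  proof -
    have "emeasure (leb n) ?Q \<le> emeasure (leb n) (closed_box n (origin n) \<bar>m\<bar>)"
      by (rule emeasure_mono) (fastforce simp: open_box_iff closed_box_iff, rule closed_box_sets)
    also have "\<dots> < \<infinity>" by (simp add: emeasure_closed_box)
    finally show ?thesis .
  qed
  have A: "A \<in> sigma_sets (pts n) ?G" using assms sets_leb_generated by simp
  have Qeq: "?Q = PiE {..<n} (\<lambda>i. {-m<..<m})" unfolding open_box_def by (rule PiE_cong) simp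
  have IS: "Int_stable ?G"
  proof (rule Int_stableI)
    fix X Y assume X: "X \<in> ?G" and Y: "Y \<in> ?G"
    from X obtain a b where *: "X = PiE {..<n} (\<lambda>i. {a i<..<b i})" unfolding mem_Collect_eq by (elim exE conjE)
    from Y obtain c d where **: "Y = PiE {..<n} (\<lambda>i. {c i<..<d i})" unfolding mem_Collect_eq by (elim exE conjE)
    have "X \<inter> Y = PiE {..<n} (\<lambda>i. {max (a i) (c i)<..<min (b i) (d i)})" unfolding * **
      by (rule set_eqI) (unfold PiE_iff Int_iff greaterThanLessThan_iff max_less_iff_conj min_less_iff_conj, blast)
    then show "X \<inter> Y \<in> ?G"
      by (intro CollectI exI[of _ "\<lambda>i. max (a i) (c i)"] exI[of _ "\<lambda>i. min (b i) (d i)"] conjI TrueI)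
  qed
  have sub: "?G \<subseteq> Pow (pts n)" by (auto simp: PiE_iff)
  show ?thesis
    using IS sub A
  proof (induction A rule: sigma_sets_induct_disjoint)
    case (basic A)
    then obtain a b where *: "A = PiE {..<n} (\<lambda>i. {a i<..<b i})" unfolding mem_Collect_eq by (elim exE conjE)
    have "A \<inter> ?Q = PiE {..<n} (\<lambda>i. {max (a i) (-m)<..<min (b i) m})" unfolding * Qeq
      by (rule set_eqI) (unfold PiE_iff Int_iff greaterThanLessThan_iff max_less_iff_conj min_less_iff_conj, blast)
    then show ?case using shift_continuous_open_box[of n "\<lambda>i. max (a i) (-m)" "\<lambda>i. min (b i) m"] by simp
  next
    case empty
    then show ?case by (intro shift_continuous_cong[of n "\<lambda>_. 0", OF _ shift_continuous_zero]) simp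
  next
    case (compl A)
    have "shift_continuous n (\<lambda>x. indicator ?Q x - indicator (A \<inter> ?Q) x)"
    proof (rule shift_continuous_diff[OF _ compl(2)])
      show "shift_continuous n (indicator ?Q)" unfolding Qeq by (rule shift_continuous_open_box)
    qed
    then show ?case
      by (rule shift_continuous_cong[rotated]) (auto simp: indicator_def)
  next
    case (union A)
    have As[measurable]: "A i \<in> sets (leb n)" for i using union(2) sets_leb_generated by (auto simp: subset_iff)
    \<comment> \<open>The tail of the disjoint union. The tails decrease to the empty set, as no
      point lies in two of the \<open>A i\<close>, so their finite measures tend to zero.\<close>
    define R where "R N = (\<Union>i\<in>{N..}. A i) \<inter> ?Q" for N
    have Rs[measurable]: "R N \<in> sets (leb n)" for N unfolding R_def by auto
    have "(\<lambda>N. emeasure (leb n) (R N)) \<longlonglongrightarrow> emeasure (leb n) (\<Inter>N. R N)"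
    proof (rule Lim_emeasure_decseq)
      show "decseq R" unfolding R_def decseq_def by fastforce
      show "emeasure (leb n) (R N) \<noteq> \<infinity>" for N
      proof -
        have "emeasure (leb n) (R N) \<le> emeasure (leb n) ?Q" by (rule emeasure_mono) (auto simp: R_def)
        then show ?thesis using fin by (auto simp: top_unique)
      qed
    qed auto
    moreover have "(\<Inter>N. R N) = {}"
    proof (rule ccontr)
      assume "(\<Inter>N. R N) \<noteq> {}"
      then obtain x where x: "\<And>N. x \<in> R N" by blast
      from x[of 0] obtain i where i: "x \<in> A i" by (auto simp: R_def)
      from x[of "Suc i"] obtain j where j: "j \<ge> Suc i" "x \<in> A j" by (auto simp: R_def)
      then have "A i \<inter> A j = {}" by (intro disjoint_family_onD[OF union(1)]) auto
      then show False using i j by blast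
    qed
    ultimately have lim: "(\<lambda>N. emeasure (leb n) (R N)) \<longlonglongrightarrow> 0" by simp
    show ?case
    proof (rule shift_continuous_approx)
      show "indicator (\<Union> (range A) \<inter> ?Q) \<in> borel_measurable (leb n)" by (intro borel_measurable_indicator) auto
      fix \<delta> :: real assume "\<delta> > 0"
      then have "\<forall>\<^sub>F N in sequentially. emeasure (leb n) (R N) < ennreal \<delta>" using lim by (intro order_tendstoD(2)) auto
      then obtain N where N: "emeasure (leb n) (R N) < ennreal \<delta>" by (auto simp: eventually_sequentially)
      let ?g = "\<lambda>x. \<Sum>i<N. indicator (A i \<inter> ?Q) x :: real"
      have "(\<integral>\<^sup>+x. ennreal \<bar>indicator (\<Union> (range A) \<inter> ?Q) x - ?g x\<bar> \<partial>leb n) = (\<integral>\<^sup>+x. indicator (R N) x \<partial>leb n)"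
      proof (rule nn_integral_cong)
        fix x
        have d: "i = j" if "x \<in> A i" "x \<in> A j" for i j using that union(1) unfolding disjoint_family_on_def by blast
        show "ennreal \<bar>indicator (\<Union> (range A) \<inter> ?Q) x - ?g x\<bar> = indicator (R N) x"
        proof (cases "x \<in> ?Q \<and> (\<exists>i. x \<in> A i)")
          case True
          then obtain i where i: "x \<in> A i" "x \<in> ?Q" by blast
          have "?g x = (\<Sum>j<N. if j = i then 1 else 0)" using i d by (intro sum.cong) (auto simp: indicator_def)
          also have "\<dots> = (if i < N then 1 else 0)" by simp
          finally have "?g x = (if i < N then 1 else 0)" .
          moreover have "x \<in> R N \<longleftrightarrow> \<not> i < N" using i by (auto simp: R_def dest: d[OF i(1)])
          ultimately show ?thesis using i by (auto simp: indicator_def)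
        next
          case False
          then have "?g x = 0" by (intro sum.neutral) (auto simp: indicator_def)
          then show ?thesis using False by (auto simp: indicator_def R_def)
        qed
      qed
      also have "\<dots> \<le> ennreal \<delta>" using N by simp
      finally show "\<exists>g. shift_continuous n g \<and> (\<integral>\<^sup>+x. ennreal \<bar>indicator (\<Union> (range A) \<inter> ?Q) x - g x\<bar> \<partial>leb n) \<le> ennreal \<delta>"
        using union(3) by (intro exI[of _ ?g] conjI shift_continuous_sum) auto
    qed
  qed
qed

text \<open>Finite measure makes the part of \<open>A\<close> outside a large cube negligible in
  \<open>L^1\<close>.\<close>

lemma shift_continuous_indicator:
  assumes A[measurable]: "A \<in> sets (leb n)" and f: "emeasure (leb n) A < \<infinity>"
  shows "shift_continuous n (indicator A)"
proof (rule shift_continuous_approx)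
  define R where "R N = A - open_box n (origin n) (real N)" for N :: nat
  have Rs[measurable]: "R N \<in> sets (leb n)" for N unfolding R_def by auto
  have "(\<lambda>N. emeasure (leb n) (R N)) \<longlonglongrightarrow> emeasure (leb n) (\<Inter>N. R N)"
  proof (rule Lim_emeasure_decseq)
    show "decseq R" unfolding R_def decseq_def by (force simp: open_box_iff)
    show "emeasure (leb n) (R N) \<noteq> \<infinity>" for N
    proof -
      have "emeasure (leb n) (R N) \<le> emeasure (leb n) A" by (rule emeasure_mono) (auto simp: R_def)
      then show ?thesis using f by (auto simp: top_unique)
    qed
  qed auto
  moreover have "(\<Inter>N. R N) = {}"
  proof (rule ccontr)
    assume "(\<Inter>N. R N) \<noteq> {}"
    then obtain x where x: "\<And>N. x \<in> R N" by blast
    obtain N where N: "(\<Sum>i<n. \<bar>x i\<bar>) < real N" using reals_Archimedean2 by blast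
    have "\<bar>x i\<bar> < real N" if "i < n" for i
      using member_le_sum[of i "{..<n}" "\<lambda>i. \<bar>x i\<bar>"] that N by auto
    moreover have "x \<in> pts n" using x[of 0] sets.sets_into_space[OF A] by (auto simp: R_def)
    ultimately have "x \<in> open_box n (origin n) (real N)" by (auto simp: open_box_iff)
    then show False using x[of N] by (auto simp: R_def)
  qed
  ultimately have lim: "(\<lambda>N. emeasure (leb n) (R N)) \<longlonglongrightarrow> 0" by simp
  fix \<delta> :: real assume "\<delta> > 0"
  then have "\<forall>\<^sub>F N in sequentially. emeasure (leb n) (R N) < ennreal \<delta>" using lim by (intro order_tendstoD(2)) auto
  then obtain N where N: "emeasure (leb n) (R N) < ennreal \<delta>" by (auto simp: eventually_sequentially)
  have "(\<integral>\<^sup>+x. ennreal \<bar>indicator A x - indicator (A \<inter> open_box n (origin n) (real N)) x\<bar> \<partial>leb n) = (\<integral>\<^sup>+x. indicator (R N) x \<partial>leb n)"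
    by (rule nn_integral_cong) (auto simp: indicator_def R_def)
  also have "\<dots> \<le> ennreal \<delta>" using N by simp
  finally show "\<exists>g. shift_continuous n g \<and> (\<integral>\<^sup>+x. ennreal \<bar>indicator A x - g x\<bar> \<partial>leb n) \<le> ennreal \<delta>"
    using shift_continuous_indicator_bounded[OF A] by blast
qed simp

text \<open>Multiples of indicators, sums and dominated limits exhaust the integrable functions;
  limits are covered by \<open>shift_continuous_approx\<close>.\<close>

lemma shift_continuous_integrable:
  assumes "integrable (leb n) f"
  shows "shift_continuous n f"
  using assms
proof (induction rule: integrable_induct)
  case (base A c)
  have "shift_continuous n (\<lambda>x. c * indicator A x)" by (rule shift_continuous_cmult[OF shift_continuous_indicator]) (use base in auto)
  then show ?case by (simp add: mult.commute)
next
  case (add f g)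
  then show ?case by (intro shift_continuous_add)
next
  case (lim f s)
  show ?case
  proof (rule shift_continuous_approx)
    show [measurable]: "f \<in> borel_measurable (leb n)" using lim by auto
    have [measurable]: "s i \<in> borel_measurable (leb n)" for i using lim(1)[of i] by auto
    have "(\<lambda>i. \<integral>\<^sup>+x. norm (f x - s i x) \<partial>leb n) \<longlonglongrightarrow> 0"
    proof (rule nn_integral_dominated_convergence_norm[where w = "\<lambda>x. 2 * norm (f x)"])
      have "integrable (leb n) (\<lambda>x. 2 * norm (f x))" using lim by auto
      then have "(\<integral>\<^sup>+x. ennreal (norm (2 * norm (f x))) \<partial>leb n) < \<infinity>" unfolding integrable_iff_bounded by blast
      then show "(\<integral>\<^sup>+x. ennreal (2 * norm (f x)) \<partial>leb n) < \<infinity>" by (simp add: abs_mult)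
    qed (use lim in auto)
    fix \<delta> :: real assume "\<delta> > 0"
    then have "\<forall>\<^sub>F i in sequentially. (\<integral>\<^sup>+x. norm (f x - s i x) \<partial>leb n) < ennreal \<delta>"
      using \<open>(\<lambda>i. \<integral>\<^sup>+x. norm (f x - s i x) \<partial>leb n) \<longlonglongrightarrow> 0\<close> by (intro order_tendstoD(2)) auto
    then obtain i where "(\<integral>\<^sup>+x. norm (f x - s i x) \<partial>leb n) < ennreal \<delta>" by (auto simp: eventually_sequentially)
    then show "\<exists>g. shift_continuous n g \<and> (\<integral>\<^sup>+x. ennreal \<bar>f x - g x\<bar> \<partial>leb n) \<le> ennreal \<delta>"
      using lim.IH[of i] by (intro exI[of _ "s i"]) auto
  qed
qed

section \<open>Mollification and uniqueness of weak derivatives\<close>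

lemma eLnorm_pts: "eLnorm n q (pts n) h = eLnorm n q UNIV h"
proof -
  have "powr_integral n q (pts n) h = powr_integral n q UNIV h" by (rule nn_integral_cong) auto
  then show ?thesis by (simp add: eLnorm_def)
qed

text \<open>The radius \<open>1 / (k + 1)\<close> admits \<open>k = 0\<close> and tends to zero; the
  same profile serves all coordinates.\<close>

definition bump :: "nat \<Rightarrow> real \<Rightarrow> real" where
  "bump k = (SOME b. smooth1 b \<and> (\<forall>t. b t \<ge> 0) \<and> (\<forall>t. \<bar>t\<bar> \<ge> 1 / (real k + 1) \<longrightarrow> b t = 0) \<and> (\<integral>\<^sup>+t. ennreal (b t) \<partial>lborel) = 1)"

lemma bump: "smooth1 (bump k)" "bump k t \<ge> 0" "\<bar>t\<bar> \<ge> 1 / (real k + 1) \<Longrightarrow> bump k t = 0" "(\<integral>\<^sup>+t. ennreal (bump k t) \<partial>lborel) = 1"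
  using someI_ex[OF bump_ex[of "1 / (real k + 1)"], folded bump_def] by auto

lemma compact_smooth_bump: "compact_smooth (bump k)"
  unfolding compact_smooth_def using bump(1,3)[of k] by (auto intro!: exI[of _ "1 / (real k + 1)"])

lemma bump_measurable [measurable]: "bump k \<in> borel_measurable borel"
  by (rule compact_smooth_measurable[OF compact_smooth_bump])

definition mollify :: "nat \<Rightarrow> nat \<Rightarrow> (point \<Rightarrow> real) \<Rightarrow> point \<Rightarrow> real" where
  "mollify n k f = conv n f (\<lambda>_. bump k)"

lemma smooth_mollify: "integrable (leb n) f \<Longrightarrow> smooth n (mollify n k f)"
  unfolding mollify_def by (rule smooth_conv) (auto simp: compact_smooth_bump)

text \<open>The kernel of \<open>mollify\<close> as a function of the difference of its two points,
  in which it is a probability density.\<close>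

definition bump_kernel :: "nat \<Rightarrow> nat \<Rightarrow> point \<Rightarrow> real" where
  "bump_kernel n k y = (\<Prod>i<n. bump k (y i))"

lemma bump_kernel_nonneg: "bump_kernel n k y \<ge> 0"
  unfolding bump_kernel_def by (intro prod_nonneg) (simp add: bump)

lemma bump_kernel_measurable [measurable]: "bump_kernel n k \<in> borel_measurable (leb n)"
  unfolding bump_kernel_def[abs_def]
proof (rule borel_measurable_prod)
  fix i assume "i \<in> {..<n}"
  then have [measurable]: "(\<lambda>y. y i) \<in> borel_measurable (leb n)" by (simp add: measurable_coord)
  show "(\<lambda>y. bump k (y i)) \<in> borel_measurable (leb n)" by measurable
qed

lemma bump_kernel_integral: "(\<integral>\<^sup>+y. ennreal (bump_kernel n k y) \<partial>leb n) = 1"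
proof -
  have "(\<integral>\<^sup>+y. ennreal (bump_kernel n k y) \<partial>leb n) = (\<integral>\<^sup>+y. (\<Prod>i<n. ennreal (bump k (y i))) \<partial>leb n)"
    unfolding bump_kernel_def by (intro nn_integral_cong prod_ennreal[symmetric]) (simp add: bump)
  also have "\<dots> = (\<Prod>i<n. \<integral>\<^sup>+t. ennreal (bump k t) \<partial>lborel)"
    by (rule leb.product_nn_integral_prod) auto
  finally show ?thesis by (simp add: bump)
qed

lemma bump_kernel_support: "\<exists>i<n. \<bar>y i\<bar> \<ge> 1 / (real k + 1) \<Longrightarrow> bump_kernel n k y = 0"
  unfolding bump_kernel_def using bump(3) by (meson finite_lessThan lessThan_iff prod_zero)

lemma mollify_eq:
  assumes f: "integrable (leb n) f"
  shows "mollify n k f x = (LINT y|leb n. f (reflect n x y) * bump_kernel n k y)" "integrable (leb n) (\<lambda>y. f (reflect n x y) * bump_kernel n k y)"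
proof -
  have e: "f (reflect n x y) * kern n (\<lambda>_. bump k) x (reflect n x y) = f (reflect n x y) * bump_kernel n k y" for y
    by (simp add: kern_def bump_kernel_def)
  have int: "integrable (leb n) (\<lambda>y. f y * kern n (\<lambda>_. bump k) x y)" by (rule kern_integrable[OF f]) (simp add: compact_smooth_bump)
  then have m: "(\<lambda>y. f y * kern n (\<lambda>_. bump k) x y) \<in> borel_measurable (leb n)" by auto
  show "mollify n k f x = (LINT y|leb n. f (reflect n x y) * bump_kernel n k y)"
    unfolding mollify_def conv_def using integral_reflect[OF m, of x] by (simp add: e)
  show "integrable (leb n) (\<lambda>y. f (reflect n x y) * bump_kernel n k y)"
    using integrable_distr[OF measurable_reflect, of n x "\<lambda>y. f y * kern n (\<lambda>_. bump k) x y"] int unfolding distr_reflect e .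
qed

section \<open>Convergence of mollifications in Lebesgue norms\<close>

lemma powr_superadd:
  fixes x y q :: real
  assumes "x \<ge> 0" "y \<ge> 0" "q \<ge> 1"
  shows "x powr q + y powr q \<le> (x + y) powr q"
proof (cases "x + y = 0")
  case False
  define s where "s = x + y"
  have s: "s > 0" using False assms by (simp add: s_def)
  have small: "c powr q \<le> c" if "0 \<le> c" "c \<le> 1" for c
    using powr_mono'[of 1 q c] that assms by simp
  have "x powr q + y powr q = s powr q * ((x / s) powr q + (y / s) powr q)"
    using s assms by (simp add: powr_divide field_simps)
  also have "\<dots> \<le> s powr q * (x / s + y / s)"
    using s assms by (intro mult_left_mono add_mono small) (auto simp: s_def)
  also have "x / s + y / s = 1" using s by (simp add: s_def add_divide_distrib[symmetric])
  finally show ?thesis by (simp add: s_def)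
next
  case True
  then have "x = 0" "y = 0" using assms by linarith+
  then show ?thesis by simp
qed

text \<open>Mollification converges in \<open>L\<^sup>q\<close> because \<open>signed_powr q \<circ> f\<close> is integrable and its translates
  are continuous in \<open>L\<^sup>1\<close>; the next lemma passes from there to \<open>f\<close>.\<close>

definition signed_powr :: "real \<Rightarrow> real \<Rightarrow> real" where "signed_powr q a = sgn a * \<bar>a\<bar> powr q"

lemma abs_diff_powr_le:
  assumes "q \<ge> 1"
  shows "\<bar>a - b\<bar> powr q \<le> 2 powr q * \<bar>signed_powr q a - signed_powr q b\<bar>"
proof -
  have same: "(s - t) powr q \<le> 2 powr q * \<bar>s powr q - t powr q\<bar>" if "s \<ge> t" "t \<ge> 0" for s t
  proof -
    have "(s - t) powr q + t powr q \<le> s powr q" using powr_superadd[of "s - t" t q] that assms by simp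
    moreover have "(1::real) \<le> 2 powr q" using assms by (simp add: ge_one_powr_ge_zero)
    moreover have "(s - t) powr q \<ge> 0" by simp
    ultimately have "(s - t) powr q \<le> s powr q - t powr q" by (simp add: le_diff_eq)
    also have "\<dots> \<le> 1 * \<bar>s powr q - t powr q\<bar>" by simp
    also have "\<dots> \<le> 2 powr q * \<bar>s powr q - t powr q\<bar>" using \<open>1 \<le> 2 powr q\<close> by (intro mult_right_mono) auto
    finally show ?thesis .
  qed
  have opp: "(s + t) powr q \<le> 2 powr q * (s powr q + t powr q)" if "s \<ge> 0" "t \<ge> 0" for s t
  proof -
    have "(s + t) powr q \<le> (2 * max s t) powr q" using that assms by (intro powr_mono2) auto
    also have "\<dots> = 2 powr q * max s t powr q" using that by (simp add: powr_mult)
    also have "max s t powr q \<le> s powr q + t powr q" by (simp add: max_def)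
    finally show ?thesis by simp
  qed
  \<comment> \<open>Equal signs lead to \<open>same\<close>, opposite signs to \<open>opp\<close>,
    up to negation and exchange of \<open>a\<close> and \<open>b\<close>.\<close>
  consider "a \<ge> b" "b \<ge> 0" | "b \<ge> a" "a \<ge> 0" | "a \<le> b" "b \<le> 0" | "b \<le> a" "a \<le> 0" | "a \<ge> 0" "b \<le> 0" | "a \<le> 0" "b \<ge> 0"
    by linarith
  then show ?thesis
  proof cases
    case 1 then show ?thesis using same[of b a] by (auto simp: signed_powr_def sgn_if)
  next
    case 2 then show ?thesis using same[of a b] by (auto simp: signed_powr_def sgn_if abs_minus_commute)
  next
    case 3 then show ?thesis using same[of "-b" "-a"] by (auto simp: signed_powr_def sgn_if abs_minus_commute)
  next
    case 4 then show ?thesis using same[of "-a" "-b"] by (auto simp: signed_powr_def sgn_if abs_minus_commute)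
  next
    case 5 then show ?thesis using opp[of a "-b"] by (auto simp: signed_powr_def sgn_if)
  next
    case 6 then show ?thesis using opp[of "-a" b] by (auto simp: signed_powr_def sgn_if abs_minus_commute add.commute)
  qed
qed

text \<open>The graph of the power lies above its tangent at \<open>c\<close>, which is the bound
  \<open>pw\<close>; integrated against a density of mass one it yields \<open>a \<le> c\<close>
  whenever \<open>c powr q\<close> exceeds the integral on the right. The integrals are nonnegative
  ones, so integrability of \<open>g\<close> is no issue.\<close>

lemma Jensen_powr:
  assumes q: "q \<ge> 1" and [measurable]: "g \<in> borel_measurable M" "\<eta> \<in> borel_measurable M"
    and nn: "\<And>y. g y \<ge> 0" "\<And>y. \<eta> y \<ge> (0::real)" and one: "(\<integral>\<^sup>+y. ennreal (\<eta> y) \<partial>M) = 1"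
    and a: "a \<ge> 0" "ennreal a \<le> (\<integral>\<^sup>+y. ennreal (g y * \<eta> y) \<partial>M)"
  shows "ennreal (a powr q) \<le> (\<integral>\<^sup>+y. ennreal (g y powr q * \<eta> y) \<partial>M)"
proof (cases "\<integral>\<^sup>+y. ennreal (g y powr q * \<eta> y) \<partial>M")
  case (real j)
  have "a powr q \<le> j + e" if e: "e > 0" for e
  proof -
    define c where "c = (j + e) powr (1 / q)"
    have c: "c > 0" "c powr q = j + e" using real e q by (simp_all add: c_def powr_powr)
    have pw: "t \<le> c * (t powr q / (q * c powr q) + (1 - 1 / q))" if "t \<ge> 0" for t
    proof (cases "q = 1")
      case True
      then show ?thesis using c that by simp
    next
      case False
      define q' where "q' = q / (q - 1)"
      have "q' > 1" "1 / q + 1 / q' = 1" using False q by (auto simp: q'_def field_simps)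
      then have "t / c * 1 \<le> (t / c) powr q / q + 1 powr q' / q'"
        using Youngs_inequality[of q q' "t / c" 1] False q that c by auto
      moreover have "1 / q' = 1 - 1 / q" using \<open>1 / q + 1 / q' = 1\<close> by simp
      ultimately have "t / c \<le> t powr q / (q * c powr q) + (1 - 1 / q)"
        using that c by (simp add: powr_divide mult.commute)
      then show ?thesis using c by (simp add: divide_le_eq mult.commute)
    qed
    define A where "A = c / (q * c powr q)"
    define B where "B = c * (1 - 1 / q)"
    have AB: "A \<ge> 0" "B \<ge> 0" using c(1) q by (simp_all add: A_def B_def)
    have "ennreal a \<le> (\<integral>\<^sup>+y. ennreal A * ennreal (g y powr q * \<eta> y) + ennreal B * ennreal (\<eta> y) \<partial>M)"
    proof (rule order_trans[OF a(2)], rule nn_integral_mono)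
      fix y
      have "g y * \<eta> y \<le> (A * g y powr q + B) * \<eta> y"
        using pw[OF nn(1)[of y]] nn(2)[of y] by (intro mult_right_mono) (simp_all add: A_def B_def distrib_left)
      then have "g y * \<eta> y \<le> A * (g y powr q * \<eta> y) + B * \<eta> y" by (simp add: algebra_simps)
      then show "ennreal (g y * \<eta> y) \<le> ennreal A * ennreal (g y powr q * \<eta> y) + ennreal B * ennreal (\<eta> y)"
        using AB nn(2)[of y] by (simp add: ennreal_mult[symmetric] ennreal_plus[symmetric] ennreal_leI del: ennreal_plus)
    qed
    also have "\<dots> = ennreal A * ennreal j + ennreal B"
      by (subst nn_integral_add) (auto simp: nn_integral_cmult real one)
    also have "\<dots> = ennreal (A * j + B)" using AB real by (simp add: ennreal_mult[symmetric] ennreal_plus[symmetric] del: ennreal_plus)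
    finally have "a \<le> A * j + B" using AB real by (simp add: ennreal_le_iff del: ennreal_plus)
    also have "\<dots> \<le> A * c powr q + B" using AB c(2) e by (intro add_right_mono mult_left_mono) auto
    also have "\<dots> = c" using c(1) q by (simp add: A_def B_def field_simps)
    finally have "a powr q \<le> c powr q" using a q by (intro powr_mono2) auto
    then show ?thesis using c by simp
  qed
  then have "a powr q \<le> j" by (rule field_le_epsilon)
  then show ?thesis using real by (simp add: ennreal_leI)
qed simp

text \<open>Jensen's inequality at each \<open>x\<close>, then Tonelli: the error is at most an
  average, over the small translations \<open>y\<close>, of the distance of \<open>f\<close> from
  its translates.\<close>

lemma mollify_powr_integral_le:
  assumes q: "q \<ge> 1" and f: "integrable (leb n) f"
  shows "powr_integral n q UNIV (\<lambda>x. mollify n k f x - f x) \<le>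
    (\<integral>\<^sup>+y. (\<integral>\<^sup>+x. ennreal (\<bar>f (reflect n x y) - f x\<bar> powr q) \<partial>leb n) * ennreal (bump_kernel n k y) \<partial>leb n)"
proof -
  have fm[measurable]: "f \<in> borel_measurable (leb n)" using f by auto
  have bi: "integrable (leb n) (bump_kernel n k)"
    by (rule integrableI_nonneg) (auto simp: bump_kernel_nonneg bump_kernel_integral)
  have b1: "(LINT y|leb n. bump_kernel n k y) = 1"
    by (subst integral_eq_nn_integral) (auto simp: bump_kernel_nonneg bump_kernel_integral)
  have pt: "ennreal (\<bar>mollify n k f x - f x\<bar> powr q) \<le> (\<integral>\<^sup>+y. ennreal (\<bar>f (reflect n x y) - f x\<bar> powr q * bump_kernel n k y) \<partial>leb n)" for x
  proof (rule Jensen_powr[OF q])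
    have "mollify n k f x - f x = (LINT y|leb n. f (reflect n x y) * bump_kernel n k y - f x * bump_kernel n k y)"
      using mollify_eq[OF f] bi b1 by (subst Bochner_Integration.integral_diff) auto
    also have "ennreal (norm \<dots>) \<le> (\<integral>\<^sup>+y. norm (f (reflect n x y) * bump_kernel n k y - f x * bump_kernel n k y) \<partial>leb n)"
      by (rule integral_norm_bound_ennreal) (use mollify_eq(2)[OF f] bi in auto)
    also have "\<dots> = (\<integral>\<^sup>+y. ennreal (\<bar>f (reflect n x y) - f x\<bar> * bump_kernel n k y) \<partial>leb n)"
      by (rule nn_integral_cong) (simp add: left_diff_distrib[symmetric] abs_mult bump_kernel_nonneg)
    finally show "ennreal \<bar>mollify n k f x - f x\<bar> \<le> (\<integral>\<^sup>+y. ennreal (\<bar>f (reflect n x y) - f x\<bar> * bump_kernel n k y) \<partial>leb n)" by simp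
  qed (auto simp: bump_kernel_nonneg bump_kernel_integral)
  have "powr_integral n q UNIV (\<lambda>x. mollify n k f x - f x) \<le> (\<integral>\<^sup>+x. (\<integral>\<^sup>+y. ennreal (\<bar>f (reflect n x y) - f x\<bar> powr q * bump_kernel n k y) \<partial>leb n) \<partial>leb n)"
    using pt by (intro nn_integral_mono) simp
  also have "\<dots> = (\<integral>\<^sup>+y. (\<integral>\<^sup>+x. ennreal (\<bar>f (reflect n x y) - f x\<bar> powr q * bump_kernel n k y) \<partial>leb n) \<partial>leb n)"
  proof (rule pair_sigma_finite.Fubini'[OF pair_sigma_finite_leb, symmetric])
    show "(\<lambda>(x, y). ennreal (\<bar>f (reflect n x y) - f x\<bar> powr q * bump_kernel n k y)) \<in> borel_measurable (leb n \<Otimes>\<^sub>M leb n)"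
      unfolding split_beta by measurable
  qed
  also have "\<dots> = (\<integral>\<^sup>+y. (\<integral>\<^sup>+x. ennreal (\<bar>f (reflect n x y) - f x\<bar> powr q) \<partial>leb n) * ennreal (bump_kernel n k y) \<partial>leb n)"
    by (rule nn_integral_cong) (simp add: ennreal_mult bump_kernel_nonneg nn_integral_multc)
  finally show ?thesis .
qed

lemma mollify_tendsto:
  assumes q: "q \<ge> 1" and f: "integrable (leb n) f" and fq: "eLnorm n q UNIV f < \<infinity>"
  shows "(\<lambda>k. eLnorm n q UNIV (\<lambda>x. mollify n k f x - f x)) \<longlonglongrightarrow> 0"
proof (subst eLnorm_tendsto_0_iff, goal_cases)
  case 2
  have fm[measurable]: "f \<in> borel_measurable (leb n)" using f by auto
  have sm[measurable]: "signed_powr q \<in> borel_measurable borel" unfolding signed_powr_def[abs_def] by measurable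
  have "integrable (leb n) (\<lambda>x. signed_powr q (f x))"
  proof (rule integrableI_bounded)
    have "(\<integral>\<^sup>+x. ennreal (norm (signed_powr q (f x))) \<partial>leb n) = powr_integral n q UNIV f"
      by (rule nn_integral_cong) (auto simp: signed_powr_def abs_mult sgn_if)
    then show "(\<integral>\<^sup>+x. ennreal (norm (signed_powr q (f x))) \<partial>leb n) < \<infinity>" using fq unfolding eLnorm_finite_iff by simp
  qed simp
  then have tc: "shift_continuous n (\<lambda>x. signed_powr q (f x))" by (rule shift_continuous_integrable)
  show ?case
  proof (rule tendsto_zero_ennreal)
    fix e :: real assume e: "e > 0"
    \<comment> \<open>\<open>2 powr q\<close> is the loss in \<open>abs_diff_powr_le\<close>; the
      factor one half makes the final inequality strict.\<close>
    define \<delta> where "\<delta> = e / 2 / 2 powr q"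
    have d: "\<delta> > 0" using e by (simp add: \<delta>_def)
    obtain \<epsilon> where ep: "\<epsilon> > 0" "\<And>y. y \<in> pts n \<Longrightarrow> (\<And>i. i < n \<Longrightarrow> \<bar>y i\<bar> \<le> \<epsilon>) \<Longrightarrow>
      (\<integral>\<^sup>+x. ennreal \<bar>signed_powr q (f (reflect n x y)) - signed_powr q (f x)\<bar> \<partial>leb n) \<le> ennreal \<delta>"
      using shift_continuousD[OF tc d] by blast
    obtain N :: nat where N: "1 / \<epsilon> < real N" using reals_Archimedean2 by blast
    have "powr_integral n q UNIV (\<lambda>x. mollify n k f x - f x) < ennreal e" if k: "k \<ge> N" for k
    proof -
      have ke: "1 / (real k + 1) \<le> \<epsilon>"
      proof -
        have "1 / \<epsilon> \<le> real k + 1" using N k by linarith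
        then show ?thesis using ep(1) by (simp add: field_simps)
      qed
      have "powr_integral n q UNIV (\<lambda>x. mollify n k f x - f x) \<le>
        (\<integral>\<^sup>+y. (\<integral>\<^sup>+x. ennreal (\<bar>f (reflect n x y) - f x\<bar> powr q) \<partial>leb n) * ennreal (bump_kernel n k y) \<partial>leb n)"
        by (rule mollify_powr_integral_le[OF q f])
      also have "\<dots> \<le> (\<integral>\<^sup>+y. ennreal (e / 2) * ennreal (bump_kernel n k y) \<partial>leb n)"
      proof (rule nn_integral_mono)
        fix y assume y: "y \<in> space (leb n)"
        show "(\<integral>\<^sup>+x. ennreal (\<bar>f (reflect n x y) - f x\<bar> powr q) \<partial>leb n) * ennreal (bump_kernel n k y) \<le> ennreal (e / 2) * ennreal (bump_kernel n k y)"
        proof (cases "\<exists>i<n. \<bar>y i\<bar> \<ge> 1 / (real k + 1)")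
          case True
          then show ?thesis by (simp add: bump_kernel_support)
        next
          case False
          have yi: "\<bar>y i\<bar> \<le> \<epsilon>" if "i < n" for i using False ke that by fastforce
          have "(\<integral>\<^sup>+x. ennreal (\<bar>f (reflect n x y) - f x\<bar> powr q) \<partial>leb n) \<le> (\<integral>\<^sup>+x. ennreal (2 powr q) * ennreal \<bar>signed_powr q (f (reflect n x y)) - signed_powr q (f x)\<bar> \<partial>leb n)"
            using abs_diff_powr_le[OF q] by (intro nn_integral_mono) (simp add: ennreal_mult[symmetric] ennreal_leI)
          also have "\<dots> = ennreal (2 powr q) * (\<integral>\<^sup>+x. ennreal \<bar>signed_powr q (f (reflect n x y)) - signed_powr q (f x)\<bar> \<partial>leb n)"
            by (rule nn_integral_cmult) measurable
          also have "\<dots> \<le> ennreal (2 powr q) * ennreal \<delta>"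
            using y by (intro mult_left_mono ep(2) yi) auto
          also have "\<dots> = ennreal (2 powr q * \<delta>)" using d by (simp add: ennreal_mult)
          also have "2 powr q * \<delta> = e / 2" by (simp add: \<delta>_def)
          finally show ?thesis by (intro mult_right_mono) auto
        qed
      qed
      also have "\<dots> = ennreal (e / 2)" by (simp add: nn_integral_cmult bump_kernel_integral)
      also have "\<dots> < ennreal e" using e by (simp add: ennreal_less_iff)
      finally show ?thesis .
    qed
    then show "\<forall>\<^sub>F k in sequentially. powr_integral n q UNIV (\<lambda>x. mollify n k f x - f x) < ennreal e"
      by (auto simp: eventually_sequentially)
  qed
qed (use q in auto)

section \<open>Uniqueness of weak derivatives\<close>

lemma continuous_compact_bounded:
  assumes "continuous_map (euc n) euclideanreal f" "compactin (euc n) K"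
  shows "\<exists>C>0. \<forall>x\<in>K. \<bar>f x\<bar> \<le> C"
proof -
  have "compactin euclideanreal (f ` K)" by (rule image_compactin[OF assms(2,1)])
  then have "bounded (f ` K)" by (simp add: compact_imp_bounded)
  then obtain C where "\<forall>y\<in>f ` K. norm y \<le> C" unfolding bounded_iff by blast
  then show ?thesis by (intro exI[of _ "max 1 C"]) (auto simp: le_max_iff_disj)
qed

lemma test_funE:
  assumes "\<phi> \<in> test_fun n \<Omega>"
  obtains K where "smooth n \<phi>" "compactin (euc n) K" "K \<subseteq> \<Omega>" "\<And>x. x \<in> pts n \<Longrightarrow> x \<notin> K \<Longrightarrow> \<phi> x = 0"
  using assms unfolding test_fun_def by blast

lemma test_fun_bounded:
  assumes "\<phi> \<in> test_fun n \<Omega>"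
  shows "\<exists>C>0. \<forall>x\<in>pts n. \<bar>\<phi> x\<bar> \<le> C"
proof -
  obtain K where K: "smooth n \<phi>" "compactin (euc n) K" "\<And>x. x \<in> pts n \<Longrightarrow> x \<notin> K \<Longrightarrow> \<phi> x = 0"
    using test_funE[OF assms] by metis
  obtain C where C: "C > 0" "\<And>x. x \<in> K \<Longrightarrow> \<bar>\<phi> x\<bar> \<le> C"
    using continuous_compact_bounded[OF smooth_basic(1)[OF K(1)] K(2)] by blast
  have "\<bar>\<phi> x\<bar> \<le> C" if "x \<in> pts n" for x using K(3)[OF that] C by (cases "x \<in> K") auto
  then show ?thesis using C(1) by blast
qed

lemma test_fun_pts: "\<phi> \<in> test_fun n \<Omega> \<Longrightarrow> \<phi> \<in> test_fun n (pts n)"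
  unfolding test_fun_def using compactin_subset_topspace[of "euc n"] by (fastforce)

lemma test_mult_integrable:
  assumes g: "loc_integrable n \<Omega> g" and \<phi>: "\<phi> \<in> test_fun n \<Omega>"
  shows "set_integrable (leb n) \<Omega> (\<lambda>x. g x * \<phi> x)"
proof -
  obtain K where K: "smooth n \<phi>" "compactin (euc n) K" "K \<subseteq> \<Omega>" "\<And>x. x \<in> pts n \<Longrightarrow> x \<notin> K \<Longrightarrow> \<phi> x = 0"
    using test_funE[OF \<phi>] by metis
  obtain C where C: "C > 0" "\<And>x. x \<in> pts n \<Longrightarrow> \<bar>\<phi> x\<bar> \<le> C" using test_fun_bounded[OF \<phi>] by blast
  have m: "(\<lambda>x. indicator K x * g x) \<in> borel_measurable (leb n)" "integrable (leb n) (\<lambda>x. indicator K x * g x)"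
    using loc_integrable_indicator[OF g K(2,3)] by auto
  have "integrable (leb n) (\<lambda>x. (indicator K x * g x) * \<phi> x)"
  proof (rule Bochner_Integration.integrable_bound)
    show "integrable (leb n) (\<lambda>x. C * (indicator K x * g x))" using m(2) by simp
    show "(\<lambda>x. (indicator K x * g x) * \<phi> x) \<in> borel_measurable (leb n)"
      by (rule borel_measurable_times[OF m(1) smooth_measurable[OF K(1)]])
    show "AE x in leb n. norm ((indicator K x * g x) * \<phi> x) \<le> norm (C * (indicator K x * g x))"
    proof (rule AE_I2)
      fix x assume "x \<in> space (leb n)"
      then have "\<bar>\<phi> x\<bar> * \<bar>indicator K x * g x\<bar> \<le> C * \<bar>indicator K x * g x\<bar>" using C(2)[of x] by (intro mult_right_mono) auto
      then show "norm ((indicator K x * g x) * \<phi> x) \<le> norm (C * (indicator K x * g x))"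
        using C(1) by (simp add: abs_mult mult_ac)
    qed
  qed
  then show ?thesis unfolding set_integrable_def
    by (rule Bochner_Integration.integrable_cong[THEN iffD1, rotated 2])
      (use K(3,4) in \<open>auto simp: indicator_def\<close>)
qed

text \<open>At a point inside a cube the mollification of \<open>g\<close> is its integral against a
  kernel that is a test function, and so vanishes once the scale is small; along a subsequence it
  converges to \<open>g\<close> almost everywhere. Countably many cubes suffice.\<close>

lemma AE_zero_of_test:
  assumes \<Omega>: "openin (euc n) \<Omega>" and g: "loc_integrable n \<Omega> g"
    and z: "\<And>\<phi>. \<phi> \<in> test_fun n \<Omega> \<Longrightarrow> (LINT x:\<Omega>|leb n. g x * \<phi> x) = 0"
  shows "AE x in leb n. x \<in> \<Omega> \<longrightarrow> g x = 0"
proof -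
  obtain C where C: "countable C" "\<forall>(a, m)\<in>C. closed_box n a m \<subseteq> \<Omega>" "\<Omega> = (\<Union>(a, m)\<in>C. open_box n a m)"
    using openin_countable_cover[OF \<Omega>] by blast
  have "AE x in leb n. x \<in> open_box n a m \<longrightarrow> g x = 0" if am: "(a, m) \<in> C" for a m
  proof -
    let ?K = "closed_box n a m"
    have K: "?K \<subseteq> \<Omega>" using C(2) am by auto
    define f where "f x = indicator ?K x * g x" for x
    have f: "integrable (leb n) f" unfolding f_def[abs_def] by (rule loc_integrable_indicator[OF g compactin_closed_box K])
    have fm[measurable]: "f \<in> borel_measurable (leb n)" using f by auto
    have [measurable]: "mollify n k f \<in> borel_measurable (leb n)" for k by (rule smooth_measurable[OF smooth_mollify[OF f]])
    have "eLnorm n 1 UNIV f < \<infinity>" unfolding eLnorm_finite_iff using f by (simp add: integrable_iff_bounded)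
    then have L: "(\<lambda>k. eLnorm n 1 UNIV (\<lambda>x. mollify n k f x - f x)) \<longlonglongrightarrow> 0" by (intro mollify_tendsto f) auto
    have "\<exists>r::nat\<Rightarrow>nat. strict_mono r \<and> (AE x in leb n. x \<in> space (leb n) \<longrightarrow> (\<lambda>k. mollify n (r k) f x) \<longlonglongrightarrow> f x)"
    proof (rule eLnorm_AE_subseq)
      show "(\<lambda>k. eLnorm n 1 (space (leb n)) (\<lambda>x. mollify n k f x - f x)) \<longlonglongrightarrow> 0" using L by (simp add: eLnorm_pts)
    qed auto
    then obtain r :: "nat \<Rightarrow> nat" where r: "strict_mono r" "AE x in leb n. x \<in> space (leb n) \<longrightarrow> (\<lambda>k. mollify n (r k) f x) \<longlonglongrightarrow> f x" by blast
    show ?thesis using r(2)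
    proof (rule AE_mp, intro AE_I2 impI)
      fix x assume x: "x \<in> space (leb n)" "x \<in> space (leb n) \<longrightarrow> (\<lambda>k. mollify n (r k) f x) \<longlonglongrightarrow> f x" "x \<in> open_box n a m"
      \<comment> \<open>Coordinate distance of \<open>x\<close> to the faces of the cube, capped by
        \<open>1\<close> so that the minimum exists for \<open>n = 0\<close>.\<close>
      define d where "d = Min (insert 1 ((\<lambda>i. m - \<bar>x i - a i\<bar>) ` {..<n}))"
      have d: "d > 0" "\<And>i. i < n \<Longrightarrow> d \<le> m - \<bar>x i - a i\<bar>" using x(3) by (auto simp: d_def open_box_iff)
      obtain N :: nat where N: "1 / d < real N" using reals_Archimedean2 by blast
      have "mollify n (r k) f x = 0" if k: "k \<ge> N" for k
      proof -
        let ?e = "1 / (real (r k) + 1)"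
        have "real k \<le> real (r k)" using seq_suble[OF r(1), of k] by simp
        then have "1 / d < real (r k) + 1" using N k by linarith
        then have e: "?e < d" using d(1) by (simp add: field_simps)
        have sub: "closed_box n x ?e \<subseteq> ?K"
        proof
          fix y assume y: "y \<in> closed_box n x ?e"
          have "\<bar>y i - a i\<bar> \<le> m" if i: "i < n" for i
          proof -
            have "\<bar>y i - x i\<bar> \<le> ?e" using y i by (auto simp: closed_box_iff)
            then show ?thesis using d(2)[OF i] e by linarith
          qed
          then show "y \<in> ?K" using y by (auto simp: closed_box_iff)
        qed
        have s: "bump (r k) t = 0" if "i < n" "\<bar>t\<bar> \<ge> ?e" for i t using bump(3) that by blast
        have "mollify n (r k) f x = (LINT y:\<Omega>|leb n. g y * kern n (\<lambda>_. bump (r k)) x y)"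
          unfolding mollify_def f_def[abs_def]
          by (rule set_integral_kern[of n ?e "\<lambda>_. bump (r k)", OF s sub K, symmetric])
        also have "\<dots> = 0"
        proof (rule z, rule kern_test_fun[of _ _ ?e])
          show "closed_box n x ?e \<subseteq> \<Omega>" using sub K by blast
        qed (use s compact_smooth_bump in auto)
        finally show ?thesis .
      qed
      then have "(\<lambda>k. mollify n (r k) f x) \<longlonglongrightarrow> 0" by (intro tendsto_eventually) (auto simp: eventually_sequentially)
      moreover have "(\<lambda>k. mollify n (r k) f x) \<longlonglongrightarrow> f x" using x by blast
      ultimately have "f x = 0" using LIMSEQ_unique by blast
      moreover have "x \<in> ?K" using x(3) by (auto simp: open_box_iff closed_box_iff less_imp_le)
      ultimately show "g x = 0" by (simp add: f_def)
    qed
  qed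
  then have "AE x in leb n. \<forall>p\<in>C. x \<in> open_box n (fst p) (snd p) \<longrightarrow> g x = 0"
    using C(1) by (subst AE_ball_countable) auto
  then show ?thesis
    by eventually_elim (unfold C(3), force)
qed

lemma has_weak_deriv_unique:
  assumes \<Omega>: "openin (euc n) \<Omega>" and g: "has_weak_deriv n \<Omega> is f g" and h: "has_weak_deriv n \<Omega> is f h"
  shows "AE x in leb n. x \<in> \<Omega> \<longrightarrow> g x = h x"
proof -
  have gl: "loc_integrable n \<Omega> g" and hl: "loc_integrable n \<Omega> h" using g h by (auto simp: has_weak_deriv_def)
  have "AE x in leb n. x \<in> \<Omega> \<longrightarrow> g x - h x = 0"
  proof (rule AE_zero_of_test[OF \<Omega>])
    show "loc_integrable n \<Omega> (\<lambda>x. g x - h x)"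
      using gl hl unfolding loc_integrable_def set_borel_measurable_def set_integrable_def by (auto simp: right_diff_distrib intro: borel_measurable_diff)
    fix \<phi> assume \<phi>: "\<phi> \<in> test_fun n \<Omega>"
    have "(LINT x:\<Omega>|leb n. (g x - h x) * \<phi> x) = (LINT x:\<Omega>|leb n. g x * \<phi> x) - (LINT x:\<Omega>|leb n. h x * \<phi> x)"
      using set_integral_diff(2)[OF test_mult_integrable[OF gl \<phi>] test_mult_integrable[OF hl \<phi>]]
      by (simp add: left_diff_distrib)
    moreover have "(LINT x:\<Omega>|leb n. f x * iter_pderiv is \<phi> x) = (-1) ^ length is * (LINT x:\<Omega>|leb n. g x * \<phi> x)"
      using g \<phi> unfolding has_weak_deriv_def by blast
    moreover have "(LINT x:\<Omega>|leb n. f x * iter_pderiv is \<phi> x) = (-1) ^ length is * (LINT x:\<Omega>|leb n. h x * \<phi> x)"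
      using h \<phi> unfolding has_weak_deriv_def by blast
    ultimately show "(LINT x:\<Omega>|leb n. (g x - h x) * \<phi> x) = 0" by simp
  qed
  then show ?thesis by simp
qed

section \<open>Test functions and the Carleman inequality\<close>

lemma test_fun_mult:
  assumes "smooth n f" "\<phi> \<in> test_fun n \<Omega>"
  shows "(\<lambda>x. f x * \<phi> x) \<in> test_fun n \<Omega>" "(\<lambda>x. \<phi> x * f x) \<in> test_fun n \<Omega>"
proof -
  obtain K where K: "smooth n \<phi>" "compactin (euc n) K" "K \<subseteq> \<Omega>" "\<And>x. x \<in> pts n \<Longrightarrow> x \<notin> K \<Longrightarrow> \<phi> x = 0"
    using test_funE[OF assms(2)] by metis
  have "smooth n (\<lambda>x. f x * \<phi> x)" "smooth n (\<lambda>x. \<phi> x * f x)" using K(1) assms(1) by (auto intro: smooth_mult)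
  then show "(\<lambda>x. f x * \<phi> x) \<in> test_fun n \<Omega>" "(\<lambda>x. \<phi> x * f x) \<in> test_fun n \<Omega>"
    unfolding test_fun_def using K(2-4) by (auto intro!: exI[of _ K])
qed

lemma pderiv_zero_outside:
  assumes K: "compactin (euc n) K" and z: "\<And>x. x \<in> pts n \<Longrightarrow> x \<notin> K \<Longrightarrow> f x = 0"
    and i: "i < n" and x: "x \<in> pts n" "x \<notin> K"
  shows "pderiv_at i f x = 0"
proof (rule has_pd_eq)
  have "closedin (euc n) K" by (rule compactin_imp_closedin[OF Hausdorff_euc K])
  then have "openin (euc n) (pts n - K)" by (simp add: closedin_def)
  then obtain e where e: "e > 0" "open_box n x e \<subseteq> pts n - K" using x unfolding openin_euc_iff by blast
  have ev: "\<forall>\<^sub>F t in nhds (x i). f (x(i := t)) = 0"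
  proof -
    have "\<forall>\<^sub>F t in nhds (x i). t \<in> {x i - e<..<x i + e}" by (rule eventually_nhds_in_open) (use e in auto)
    then show ?thesis
    proof eventually_elim
      case (elim t)
      have "x(i := t) \<in> open_box n x e"
        unfolding open_box_iff using elim e(1) upd_in_pts[OF x(1) i, of t] by (auto simp: abs_less_iff)
      then show ?case using e(2) z by blast
    qed
  qed
  have "has_pd i f x 0 \<longleftrightarrow> ((\<lambda>t. 0) has_real_derivative 0) (at (x i))"
    by (rule DERIV_cong_ev[OF refl ev refl])
  then show "has_pd i f x 0" by simp
qed

lemma test_fun_pderiv:
  assumes "\<phi> \<in> test_fun n \<Omega>" "i < n"
  shows "pderiv_at i \<phi> \<in> test_fun n \<Omega>"
proof -
  obtain K where K: "smooth n \<phi>" "compactin (euc n) K" "K \<subseteq> \<Omega>" "\<And>x. x \<in> pts n \<Longrightarrow> x \<notin> K \<Longrightarrow> \<phi> x = 0"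
    using test_funE[OF assms(1)] by metis
  have "\<forall>x\<in>pts n - K. pderiv_at i \<phi> x = 0"
    using pderiv_zero_outside[OF K(2,4) assms(2)] by auto
  then show ?thesis unfolding test_fun_def using smooth_pderiv[OF K(1) assms(2)] K(2,3) by blast
qed

lemma test_fun_iter_pderiv: "\<phi> \<in> test_fun n \<Omega> \<Longrightarrow> set is \<subseteq> {..<n} \<Longrightarrow> iter_pderiv is \<phi> \<in> test_fun n \<Omega>"
  by (induction "is") (auto intro: test_fun_pderiv)

lemma smooth_iter_pderiv: "smooth n f \<Longrightarrow> set is \<subseteq> {..<n} \<Longrightarrow> smooth n (iter_pderiv is f)"
  by (induction "is") (auto intro: smooth_pderiv)

lemma test_fun_smooth: "\<phi> \<in> test_fun n \<Omega> \<Longrightarrow> smooth n \<phi>"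
  by (simp add: test_fun_def)

lemma test_fun_measurable: "\<phi> \<in> test_fun n \<Omega> \<Longrightarrow> \<phi> \<in> borel_measurable (leb n)"
  by (rule smooth_measurable[OF test_fun_smooth])

lemma smooth_loc_integrable:
  assumes f: "smooth n f" and \<Omega>: "openin (euc n) \<Omega>"
  shows "loc_integrable n \<Omega> f"
  unfolding loc_integrable_def
proof (intro conjI allI impI)
  have fm[measurable]: "f \<in> borel_measurable (leb n)" by (rule smooth_measurable[OF f])
  have [measurable]: "\<Omega> \<in> sets (leb n)" by (rule openin_sets[OF \<Omega>])
  show "set_borel_measurable (leb n) \<Omega> f" unfolding set_borel_measurable_def by measurable
  fix K assume K: "compactin (euc n) K \<and> K \<subseteq> \<Omega>"
  obtain C where C: "C > 0" "\<And>x. x \<in> K \<Longrightarrow> \<bar>f x\<bar> \<le> C"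
    using continuous_compact_bounded[OF smooth_basic(1)[OF f]] K by blast
  have [measurable]: "K \<in> sets (leb n)" using K compactin_sets by blast
  have "integrable (leb n) (\<lambda>x. indicator K x *\<^sub>R f x)"
  proof (rule Bochner_Integration.integrable_bound)
    show "integrable (leb n) (\<lambda>x. C * indicator K x)"
      using compactin_emeasure_finite[of n K] K by (intro integrable_mult_right integrable_real_indicator) auto
  qed (use C in \<open>auto intro!: AE_I2 simp: indicator_def\<close>)
  then show "set_integrable (leb n) K f" unfolding set_integrable_def .
qed

lemma test_fun_integrable:
  assumes "\<phi> \<in> test_fun n \<Omega>"
  shows "integrable (leb n) \<phi>"
proof -
  obtain K where K: "smooth n \<phi>" "compactin (euc n) K" "\<And>x. x \<in> pts n \<Longrightarrow> x \<notin> K \<Longrightarrow> \<phi> x = 0"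
    using test_funE[OF assms] by metis
  have "K \<subseteq> pts n" using compactin_subset_topspace[OF K(2)] by simp
  moreover have "openin (euc n) (pts n)" using openin_topspace[of "euc n"] by simp
  ultimately have "integrable (leb n) (\<lambda>y. indicator K y * \<phi> y)"
    using loc_integrable_indicator[OF smooth_loc_integrable[OF K(1)] K(2)] by blast
  then show ?thesis
    by (rule Bochner_Integration.integrable_cong[THEN iffD1, rotated 2]) (use K(3) in \<open>auto simp: indicator_def\<close>)
qed

section \<open>Integration by parts\<close>

lemma lebesgue_FTC:
  fixes F f :: "real \<Rightarrow> real"
  assumes "a \<le> b" "\<And>t. (F has_real_derivative f t) (at t)" "continuous_on {a..b} f"
  shows "(LINT t|lborel. indicator {a..b} t *\<^sub>R f t) = F b - F a"
proof (rule integral_FTC_atLeastAtMost[OF assms(1) _ assms(3)])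
  fix t
  show "(F has_vector_derivative f t) (at t within {a..b})"
    unfolding has_real_derivative_iff_has_vector_derivative[symmetric]
    by (rule has_field_derivative_at_within[OF assms(2)])
qed

text \<open>Fubini isolates the coordinate \<open>i\<close>, and on each line the fundamental
  theorem is applied to the interval from \<open>- m - 1\<close> to \<open>m + 1\<close>: the
  support lies between \<open>- m\<close> and \<open>m\<close>, so the boundary values
  vanish.\<close>

lemma integral_pderiv_test:
  assumes \<phi>: "\<phi> \<in> test_fun n \<Omega>" and i: "i < n"
  shows "(LINT x|leb n. pderiv_at i \<phi> x) = 0"
proof -
  obtain K where K: "smooth n \<phi>" "compactin (euc n) K" "\<And>x. x \<in> pts n \<Longrightarrow> x \<notin> K \<Longrightarrow> \<phi> x = 0"
    using test_funE[OF \<phi>] by metis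
  obtain m where m: "m > 0" "K \<subseteq> closed_box n (origin n) m" using compactin_bounded[OF K(2)] by blast
  have z: "\<phi> x = 0" if "x \<in> pts n" "\<bar>x i\<bar> > m" for x
    using K(3)[OF that(1)] m(2) that i by (fastforce simp: closed_box_iff)
  have e: "insert i ({..<n} - {i}) = {..<n}" using i by auto
  have int: "integrable (leb n) (pderiv_at i \<phi>)" by (rule test_fun_integrable[OF test_fun_pderiv[OF \<phi> i]])
  have "(LINT x|leb n. pderiv_at i \<phi> x) = (LINT x|Pi\<^sub>M ({..<n} - {i}) (\<lambda>_. lborel). (LINT t|lborel. pderiv_at i \<phi> (x(i := t))))"
    using leb.product_integral_insert[of "{..<n} - {i}" i "pderiv_at i \<phi>"] int unfolding e by simp
  also have "\<dots> = (LINT x|Pi\<^sub>M ({..<n} - {i}) (\<lambda>_. lborel :: real measure). 0)"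
  proof (rule Bochner_Integration.integral_cong[OF refl])
    fix x :: point assume x: "x \<in> space (Pi\<^sub>M ({..<n} - {i}) (\<lambda>_. lborel))"
    then have xp: "x(i := t) \<in> pts n" for t using i by (auto simp: space_PiM PiE_iff extensional_def)
    let ?F = "\<lambda>t. \<phi> (x(i := t))"
    let ?f = "\<lambda>t. pderiv_at i \<phi> (x(i := t))"
    have d: "(?F has_real_derivative ?f t) (at t)" for t
      using smooth_has_pd[OF K(1) i xp[of t]] by simp
    have "continuous_on {-m-1..m+1} ?f"
    proof (rule DERIV_continuous_on)
      fix t
      show "(?f has_real_derivative pderiv_at i (pderiv_at i \<phi>) (x(i := t))) (at t within {-m-1..m+1})"
        using smooth_has_pd[OF smooth_pderiv[OF K(1) i] i xp[of t]] by (auto intro: has_field_derivative_at_within)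
    qed
    then have "(LINT t|lborel. indicator {-m-1..m+1} t *\<^sub>R ?f t) = ?F (m+1) - ?F (-m-1)"
      by (intro lebesgue_FTC[OF _ d]) (use m(1) in auto)
    also have "\<dots> = 0" using z[OF xp[of "m+1"]] z[OF xp[of "-m-1"]] m(1) by simp
    also have "(LINT t|lborel. indicator {-m-1..m+1} t *\<^sub>R ?f t) = (LINT t|lborel. ?f t)"
    proof (rule Bochner_Integration.integral_cong[OF refl])
      fix t
      show "indicator {-m-1..m+1} t *\<^sub>R ?f t = ?f t"
      proof (cases "\<bar>t\<bar> \<le> m + 1")
        case False
        then have "x(i := t) \<notin> K" using m i by (fastforce simp: closed_box_iff)
        then have "?f t = 0" by (intro pderiv_zero_outside[OF K(2,3) i xp])
        then show ?thesis by simp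
      qed (auto simp: indicator_def abs_le_iff)
    qed
    finally show "(LINT t|lborel. ?f t) = 0" .
  qed
  finally show ?thesis by simp
qed

lemma integral_by_parts:
  assumes f: "smooth n f" and \<phi>: "\<phi> \<in> test_fun n \<Omega>" and i: "i < n"
  shows "(LINT x|leb n. f x * pderiv_at i \<phi> x) = - (LINT x|leb n. pderiv_at i f x * \<phi> x)"
proof -
  have "0 = (LINT x|leb n. pderiv_at i (\<lambda>x. f x * \<phi> x) x)"
    using integral_pderiv_test[OF test_fun_mult(1)[OF f \<phi>] i] by simp
  also have "\<dots> = (LINT x|leb n. pderiv_at i f x * \<phi> x + f x * pderiv_at i \<phi> x)"
    by (rule Bochner_Integration.integral_cong[OF refl]) (simp add: pderiv_mult[OF f test_fun_smooth[OF \<phi>] i])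
  also have "\<dots> = (LINT x|leb n. pderiv_at i f x * \<phi> x) + (LINT x|leb n. f x * pderiv_at i \<phi> x)"
    by (rule Bochner_Integration.integral_add)
      (rule test_fun_integrable[OF test_fun_mult(1)[OF smooth_pderiv[OF f i] \<phi>]], rule test_fun_integrable[OF test_fun_mult(1)[OF f test_fun_pderiv[OF \<phi> i]]])
  finally show ?thesis by simp
qed

text \<open>Derivatives are moved one by one, outermost first, hence in reversed order; symmetry of
  mixed derivatives is avoided. For the lists \<open>[i]\<close> and \<open>[i, i]\<close> the
  reversal is invisible.\<close>

lemma integral_by_parts_iter:
  assumes "smooth n f" "\<phi> \<in> test_fun n \<Omega>" "set is \<subseteq> {..<n}"
  shows "(LINT x|leb n. f x * iter_pderiv is \<phi> x) = (-1) ^ length is * (LINT x|leb n. iter_pderiv (rev is) f x * \<phi> x)"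
  using assms(1,3)
proof (induction "is" arbitrary: f)
  case (Cons i js)
  have "(LINT x|leb n. f x * pderiv_at i (iter_pderiv js \<phi>) x) = - (LINT x|leb n. pderiv_at i f x * iter_pderiv js \<phi> x)"
    by (rule integral_by_parts[OF Cons.prems(1) test_fun_iter_pderiv[OF assms(2)]]) (use Cons.prems in auto)
  also have "(LINT x|leb n. pderiv_at i f x * iter_pderiv js \<phi> x) = (-1) ^ length js * (LINT x|leb n. iter_pderiv (rev js) (pderiv_at i f) x * \<phi> x)"
    by (rule Cons.IH[OF smooth_pderiv[OF Cons.prems(1)]]) (use Cons.prems in auto)
  finally show ?case by (simp add: iter_pderiv_append)
qed simp

lemma smooth_has_weak_deriv:
  assumes f: "smooth n f" and \<Omega>: "openin (euc n) \<Omega>" and s: "set is \<subseteq> {..<n}"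
  shows "has_weak_deriv n \<Omega> is f (iter_pderiv (rev is) f)"
  unfolding has_weak_deriv_def
proof (intro conjI ballI)
  show "loc_integrable n \<Omega> f" by (rule smooth_loc_integrable[OF f \<Omega>])
  show "loc_integrable n \<Omega> (iter_pderiv (rev is) f)"
    by (rule smooth_loc_integrable[OF smooth_iter_pderiv[OF f] \<Omega>]) (use s in auto)
  fix \<phi> assume \<phi>: "\<phi> \<in> test_fun n \<Omega>"
  have e: "(LINT x:\<Omega>|leb n. h x * \<psi> x) = (LINT x|leb n. h x * \<psi> x)" if \<psi>: "\<psi> \<in> test_fun n \<Omega>" for h \<psi>
  proof -
    obtain K where K: "K \<subseteq> \<Omega>" "\<And>x. x \<in> pts n \<Longrightarrow> x \<notin> K \<Longrightarrow> \<psi> x = 0" using test_funE[OF \<psi>] by metis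
    show ?thesis unfolding set_lebesgue_integral_def
      by (rule Bochner_Integration.integral_cong[OF refl]) (use K in \<open>auto simp: indicator_def\<close>)
  qed
  show "(LINT x:\<Omega>|leb n. f x * iter_pderiv is \<phi> x) = (-1) ^ length is * (LINT x:\<Omega>|leb n. iter_pderiv (rev is) f x * \<phi> x)"
    unfolding e[OF \<phi>] e[OF test_fun_iter_pderiv[OF \<phi> s]] by (rule integral_by_parts_iter[OF f \<phi> s])
qed

lemma weak_deriv_smooth:
  assumes f: "smooth n f" and \<Omega>: "openin (euc n) \<Omega>" and s: "set is \<subseteq> {..<n}"
  shows "AE x in leb n. x \<in> \<Omega> \<longrightarrow> weak_deriv n \<Omega> is f x = iter_pderiv (rev is) f x"
proof (rule has_weak_deriv_unique[OF \<Omega>])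
  show "has_weak_deriv n \<Omega> is f (iter_pderiv (rev is) f)" by (rule smooth_has_weak_deriv[OF assms])
  then show "has_weak_deriv n \<Omega> is f (weak_deriv n \<Omega> is f)" unfolding weak_deriv_def by (rule someI[of "has_weak_deriv n \<Omega> is f"])
qed

section \<open>Test functions in Sobolev spaces and the Carleman inequality for them\<close>

lemma test_fun_eLnorm_finite:
  assumes \<phi>: "\<phi> \<in> test_fun n \<Omega>" and q: "q > 0"
  shows "eLnorm n q S \<phi> < \<infinity>"
proof -
  obtain K where K: "smooth n \<phi>" "compactin (euc n) K" "\<And>x. x \<in> pts n \<Longrightarrow> x \<notin> K \<Longrightarrow> \<phi> x = 0"
    using test_funE[OF \<phi>] by metis
  have [measurable]: "K \<in> sets (leb n)" using K compactin_sets by blast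
  obtain C where C: "C > 0" "\<And>x. x \<in> pts n \<Longrightarrow> \<bar>\<phi> x\<bar> \<le> C" using test_fun_bounded[OF \<phi>] by blast
  have "powr_integral n q S \<phi> \<le> (\<integral>\<^sup>+x. ennreal (C powr q) * indicator K x \<partial>leb n)"
    by (rule nn_integral_mono) (use K(3) C q in \<open>auto simp: indicator_def intro!: ennreal_leI powr_mono2\<close>)
  also have "\<dots> = ennreal (C powr q) * emeasure (leb n) K" by (simp add: nn_integral_cmult)
  also have "\<dots> < \<infinity>" using compactin_emeasure_finite[OF K(2)] by (simp add: ennreal_mult_less_top)
  finally show ?thesis unfolding eLnorm_finite_iff .
qed

lemma test_fun_Lspace:
  assumes \<phi>: "\<phi> \<in> test_fun n \<Omega>" and q: "q > 0" and S: "openin (euc n) S"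
  shows "\<phi> \<in> Lspace n q S"
  unfolding Lspace_def set_borel_measurable_def
  using test_fun_eLnorm_finite[OF \<phi> q] test_fun_measurable[OF \<phi>] openin_sets[OF S] by auto

lemma test_fun_sobolev:
  assumes \<phi>: "\<phi> \<in> test_fun n \<Omega>" and q: "q > 0" and S: "openin (euc n) S"
  shows "\<phi> \<in> sobolev n k q S"
  unfolding sobolev_def
proof (intro CollectI conjI allI impI test_fun_Lspace[OF \<phi> q S])
  fix js assume "set js \<subseteq> {..<n} \<and> length js \<le> k"
  then have "iter_pderiv (rev js) \<phi> \<in> Lspace n q S" "has_weak_deriv n S js \<phi> (iter_pderiv (rev js) \<phi>)"
    using test_fun_Lspace[OF test_fun_iter_pderiv[OF \<phi>] q S] smooth_has_weak_deriv[OF test_fun_smooth[OF \<phi>] S] by auto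
  then show "\<exists>g\<in>Lspace n q S. has_weak_deriv n S js \<phi> g" by blast
qed

lemma laplacian_test:
  assumes f: "smooth n f" and \<Omega>: "openin (euc n) \<Omega>"
  shows "AE x in leb n. x \<in> \<Omega> \<longrightarrow> laplacian n \<Omega> f x = lap n f x"
proof -
  have "AE x in leb n. \<forall>i\<in>{..<n}. x \<in> \<Omega> \<longrightarrow> weak_deriv n \<Omega> [i, i] f x = iter_pderiv (rev [i, i]) f x"
  proof (rule AE_finite_allI)
    fix i assume "i \<in> {..<n}"
    then show "AE x in leb n. x \<in> \<Omega> \<longrightarrow> weak_deriv n \<Omega> [i, i] f x = iter_pderiv (rev [i, i]) f x"
      by (intro weak_deriv_smooth[OF f \<Omega>]) auto
  qed simp
  then show ?thesis
    by eventually_elim (auto simp: laplacian_def lap_def)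
qed

lemma eLnorm_UNIV_eq:
  assumes "\<And>x. x \<in> pts n \<Longrightarrow> x \<notin> S \<Longrightarrow> f x = 0"
  shows "eLnorm n q S f = eLnorm n q UNIV f"
proof -
  have "powr_integral n q S f = powr_integral n q UNIV f"
    by (rule nn_integral_cong) (use assms in \<open>auto simp: indicator_def\<close>)
  then show ?thesis by (simp add: eLnorm_def)
qed

lemma exp_p_props:
  assumes "n \<ge> 3"
  shows "exp_p n > 1" "exp_p' n > 2" "exp_p n > 0" "exp_p' n > 0" "1 / exp_p n = 1 / real n + 1 / 2"
    "1 / 2 = 1 / real n + 1 / exp_p' n" "1 / exp_p n = 1 / (real n / 2) + 1 / exp_p' n" "1 / exp_p n + 1 / exp_p' n = 1"
  using assms by (auto simp: exp_p_def exp_p'_def field_simps)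

text \<open>The inequality is assumed on balls and with weak derivatives. A ball around the support
  turns it into one on the whole space, and \<open>laplacian\<close> agrees almost everywhere with
  the classical \<open>lap\<close>. All later applications go through this form.\<close>

lemma carleman_test:
  assumes n: "n \<ge> 3" and c: "carleman_const n \<theta>" and l: "l \<in> carleman_exps n"
    and w: "w \<in> test_fun n (pts n - {origin n})"
  shows "eLnorm n (exp_p' n) UNIV (\<lambda>x. nnorm n x powr (- l) * w x)
    \<le> ennreal \<theta> * eLnorm n (exp_p n) UNIV (\<lambda>x. nnorm n x powr (- l) * lap n w x)"
proof -
  obtain K where K: "smooth n w" "compactin (euc n) K" "K \<subseteq> pts n - {origin n}" "\<And>x. x \<in> pts n \<Longrightarrow> x \<notin> K \<Longrightarrow> w x = 0"
    using test_funE[OF w] by metis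
  obtain R where R: "R > 0" "\<And>x. x \<in> K \<Longrightarrow> \<bar>nnorm n x\<bar> \<le> R"
    using continuous_compact_bounded[OF continuous_nnorm K(2)] by blast
  \<comment> \<open>\<open>R + 1\<close>, because the support may reach norm \<open>R\<close> while
    the ball is open.\<close>
  define B where "B = nball n (origin n) (R + 1)"
  have KB: "K \<subseteq> B" using R K(3) by (force simp: B_def nball_origin)
  have oB: "openin (euc n) B" unfolding B_def by (rule openin_nball_origin)
  have ess: "ess_support n B w \<subseteq> B - {origin n}"
  proof
    fix x assume x: "x \<in> ess_support n B w"
    show "x \<in> B - {origin n}"
    proof (rule ccontr)
      assume "x \<notin> B - {origin n}"
      then have "x \<notin> K" using KB K(3) by blast
      moreover have xp: "x \<in> pts n" using x by (simp add: ess_support_def)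
      moreover have "openin (euc n) (pts n - K)"
        using compactin_imp_closedin[OF Hausdorff_euc K(2)] by (simp add: closedin_def)
      moreover have "AE y in leb n. y \<in> (pts n - K) \<inter> B \<longrightarrow> w y = 0" using K(4) by (intro AE_I2) auto
      ultimately show False using x unfolding ess_support_def by blast
    qed
  qed
  have wz: "w x = 0" if "x \<in> pts n" "x \<notin> B" for x using K(4) that KB by blast
  have lz: "lap n w x = 0" if "x \<in> pts n" "x \<notin> B" for x
  proof -
    have xK: "x \<notin> K" using that KB by blast
    have "pderiv_at i (pderiv_at i w) x = 0" if i: "i < n" for i
      by (rule pderiv_zero_outside[OF K(2) pderiv_zero_outside[OF K(2,4) i] i \<open>x \<in> pts n\<close> xK])
    then show ?thesis by (simp add: lap_def)
  qed
  have "w \<in> sobolev n 2 (exp_p n) B" by (rule test_fun_sobolev[OF w _ oB]) (use exp_p_props[OF n] in auto)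
  then have "eLnorm n (exp_p' n) B (\<lambda>x. nnorm n x powr (- l) * w x)
        \<le> ennreal \<theta> * eLnorm n (exp_p n) B (\<lambda>x. nnorm n x powr (- l) * laplacian n B w x)"
    using c l ess R(1) unfolding carleman_const_def B_def by (meson add_pos_pos zero_less_one)
  also have "eLnorm n (exp_p n) B (\<lambda>x. nnorm n x powr (- l) * laplacian n B w x) = eLnorm n (exp_p n) B (\<lambda>x. nnorm n x powr (- l) * lap n w x)"
    by (rule eLnorm_cong_AE) (use laplacian_test[OF K(1) oB] in \<open>eventually_elim, simp\<close>)
  also have "\<dots> = eLnorm n (exp_p n) UNIV (\<lambda>x. nnorm n x powr (- l) * lap n w x)"
    by (rule eLnorm_UNIV_eq) (use lz in auto)
  also have "eLnorm n (exp_p' n) B (\<lambda>x. nnorm n x powr (- l) * w x) = eLnorm n (exp_p' n) UNIV (\<lambda>x. nnorm n x powr (- l) * w x)"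
    by (rule eLnorm_UNIV_eq) (use wz in auto)
  finally show ?thesis .
qed

lemma integral_grad_inner:
  assumes f: "smooth n f" and w: "w \<in> test_fun n \<Omega>"
  shows "(LINT x|leb n. grad_inner n f w x) = - (LINT x|leb n. w x * lap n f x)"
proof -
  have "(LINT x|leb n. grad_inner n f w x) = (\<Sum>i<n. LINT x|leb n. pderiv_at i f x * pderiv_at i w x)"
    unfolding grad_inner_def
    by (rule Bochner_Integration.integral_sum, rule test_fun_integrable[OF test_fun_mult(1)[OF smooth_pderiv[OF f] test_fun_pderiv[OF w]]]) auto
  also have "\<dots> = (\<Sum>i<n. - (LINT x|leb n. pderiv_at i (pderiv_at i f) x * w x))"
    by (rule sum.cong[OF refl], rule integral_by_parts[OF smooth_pderiv[OF f] w]) auto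
  also have "\<dots> = - (\<Sum>i<n. (LINT x|leb n. pderiv_at i (pderiv_at i f) x * w x))" by (rule sum_negf)
  also have "(\<Sum>i<n. (LINT x|leb n. pderiv_at i (pderiv_at i f) x * w x)) = (LINT x|leb n. (\<Sum>i<n. pderiv_at i (pderiv_at i f) x * w x))"
    by (rule Bochner_Integration.integral_sum[symmetric], rule test_fun_integrable[OF test_fun_mult(1)[OF smooth_pderiv[OF smooth_pderiv[OF f]] w]]) auto
  also have "(\<lambda>x. (\<Sum>i<n. pderiv_at i (pderiv_at i f) x * w x)) = (\<lambda>x. w x * lap n f x)"
    by (simp add: lap_def sum_distrib_left mult.commute)
  finally show ?thesis .
qed

section \<open>The Sobolev inequality\<close>

text \<open>Integrals along lines may be infinite before anything is known about them, so powers of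
  extended reals are formed here after all; the exponents that occur are positive.\<close>

definition ennpowr :: "ennreal \<Rightarrow> real \<Rightarrow> ennreal" where
  "ennpowr x a = (if x = \<infinity> then \<infinity> else ennreal (enn2real x powr a))"

lemma ennpowr_ennreal: "x \<ge> 0 \<Longrightarrow> ennpowr (ennreal x) a = ennreal (x powr a)"
  by (simp add: ennpowr_def)

lemma ennpowr_mono: "x \<le> y \<Longrightarrow> a \<ge> 0 \<Longrightarrow> ennpowr x a \<le> ennpowr y a"
  by (cases x; cases y) (auto simp: ennpowr_def top_unique intro!: ennreal_leI powr_mono2)

lemma ennpowr_0: "ennpowr 0 a = 0"
  by (simp add: ennpowr_def)

lemma ennpowr_nonzero: "x \<noteq> 0 \<Longrightarrow> ennpowr x a \<noteq> 0"
  by (cases x) (auto simp: ennpowr_def)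

lemma borel_measurable_ennpowr [measurable]:
  assumes [measurable]: "f \<in> borel_measurable M"
  shows "(\<lambda>x. ennpowr (f x) a) \<in> borel_measurable M"
  unfolding ennpowr_def by measurable

text \<open>Each factor is divided by its integral \<open>c j\<close>; the inequality between the
  geometric and the arithmetic mean then replaces the product by an average of functions of integral
  one.\<close>

lemma generalized_Holder:
  fixes H :: "nat \<Rightarrow> 'a \<Rightarrow> ennreal"
  assumes J: "finite J" "J \<noteq> {}" and m[measurable]: "\<And>j. j \<in> J \<Longrightarrow> H j \<in> borel_measurable M"
  shows "(\<integral>\<^sup>+t. (\<Prod>j\<in>J. ennpowr (H j t) (1 / card J)) \<partial>M) \<le> (\<Prod>j\<in>J. ennpowr (\<integral>\<^sup>+t. H j t \<partial>M) (1 / card J))"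
proof -
  let ?c = "\<lambda>j. \<integral>\<^sup>+t. H j t \<partial>M"
  have mp: "real (card J) > 0" using J by (simp add: card_gt_0_iff)
  \<comment> \<open>Normalisation fails for integrals \<open>0\<close> and \<infinity>. Zero comes
    first: it makes the left-hand side vanish, also when another integral is infinite.\<close>
  consider (z) j where "j \<in> J" "?c j = 0" | (t) j where "\<forall>j\<in>J. ?c j \<noteq> 0" "j \<in> J" "?c j = \<infinity>"
    | (f) "\<forall>j\<in>J. ?c j \<noteq> 0 \<and> ?c j \<noteq> \<infinity>" by blast
  then show ?thesis
  proof cases
    case z
    have "AE t in M. H j t = 0" using z m[OF z(1)] by (simp add: nn_integral_0_iff_AE)
    then have "AE t in M. (\<Prod>j\<in>J. ennpowr (H j t) (1 / card J)) = 0"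
    proof eventually_elim
      case (elim t)
      then have "ennpowr (H j t) (1 / card J) = 0" by (simp add: ennpowr_0)
      then show ?case using J(1) z(1) by (meson prod_zero)
    qed
    then have "(\<integral>\<^sup>+t. (\<Prod>j\<in>J. ennpowr (H j t) (1 / card J)) \<partial>M) = (\<integral>\<^sup>+t. 0 \<partial>M)" by (rule nn_integral_cong_AE)
    then show ?thesis by simp
  next
    case t
    have "(\<Prod>j\<in>J. ennpowr (?c j) (1 / card J)) = ennpowr (?c j) (1 / card J) * (\<Prod>j\<in>J - {j}. ennpowr (?c j) (1 / card J))"
      using J t(2) by (simp add: prod.remove)
    moreover have "(\<Prod>j\<in>J - {j}. ennpowr (?c j) (1 / card J)) \<noteq> 0"
    proof
      assume "(\<Prod>j\<in>J - {j}. ennpowr (?c j) (1 / card J)) = 0"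
      then obtain a where a: "a \<in> J - {j}" "ennpowr (?c a) (1 / card J) = 0"
        using J(1) by auto
      then show False using ennpowr_nonzero[of "?c a"] t(1) by simp
    qed
    moreover have "ennpowr (?c j) (1 / card J) = top" using t by (simp add: ennpowr_def)
    ultimately have "(\<Prod>j\<in>J. ennpowr (?c j) (1 / card J)) = top" by (simp add: ennreal_top_mult)
    then show ?thesis by simp
  next
    case f
    define c where "c j = enn2real (?c j)" for j
    have c: "?c j = ennreal (c j)" "c j > 0" if "j \<in> J" for j
    proof -
      show e: "?c j = ennreal (c j)" using f that by (auto simp: c_def less_top)
      show "c j > 0" using f that by (auto simp: c_def enn2real_positive_iff less_top zero_less_iff_neq_zero)
    qed
    define C where "C = (\<Prod>j\<in>J. c j powr (1 / card J))"
    have C: "C \<ge> 0" unfolding C_def by (intro prod_nonneg) auto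
    have "AE t in M. \<forall>j\<in>J. H j t \<noteq> \<infinity>"
      using J(1) f m by (intro AE_finite_allI nn_integral_PInf_AE) auto
    then have "(\<integral>\<^sup>+t. (\<Prod>j\<in>J. ennpowr (H j t) (1 / card J)) \<partial>M) \<le> (\<integral>\<^sup>+t. (\<Sum>j\<in>J. ennreal (C / card J / c j) * H j t) \<partial>M)"
    proof (intro nn_integral_mono_AE, eventually_elim)
      fix t assume fin: "\<forall>j\<in>J. H j t \<noteq> \<infinity>"
      define h where "h j = enn2real (H j t)" for j
      have h: "H j t = ennreal (h j)" "h j \<ge> 0" if "j \<in> J" for j using fin that by (auto simp: h_def less_top)
      have "(\<Prod>j\<in>J. ennpowr (H j t) (1 / card J)) = (\<Prod>j\<in>J. ennreal (h j powr (1 / card J)))"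
        by (rule prod.cong[OF refl]) (simp add: h ennpowr_ennreal)
      also have "\<dots> = ennreal (\<Prod>j\<in>J. h j powr (1 / card J))" by (rule prod_ennreal) simp
      also have "(\<Prod>j\<in>J. h j powr (1 / card J)) = C * (\<Prod>j\<in>J. (h j / c j)) powr (1 / card J)"
      proof -
        have "(\<Prod>j\<in>J. h j / c j) powr (1 / card J) = (\<Prod>j\<in>J. (h j / c j) powr (1 / card J))"
          by (rule prod_powr_distrib)
        also have "C * \<dots> = (\<Prod>j\<in>J. c j powr (1 / card J) * (h j / c j) powr (1 / card J))"
          unfolding C_def by (rule prod.distrib[symmetric])
        also have "\<dots> = (\<Prod>j\<in>J. h j powr (1 / card J))"
        proof (rule prod.cong[OF refl])
          fix j assume j: "j \<in> J"
          show "c j powr (1 / card J) * (h j / c j) powr (1 / card J) = h j powr (1 / card J)"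
            using c(2)[OF j] h(2)[OF j] by (simp add: powr_divide)
        qed
        finally show ?thesis by simp
      qed
      also have "\<dots> \<le> C * (\<Sum>j\<in>J. h j / c j / card J)"
        by (intro mult_left_mono arith_geom_mean J C) (use c h in \<open>auto simp: less_imp_le\<close>)
      also have "\<dots> = (\<Sum>j\<in>J. C / card J / c j * h j)" by (simp add: sum_distrib_left mult_ac)
      finally have "(\<Prod>j\<in>J. ennpowr (H j t) (1 / card J)) \<le> ennreal (\<Sum>j\<in>J. C / card J / c j * h j)" by (simp add: ennreal_leI)
      also have "\<dots> = (\<Sum>j\<in>J. ennreal (C / card J / c j * h j))"
        by (rule sum_ennreal[symmetric]) (use c h C in \<open>auto intro!: mult_nonneg_nonneg divide_nonneg_nonneg simp: less_imp_le\<close>)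
      also have "\<dots> = (\<Sum>j\<in>J. ennreal (C / card J / c j) * H j t)"
      proof (rule sum.cong[OF refl])
        fix j assume j: "j \<in> J"
        have "C / card J / c j \<ge> 0" using C c(2)[OF j] by simp
        then show "ennreal (C / card J / c j * h j) = ennreal (C / card J / c j) * H j t"
          using h[OF j] by (simp only: ennreal_mult)
      qed
      finally show "(\<Prod>j\<in>J. ennpowr (H j t) (1 / card J)) \<le> (\<Sum>j\<in>J. ennreal (C / card J / c j) * H j t)" .
    qed
    also have "\<dots> = (\<Sum>j\<in>J. ennreal (C / card J / c j) * ?c j)"
      by (subst nn_integral_sum) (auto simp: nn_integral_cmult m)
    also have "\<dots> = (\<Sum>j\<in>J. ennreal (C / card J))"
    proof (rule sum.cong[OF refl])
      fix j assume j: "j \<in> J"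
      have "ennreal (C / card J / c j) * ennreal (c j) = ennreal (C / card J / c j * c j)"
        using C c(2)[OF j] by (intro ennreal_mult[symmetric]) auto
      then show "ennreal (C / card J / c j) * ?c j = ennreal (C / card J)" using c[OF j] by simp
    qed
    also have "\<dots> = ennreal (real (card J) * (C / card J))"
      unfolding sum_constant ennreal_of_nat_eq_real_of_nat by (rule ennreal_mult[symmetric]) (use C in auto)
    also have "\<dots> = ennreal C" using mp by simp
    also have "\<dots> = (\<Prod>j\<in>J. ennpowr (?c j) (1 / card J))"
    proof -
      have "(\<Prod>j\<in>J. ennpowr (?c j) (1 / card J)) = (\<Prod>j\<in>J. ennreal (c j powr (1 / card J)))"
        by (rule prod.cong[OF refl]) (use c in \<open>auto simp: ennpowr_ennreal less_imp_le\<close>)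
      also have "\<dots> = ennreal C" unfolding C_def by (rule prod_ennreal) simp
      finally show ?thesis by simp
    qed
    finally show ?thesis .
  qed
qed

text \<open>The coordinates of \<open>x\<close> outside \<open>S\<close> are kept, those in
  \<open>S\<close> are overwritten. The argument remains a point of \<open>n\<close>-space
  throughout, so that an induction on \<open>S\<close> does not change the dimension.\<close>

definition integrate_out :: "nat \<Rightarrow> nat set \<Rightarrow> (point \<Rightarrow> ennreal) \<Rightarrow> point \<Rightarrow> ennreal" where
  "integrate_out n S f x = (\<integral>\<^sup>+y. f (\<lambda>i\<in>{..<n}. if i \<in> S then y i else x i) \<partial>Pi\<^sub>M S (\<lambda>_. lborel))"

lemma integrate_out_measurable_pair:
  assumes f: "f \<in> borel_measurable (leb n)" and S: "S \<subseteq> {..<n}"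
  shows "(\<lambda>z. f (\<lambda>i\<in>{..<n}. if i \<in> S then snd z i else (x(j := fst z)) i)) \<in> borel_measurable (lborel \<Otimes>\<^sub>M Pi\<^sub>M S (\<lambda>_. lborel))"
proof (rule measurable_compose[OF _ f], rule measurable_restrict)
  fix i assume i: "i \<in> {..<n}"
  show "(\<lambda>z. if i \<in> S then snd z i else (x(j := fst z)) i) \<in> measurable (lborel \<Otimes>\<^sub>M Pi\<^sub>M S (\<lambda>_. lborel)) lborel"
  proof (cases "i \<in> S")
    case True
    have "(\<lambda>z. snd z i) \<in> measurable (lborel \<Otimes>\<^sub>M Pi\<^sub>M S (\<lambda>_. lborel :: real measure)) lborel"
      by (rule measurable_compose[OF measurable_snd measurable_component_singleton[OF True]])
    then show ?thesis using True by simp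
  next
    case False
    then show ?thesis by (cases "i = j") auto
  qed
qed

lemma integrate_out_measurable_slice:
  assumes f: "f \<in> borel_measurable (leb n)" and S: "S \<subseteq> {..<n}"
  shows "(\<lambda>t. integrate_out n S f (x(j := t))) \<in> borel_measurable lborel"
proof -
  interpret S: sigma_finite_measure "Pi\<^sub>M S (\<lambda>_. lborel :: real measure)"
    by (rule leb.sigma_finite) (use S finite_subset in blast)
  show ?thesis unfolding integrate_out_def
    by (rule S.borel_measurable_nn_integral) (use integrate_out_measurable_pair[OF f S, of x j] in \<open>simp add: split_beta\<close>)
qed

lemma integrate_out_insert:
  assumes f: "f \<in> borel_measurable (leb n)" and S: "S \<subseteq> {..<n}" "j < n" "j \<notin> S"
  shows "integrate_out n (insert j S) f x = (\<integral>\<^sup>+t. integrate_out n S f (x(j := t)) \<partial>lborel)"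
proof -
  have fin: "finite S" using S finite_subset by blast
  have m: "(\<lambda>y. f (\<lambda>i\<in>{..<n}. if i \<in> insert j S then y i else x i)) \<in> borel_measurable (Pi\<^sub>M (insert j S) (\<lambda>_. lborel))"
  proof (rule measurable_compose[OF _ f], rule measurable_restrict)
    fix i assume "i \<in> {..<n}"
    show "(\<lambda>y. if i \<in> insert j S then y i else x i) \<in> measurable (Pi\<^sub>M (insert j S) (\<lambda>_. lborel)) lborel"
      by (cases "i \<in> insert j S") (auto simp del: insert_iff intro: measurable_component_singleton)
  qed
  have "integrate_out n (insert j S) f x = (\<integral>\<^sup>+t. (\<integral>\<^sup>+y. f (\<lambda>i\<in>{..<n}. if i \<in> insert j S then (y(j := t)) i else x i) \<partial>Pi\<^sub>M S (\<lambda>_. lborel)) \<partial>lborel)"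
    unfolding integrate_out_def by (rule leb.product_nn_integral_insert_rev[OF fin S(3) m])
  also have "\<dots> = (\<integral>\<^sup>+t. integrate_out n S f (x(j := t)) \<partial>lborel)"
    unfolding integrate_out_def
  proof (intro nn_integral_cong)
    fix t y
    have "(\<lambda>i\<in>{..<n}. if i \<in> insert j S then (y(j := t)) i else x i) = (\<lambda>i\<in>{..<n}. if i \<in> S then y i else (x(j := t)) i)"
      by (rule restrict_ext) (use S(3) in auto)
    then show "f (\<lambda>i\<in>{..<n}. if i \<in> insert j S then (y(j := t)) i else x i) = f (\<lambda>i\<in>{..<n}. if i \<in> S then y i else (x(j := t)) i)"
      by (rule arg_cong)
  qed
  finally show ?thesis .
qed

lemma integrate_out_empty: "x \<in> pts n \<Longrightarrow> integrate_out n {} f x = f x"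
proof -
  assume "x \<in> pts n"
  then have "(\<lambda>i\<in>{..<n}. if i \<in> {} then y i else x i) = x" for y by (auto simp: restrict_def PiE_iff extensional_def)
  then show ?thesis unfolding integrate_out_def by (simp add: PiM_empty nn_integral_count_space_finite)
qed

lemma integrate_out_all: "f \<in> borel_measurable (leb n) \<Longrightarrow> integrate_out n {..<n} f x = (\<integral>\<^sup>+y. f y \<partial>leb n)"
  unfolding integrate_out_def
proof (rule nn_integral_cong)
  fix y assume "y \<in> space (leb n)"
  then have "(\<lambda>i\<in>{..<n}. if i \<in> {..<n} then y i else x i) = y" by (auto simp: restrict_def PiE_iff extensional_def)
  then show "f (\<lambda>i\<in>{..<n}. if i \<in> {..<n} then y i else x i) = f y" by simp
qed

lemma integrate_out_upd: "j \<in> S \<Longrightarrow> integrate_out n S f (x(j := t)) = integrate_out n S f x"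
proof -
  assume "j \<in> S"
  then have "(\<lambda>i\<in>{..<n}. if i \<in> S then y i else (x(j := t)) i) = (\<lambda>i\<in>{..<n}. if i \<in> S then y i else x i)" for y
    by (auto simp: restrict_def)
  then show ?thesis unfolding integrate_out_def by simp
qed

text \<open>Induction on the set \<open>S\<close> of integrated coordinates: in each step one factor does not depend on
  the new coordinate and the others are treated by Hoelder's inequality.\<close>

lemma Loomis_Whitney:
  assumes n: "n \<ge> 2" and g: "\<And>i. i < n \<Longrightarrow> g i \<in> borel_measurable (leb n)"
    and F: "F \<in> borel_measurable (leb n)" "\<And>x. x \<in> pts n \<Longrightarrow> F x \<le> (\<Prod>i<n. ennpowr (integrate_out n {i} (g i) x) (1 / (real n - 1)))"
  shows "(\<integral>\<^sup>+x. F x \<partial>leb n) \<le> (\<Prod>i<n. ennpowr (\<integral>\<^sup>+x. g i x \<partial>leb n) (1 / (real n - 1)))"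
proof -
  let ?a = "1 / (real n - 1)"
  have a: "?a \<ge> 0" using n by simp
  have main: "S \<subseteq> {..<n} \<Longrightarrow> x \<in> pts n \<Longrightarrow> integrate_out n S F x \<le> (\<Prod>i<n. ennpowr (integrate_out n (insert i S) (g i) x) ?a)" if "finite S" for S x
    using that
  proof (induction S arbitrary: x rule: finite_induct)
    case empty
    then show ?case using F(2) by (simp add: integrate_out_empty)
  next
    case (insert j S)
    have j: "j < n" and S: "S \<subseteq> {..<n}" using insert.prems by auto
    \<comment> \<open>The number \<open>n - 1\<close> of remaining indices is the reciprocal of the
      exponent \<open>?a\<close>, as \<open>generalized_Holder\<close> requires.\<close>
    let ?J = "{..<n} - {j}"
    have J: "finite ?J" "?J \<noteq> {}" and cJ: "real (card ?J) = real n - 1"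
    proof -
      have "card ?J = n - 1" using j by simp
      then show "real (card ?J) = real n - 1" using n by (simp add: of_nat_diff)
      show "?J \<noteq> {}"
      proof
        assume "?J = {}"
        then have "card ?J = 0" by (simp only: card.empty)
        then show False using \<open>card ?J = n - 1\<close> n by linarith
      qed
    qed simp
    have "integrate_out n (insert j S) F x = (\<integral>\<^sup>+t. integrate_out n S F (x(j := t)) \<partial>lborel)"
      by (rule integrate_out_insert[OF F(1) S j insert.hyps(2)])
    also have "\<dots> \<le> (\<integral>\<^sup>+t. (\<Prod>i<n. ennpowr (integrate_out n (insert i S) (g i) (x(j := t))) ?a) \<partial>lborel)"
      by (intro nn_integral_mono insert.IH S upd_in_pts insert.prems j)
    also have "\<dots> = (\<integral>\<^sup>+t. ennpowr (integrate_out n (insert j S) (g j) x) ?a * (\<Prod>i\<in>?J. ennpowr (integrate_out n (insert i S) (g i) (x(j := t))) ?a) \<partial>lborel)"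
    proof (rule nn_integral_cong)
      fix t
      have "(\<Prod>i<n. ennpowr (integrate_out n (insert i S) (g i) (x(j := t))) ?a) = ennpowr (integrate_out n (insert j S) (g j) (x(j := t))) ?a * (\<Prod>i\<in>?J. ennpowr (integrate_out n (insert i S) (g i) (x(j := t))) ?a)"
        using j by (intro prod.remove) auto
      then show "(\<Prod>i<n. ennpowr (integrate_out n (insert i S) (g i) (x(j := t))) ?a) = ennpowr (integrate_out n (insert j S) (g j) x) ?a * (\<Prod>i\<in>?J. ennpowr (integrate_out n (insert i S) (g i) (x(j := t))) ?a)"
        by (simp only: integrate_out_upd insertI1)
    qed
    also have "\<dots> = ennpowr (integrate_out n (insert j S) (g j) x) ?a * (\<integral>\<^sup>+t. (\<Prod>i\<in>?J. ennpowr (integrate_out n (insert i S) (g i) (x(j := t))) ?a) \<partial>lborel)"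
      using g S by (intro nn_integral_cmult borel_measurable_prod_ennreal borel_measurable_ennpowr integrate_out_measurable_slice) auto
    also have "\<dots> \<le> ennpowr (integrate_out n (insert j S) (g j) x) ?a * (\<Prod>i\<in>?J. ennpowr (\<integral>\<^sup>+t. integrate_out n (insert i S) (g i) (x(j := t)) \<partial>lborel) ?a)"
    proof (rule mult_left_mono)
      show "(\<integral>\<^sup>+t. (\<Prod>i\<in>?J. ennpowr (integrate_out n (insert i S) (g i) (x(j := t))) ?a) \<partial>lborel) \<le> (\<Prod>i\<in>?J. ennpowr (\<integral>\<^sup>+t. integrate_out n (insert i S) (g i) (x(j := t)) \<partial>lborel) ?a)"
        unfolding cJ[symmetric]
      proof (rule generalized_Holder[OF J])
        fix i assume "i \<in> ?J"
        then show "(\<lambda>t. integrate_out n (insert i S) (g i) (x(j := t))) \<in> borel_measurable lborel"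
          using g S by (intro integrate_out_measurable_slice) auto
      qed
    qed simp
    also have "(\<Prod>i\<in>?J. ennpowr (\<integral>\<^sup>+t. integrate_out n (insert i S) (g i) (x(j := t)) \<partial>lborel) ?a) = (\<Prod>i\<in>?J. ennpowr (integrate_out n (insert i (insert j S)) (g i) x) ?a)"
    proof (rule prod.cong[OF refl])
      fix i assume i: "i \<in> ?J"
      have "integrate_out n (insert j (insert i S)) (g i) x = (\<integral>\<^sup>+t. integrate_out n (insert i S) (g i) (x(j := t)) \<partial>lborel)"
        by (rule integrate_out_insert) (use i g S j insert.hyps in auto)
      then show "ennpowr (\<integral>\<^sup>+t. integrate_out n (insert i S) (g i) (x(j := t)) \<partial>lborel) ?a = ennpowr (integrate_out n (insert i (insert j S)) (g i) x) ?a"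
        by (simp add: insert_commute)
    qed
    also have "ennpowr (integrate_out n (insert j S) (g j) x) ?a * \<dots> = (\<Prod>i<n. ennpowr (integrate_out n (insert i (insert j S)) (g i) x) ?a)"
      using j prod.remove[of "{..<n}" j "\<lambda>i. ennpowr (integrate_out n (insert i (insert j S)) (g i) x) ?a"] by simp
    finally show ?case .
  qed
  have "(\<integral>\<^sup>+x. F x \<partial>leb n) = integrate_out n {..<n} F (origin n)" by (simp add: integrate_out_all F)
  also have "\<dots> \<le> (\<Prod>i<n. ennpowr (integrate_out n (insert i {..<n}) (g i) (origin n)) ?a)" by (rule main) auto
  also have "\<dots> = (\<Prod>i<n. ennpowr (\<integral>\<^sup>+x. g i x \<partial>leb n) ?a)"
  proof (rule prod.cong[OF refl])
    fix i assume i: "i \<in> {..<n}"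
    then have "insert i {..<n} = {..<n}" by auto
    then show "ennpowr (integrate_out n (insert i {..<n}) (g i) (origin n)) ?a = ennpowr (\<integral>\<^sup>+x. g i x \<partial>leb n) ?a"
      using integrate_out_all[OF g] i by simp
  qed
  finally show ?thesis .
qed

section \<open>A Sobolev inequality with an explicit constant\<close>

lemma DERIV_abs_powr:
  assumes "\<gamma> > 1"
  shows "((\<lambda>s::real. \<bar>s\<bar> powr \<gamma>) has_real_derivative \<gamma> * (max s 0 powr (\<gamma> - 1) - max (- s) 0 powr (\<gamma> - 1))) (at s)"
proof (cases s "0::real" rule: linorder_cases)
  case less
  have ev: "\<forall>\<^sub>F t in nhds s. \<bar>t\<bar> powr \<gamma> = (- t) powr \<gamma>"
    using eventually_nhds_in_open[of "{..<0}" s] less by (auto elim!: eventually_mono)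
  have "((\<lambda>t. (- t) powr \<gamma>) has_real_derivative \<gamma> * (- s) powr (\<gamma> - 1) * (- 1)) (at s)"
    by (rule DERIV_chain2[OF has_real_derivative_powr]) (use less in \<open>auto intro!: derivative_eq_intros\<close>)
  then have "((\<lambda>t. \<bar>t\<bar> powr \<gamma>) has_real_derivative \<gamma> * (- s) powr (\<gamma> - 1) * (- 1)) (at s)"
    by (subst DERIV_cong_ev[OF refl ev refl])
  then show ?thesis using less by (simp add: max_def)
next
  case greater
  have ev: "\<forall>\<^sub>F t in nhds s. \<bar>t\<bar> powr \<gamma> = t powr \<gamma>"
    using eventually_nhds_in_open[of "{0<..}" s] greater by (auto elim!: eventually_mono)
  have "((\<lambda>t. t powr \<gamma>) has_real_derivative \<gamma> * s powr (\<gamma> - 1)) (at s)"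
    by (rule has_real_derivative_powr[OF greater])
  then have "((\<lambda>t. \<bar>t\<bar> powr \<gamma>) has_real_derivative \<gamma> * s powr (\<gamma> - 1)) (at s)"
    by (subst DERIV_cong_ev[OF refl ev refl])
  then show ?thesis using greater by (simp add: max_def)
next
  case equal
  have "((\<lambda>h::real. \<bar>h\<bar> powr \<gamma> / h) \<longlongrightarrow> 0) (at 0)"
  proof (rule Lim_null_comparison)
    show "\<forall>\<^sub>F h in at 0. norm (\<bar>h\<bar> powr \<gamma> / h) \<le> \<bar>h\<bar> powr (\<gamma> - 1)"
      using assms by (auto simp: eventually_at_filter abs_mult powr_diff)
    have "((\<lambda>h::real. \<bar>h\<bar> powr (\<gamma> - 1)) \<longlongrightarrow> \<bar>0\<bar> powr (\<gamma> - 1)) (at 0)"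
      by (rule tendsto_powr'[OF tendsto_rabs[OF tendsto_ident_at] tendsto_const]) (use assms in auto)
    then show "((\<lambda>h::real. \<bar>h\<bar> powr (\<gamma> - 1)) \<longlongrightarrow> 0) (at 0)" using assms by simp
  qed
  then show ?thesis using equal assms by (simp add: has_field_derivative_iff)
qed

text \<open>The fundamental theorem along the line through \<open>x\<close> in direction
  \<open>i\<close>, starting outside the support. As \<gamma> exceeds one,
  \<open>|w| powr \<gamma>\<close> is continuously differentiable also at zeros of
  \<open>w\<close>.\<close>

lemma abs_powr_le_line_integral:
  assumes \<gamma>: "\<gamma> > 1" and w: "w \<in> test_fun n (pts n)" and i: "i < n" and x: "x \<in> pts n"
  shows "ennreal (\<bar>w x\<bar> powr \<gamma>) \<le> (\<integral>\<^sup>+t. ennreal (\<gamma> * \<bar>w (x(i := t))\<bar> powr (\<gamma> - 1) * \<bar>pderiv_at i w (x(i := t))\<bar>) \<partial>lborel)"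
proof -
  obtain K where K: "smooth n w" "compactin (euc n) K" "\<And>x. x \<in> pts n \<Longrightarrow> x \<notin> K \<Longrightarrow> w x = 0"
    using test_funE[OF w] by metis
  obtain m where m: "m > 0" "K \<subseteq> closed_box n (origin n) m" using compactin_bounded[OF K(2)] by blast
  have xp: "x(i := t) \<in> pts n" for t using x i by simp
  define M where "M = m + \<bar>x i\<bar> + 1"
  let ?u = "\<lambda>t. w (x(i := t))"
  let ?v = "\<lambda>t. pderiv_at i w (x(i := t))"
  \<comment> \<open>The derivative of \<open>|s| powr \<gamma>\<close>. Written with the positive
    and the negative part it is continuous without a case distinction at zero.\<close>
  let ?\<psi> = "\<lambda>s::real. \<gamma> * (max s 0 powr (\<gamma> - 1) - max (- s) 0 powr (\<gamma> - 1))"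
  have du: "(?u has_real_derivative ?v t) (at t)" for t
    using smooth_has_pd[OF K(1) i xp[of t]] by simp
  have dv: "(?v has_real_derivative pderiv_at i (pderiv_at i w) (x(i := t))) (at t)" for t
    using smooth_has_pd[OF smooth_pderiv[OF K(1) i] i xp[of t]] by simp
  have cu: "continuous_on A ?u" and cv: "continuous_on A ?v" for A
    by (rule DERIV_continuous_on[OF has_field_derivative_at_within[OF du]],
        rule DERIV_continuous_on[OF has_field_derivative_at_within[OF dv]])
  have dF: "((\<lambda>t. \<bar>?u t\<bar> powr \<gamma>) has_real_derivative ?\<psi> (?u t) * ?v t) (at t)" for t
    by (rule DERIV_chain2[OF DERIV_abs_powr[OF \<gamma>] du])
  have cf: "continuous_on A (\<lambda>t. ?\<psi> (?u t) * ?v t)" for A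
    using \<gamma> by (intro continuous_intros cu cv continuous_on_powr') auto
  have z: "?u (- M) = 0"
  proof -
    have "x(i := - M) \<notin> K"
    proof
      assume "x(i := - M) \<in> K"
      then have "\<bar>(x(i := - M)) i - origin n i\<bar> \<le> m" using m(2) i by (auto simp only: closed_box_iff subset_iff)
      then show False using m(1) i by (simp add: M_def)
    qed
    then show ?thesis using K(3) xp by blast
  qed
  have le: "- M \<le> x i" using m(1) by (simp add: M_def)
  have "(LINT t|lborel. indicator {-M..x i} t *\<^sub>R (?\<psi> (?u t) * ?v t)) = \<bar>?u (x i)\<bar> powr \<gamma> - \<bar>?u (- M)\<bar> powr \<gamma>"
    by (rule lebesgue_FTC[OF le dF cf])
  then have e: "\<bar>w x\<bar> powr \<gamma> = (LINT t|lborel. indicator {-M..x i} t *\<^sub>R (?\<psi> (?u t) * ?v t))" using z \<gamma> by simp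
  have int: "integrable lborel (\<lambda>t. indicator {-M..x i} t *\<^sub>R (?\<psi> (?u t) * ?v t))"
    using borel_integrable_atLeastAtMost'[OF cf, of "-M" "x i"] by (simp add: set_integrable_def)
  have "ennreal (\<bar>w x\<bar> powr \<gamma>) = ennreal (norm (LINT t|lborel. indicator {-M..x i} t *\<^sub>R (?\<psi> (?u t) * ?v t)))"
    unfolding e[symmetric] by simp
  also have "\<dots> \<le> (\<integral>\<^sup>+t. norm (indicator {-M..x i} t *\<^sub>R (?\<psi> (?u t) * ?v t)) \<partial>lborel)"
    by (rule integral_norm_bound_ennreal[OF int])
  also have "\<dots> \<le> (\<integral>\<^sup>+t. ennreal (\<gamma> * \<bar>?u t\<bar> powr (\<gamma> - 1) * \<bar>?v t\<bar>) \<partial>lborel)"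
  proof (rule nn_integral_mono, rule ennreal_leI)
    fix t
    have "\<bar>?\<psi> (?u t)\<bar> = \<gamma> * \<bar>?u t\<bar> powr (\<gamma> - 1)" using \<gamma> by (cases "?u t \<ge> 0") (simp_all add: abs_mult max_def)
    then show "norm (indicator {-M..x i} t *\<^sub>R (?\<psi> (?u t) * ?v t)) \<le> \<gamma> * \<bar>?u t\<bar> powr (\<gamma> - 1) * \<bar>?v t\<bar>"
      using \<gamma> by (auto simp: indicator_def abs_mult)
  qed
  finally show ?thesis .
qed

lemma grad_len_le_sum: "grad_len n f x \<le> (\<Sum>i<n. \<bar>pderiv_at i f x\<bar>)"
  unfolding grad_len_def by (rule L2_set_le_sum_abs)

lemma abs_pderiv_le_grad_len: "i < n \<Longrightarrow> \<bar>pderiv_at i f x\<bar> \<le> grad_len n f x"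
  unfolding grad_len_def L2_set_def
  by (rule real_le_rsqrt) (auto intro!: member_le_sum[of i "{..<n}" "\<lambda>i. (pderiv_at i f x)\<^sup>2"])

lemma test_grad_len_finite:
  assumes w: "w \<in> test_fun n \<Omega>" and q: "q \<ge> 1" and S: "S \<in> sets (leb n)"
  shows "eLnorm n q S (grad_len n w) < \<infinity>"
proof -
  have m[measurable]: "pderiv_at i w \<in> borel_measurable (leb n)" if "i \<in> {..<n}" for i
    using test_fun_measurable[OF test_fun_pderiv[OF w]] that by simp
  have "eLnorm n q S (grad_len n w) \<le> eLnorm n q S (\<lambda>x. \<Sum>i<n. \<bar>pderiv_at i w x\<bar>)"
    by (rule eLnorm_mono) (use q grad_len_le_sum in \<open>auto simp: sum_nonneg\<close>)
  also have "\<dots> \<le> (\<Sum>i<n. eLnorm n q S (\<lambda>x. \<bar>pderiv_at i w x\<bar>))"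
    by (rule eLnorm_sum_le[OF q]) (use S in \<open>auto intro: borel_measurable_abs m\<close>)
  also have "\<dots> = (\<Sum>i<n. eLnorm n q S (pderiv_at i w))"
    by (rule sum.cong[OF refl], rule eLnorm_cong) simp
  also have "\<dots> < \<infinity>"
    unfolding infinity_ennreal_def using test_fun_eLnorm_finite[OF test_fun_pderiv[OF w], of _ q S] q
    by (subst ennreal_sum_less_top) auto
  finally show ?thesis .
qed

text \<open>The exponent \<gamma> is chosen such that \<open>\<gamma> * n / (n - 1) = p'\<close>, as
  required by Loomis-Whitney, and \<open>2 * (\<gamma> - 1) = p'\<close>, so that Cauchy-Schwarz
  leaves a power of the norm of \<open>w\<close> times that of its gradient. The constant matters
  only through its finiteness.\<close>

lemma Gagliardo_Nirenberg_test:
  assumes n: "n \<ge> 3" and w: "w \<in> test_fun n (pts n)"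
  shows "eLnorm n (exp_p' n) UNIV w \<le> ennreal (2 * (real n - 1) / (real n - 2)) * eLnorm n 2 UNIV (grad_len n w)"
proof -
  define \<gamma> where "\<gamma> = 2 * (real n - 1) / (real n - 2)"
  have n3: "real n \<ge> 3" using n by simp
  have \<gamma>: "\<gamma> > 1" using n3 by (simp add: \<gamma>_def field_simps)
  have \<gamma>2: "(\<gamma> - 1) * 2 = exp_p' n" using n3 by (simp add: \<gamma>_def exp_p'_def field_simps)
  have \<gamma>n: "\<gamma> * (1 / (real n - 1)) * real n = exp_p' n"
  proof -
    have nz: "real n - 1 \<noteq> 0" "real n - 2 \<noteq> 0" using n3 by linarith+
    show ?thesis unfolding \<gamma>_def exp_p'_def times_divide_times_eq times_divide_eq_left
      using nz by (simp add: frac_eq_eq)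
  qed
  note p = exp_p_props[OF n]
  have wm[measurable]: "w \<in> borel_measurable (leb n)" by (rule test_fun_measurable[OF w])
  have gm[measurable]: "grad_len n w \<in> borel_measurable (leb n)" by (rule measurable_grad_len[OF test_fun_smooth[OF w]])
  define A where "A = Lnorm n (exp_p' n) UNIV w"
  define G where "G = Lnorm n 2 UNIV (grad_len n w)"
  have fA: "eLnorm n (exp_p' n) UNIV w < \<infinity>" by (rule test_fun_eLnorm_finite[OF w p(4)])
  have fG: "eLnorm n 2 UNIV (grad_len n w) < \<infinity>"
  proof -
    have "eLnorm n 2 (pts n) (grad_len n w) < \<infinity>" by (rule test_grad_len_finite[OF w]) (use sets.top[of "leb n"] in simp_all)
    then show ?thesis by (simp add: eLnorm_pts)
  qed
  have A: "eLnorm n (exp_p' n) UNIV w = ennreal A" "A \<ge> 0" and G: "eLnorm n 2 UNIV (grad_len n w) = ennreal G" "G \<ge> 0"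
    using fA fG by (auto simp: A_def G_def less_top)
  have PA: "(\<integral>\<^sup>+x. ennreal (\<bar>w x\<bar> powr exp_p' n) \<partial>leb n) = ennreal (A powr exp_p' n)"
    using eLnorm_powr[OF p(4) fA] by (simp add: A_def)
  define Q where "Q = \<gamma> * (A powr (exp_p' n / 2) * G)"
  have Q: "Q \<ge> 0" using \<gamma> G by (simp add: Q_def)
  define g where "g i x = ennreal (\<gamma> * \<bar>w x\<bar> powr (\<gamma> - 1) * \<bar>pderiv_at i w x\<bar>)" for i x
  have gi: "(\<integral>\<^sup>+x. g i x \<partial>leb n) \<le> ennreal Q" if i: "i < n" for i
  proof -
    let ?h = "\<lambda>x. \<bar>w x\<bar> powr (\<gamma> - 1)"
    have eh: "eLnorm n 2 (pts n) ?h = ennreal (A powr (exp_p' n / 2))"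
    proof -
      have "powr_integral n 2 (pts n) ?h = (\<integral>\<^sup>+x. ennreal (\<bar>w x\<bar> powr exp_p' n) \<partial>leb n)"
      proof (rule nn_integral_cong)
        fix x assume x: "x \<in> space (leb n)"
        have "\<bar>?h x\<bar> powr 2 = \<bar>w x\<bar> powr exp_p' n"
          by (simp only: abs_of_nonneg[OF powr_ge_zero] powr_powr \<gamma>2)
        then show "ennreal (\<bar>?h x\<bar> powr 2) * indicator (pts n) x = ennreal (\<bar>w x\<bar> powr exp_p' n)"
          using x by simp
      qed
      then have "eLnorm n 2 (pts n) ?h = ennreal ((A powr exp_p' n) powr (1 / 2))"
        using PA by (intro eLnorm_eq) auto
      then show ?thesis by (simp add: powr_powr)
    qed
    have "eLnorm n 1 (pts n) (\<lambda>x. ?h x * grad_len n w x) \<le> eLnorm n 2 (pts n) ?h * eLnorm n 2 (pts n) (grad_len n w)"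
    proof (rule eLnorm_Holder)
      show "?h \<in> borel_measurable (leb n)" by measurable
      show "pts n \<in> sets (leb n)" using sets.top[of "leb n"] by simp
      show "eLnorm n 2 (pts n) ?h < \<infinity>" unfolding eh by simp
      show "eLnorm n 2 (pts n) (grad_len n w) < \<infinity>" unfolding eLnorm_pts by (rule fG)
    qed (use gm in simp_all)
    also have "\<dots> = ennreal (A powr (exp_p' n / 2) * G)" using eh G by (simp add: eLnorm_pts ennreal_mult)
    finally have "powr_integral n 1 (pts n) (\<lambda>x. ?h x * grad_len n w x) \<le> ennreal ((A powr (exp_p' n / 2) * G) powr 1)"
      using G by (subst eLnorm_le_iff[symmetric]) auto
    moreover have "powr_integral n 1 (pts n) (\<lambda>x. ?h x * grad_len n w x) = (\<integral>\<^sup>+x. ennreal (?h x * grad_len n w x) \<partial>leb n)"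
      by (rule nn_integral_cong) (auto simp: abs_mult)
    ultimately have b: "(\<integral>\<^sup>+x. ennreal (?h x * grad_len n w x) \<partial>leb n) \<le> ennreal (A powr (exp_p' n / 2) * G)" using G by simp
    have "(\<integral>\<^sup>+x. g i x \<partial>leb n) \<le> (\<integral>\<^sup>+x. ennreal \<gamma> * ennreal (?h x * grad_len n w x) \<partial>leb n)"
    proof (rule nn_integral_mono)
      fix x
      have "\<gamma> * ?h x * \<bar>pderiv_at i w x\<bar> \<le> \<gamma> * ?h x * grad_len n w x"
        using \<gamma> abs_pderiv_le_grad_len[OF i] by (intro mult_left_mono) auto
      then show "g i x \<le> ennreal \<gamma> * ennreal (?h x * grad_len n w x)"
        using \<gamma> by (simp add: g_def ennreal_mult[symmetric] ennreal_leI mult.assoc)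
    qed
    also have "\<dots> = ennreal \<gamma> * (\<integral>\<^sup>+x. ennreal (?h x * grad_len n w x) \<partial>leb n)" by (rule nn_integral_cmult) measurable
    also have "\<dots> \<le> ennreal \<gamma> * ennreal (A powr (exp_p' n / 2) * G)" by (rule mult_left_mono[OF b]) simp
    also have "\<dots> = ennreal Q" using \<gamma> G by (simp add: Q_def ennreal_mult)
    finally show ?thesis .
  qed
  have prod_e: "(\<Prod>i<n. ennpowr (ennreal c) (1 / (real n - 1))) = ennreal (c powr (1 / (real n - 1) * real n))" if "c \<ge> 0" for c
  proof -
    have "(\<Prod>i<n. ennpowr (ennreal c) (1 / (real n - 1))) = (ennreal (c powr (1 / (real n - 1)))) ^ n"
      using that by (simp add: ennpowr_ennreal)
    also have "\<dots> = ennreal ((c powr (1 / (real n - 1))) ^ n)" by (simp add: ennreal_power)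
    also have "(c powr (1 / (real n - 1))) ^ n = (c powr (1 / (real n - 1))) powr real n"
      using that n by (cases "c = 0") (auto simp: powr_realpow)
    also have "\<dots> = c powr (1 / (real n - 1) * real n)" by (simp add: powr_powr)
    finally show ?thesis .
  qed
  have "(\<integral>\<^sup>+x. ennreal (\<bar>w x\<bar> powr exp_p' n) \<partial>leb n) \<le> (\<Prod>i<n. ennpowr (\<integral>\<^sup>+x. g i x \<partial>leb n) (1 / (real n - 1)))"
  proof (rule Loomis_Whitney)
    show "n \<ge> 2" using n by simp
    show "g i \<in> borel_measurable (leb n)" if "i < n" for i
    proof -
      have [measurable]: "pderiv_at i w \<in> borel_measurable (leb n)" by (rule test_fun_measurable[OF test_fun_pderiv[OF w that]])
      show ?thesis unfolding g_def[abs_def] by measurable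
    qed
    show "(\<lambda>x. ennreal (\<bar>w x\<bar> powr exp_p' n)) \<in> borel_measurable (leb n)" by measurable
    fix x assume x: "x \<in> pts n"
    have "ennreal (\<bar>w x\<bar> powr exp_p' n) = (\<Prod>i<n. ennpowr (ennreal (\<bar>w x\<bar> powr \<gamma>)) (1 / (real n - 1)))"
      by (subst prod_e) (use \<gamma>n in \<open>auto simp: powr_powr mult.assoc\<close>)
    also have "\<dots> \<le> (\<Prod>i<n. ennpowr (integrate_out n {i} (g i) x) (1 / (real n - 1)))"
    proof (rule prod_mono_ennreal)
      fix i assume i: "i \<in> {..<n}"
      have gim: "g i \<in> borel_measurable (leb n)"
      proof -
        have [measurable]: "pderiv_at i w \<in> borel_measurable (leb n)" by (rule test_fun_measurable[OF test_fun_pderiv[OF w]]) (use i in simp)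
        show ?thesis unfolding g_def[abs_def] by measurable
      qed
      have "integrate_out n {i} (g i) x = (\<integral>\<^sup>+t. integrate_out n {} (g i) (x(i := t)) \<partial>lborel)"
        by (rule integrate_out_insert) (use gim i in auto)
      also have "\<dots> = (\<integral>\<^sup>+t. g i (x(i := t)) \<partial>lborel)"
        by (rule nn_integral_cong, rule integrate_out_empty, rule upd_in_pts) (use x i in auto)
      finally have "ennreal (\<bar>w x\<bar> powr \<gamma>) \<le> integrate_out n {i} (g i) x"
        using abs_powr_le_line_integral[OF \<gamma> w _ x, of i] i by (simp add: g_def)
      then show "ennpowr (ennreal (\<bar>w x\<bar> powr \<gamma>)) (1 / (real n - 1)) \<le> ennpowr (integrate_out n {i} (g i) x) (1 / (real n - 1))"
        using n3 by (intro ennpowr_mono) auto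
    qed
    finally show "ennreal (\<bar>w x\<bar> powr exp_p' n) \<le> (\<Prod>i<n. ennpowr (integrate_out n {i} (g i) x) (1 / (real n - 1)))" .
  qed
  also have "\<dots> \<le> (\<Prod>i<n. ennpowr (ennreal Q) (1 / (real n - 1)))"
    by (rule prod_mono_ennreal, rule ennpowr_mono) (use gi n3 in auto)
  also have "\<dots> = ennreal (Q powr (1 / (real n - 1) * real n))" by (rule prod_e[OF Q])
  finally have main: "A powr exp_p' n \<le> Q powr (real n / (real n - 1))"
    unfolding PA by (simp add: ennreal_le_iff)
  have "A \<le> \<gamma> * G"
  proof (cases "A = 0")
    case True
    then show ?thesis using \<gamma> G by simp
  next
    case False
    then have Ap: "A > 0" using A by simp
    \<comment> \<open>\<open>A\<close> is finite and now positive, so the power of \<open>A\<close>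
      common to both sides of \<open>main\<close> can be cancelled; \<open>?e\<close> is what
      remains of the exponent \<open>p'\<close>.\<close>
    let ?e = "real n / (real n - 1)"
    have ee: "exp_p' n = exp_p' n / 2 * ?e + ?e" using n3 by (simp add: exp_p'_def divide_simps) (simp add: algebra_simps)
    have "A powr (exp_p' n / 2 * ?e) * A powr ?e = A powr exp_p' n" by (simp only: powr_add[symmetric] ee[symmetric])
    also have "\<dots> \<le> Q powr ?e" by (rule main)
    also have "Q powr ?e = A powr (exp_p' n / 2 * ?e) * (\<gamma> * G) powr ?e"
      using \<gamma> G by (simp add: Q_def powr_mult powr_powr mult_ac)
    finally have "A powr ?e \<le> (\<gamma> * G) powr ?e" using Ap by simp
    moreover have "?e > 0" using n3 by simp
    ultimately show ?thesis using Ap \<gamma> G by (meson less_imp_le linorder_not_less mult_nonneg_nonneg order_trans powr_less_mono2 zero_le_one)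
  qed
  then show ?thesis using A G \<gamma> unfolding \<gamma>_def[symmetric] by (simp add: ennreal_mult[symmetric] ennreal_leI)
qed

section \<open>The Sobolev constant of the domain\<close>

lemma ennreal_tendsto_0_eventually_le:
  assumes "(X \<longlongrightarrow> (0::ennreal)) F" "e > 0"
  shows "\<forall>\<^sub>F k in F. X k \<le> ennreal e"
  using order_tendstoD(2)[OF assms(1), of "ennreal e"] assms(2) by (auto elim: eventually_mono)

text \<open>Convergence with exponent \<open>a\<close> identifies the limit almost everywhere along
  a subsequence; Fatou's lemma then transports the bound, which may have another exponent
  \<open>b\<close>.\<close>

lemma eLnorm_limit_le:
  assumes a: "a > 0" and b: "b > 0" and c: "c \<ge> 0"
    and m: "\<And>k. f k \<in> borel_measurable (leb n)" "g \<in> borel_measurable (leb n)" "S \<in> sets (leb n)"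
    and L: "(\<lambda>k. eLnorm n a S (\<lambda>x. f k x - g x)) \<longlonglongrightarrow> 0"
    and le: "\<forall>\<^sub>F k in sequentially. eLnorm n b S (f k) \<le> ennreal c"
  shows "eLnorm n b S g \<le> ennreal c"
proof -
  obtain N where N: "\<And>k. k \<ge> N \<Longrightarrow> eLnorm n b S (f k) \<le> ennreal c" using le by (auto simp: eventually_sequentially)
  obtain r :: "nat \<Rightarrow> nat" where r: "strict_mono r" "AE x in leb n. x \<in> S \<longrightarrow> (\<lambda>k. f (r k) x) \<longlonglongrightarrow> g x"
    using eLnorm_AE_subseq[OF a m L] by blast
  show ?thesis
  proof (rule eLnorm_Fatou[OF b c, of "\<lambda>k. f (r (k + N))"])
    show "AE x in leb n. x \<in> S \<longrightarrow> (\<lambda>k. f (r (k + N)) x) \<longlonglongrightarrow> g x"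
      using r(2) by eventually_elim (auto intro: LIMSEQ_ignore_initial_segment)
    fix k
    have "N \<le> r (k + N)" using seq_suble[OF r(1), of "k + N"] by simp
    then show "eLnorm n b S (f (r (k + N))) \<le> ennreal c" by (rule N)
  qed (use m in auto)
qed

lemma grad_norm_smooth:
  assumes f: "smooth n f" and \<Omega>: "openin (euc n) \<Omega>"
  shows "AE x in leb n. x \<in> \<Omega> \<longrightarrow> grad_norm n \<Omega> f x = grad_len n f x"
proof -
  have "AE x in leb n. \<forall>i\<in>{..<n}. x \<in> \<Omega> \<longrightarrow> weak_deriv n \<Omega> [i] f x = pderiv_at i f x"
  proof (rule AE_finite_allI)
    fix i assume "i \<in> {..<n}"
    then show "AE x in leb n. x \<in> \<Omega> \<longrightarrow> weak_deriv n \<Omega> [i] f x = pderiv_at i f x"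
      using weak_deriv_smooth[OF f \<Omega>, of "[i]"] by simp
  qed simp
  then show ?thesis
    by eventually_elim (auto simp: grad_norm_def grad_len_def intro!: L2_set_cong)
qed

text \<open>Needed only to know that the supremum in \<open>sob_const\<close> is finite; otherwise \<open>enn2real\<close> would make
  it \<open>0\<close>.\<close>

lemma H1_0_bound:
  assumes n: "n \<ge> 3" and \<Omega>: "openin (euc n) \<Omega>" and w: "w \<in> H1_0 n \<Omega>" and g1: "eLnorm n 2 \<Omega> (grad_norm n \<Omega> w) = 1"
  shows "eLnorm n (exp_p' n) \<Omega> w \<le> ennreal (2 * (real n - 1) / (real n - 2) * 2)"
proof -
  note p = exp_p_props[OF n]
  have \<Omega>s[measurable]: "\<Omega> \<in> sets (leb n)" by (rule openin_sets[OF \<Omega>])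
  obtain \<phi> where \<phi>: "\<And>k::nat. \<phi> k \<in> test_fun n \<Omega>" "(\<lambda>k. eLnorm n 2 \<Omega> (\<lambda>x. \<phi> k x - w x)) \<longlonglongrightarrow> 0"
    "\<And>i. i < n \<Longrightarrow> (\<lambda>k. eLnorm n 2 \<Omega> (\<lambda>x. pderiv_at i (\<phi> k) x - weak_deriv n \<Omega> [i] w x)) \<longlonglongrightarrow> 0"
    using w unfolding H1_0_def by blast
  have ws: "w \<in> sobolev n 1 2 \<Omega>" using w by (simp add: H1_0_def)
  \<comment> \<open>Elements of Sobolev spaces are Borel on \<Omega> only; extension by zero makes
    them measurable on the whole space without changing norms on \<Omega>.\<close>
  define w0 where "w0 x = indicator \<Omega> x * w x" for x
  have w0m[measurable]: "w0 \<in> borel_measurable (leb n)"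
    using ws unfolding sobolev_def Lspace_def set_borel_measurable_def w0_def[abs_def] by simp
  define D where "D i x = indicator \<Omega> x * weak_deriv n \<Omega> [i] w x" for i x
  have Dm: "D i \<in> borel_measurable (leb n)" if "i < n" for i
  proof -
    have "\<exists>g\<in>Lspace n 2 \<Omega>. has_weak_deriv n \<Omega> [i] w g"
      using ws that unfolding sobolev_def by (auto dest!: spec[of _ "[i]"])
    then have "has_weak_deriv n \<Omega> [i] w (weak_deriv n \<Omega> [i] w)"
      unfolding weak_deriv_def by (auto intro: someI[of "has_weak_deriv n \<Omega> [i] w"])
    then show ?thesis unfolding has_weak_deriv_def loc_integrable_def set_borel_measurable_def D_def[abs_def] by simp
  qed
  have pm: "pderiv_at i (\<phi> k) \<in> borel_measurable (leb n)" if "i < n" for i k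
    by (rule test_fun_measurable[OF test_fun_pderiv[OF \<phi>(1) that]])
  define GN where "GN x = L2_set (\<lambda>i. D i x) {..<n}" for x
  have GNm[measurable]: "GN \<in> borel_measurable (leb n)"
    unfolding GN_def[abs_def] L2_set_def using Dm
    by (intro borel_measurable_sqrt[THEN measurable_compose[rotated]] measurable_compose[OF _ borel_measurable_sqrt] borel_measurable_sum borel_measurable_power) auto
  have GN1: "eLnorm n 2 \<Omega> GN = 1"
    unfolding g1[symmetric] by (rule eLnorm_cong) (simp add: GN_def grad_norm_def D_def)
  have e2: "(\<lambda>k. \<Sum>i<n. eLnorm n 2 \<Omega> (\<lambda>x. pderiv_at i (\<phi> k) x - D i x)) \<longlonglongrightarrow> (\<Sum>i<n. 0)"
  proof (rule tendsto_sum)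
    fix i assume i: "i \<in> {..<n}"
    have "eLnorm n 2 \<Omega> (\<lambda>x. pderiv_at i (\<phi> k) x - D i x) = eLnorm n 2 \<Omega> (\<lambda>x. pderiv_at i (\<phi> k) x - weak_deriv n \<Omega> [i] w x)" for k
      by (rule eLnorm_cong) (simp add: D_def)
    then show "(\<lambda>k. eLnorm n 2 \<Omega> (\<lambda>x. pderiv_at i (\<phi> k) x - D i x)) \<longlonglongrightarrow> 0" using \<phi>(3) i by simp
  qed
  then have "(\<lambda>k. \<Sum>i<n. eLnorm n 2 \<Omega> (\<lambda>x. pderiv_at i (\<phi> k) x - D i x)) \<longlonglongrightarrow> 0" by simp
  \<comment> \<open>Gradient norm \<open>1\<close> of \<open>w\<close> plus an error of at most
    \<open>1\<close>: this is the final factor \<open>2\<close> in the bound.\<close>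
  then have ev: "\<forall>\<^sub>F k in sequentially. (\<Sum>i<n. eLnorm n 2 \<Omega> (\<lambda>x. pderiv_at i (\<phi> k) x - D i x)) \<le> ennreal 1"
    by (rule ennreal_tendsto_0_eventually_le) simp
  have "eLnorm n (exp_p' n) \<Omega> w0 \<le> ennreal (2 * (real n - 1) / (real n - 2) * 2)"
  proof (rule eLnorm_limit_le[where a = 2 and f = \<phi>])
    show "\<phi> k \<in> borel_measurable (leb n)" for k by (rule test_fun_measurable[OF \<phi>(1)])
    have "eLnorm n 2 \<Omega> (\<lambda>x. \<phi> k x - w0 x) = eLnorm n 2 \<Omega> (\<lambda>x. \<phi> k x - w x)" for k
      by (rule eLnorm_cong) (simp add: w0_def)
    then show "(\<lambda>k. eLnorm n 2 \<Omega> (\<lambda>x. \<phi> k x - w0 x)) \<longlonglongrightarrow> 0" using \<phi>(2) by simp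
    show "\<forall>\<^sub>F k in sequentially. eLnorm n (exp_p' n) \<Omega> (\<phi> k) \<le> ennreal (2 * (real n - 1) / (real n - 2) * 2)"
      using ev
    proof eventually_elim
      case (elim k)
      have "eLnorm n 2 UNIV (grad_len n (\<phi> k)) = eLnorm n 2 \<Omega> (grad_len n (\<phi> k))"
      proof (rule eLnorm_UNIV_eq[symmetric])
        fix x assume x: "x \<in> pts n" "x \<notin> \<Omega>"
        have "pderiv_at i (\<phi> k) x = 0" if "i < n" for i
          using test_fun_pderiv[OF \<phi>(1) that, of k] x by (auto simp: test_fun_def)
        then show "grad_len n (\<phi> k) x = 0" by (simp add: grad_len_def L2_set_def)
      qed
      also have "\<dots> \<le> eLnorm n 2 \<Omega> (\<lambda>x. GN x + (\<Sum>i<n. \<bar>pderiv_at i (\<phi> k) x - D i x\<bar>))"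
      proof (rule eLnorm_mono)
        fix x assume x: "x \<in> \<Omega>"
        have "grad_len n (\<phi> k) x \<le> L2_set (\<lambda>i. D i x) {..<n} + L2_set (\<lambda>i. pderiv_at i (\<phi> k) x - D i x) {..<n}"
          unfolding grad_len_def using L2_set_triangle_ineq[of "\<lambda>i. D i x" "\<lambda>i. pderiv_at i (\<phi> k) x - D i x" "{..<n}"] by simp
        also have "\<dots> \<le> GN x + (\<Sum>i<n. \<bar>pderiv_at i (\<phi> k) x - D i x\<bar>)"
          unfolding GN_def by (intro add_left_mono L2_set_le_sum_abs)
        finally show "x \<in> \<Omega> \<and> \<bar>grad_len n (\<phi> k) x\<bar> \<le> \<bar>GN x + (\<Sum>i<n. \<bar>pderiv_at i (\<phi> k) x - D i x\<bar>)\<bar>" using x by simp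
      qed simp
      also have "\<dots> \<le> eLnorm n 2 \<Omega> GN + eLnorm n 2 \<Omega> (\<lambda>x. \<Sum>i<n. \<bar>pderiv_at i (\<phi> k) x - D i x\<bar>)"
        by (rule eLnorm_triangle) (use pm Dm in \<open>auto intro!: borel_measurable_sum borel_measurable_abs borel_measurable_diff\<close>)
      also have "eLnorm n 2 \<Omega> (\<lambda>x. \<Sum>i<n. \<bar>pderiv_at i (\<phi> k) x - D i x\<bar>) \<le> (\<Sum>i<n. eLnorm n 2 \<Omega> (\<lambda>x. \<bar>pderiv_at i (\<phi> k) x - D i x\<bar>))"
        by (rule eLnorm_sum_le) (use pm Dm in \<open>auto intro!: borel_measurable_abs borel_measurable_diff\<close>)
      also have "\<dots> = (\<Sum>i<n. eLnorm n 2 \<Omega> (\<lambda>x. pderiv_at i (\<phi> k) x - D i x))"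
        by (rule sum.cong[OF refl], rule eLnorm_cong) simp
      also have "eLnorm n 2 \<Omega> GN + \<dots> \<le> ennreal 1 + ennreal 1" using elim GN1 by (intro add_mono) auto
      finally have g2: "eLnorm n 2 UNIV (grad_len n (\<phi> k)) \<le> ennreal 2" by (simp add: add_left_mono)
      have "eLnorm n (exp_p' n) \<Omega> (\<phi> k) \<le> eLnorm n (exp_p' n) UNIV (\<phi> k)" by (rule eLnorm_subset_le) (use p in auto)
      also have "\<dots> \<le> ennreal (2 * (real n - 1) / (real n - 2)) * eLnorm n 2 UNIV (grad_len n (\<phi> k))"
        by (rule Gagliardo_Nirenberg_test[OF n test_fun_pts[OF \<phi>(1)]])
      also have "\<dots> \<le> ennreal (2 * (real n - 1) / (real n - 2)) * ennreal 2" by (rule mult_left_mono[OF g2]) simp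
      also have "\<dots> = ennreal (2 * (real n - 1) / (real n - 2) * 2)" using n by (intro ennreal_mult[symmetric]) auto
      finally show ?case .
    qed
  qed (use p n in auto)
  moreover have "eLnorm n (exp_p' n) \<Omega> w0 = eLnorm n (exp_p' n) \<Omega> w" by (rule eLnorm_cong) (simp add: w0_def)
  ultimately show ?thesis by simp
qed

lemma sob_const_nonneg: "sob_const n \<Omega> \<ge> 0"
  by (simp add: sob_const_def)

text \<open>After division by its gradient norm a test function competes in the supremum; the
  constant sequence shows that it lies in \<open>H1_0\<close>. If the gradient norm is zero,
  division is impossible and \<open>Gagliardo_Nirenberg_test\<close> shows that the left-hand side
  vanishes.\<close>

lemma sobolev_test:
  assumes n: "n \<ge> 3" and \<Omega>: "openin (euc n) \<Omega>" and w: "w \<in> test_fun n \<Omega>"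
  shows "eLnorm n (exp_p' n) UNIV w \<le> ennreal (sob_const n \<Omega>) * eLnorm n 2 UNIV (grad_len n w)"
proof -
  note p = exp_p_props[OF n]
  have \<Omega>s[measurable]: "\<Omega> \<in> sets (leb n)" by (rule openin_sets[OF \<Omega>])
  have wm[measurable]: "w \<in> borel_measurable (leb n)" by (rule test_fun_measurable[OF w])
  have gm[measurable]: "grad_len n w \<in> borel_measurable (leb n)" by (rule measurable_grad_len[OF test_fun_smooth[OF w]])
  let ?S = "SUP w\<in>{w \<in> H1_0 n \<Omega>. eLnorm n 2 \<Omega> (grad_norm n \<Omega> w) = 1}. eLnorm n (exp_p' n) \<Omega> w"
  have "?S \<le> ennreal (2 * (real n - 1) / (real n - 2) * 2)"
    by (rule SUP_least) (use H1_0_bound[OF n \<Omega>] in blast)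
  then have "?S < \<infinity>" by (rule le_less_trans) simp
  then have S: "?S = ennreal (sob_const n \<Omega>)" unfolding sob_const_def by (simp add: less_top)
  have gO: "eLnorm n 2 \<Omega> (grad_len n f) = eLnorm n 2 UNIV (grad_len n f)" if f: "f \<in> test_fun n \<Omega>" for f
  proof (rule eLnorm_UNIV_eq)
    fix x assume x: "x \<in> pts n" "x \<notin> \<Omega>"
    have "pderiv_at i f x = 0" if "i < n" for i
      using test_fun_pderiv[OF f that] x unfolding test_fun_def by blast
    then show "grad_len n f x = 0" by (simp add: grad_len_def L2_set_def)
  qed
  define G where "G = Lnorm n 2 UNIV (grad_len n w)"
  have fG: "eLnorm n 2 UNIV (grad_len n w) < \<infinity>"
    using test_grad_len_finite[OF w, of 2 "pts n"] sets.top[of "leb n"] by (simp add: eLnorm_pts)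
  have G: "eLnorm n 2 UNIV (grad_len n w) = ennreal G" "G \<ge> 0" using fG by (auto simp: G_def less_top)
  show ?thesis
  proof (cases "G = 0")
    case True
    have "eLnorm n (exp_p' n) UNIV w \<le> ennreal (2 * (real n - 1) / (real n - 2)) * eLnorm n 2 UNIV (grad_len n w)"
      by (rule Gagliardo_Nirenberg_test[OF n test_fun_pts[OF w]])
    then show ?thesis using G True by simp
  next
    case False
    then have Gp: "G > 0" using G by simp
    define v where "v x = inverse G * w x" for x
    have v: "v \<in> test_fun n \<Omega>" unfolding v_def[abs_def] by (rule test_fun_mult(1)[OF smooth_const w])
    have pv: "pderiv_at i v x = inverse G * pderiv_at i w x" if "i < n" "x \<in> pts n" for i x
      unfolding v_def[abs_def] by (rule has_pd_eq, rule DERIV_cmult, rule smooth_has_pd[OF test_fun_smooth[OF w] that])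
    have gv: "grad_len n v x = inverse G * grad_len n w x" if "x \<in> pts n" for x
    proof -
      have "grad_len n v x = L2_set (\<lambda>i. inverse G * pderiv_at i w x) {..<n}" unfolding grad_len_def by (rule L2_set_cong) (use pv that in auto)
      also have "\<dots> = sqrt ((inverse G)\<^sup>2 * (\<Sum>i<n. (pderiv_at i w x)\<^sup>2))" by (simp add: L2_set_def power_mult_distrib sum_distrib_left)
      also have "\<dots> = inverse G * grad_len n w x" using Gp by (simp add: real_sqrt_mult grad_len_def L2_set_def)
      finally show ?thesis .
    qed
    have "eLnorm n 2 UNIV (grad_len n v) = eLnorm n 2 (pts n) (\<lambda>x. inverse G * grad_len n w x)"
      unfolding eLnorm_pts[symmetric, of _ _ "grad_len n v"] by (rule eLnorm_cong) (simp add: gv)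
    also have "\<dots> = ennreal \<bar>inverse G\<bar> * eLnorm n 2 (pts n) (grad_len n w)"
      by (rule eLnorm_cmult) (use sets.top[of "leb n"] in auto)
    also have "\<dots> = 1" using G Gp by (simp add: eLnorm_pts ennreal_mult[symmetric])
    finally have g1: "eLnorm n 2 UNIV (grad_len n v) = 1" .
    have "eLnorm n 2 \<Omega> (grad_norm n \<Omega> v) = eLnorm n 2 \<Omega> (grad_len n v)"
      by (rule eLnorm_cong_AE) (use grad_norm_smooth[OF test_fun_smooth[OF v] \<Omega>] in \<open>eventually_elim, simp\<close>)
    then have g2: "eLnorm n 2 \<Omega> (grad_norm n \<Omega> v) = 1" using gO[OF v] g1 by simp
    have "v \<in> H1_0 n \<Omega>" unfolding H1_0_def
    proof (intro CollectI conjI exI[of _ "\<lambda>_. v"] allI impI)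
      show "v \<in> sobolev n 1 2 \<Omega>" by (rule test_fun_sobolev[OF v _ \<Omega>]) simp
      show "v \<in> test_fun n \<Omega>" by (rule v)
      show "(\<lambda>k. eLnorm n 2 \<Omega> (\<lambda>x. v x - v x)) \<longlonglongrightarrow> 0" by (simp add: eLnorm_eq_0_AE)
      fix i assume i: "i < n"
      have "AE x in leb n. x \<in> \<Omega> \<longrightarrow> weak_deriv n \<Omega> [i] v x = iter_pderiv (rev [i]) v x"
        by (rule weak_deriv_smooth[OF test_fun_smooth[OF v] \<Omega>]) (use i in simp)
      then have "eLnorm n 2 \<Omega> (\<lambda>x. pderiv_at i v x - weak_deriv n \<Omega> [i] v x) = 0"
        by (intro eLnorm_eq_0_AE) (auto elim: eventually_mono)
      then show "(\<lambda>k. eLnorm n 2 \<Omega> (\<lambda>x. pderiv_at i v x - weak_deriv n \<Omega> [i] v x)) \<longlonglongrightarrow> 0" by simp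
    qed
    then have "eLnorm n (exp_p' n) \<Omega> v \<le> ?S" using g2 by (intro SUP_upper) auto
    then have b: "eLnorm n (exp_p' n) \<Omega> v \<le> ennreal (sob_const n \<Omega>)" using S by simp
    have "eLnorm n (exp_p' n) UNIV w = eLnorm n (exp_p' n) \<Omega> w"
      by (rule eLnorm_UNIV_eq[symmetric]) (use w in \<open>auto simp: test_fun_def\<close>)
    also have "\<dots> = eLnorm n (exp_p' n) \<Omega> (\<lambda>x. G * v x)" by (rule eLnorm_cong) (use Gp in \<open>simp add: v_def mult.assoc[symmetric]\<close>)
    also have "\<dots> \<le> ennreal \<bar>G\<bar> * eLnorm n (exp_p' n) \<Omega> v"
      by (rule eLnorm_cmult_le) (use p test_fun_measurable[OF v] in auto)
    also have "\<dots> \<le> ennreal \<bar>G\<bar> * ennreal (sob_const n \<Omega>)" by (rule mult_left_mono[OF b]) simp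
    also have "\<dots> = ennreal (sob_const n \<Omega>) * eLnorm n 2 UNIV (grad_len n w)" using G by (simp add: mult.commute)
    finally show ?thesis .
  qed
qed

section \<open>Weak solutions and their mollifications\<close>

lemma nnorm_diff_closed_box:
  assumes "y \<in> closed_box n x e"
  shows "\<bar>nnorm n y - nnorm n x\<bar> \<le> real n * e"
proof -
  let ?d = "\<lambda>i. y i - x i"
  have d: "L2_set ?d {..<n} \<le> real n * e"
  proof -
    have "L2_set ?d {..<n} \<le> (\<Sum>i<n. \<bar>y i - x i\<bar>)" by (rule L2_set_le_sum_abs)
    also have "\<dots> \<le> (\<Sum>i<n. e)" by (rule sum_mono) (use assms in \<open>simp add: closed_box_iff\<close>)
    finally show ?thesis by simp
  qed
  have "nnorm n y \<le> nnorm n x + L2_set ?d {..<n}"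
    using L2_set_triangle_ineq[of x ?d "{..<n}"] by (simp add: nnorm_def)
  moreover have "nnorm n x \<le> nnorm n y + L2_set ?d {..<n}"
  proof -
    have "L2_set (\<lambda>i. x i - y i) {..<n} = L2_set ?d {..<n}" by (simp add: L2_set_def power2_commute)
    then show ?thesis using L2_set_triangle_ineq[of y "\<lambda>i. x i - y i" "{..<n}"] by (simp add: nnorm_def)
  qed
  ultimately show ?thesis using d by linarith
qed

lemma conv_local:
  assumes "\<And>i t. i < n \<Longrightarrow> \<bar>t\<bar> \<ge> e \<Longrightarrow> \<beta> i t = 0" "closed_box n x e \<subseteq> K"
  shows "conv n (\<lambda>y. indicator K y * f y) \<beta> x = conv n f \<beta> x"
  unfolding conv_def
proof (rule Bochner_Integration.integral_cong[OF refl])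
  fix y assume y: "y \<in> space (leb n)"
  show "indicator K y * f y * kern n \<beta> x y = f y * kern n \<beta> x y"
  proof (cases "y \<in> K")
    case False
    then have "kern n \<beta> x y = 0" using kern_support[of n e \<beta> y x, OF assms(1)] assms(2) y by auto
    then show ?thesis by simp
  qed simp
qed

lemma mollify_local:
  assumes "1 / (real k + 1) \<le> e" "closed_box n x e \<subseteq> K"
  shows "mollify n k (\<lambda>y. indicator K y * f y) x = mollify n k f x"
  unfolding mollify_def
proof (rule conv_local[of n e])
  show "bump k t = 0" if "\<bar>t\<bar> \<ge> e" for t using that assms(1) by (intro bump(3)) linarith
qed (rule assms(2))

lemma eventually_scale_le:
  assumes "e > 0"
  shows "\<forall>\<^sub>F k in sequentially. 1 / (real k + 1) \<le> e"
proof -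
  obtain N :: nat where N: "1 / e < real N" using reals_Archimedean2 by blast
  have "1 / (real k + 1) \<le> e" if "k \<ge> N" for k
  proof -
    have "1 / e \<le> real k + 1" using N that by linarith
    then show ?thesis using assms by (simp add: field_simps)
  qed
  then show ?thesis by (auto simp: eventually_sequentially)
qed

text \<open>Only on \<open>K\<close> is the power \<open>q\<close> of \<open>f\<close> integrable.
  Averages at small scales around points of \<open>S\<close> see nothing outside \<open>K\<close>,
  so \<open>f\<close> may be truncated first.\<close>

lemma mollify_local_tendsto:
  assumes q: "q \<ge> 1" and f: "integrable (leb n) f" and K[measurable]: "K \<in> sets (leb n)"
    and fq: "eLnorm n q K f < \<infinity>" and e: "e > 0" and S: "\<And>x. x \<in> pts n \<Longrightarrow> x \<in> S \<Longrightarrow> closed_box n x e \<subseteq> K"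
  shows "(\<lambda>k. eLnorm n q S (\<lambda>x. mollify n k f x - f x)) \<longlonglongrightarrow> 0"
proof -
  define g where "g x = indicator K x * f x" for x
  have g: "integrable (leb n) g" unfolding g_def[abs_def]
    using integrable_mult_indicator[OF K f] by simp
  have "eLnorm n q UNIV g = eLnorm n q K f" unfolding g_def[abs_def] by (rule eLnorm_indicator) (use q in auto)
  then have L: "(\<lambda>k. eLnorm n q UNIV (\<lambda>x. mollify n k g x - g x)) \<longlonglongrightarrow> 0" using fq by (intro mollify_tendsto q g) simp
  have "\<forall>\<^sub>F k in sequentially. eLnorm n q S (\<lambda>x. mollify n k f x - f x) \<le> eLnorm n q UNIV (\<lambda>x. mollify n k g x - g x)"
    using eventually_scale_le[OF e]
  proof eventually_elim
    case (elim k)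
    show ?case
    proof (rule eLnorm_mono)
      fix x assume x: "x \<in> pts n" "x \<in> S"
      have "x \<in> closed_box n x e" using x(1) e by (simp add: closed_box_iff)
      then have "x \<in> K" using S[OF x] by blast
      then have "g x = f x" by (simp add: g_def)
      moreover have "mollify n k g x = mollify n k f x" unfolding g_def[abs_def] by (rule mollify_local[OF elim S[OF x]])
      ultimately show "x \<in> UNIV \<and> \<bar>mollify n k f x - f x\<bar> \<le> \<bar>mollify n k g x - g x\<bar>" by simp
    qed (use q in simp)
  qed
  then show ?thesis by (intro tendsto_sandwich[OF _ _ tendsto_const L]) auto
qed

lemma eventually_eLnorm_le:
  assumes q: "q \<ge> 1" and m: "\<And>k. f k \<in> borel_measurable (leb n)" "g \<in> borel_measurable (leb n)" "S \<in> sets (leb n)"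
    and L: "(\<lambda>k. eLnorm n q S (\<lambda>x. f k x - g x)) \<longlonglongrightarrow> 0" and c: "eLnorm n q S g \<le> ennreal c" "c \<ge> 0" and d: "\<delta> > 0"
  shows "\<forall>\<^sub>F k in sequentially. eLnorm n q S (f k) \<le> ennreal (c + \<delta>)"
  using ennreal_tendsto_0_eventually_le[OF L d]
proof eventually_elim
  case (elim k)
  have "eLnorm n q S (f k) = eLnorm n q S (\<lambda>x. g x + (f k x - g x))" by simp
  also have "\<dots> \<le> eLnorm n q S g + eLnorm n q S (\<lambda>x. f k x - g x)"
    by (rule eLnorm_triangle[OF q]) (use m in auto)
  also have "\<dots> \<le> ennreal c + ennreal \<delta>" by (rule add_mono[OF c(1) elim])
  finally show ?case using c d by simp
qed

text \<open>Hoelder's inequality with the constant function in exponent \<open>n\<close>, whose norm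
  on a shell is at most \<open>2 * b\<close>. The steps from \<open>p'\<close> to \<open>2\<close>
  and from \<open>2\<close> to \<open>p\<close> both have the gap \<open>1 / n\<close> between the
  reciprocals.\<close>

lemma Holder_shell:
  assumes n: "n > 0" and q: "q > 0" "s > 0" "1 / q = 1 / real n + 1 / s" and b: "b \<ge> 0"
    and f: "f \<in> borel_measurable (leb n)" and S: "S \<in> sets (leb n)" "S \<subseteq> shell n a b" and fin: "eLnorm n s S f < \<infinity>"
  shows "eLnorm n q S f \<le> ennreal (2 * b) * eLnorm n s S f"
proof -
  have "powr_integral n (real n) S (\<lambda>_. 1) = emeasure (leb n) S" using S by simp
  also have "\<dots> \<le> emeasure (leb n) (shell n a b)" using S by (intro emeasure_mono) auto
  also have "\<dots> \<le> ennreal ((2 * b) ^ n)" by (rule emeasure_shell_le[OF b])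
  also have "(2 * b) ^ n = (2 * b) powr real n"
    using b n by (cases "b = 0") (auto simp: powr_realpow)
  finally have one: "eLnorm n (real n) S (\<lambda>_. 1) \<le> ennreal (2 * b)"
    using n b by (subst eLnorm_le_iff) auto
  have "eLnorm n q S (\<lambda>x. 1 * f x) \<le> eLnorm n (real n) S (\<lambda>_. 1) * eLnorm n s S f"
    by (rule eLnorm_Holder) (use q n f S fin le_less_trans[OF one ennreal_less_top] in auto)
  also have "\<dots> \<le> ennreal (2 * b) * eLnorm n s S f" by (rule mult_right_mono[OF one]) simp
  finally show ?thesis by simp
qed

lemma smooth_pderiv_mollify:
  assumes u: "integrable (leb n) u" and i: "i < n" and w: "has_weak_deriv n \<Omega> [i] u g"
    and k: "closed_box n x (1 / (real k + 1)) \<subseteq> \<Omega>"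
  shows "pderiv_at i (mollify n k u) x = mollify n k g x"
proof -
  let ?e = "1 / (real k + 1)"
  let ?\<beta> = "\<lambda>_::nat. bump k"
  let ?b = "?\<beta>(i := deriv (?\<beta> i))"
  let ?K = "closed_box n x ?e"
  have c: "\<forall>i<n. compact_smooth (?\<beta> i)" by (simp add: compact_smooth_bump)
  have s: "?\<beta> j t = 0" if "j < n" "\<bar>t\<bar> \<ge> ?e" for j t using that bump(3) by blast
  have s': "?b j t = 0" if "j < n" "\<bar>t\<bar> \<ge> ?e" for j t
    using bump(3)[OF that(2)] compact_smooth_support_deriv[of "bump k" ?e t] bump(1,3) that by auto
  have int: "integrable (leb n) (\<lambda>y. indicator ?K y * u y)"
    using integrable_mult_indicator[OF closed_box_sets u] by simp
  have "pderiv_at i (mollify n k u) x = conv n u ?b x" unfolding mollify_def by (simp only: pderiv_conv[OF u c i])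
  also have "\<dots> = conv n (\<lambda>y. indicator ?K y * u y) ?b x" by (rule conv_local[symmetric, of n ?e]) (use s' in auto)
  also have "\<dots> = pderiv_at i (conv n (\<lambda>y. indicator ?K y * u y) ?\<beta>) x" by (simp only: pderiv_conv[OF int c i])
  also have "\<dots> = conv n (\<lambda>y. indicator ?K y * g y) ?\<beta> x"
    by (rule conv_weak_deriv1[OF w i compactin_closed_box k c _ s]) auto
  also have "\<dots> = mollify n k g x" unfolding mollify_def by (rule conv_local[of n ?e]) (use s in auto)
  finally show ?thesis .
qed

lemma smooth_pderiv2_mollify:
  assumes u: "integrable (leb n) u" and i: "i < n" and w: "has_weak_deriv n \<Omega> [i, i] u g"
    and k: "closed_box n x (1 / (real k + 1)) \<subseteq> \<Omega>"
  shows "pderiv_at i (pderiv_at i (mollify n k u)) x = mollify n k g x"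
proof -
  let ?e = "1 / (real k + 1)"
  let ?\<beta> = "\<lambda>_::nat. bump k"
  let ?b = "?\<beta>(i := deriv (?\<beta> i))"
  let ?c = "?b(i := deriv (?b i))"
  let ?K = "closed_box n x ?e"
  have c: "\<forall>i<n. compact_smooth (?\<beta> i)" by (simp add: compact_smooth_bump)
  have c': "\<forall>j<n. compact_smooth (?b j)" by (rule compact_smooth_upd_deriv[OF c i])
  have s: "?\<beta> j t = 0" if "j < n" "\<bar>t\<bar> \<ge> ?e" for j t using that bump(3) by blast
  have d1: "deriv (bump k) t = 0" if "\<bar>t\<bar> \<ge> ?e" for t
    by (rule compact_smooth_support_deriv[of "bump k" ?e]) (use bump(1,3) that in auto)
  have d2: "deriv (deriv (bump k)) t = 0" if "\<bar>t\<bar> \<ge> ?e" for t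
    by (rule compact_smooth_support_deriv[of "deriv (bump k)" ?e]) (use smooth1_deriv[OF bump(1)] d1 that in auto)
  have s'': "?c j t = 0" if "j < n" "\<bar>t\<bar> \<ge> ?e" for j t
    using bump(3)[OF that(2)] d1[OF that(2)] d2[OF that(2)] by auto
  have int: "integrable (leb n) (\<lambda>y. indicator ?K y * u y)"
    using integrable_mult_indicator[OF closed_box_sets u] by simp
  have "pderiv_at i (pderiv_at i (mollify n k u)) x = conv n u ?c x"
    unfolding mollify_def by (simp only: pderiv_conv[OF u c i] pderiv_conv[OF u c' i])
  also have "\<dots> = conv n (\<lambda>y. indicator ?K y * u y) ?c x" by (rule conv_local[symmetric, of n ?e]) (use s'' in auto)
  also have "\<dots> = pderiv_at i (pderiv_at i (conv n (\<lambda>y. indicator ?K y * u y) ?\<beta>)) x"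
    by (simp only: pderiv_conv[OF int c i] pderiv_conv[OF int c' i])
  also have "\<dots> = conv n (\<lambda>y. indicator ?K y * g y) ?\<beta> x"
    by (rule conv_weak_deriv2[OF w i compactin_closed_box k c _ s]) auto
  also have "\<dots> = mollify n k g x" unfolding mollify_def by (rule conv_local[of n ?e]) (use s in auto)
  finally show ?thesis .
qed

lemma grad_inner_diff_left:
  assumes "smooth n f" "smooth n g" "x \<in> pts n"
  shows "grad_inner n (\<lambda>x. f x - g x) h x = grad_inner n f h x - grad_inner n g h x"
  unfolding grad_inner_def sum_subtractf[symmetric]
  by (rule sum.cong) (use assms in \<open>auto simp: pderiv_diff left_diff_distrib\<close>)

lemma lap_diff:
  assumes "smooth n f" "smooth n g" "x \<in> pts n"
  shows "lap n (\<lambda>x. f x - g x) x = lap n f x - lap n g x"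
  unfolding lap_def sum_subtractf[symmetric]
proof (rule sum.cong[OF refl])
  fix i assume i: "i \<in> {..<n}"
  have "pderiv_at i (pderiv_at i (\<lambda>x. f x - g x)) x = pderiv_at i (\<lambda>x. pderiv_at i f x - pderiv_at i g x) x"
    by (rule pderiv_cong) (use assms i pderiv_diff in auto)
  also have "\<dots> = pderiv_at i (pderiv_at i f) x - pderiv_at i (pderiv_at i g) x"
    by (rule pderiv_diff) (use assms i smooth_pderiv in auto)
  finally show "pderiv_at i (pderiv_at i (\<lambda>x. f x - g x)) x = pderiv_at i (pderiv_at i f) x - pderiv_at i (pderiv_at i g) x" .
qed

text \<open>The terms of the squared gradient of \<open>\<phi> * v\<close> that contain derivatives
  of \<open>v\<close> are exactly those of the gradient of \<open>v\<close> against that of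
  \<open>\<phi> * \<phi> * v\<close>; what is left has no derivative of \<open>v\<close>.\<close>

lemma grad_inner_energy:
  assumes \<phi>: "smooth n \<phi>" and v: "smooth n v" and x: "x \<in> pts n"
  shows "grad_inner n (\<lambda>x. \<phi> x * v x) (\<lambda>x. \<phi> x * v x) x = grad_inner n v (\<lambda>x. (\<phi> x * \<phi> x) * v x) x + (v x)\<^sup>2 * grad_inner n \<phi> \<phi> x"
proof -
  have "pderiv_at i (\<lambda>x. \<phi> x * v x) x * pderiv_at i (\<lambda>x. \<phi> x * v x) x =
     pderiv_at i v x * pderiv_at i (\<lambda>x. (\<phi> x * \<phi> x) * v x) x + (v x)\<^sup>2 * (pderiv_at i \<phi> x * pderiv_at i \<phi> x)"
    if i: "i < n" for i
    unfolding pderiv_mult[OF \<phi> v i x] pderiv_mult[OF smooth_mult[OF \<phi> \<phi>] v i x] pderiv_mult[OF \<phi> \<phi> i x]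
    by (simp add: algebra_simps power2_eq_square)
  then show ?thesis unfolding grad_inner_def sum_distrib_left sum.distrib[symmetric] by (intro sum.cong) auto
qed

lemma annulus_subset_shell: "annulus n c d \<subseteq> shell n c d"
  by (rule subsetI) (simp add: annulus_def shell_def)

lemma carleman_exps_pos: "l \<in> carleman_exps n \<Longrightarrow> l > 0" by (simp add: carleman_exps_def)

lemma eLnorm_le_ennreal_Lnorm: "eLnorm n q S f < \<infinity> \<Longrightarrow> eLnorm n q S f \<le> ennreal (Lnorm n q S f)"
  by (simp add: less_top)

text \<open>\<open>U\<close> and \<open>W\<close> stand for the solution and the potential, translated and extended by zero from the
  ball of radius \<open>R\<close>; \<open>D\<close> and \<open>H\<close> are the first and the pure second weak derivatives of \<open>U\<close>.\<close>

locale weak_solution =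
  fixes n :: nat and \<theta> \<sigma> \<kappa> R :: real and U W :: "point \<Rightarrow> real" and D H :: "nat \<Rightarrow> point \<Rightarrow> real"
  assumes n3: "n \<ge> 3" and carl: "carleman_const n \<theta>" and R: "R > 0"
    and Um[measurable]: "U \<in> borel_measurable (leb n)" and Wm[measurable]: "W \<in> borel_measurable (leb n)"
    and U0: "\<And>x. x \<in> pts n \<Longrightarrow> nnorm n x \<ge> R \<Longrightarrow> U x = 0" and Up: "eLnorm n (exp_p n) UNIV U < \<infinity>"
    and Dw: "\<And>i. i < n \<Longrightarrow> has_weak_deriv n (nball n (origin n) R) [i] U (D i)"
    and Dm: "\<And>i. i < n \<Longrightarrow> D i \<in> borel_measurable (leb n)"
    and D0: "\<And>i x. i < n \<Longrightarrow> x \<in> pts n \<Longrightarrow> nnorm n x \<ge> R \<Longrightarrow> D i x = 0"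
    and Dp: "\<And>i. i < n \<Longrightarrow> eLnorm n (exp_p n) UNIV (D i) < \<infinity>"
    and Hw: "\<And>i. i < n \<Longrightarrow> has_weak_deriv n (nball n (origin n) R) [i, i] U (H i)"
    and Hm: "\<And>i. i < n \<Longrightarrow> H i \<in> borel_measurable (leb n)"
    and H0: "\<And>i x. i < n \<Longrightarrow> x \<in> pts n \<Longrightarrow> nnorm n x \<ge> R \<Longrightarrow> H i x = 0"
    and Hp: "\<And>i. i < n \<Longrightarrow> eLnorm n (exp_p n) UNIV (H i) < \<infinity>"
    and eq: "AE x in leb n. nnorm n x < R \<longrightarrow> (\<Sum>i<n. H i x) = W x * U x"
    and \<kappa>: "\<kappa> \<ge> 0" "eLnorm n (real n / 2) UNIV W \<le> ennreal \<kappa>" "\<theta> * \<kappa> < 1" "2 * \<sigma>\<^sup>2 * \<kappa> < 1"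
    and \<sigma>: "\<sigma> \<ge> 0" "\<And>w. w \<in> test_fun n (nball n (origin n) R) \<Longrightarrow> eLnorm n (exp_p' n) UNIV w \<le> ennreal \<sigma> * eLnorm n 2 UNIV (grad_len n w)"
begin

abbreviation "p \<equiv> exp_p n"
abbreviation "p' \<equiv> exp_p' n"

lemma p: "p > 1" "p' > 2" "p > 0" "p' > 0" "p \<ge> 1" "p' \<ge> 1"
  using exp_p_props[OF n3] by auto

text \<open>\<open>|f|\<close> is at most \<open>1 + |f| powr p\<close>, and the constant is needed
  on a bounded set only.\<close>

lemma integrable_of_Lp:
  assumes m: "f \<in> borel_measurable (leb n)" and z: "\<And>x. x \<in> pts n \<Longrightarrow> nnorm n x \<ge> R \<Longrightarrow> f x = 0"
    and fp: "eLnorm n p UNIV f < \<infinity>"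
  shows "integrable (leb n) f"
proof (rule integrableI_bounded[OF m])
  let ?B = "shell n 0 R"
  have "(\<integral>\<^sup>+x. ennreal (norm (f x)) \<partial>leb n) \<le> (\<integral>\<^sup>+x. indicator ?B x + ennreal (\<bar>f x\<bar> powr p) \<partial>leb n)"
  proof (rule nn_integral_mono)
    fix x assume x: "x \<in> space (leb n)"
    show "ennreal (norm (f x)) \<le> indicator ?B x + ennreal (\<bar>f x\<bar> powr p)"
    proof (cases "\<bar>f x\<bar> \<le> 1")
      case True
      show ?thesis
      proof (cases "x \<in> ?B")
        case True
        have "ennreal (norm (f x)) \<le> 1" using \<open>\<bar>f x\<bar> \<le> 1\<close> by simp
        also have "\<dots> \<le> indicator ?B x + ennreal (\<bar>f x\<bar> powr p)" using True by simp
        finally show ?thesis .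
      next
        case False
        then have "nnorm n x \<ge> R" using x by (simp add: shell_def)
        then show ?thesis using z x by simp
      qed
    next
      case False
      then have "\<bar>f x\<bar> powr 1 \<le> \<bar>f x\<bar> powr p" using p by (intro powr_mono) auto
      then have "ennreal (norm (f x)) \<le> ennreal (\<bar>f x\<bar> powr p)" by (intro ennreal_leI) simp
      then show ?thesis by (simp add: add_increasing)
    qed
  qed
  also have "\<dots> = emeasure (leb n) ?B + (\<integral>\<^sup>+x. ennreal (\<bar>f x\<bar> powr p) \<partial>leb n)"
    using m by (subst nn_integral_add) auto
  also have "\<dots> < \<infinity>"
    using fp compactin_emeasure_finite[OF compactin_shell, of n 0 R] unfolding eLnorm_finite_iff by simp
  finally show "(\<integral>\<^sup>+x. ennreal (norm (f x)) \<partial>leb n) < \<infinity>" .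
qed

lemma integrable_U: "integrable (leb n) U" by (rule integrable_of_Lp[OF Um U0 Up])
lemma integrable_D: "i < n \<Longrightarrow> integrable (leb n) (D i)" by (rule integrable_of_Lp[OF Dm D0 Dp])
lemma integrable_H: "i < n \<Longrightarrow> integrable (leb n) (H i)" by (rule integrable_of_Lp[OF Hm H0 Hp])

definition v :: "nat \<Rightarrow> point \<Rightarrow> real" where "v k = mollify n k U"

lemma smooth_v: "smooth n (v k)" unfolding v_def by (rule smooth_mollify[OF integrable_U])
lemma v_measurable [measurable]: "v k \<in> borel_measurable (leb n)" by (rule smooth_measurable[OF smooth_v])
lemma lap_v_measurable [measurable]: "lap n (v k) \<in> borel_measurable (leb n)" by (rule smooth_measurable[OF smooth_lap[OF smooth_v]])
lemma grad_len_v_measurable [measurable]: "grad_len n (v k) \<in> borel_measurable (leb n)" by (rule measurable_grad_len[OF smooth_v])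
lemma pderiv_v_measurable: "i < n \<Longrightarrow> pderiv_at i (v k) \<in> borel_measurable (leb n)" by (rule smooth_measurable[OF smooth_pderiv[OF smooth_v]])

lemma shell_nested:
  assumes "x \<in> shell n a d" "a' \<le> a - real n * e" "d + real n * e \<le> d'"
  shows "closed_box n x e \<subseteq> shell n a' d'"
proof
  fix y assume y: "y \<in> closed_box n x e"
  then show "y \<in> shell n a' d'" using nnorm_diff_closed_box[OF y] assms by (auto simp: shell_def closed_box_iff abs_le_iff)
qed

lemma tendsto_global:
  assumes "integrable (leb n) f" "eLnorm n p UNIV f < \<infinity>"
  shows "(\<lambda>k. eLnorm n p S (\<lambda>x. mollify n k f x - f x)) \<longlonglongrightarrow> 0"
  by (rule tendsto_sandwich[OF _ _ tendsto_const mollify_tendsto[OF p(5) assms]])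
    (use p in \<open>auto intro!: always_eventually eLnorm_subset_le\<close>)

lemma v_tendsto: "(\<lambda>k. eLnorm n p S (\<lambda>x. v k x - U x)) \<longlonglongrightarrow> 0"
  unfolding v_def by (rule tendsto_global[OF integrable_U Up])

lemma v_tendsto_q:
  assumes q: "q \<ge> 1" and r: "a' < a" "d < d'" and f: "eLnorm n q (shell n a' d') U < \<infinity>"
  shows "(\<lambda>k. eLnorm n q (shell n a d) (\<lambda>x. v k x - U x)) \<longlonglongrightarrow> 0"
  unfolding v_def
proof (rule mollify_local_tendsto[OF q integrable_U shell_sets f])
  let ?e = "min (a - a') (d' - d) / real n"
  show "?e > 0" using r n3 by simp
  fix x assume x: "x \<in> pts n" "x \<in> shell n a d"
  have e: "real n * ?e = min (a - a') (d' - d)" using n3 by simp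
  show "closed_box n x ?e \<subseteq> shell n a' d'" by (rule shell_nested[OF x(2)]; unfold e; linarith)
qed

text \<open>\<open>D\<close> and \<open>H\<close> are derivatives of \<open>U\<close> on the open
  ball only, as extension by zero may create jumps at its boundary; mollification commutes with them
  at points whose averaging cube stays inside.\<close>

lemma eventually_closed_box_ball:
  assumes "d < R"
  shows "\<forall>\<^sub>F k in sequentially. \<forall>x\<in>shell n a d. closed_box n x (1 / (real k + 1)) \<subseteq> nball n (origin n) R"
proof -
  have "(R - d) / (2 * real n) > 0" using assms n3 by simp
  from eventually_scale_le[OF this] show ?thesis
  proof eventually_elim
    case (elim k)
    show ?case
    proof (intro ballI subsetI)
      fix x y assume x: "x \<in> shell n a d" and y: "y \<in> closed_box n x (1 / (real k + 1))"
      have "real n * (1 / (real k + 1)) \<le> real n * ((R - d) / (2 * real n))" by (intro mult_left_mono elim) simp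
      also have "\<dots> = (R - d) / 2" using n3 by simp
      finally have "real n * (1 / (real k + 1)) \<le> (R - d) / 2" .
      moreover have "nnorm n x \<le> d" using x by (simp add: shell_def)
      moreover have "nnorm n y - nnorm n x \<le> (R - d) / 2"
        by (rule order_trans[OF abs_ge_self order_trans[OF nnorm_diff_closed_box[OF y]]]) fact
      ultimately have "nnorm n y < R" using assms by (simp add: field_simps)
      then show "y \<in> nball n (origin n) R" using y by (auto simp: nball_origin closed_box_iff)
    qed
  qed
qed

lemma pderiv_v_tendsto:
  assumes i: "i < n" and d: "d < R"
  shows "(\<lambda>k. eLnorm n p (shell n a d) (\<lambda>x. pderiv_at i (v k) x - D i x)) \<longlonglongrightarrow> 0"
proof (rule Lim_transform_eventually[OF tendsto_global[OF integrable_D[OF i] Dp[OF i]]])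
  show "\<forall>\<^sub>F k in sequentially. eLnorm n p (shell n a d) (\<lambda>x. mollify n k (D i) x - D i x) = eLnorm n p (shell n a d) (\<lambda>x. pderiv_at i (v k) x - D i x)"
    using eventually_closed_box_ball[OF d, of a]
    by eventually_elim (auto intro!: eLnorm_cong simp: v_def smooth_pderiv_mollify[OF integrable_U i Dw[OF i]])
qed

text \<open>The pure second derivatives are mollified separately and converge to \<open>H i\<close>;
  the equation is used only for the sum of the limits, so that \<open>W\<close> is never
  mollified.\<close>

lemma lap_v_tendsto:
  assumes d: "d < R"
  shows "(\<lambda>k. eLnorm n p (shell n a d) (\<lambda>x. lap n (v k) x - W x * U x)) \<longlonglongrightarrow> 0"
proof -
  have Hmm: "mollify n k (H i) \<in> borel_measurable (leb n)" if "i < n" for i k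
    by (rule smooth_measurable[OF smooth_mollify[OF integrable_H[OF that]]])
  have L: "(\<lambda>k. \<Sum>i<n. eLnorm n p (shell n a d) (\<lambda>x. mollify n k (H i) x - H i x)) \<longlonglongrightarrow> (\<Sum>i<n. 0)"
    by (intro tendsto_sum tendsto_global integrable_H Hp) auto
  have "\<forall>\<^sub>F k in sequentially. eLnorm n p (shell n a d) (\<lambda>x. lap n (v k) x - W x * U x) \<le> (\<Sum>i<n. eLnorm n p (shell n a d) (\<lambda>x. mollify n k (H i) x - H i x))"
    using eventually_closed_box_ball[OF d, of a]
  proof eventually_elim
    case (elim k)
    have "eLnorm n p (shell n a d) (\<lambda>x. lap n (v k) x - W x * U x) = eLnorm n p (shell n a d) (\<lambda>x. \<Sum>i<n. mollify n k (H i) x - H i x)"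
    proof (rule eLnorm_cong_AE)
      show "AE x in leb n. x \<in> shell n a d \<longrightarrow> \<bar>lap n (v k) x - W x * U x\<bar> = \<bar>\<Sum>i<n. mollify n k (H i) x - H i x\<bar>"
        using eq
      proof (eventually_elim, intro impI)
        fix x assume e: "nnorm n x < R \<longrightarrow> (\<Sum>i<n. H i x) = W x * U x" and x: "x \<in> shell n a d"
        have "nnorm n x < R" using x d by (simp add: shell_def)
        moreover have "lap n (v k) x = (\<Sum>i<n. mollify n k (H i) x)"
          unfolding lap_def v_def by (rule sum.cong[OF refl], rule smooth_pderiv2_mollify[OF integrable_U _ Hw]) (use elim x in auto)
        ultimately show "\<bar>lap n (v k) x - W x * U x\<bar> = \<bar>\<Sum>i<n. mollify n k (H i) x - H i x\<bar>"
          using e by (simp add: sum_subtractf)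
      qed
    qed
    also have "\<dots> \<le> (\<Sum>i<n. eLnorm n p (shell n a d) (\<lambda>x. mollify n k (H i) x - H i x))"
      by (rule eLnorm_sum_le) (use p Hm Hmm in auto)
    finally show ?case .
  qed
  moreover have "(\<lambda>k. \<Sum>i<n. eLnorm n p (shell n a d) (\<lambda>x. mollify n k (H i) x - H i x)) \<longlonglongrightarrow> 0" using L by simp
  ultimately show ?thesis by (rule tendsto_sandwich[OF _ _ tendsto_const, rotated]) simp
qed

end

section \<open>Ring-shaped cutoffs\<close>

lemma grad_len_diff_le:
  assumes "smooth n f" "smooth n g" "x \<in> pts n"
  shows "grad_len n (\<lambda>x. f x - g x) x \<le> grad_len n f x + grad_len n g x"
proof -
  have "grad_len n (\<lambda>x. f x - g x) x = L2_set (\<lambda>i. pderiv_at i f x + - pderiv_at i g x) {..<n}"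
    unfolding grad_len_def by (rule L2_set_cong) (use assms pderiv_diff in auto)
  also have "\<dots> \<le> L2_set (\<lambda>i. pderiv_at i f x) {..<n} + L2_set (\<lambda>i. - pderiv_at i g x) {..<n}"
    by (rule L2_set_triangle_ineq)
  finally show ?thesis by (simp add: grad_len_def L2_set_def)
qed

text \<open>A difference of two radial cutoffs, with transitions between \<open>a\<close> and
  \<open>b\<close> and between \<open>c\<close> and \<open>d\<close>. By linearity its commutator is
  the difference of theirs, and the two transition zones can be estimated separately.\<close>

definition ring_cut :: "nat \<Rightarrow> real \<Rightarrow> real \<Rightarrow> real \<Rightarrow> real \<Rightarrow> point \<Rightarrow> real" where
  "ring_cut n a b c d x = cut n a b x - cut n c d x"

lemma smooth_ring_cut: "smooth n (ring_cut n a b c d)"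
  unfolding ring_cut_def[abs_def] by (intro smooth_diff smooth_cut)

context
  fixes a b c d :: real assumes abcd: "0 \<le> a" "a < b" "b \<le> c" "c < d"
begin

lemma ring_cut_outside: "nnorm n x \<le> a \<or> d \<le> nnorm n x \<Longrightarrow> ring_cut n a b c d x = 0"
  using abcd by (auto simp: ring_cut_def cut_0 cut_1)

lemma ring_cut_inside: "b \<le> nnorm n x \<Longrightarrow> nnorm n x \<le> c \<Longrightarrow> ring_cut n a b c d x = 1"
  using abcd by (simp add: ring_cut_def cut_0 cut_1)

lemma abs_ring_cut_le: "\<bar>ring_cut n a b c d x\<bar> \<le> 1"
  using cut_range[of n a b x] cut_range[of n c d x] by (simp add: ring_cut_def abs_le_iff)

lemma grad_len_ring_cut_le:
  assumes "x \<in> pts n"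
  shows "grad_len n (ring_cut n a b c d) x \<le> 2 * step_bound * b / (b\<^sup>2 - a\<^sup>2) + 2 * step_bound * d / (d\<^sup>2 - c\<^sup>2)"
proof -
  have "grad_len n (ring_cut n a b c d) x \<le> grad_len n (cut n a b) x + grad_len n (cut n c d) x"
    unfolding ring_cut_def[abs_def] by (rule grad_len_diff_le[OF smooth_cut smooth_cut assms])
  also have "\<dots> \<le> 2 * step_bound * b / (b\<^sup>2 - a\<^sup>2) + 2 * step_bound * d / (d\<^sup>2 - c\<^sup>2)"
    by (intro add_mono grad_len_cut_le assms) (use abcd in auto)
  finally show ?thesis .
qed

lemma grad_len_ring_cut_outside:
  assumes "x \<in> pts n" "nnorm n x \<le> a \<or> d \<le> nnorm n x \<or> b \<le> nnorm n x \<and> nnorm n x \<le> c"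
  shows "grad_len n (ring_cut n a b c d) x = 0"
proof -
  have "grad_len n (ring_cut n a b c d) x \<le> grad_len n (cut n a b) x + grad_len n (cut n c d) x"
    unfolding ring_cut_def[abs_def] by (rule grad_len_diff_le[OF smooth_cut smooth_cut assms(1)])
  moreover have "grad_len n (cut n a b) x = 0"
  proof (rule grad_len_cut_outside(1)[OF abcd(1,2) assms(1)])
    show "\<not> (a < nnorm n x \<and> nnorm n x < b)" using assms(2) abcd by linarith
  qed
  moreover have "grad_len n (cut n c d) x = 0"
  proof (rule grad_len_cut_outside(1)[OF _ abcd(4) assms(1)])
    show "0 \<le> c" using abcd by linarith
    show "\<not> (c < nnorm n x \<and> nnorm n x < d)" using assms(2) abcd by linarith
  qed
  ultimately show ?thesis using grad_len_nonneg[of n "ring_cut n a b c d" x] by linarith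
qed

lemma lap_ring_cut_bounded: "\<exists>C\<ge>0. \<forall>x\<in>pts n. \<bar>lap n (ring_cut n a b c d) x\<bar> \<le> C"
proof -
  define C1 where "C1 = 4 * step_bound * b\<^sup>2 / (b\<^sup>2 - a\<^sup>2)\<^sup>2 + 2 * real n * step_bound / (b\<^sup>2 - a\<^sup>2)"
  define C2 where "C2 = 4 * step_bound * d\<^sup>2 / (d\<^sup>2 - c\<^sup>2)\<^sup>2 + 2 * real n * step_bound / (d\<^sup>2 - c\<^sup>2)"
  have "\<bar>lap n (ring_cut n a b c d) x\<bar> \<le> C1 + C2" if x: "x \<in> pts n" for x
  proof -
    have "lap n (ring_cut n a b c d) x = lap n (cut n a b) x - lap n (cut n c d) x"
      unfolding ring_cut_def[abs_def] by (rule lap_diff[OF smooth_cut smooth_cut x])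
    moreover have "\<bar>lap n (cut n a b) x\<bar> \<le> C1" unfolding C1_def by (rule lap_cut_le) (use abcd x in auto)
    moreover have "\<bar>lap n (cut n c d) x\<bar> \<le> C2" unfolding C2_def by (rule lap_cut_le) (use abcd x in auto)
    ultimately show ?thesis by linarith
  qed
  then show ?thesis by (intro exI[of _ "\<bar>C1 + C2\<bar>"]) fastforce
qed

end

lemma pderiv_const_mult_inside:
  assumes f: "smooth n f" and v: "smooth n v" and x: "x \<in> pts n" and g: "grad_len n f x = 0" and one: "f x = 1"
  shows "grad_len n (\<lambda>x. f x * v x) x = grad_len n v x"
proof -
  have "pderiv_at i (\<lambda>x. f x * v x) x = pderiv_at i v x" if i: "i < n" for i
    using pderiv_mult[OF f v i x] abs_pderiv_le_grad_len[OF i, of f x] g one by simp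
  then show ?thesis unfolding grad_len_def by (intro L2_set_cong) auto
qed

text \<open>These exponents lie halfway between consecutive points of the excluded
  progression.\<close>

lemma carleman_exps_mem:
  assumes n3: "n \<ge> 3"
  shows "(real n - 1) / 2 + real m \<in> carleman_exps n"
proof -
  let ?l = "(real n - 1) / 2 + real m"
  have "infdist ?l (range (\<lambda>m::nat. real m + (real n - 2) / 2)) = 1 / 2"
  proof (rule antisym)
    have "infdist ?l (range (\<lambda>m::nat. real m + (real n - 2) / 2)) \<le> dist ?l (real m + (real n - 2) / 2)"
      by (rule infdist_le) blast
    also have "\<dots> = 1 / 2" by (simp add: dist_real_def diff_divide_distrib)
    finally show "infdist ?l (range (\<lambda>m::nat. real m + (real n - 2) / 2)) \<le> 1 / 2" .
    show "1 / 2 \<le> infdist ?l (range (\<lambda>m::nat. real m + (real n - 2) / 2))"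
    proof (subst infdist_notempty, simp, rule cINF_greatest)
      fix y assume "y \<in> range (\<lambda>m::nat. real m + (real n - 2) / 2)"
      then obtain j :: nat where j: "y = real j + (real n - 2) / 2" by blast
      have "1 / 2 \<le> \<bar>1 / 2 + real m - real j\<bar>"
      proof (cases "j \<le> m")
        case False
        then have "real j \<ge> real m + 1" by linarith
        then show ?thesis by linarith
      qed simp
      then show "1 / 2 \<le> dist ?l y" by (simp add: j dist_real_def diff_divide_distrib algebra_simps)
    qed simp
  qed
  moreover have "?l > 0" using n3 by (intro add_pos_nonneg) auto
  ultimately show ?thesis unfolding carleman_exps_def by blast
qed

section \<open>Integrability of the solution away from the centre\<close>

context weak_solution
begin

text \<open>The commutator of the Laplacian with \<open>\<psi>\<close>, applied to \<open>v k\<close>.\<close>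

definition comm_lap :: "(point \<Rightarrow> real) \<Rightarrow> nat \<Rightarrow> point \<Rightarrow> real" where
  "comm_lap \<psi> k x = 2 * grad_inner n \<psi> (v k) x + v k x * lap n \<psi> x"

abbreviation weight :: "real \<Rightarrow> point \<Rightarrow> real" where "weight l x \<equiv> nnorm n x powr (- l)"

lemma weight_measurable [measurable]: "weight l \<in> borel_measurable (leb n)" by measurable

lemma comm_lap_measurable [measurable]: "smooth n \<psi> \<Longrightarrow> comm_lap \<psi> k \<in> borel_measurable (leb n)"
  unfolding comm_lap_def[abs_def]
  by (intro borel_measurable_add borel_measurable_times borel_measurable_const smooth_measurable smooth_grad_inner smooth_lap smooth_v)

lemma weight_le: "l > 0 \<Longrightarrow> 0 < a \<Longrightarrow> a \<le> nnorm n x \<Longrightarrow> weight l x \<le> a powr (- l)"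
  by (simp add: powr_minus le_imp_inverse_le powr_mono2)

lemma theta_pos: "\<theta> \<ge> 1" using carl by (simp add: carleman_const_def)

lemma test_of_shell:
  assumes "smooth n \<phi>" "\<And>x. x \<in> pts n \<Longrightarrow> x \<notin> shell n a d \<Longrightarrow> \<phi> x = 0"
  shows "0 < a \<Longrightarrow> \<phi> \<in> test_fun n (pts n - {origin n})" "d < R \<Longrightarrow> \<phi> \<in> test_fun n (nball n (origin n) R)"
proof -
  have o: "nnorm n (origin n) = 0" by (simp add: nnorm_def L2_set_def)
  have T: "\<phi> \<in> test_fun n \<Omega>" if "shell n a d \<subseteq> \<Omega>" for \<Omega>
    unfolding test_fun_def
  proof (intro CollectI conjI exI[of _ "shell n a d"] ballI)
    show "\<phi> x = 0" if "x \<in> pts n - shell n a d" for x using assms(2) that by simp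
  qed (rule assms(1) compactin_shell that)+
  show "\<phi> \<in> test_fun n (pts n - {origin n})" if "0 < a"
  proof (rule T, rule subsetI)
    fix x assume x: "x \<in> shell n a d"
    then have "nnorm n x \<ge> a" by (simp add: shell_def)
    then have "x \<noteq> origin n" using o that by auto
    then show "x \<in> pts n - {origin n}" using x by (simp add: shell_def)
  qed
  show "\<phi> \<in> test_fun n (nball n (origin n) R)" if "d < R"
  proof (rule T, rule subsetI)
    fix x assume x: "x \<in> shell n a d"
    then show "x \<in> nball n (origin n) R" using that by (simp add: shell_def nball_origin)
  qed
qed

lemma carleman_v:
  assumes l: "l \<in> carleman_exps n" and \<psi>: "smooth n \<psi>" "\<And>x. x \<in> pts n \<Longrightarrow> x \<notin> shell n a d \<Longrightarrow> \<psi> x = 0" and a: "0 < a"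
  shows "eLnorm n p' UNIV (\<lambda>x. weight l x * (\<psi> x * v k x)) \<le> ennreal \<theta> * eLnorm n p UNIV (\<lambda>x. weight l x * (\<psi> x * lap n (v k) x + comm_lap \<psi> k x))"
proof -
  have "(\<lambda>x. \<psi> x * v k x) \<in> test_fun n (pts n - {origin n})"
    by (rule test_fun_mult(2)[OF smooth_v test_of_shell(1)[OF \<psi> a]])
  then have "eLnorm n p' UNIV (\<lambda>x. weight l x * (\<psi> x * v k x)) \<le> ennreal \<theta> * eLnorm n p UNIV (\<lambda>x. weight l x * lap n (\<lambda>x. \<psi> x * v k x) x)"
    by (rule carleman_test[OF n3 carl l])
  also have "eLnorm n p UNIV (\<lambda>x. weight l x * lap n (\<lambda>x. \<psi> x * v k x) x) = eLnorm n p UNIV (\<lambda>x. weight l x * (\<psi> x * lap n (v k) x + comm_lap \<psi> k x))"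
    by (rule eLnorm_cong) (simp add: lap_mult[OF \<psi>(1) smooth_v] comm_lap_def add.assoc)
  finally show ?thesis .
qed

lemma comm_lap_zero_outside:
  assumes \<psi>: "smooth n \<psi>" "\<And>x. x \<in> pts n \<Longrightarrow> x \<notin> K \<Longrightarrow> \<psi> x = 0" and K: "compactin (euc n) K" and x: "x \<in> pts n" "x \<notin> K"
  shows "comm_lap \<psi> k x = 0"
proof -
  have z: "pderiv_at i \<psi> y = 0" if "i < n" "y \<in> pts n" "y \<notin> K" for i y
    by (rule pderiv_zero_outside[OF K \<psi>(2) that])
  then have "grad_inner n \<psi> (v k) x = 0" using x by (simp add: grad_inner_def)
  moreover have "lap n \<psi> x = 0" unfolding lap_def
    by (rule sum.neutral) (use pderiv_zero_outside[OF K z] x in auto)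
  ultimately show ?thesis by (simp add: comm_lap_def)
qed

text \<open>The Carleman inequality itself gives local integrability to the power \<open>p'\<close> away from the origin.\<close>

lemma regularity:
  assumes a: "0 < a" "a \<le> d" "d < R"
  shows "eLnorm n p' (shell n a d) U < \<infinity>"
proof -
  \<comment> \<open>Any admissible exponent would do; on a shell the weight is bounded above and
    below.\<close>
  define l where "l = (real n - 1) / 2 + real 0"
  have l: "l \<in> carleman_exps n" unfolding l_def by (rule carleman_exps_mem[OF n3])
  have lp: "l > 0" by (rule carleman_exps_pos[OF l])
  \<comment> \<open>The radii of a larger shell, still away from the origin and inside the ball,
    which leaves room for the cutoff on both sides.\<close>
  define a1 where "a1 = a / 2"
  define d1 where "d1 = (d + R) / 2"
  have r: "0 < a1" "a1 < a" "d < d1" "d1 < R" using a by (auto simp: a1_def d1_def)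
  have abcd: "0 \<le> a1" "a1 < a" "a \<le> d" "d < d1" using r a by auto
  define \<psi> where "\<psi> = ring_cut n a1 a d d1"
  let ?S1 = "shell n a1 d1"
  have \<psi>: "smooth n \<psi>" "\<And>x. x \<in> pts n \<Longrightarrow> x \<notin> ?S1 \<Longrightarrow> \<psi> x = 0" "\<And>x. \<bar>\<psi> x\<bar> \<le> 1"
    using ring_cut_outside[OF abcd] by (auto simp: \<psi>_def smooth_ring_cut abs_ring_cut_le[OF abcd] shell_def not_le less_imp_le)
  define C1 where "C1 = 2 * step_bound * a / (a\<^sup>2 - a1\<^sup>2) + 2 * step_bound * d1 / (d1\<^sup>2 - d\<^sup>2)"
  have C1: "grad_len n \<psi> x \<le> C1" if "x \<in> pts n" for x unfolding \<psi>_def C1_def by (rule grad_len_ring_cut_le[OF abcd that])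
  have C1n: "C1 \<ge> 0" using C1[OF origin_in_pts] grad_len_nonneg[of n \<psi> "origin n"] by linarith
  obtain C2 where C2: "C2 \<ge> 0" "\<And>x. x \<in> pts n \<Longrightarrow> \<bar>lap n \<psi> x\<bar> \<le> C2"
    using lap_ring_cut_bounded[OF abcd, of n] unfolding \<psi>_def by blast
  have fin: "eLnorm n p ?S1 f < \<infinity>" if "eLnorm n p UNIV f < \<infinity>" for f
    using eLnorm_subset_le[of p ?S1 UNIV n f] that p by (simp add: le_less_trans)
  have WUm: "(\<lambda>x. W x * U x) \<in> borel_measurable (leb n)" by measurable
  \<comment> \<open>By the equation \<open>W * U\<close> is a sum of second derivatives and so has
    exponent \<open>p\<close>; Hoelder's inequality would presuppose the exponent \<open>p'\<close>
    for \<open>U\<close> that is being proved.\<close>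
  have fWU: "eLnorm n p ?S1 (\<lambda>x. W x * U x) < \<infinity>"
  proof -
    have "eLnorm n p ?S1 (\<lambda>x. W x * U x) = eLnorm n p ?S1 (\<lambda>x. \<Sum>i<n. H i x)"
      by (rule eLnorm_cong_AE) (use eq in \<open>eventually_elim, use r in \<open>auto simp: shell_def\<close>\<close>)
    also have "\<dots> \<le> (\<Sum>i<n. eLnorm n p ?S1 (H i))" by (rule eLnorm_sum_le) (use p Hm in auto)
    also have "\<dots> < \<infinity>" unfolding infinity_ennreal_def by (subst ennreal_sum_less_top) (use fin[OF Hp] in auto)
    finally show ?thesis .
  qed
  define cU where "cU = Lnorm n p ?S1 U + 1"
  define cW where "cW = Lnorm n p ?S1 (\<lambda>x. W x * U x) + 1"
  define cD where "cD i = Lnorm n p ?S1 (D i) + 1" for i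
  have evU: "\<forall>\<^sub>F k in sequentially. eLnorm n p ?S1 (v k) \<le> ennreal cU" unfolding cU_def
    by (rule eventually_eLnorm_le[OF p(5) v_measurable Um shell_sets v_tendsto eLnorm_le_ennreal_Lnorm[OF fin[OF Up]]]) auto
  have evW: "\<forall>\<^sub>F k in sequentially. eLnorm n p ?S1 (lap n (v k)) \<le> ennreal cW" unfolding cW_def
    by (rule eventually_eLnorm_le[OF p(5) lap_v_measurable WUm shell_sets lap_v_tendsto[OF r(4)] eLnorm_le_ennreal_Lnorm[OF fWU]]) auto
  have evD: "\<forall>\<^sub>F k in sequentially. \<forall>i\<in>{..<n}. eLnorm n p ?S1 (pderiv_at i (v k)) \<le> ennreal (cD i)"
  proof (rule eventually_ball_finite, simp, intro ballI)
    fix i assume "i \<in> {..<n}"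
    then have i: "i < n" by simp
    show "\<forall>\<^sub>F k in sequentially. eLnorm n p ?S1 (pderiv_at i (v k)) \<le> ennreal (cD i)" unfolding cD_def
      by (rule eventually_eLnorm_le[OF p(5) pderiv_v_measurable[OF i] Dm[OF i] shell_sets pderiv_v_tendsto[OF i r(4)] eLnorm_le_ennreal_Lnorm[OF fin[OF Dp[OF i]]]]) auto
  qed
  define M where "M = a1 powr (- l) * (cW + (2 * C1 * (\<Sum>i<n. cD i) + C2 * cU))"
  have cpos: "cU \<ge> 0" "cW \<ge> 0" "cD i \<ge> 0" for i by (auto simp: cU_def cW_def cD_def)
  have M: "M \<ge> 0" unfolding M_def using C1n C2 cpos by (auto intro!: mult_nonneg_nonneg add_nonneg_nonneg sum_nonneg)
  have ev: "\<forall>\<^sub>F k in sequentially. eLnorm n p' (shell n a d) (v k) \<le> ennreal (d powr l * (\<theta> * M))"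
    using evU evW evD
  proof eventually_elim
    case (elim k)
    let ?h = "\<lambda>x. \<bar>lap n (v k) x\<bar> + (2 * C1 * (\<Sum>i<n. \<bar>pderiv_at i (v k) x\<bar>) + C2 * \<bar>v k x\<bar>)"
    have pm: "(\<lambda>x. \<Sum>i<n. \<bar>pderiv_at i (v k) x\<bar>) \<in> borel_measurable (leb n)"
      by (intro borel_measurable_sum borel_measurable_abs pderiv_v_measurable) simp
    have hm: "?h \<in> borel_measurable (leb n)" using pm by measurable
    have "eLnorm n p UNIV (\<lambda>x. weight l x * (\<psi> x * lap n (v k) x + comm_lap \<psi> k x)) = eLnorm n p ?S1 (\<lambda>x. weight l x * (\<psi> x * lap n (v k) x + comm_lap \<psi> k x))"
      by (rule eLnorm_UNIV_eq[symmetric]) (simp add: \<psi>(2) comm_lap_zero_outside[OF \<psi>(1,2) compactin_shell])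
    also have "\<dots> \<le> ennreal (a1 powr (- l)) * eLnorm n p ?S1 ?h"
    proof (rule eLnorm_bound_mult[OF p(3) hm shell_sets])
      fix x assume x: "x \<in> pts n" "x \<in> ?S1"
      have "\<bar>grad_inner n \<psi> (v k) x\<bar> \<le> C1 * (\<Sum>i<n. \<bar>pderiv_at i (v k) x\<bar>)"
        by (rule order_trans[OF abs_grad_inner_le]) (use C1[OF x(1)] C1n grad_len_le_sum in \<open>auto intro!: mult_mono\<close>)
      moreover have "\<bar>v k x * lap n \<psi> x\<bar> \<le> C2 * \<bar>v k x\<bar>"
        using mult_right_mono[OF C2(2)[OF x(1)], of "\<bar>v k x\<bar>"] by (simp add: abs_mult mult.commute)
      moreover have "\<bar>\<psi> x * lap n (v k) x\<bar> \<le> \<bar>lap n (v k) x\<bar>"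
        using mult_right_mono[OF \<psi>(3)[of x], of "\<bar>lap n (v k) x\<bar>"] by (simp add: abs_mult)
      ultimately have "\<bar>\<psi> x * lap n (v k) x + comm_lap \<psi> k x\<bar> \<le> ?h x" unfolding comm_lap_def by (simp add: abs_le_iff)
      moreover have "weight l x \<le> a1 powr (- l)" by (rule weight_le) (use lp r x in \<open>auto simp: shell_def\<close>)
      ultimately have "weight l x * \<bar>\<psi> x * lap n (v k) x + comm_lap \<psi> k x\<bar> \<le> a1 powr (- l) * ?h x" by (intro mult_mono) auto
      also have "\<dots> \<le> a1 powr (- l) * \<bar>?h x\<bar>" by (intro mult_left_mono) auto
      finally show "\<bar>weight l x * (\<psi> x * lap n (v k) x + comm_lap \<psi> k x)\<bar> \<le> a1 powr (- l) * \<bar>?h x\<bar>" by (simp add: abs_mult)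
    qed simp
    also have "eLnorm n p ?S1 ?h \<le> ennreal (cW + (2 * C1 * (\<Sum>i<n. cD i) + C2 * cU))"
    proof -
      have "eLnorm n p ?S1 ?h \<le> eLnorm n p ?S1 (\<lambda>x. \<bar>lap n (v k) x\<bar>) + eLnorm n p ?S1 (\<lambda>x. 2 * C1 * (\<Sum>i<n. \<bar>pderiv_at i (v k) x\<bar>) + C2 * \<bar>v k x\<bar>)"
        by (rule eLnorm_triangle[OF p(5)]) (use pm in measurable)
      also have "\<dots> \<le> ennreal cW + ennreal (2 * C1 * (\<Sum>i<n. cD i) + C2 * cU)"
      proof (rule add_mono)
        have "eLnorm n p ?S1 (\<lambda>x. \<bar>lap n (v k) x\<bar>) = eLnorm n p ?S1 (lap n (v k))" by (rule eLnorm_cong) simp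
        then show "eLnorm n p ?S1 (\<lambda>x. \<bar>lap n (v k) x\<bar>) \<le> ennreal cW" using elim by simp
        have "eLnorm n p ?S1 (\<lambda>x. 2 * C1 * (\<Sum>i<n. \<bar>pderiv_at i (v k) x\<bar>) + C2 * \<bar>v k x\<bar>) \<le>
          eLnorm n p ?S1 (\<lambda>x. 2 * C1 * (\<Sum>i<n. \<bar>pderiv_at i (v k) x\<bar>)) + eLnorm n p ?S1 (\<lambda>x. C2 * \<bar>v k x\<bar>)"
          by (rule eLnorm_triangle[OF p(5)]) (use pm in measurable)
        also have "\<dots> \<le> ennreal \<bar>2 * C1\<bar> * eLnorm n p ?S1 (\<lambda>x. \<Sum>i<n. \<bar>pderiv_at i (v k) x\<bar>) + ennreal \<bar>C2\<bar> * eLnorm n p ?S1 (\<lambda>x. \<bar>v k x\<bar>)"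
          by (intro add_mono eLnorm_cmult_le p pm shell_sets borel_measurable_abs v_measurable)
        also have "eLnorm n p ?S1 (\<lambda>x. \<bar>v k x\<bar>) = eLnorm n p ?S1 (v k)" by (rule eLnorm_cong) simp
        also have "ennreal \<bar>2 * C1\<bar> * eLnorm n p ?S1 (\<lambda>x. \<Sum>i<n. \<bar>pderiv_at i (v k) x\<bar>) + ennreal \<bar>C2\<bar> * eLnorm n p ?S1 (v k)
          \<le> ennreal \<bar>2 * C1\<bar> * ennreal (\<Sum>i<n. cD i) + ennreal \<bar>C2\<bar> * ennreal cU"
        proof (intro add_mono mult_left_mono)
          have "eLnorm n p ?S1 (\<lambda>x. \<Sum>i<n. \<bar>pderiv_at i (v k) x\<bar>) \<le> (\<Sum>i<n. eLnorm n p ?S1 (\<lambda>x. \<bar>pderiv_at i (v k) x\<bar>))"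
            by (rule eLnorm_sum_le) (use p pderiv_v_measurable in auto)
          also have "\<dots> = (\<Sum>i<n. eLnorm n p ?S1 (pderiv_at i (v k)))" by (rule sum.cong[OF refl], rule eLnorm_cong) simp
          also have "\<dots> \<le> (\<Sum>i<n. ennreal (cD i))" by (rule sum_mono) (use elim in auto)
          also have "\<dots> = ennreal (\<Sum>i<n. cD i)" by (rule sum_ennreal) (rule cpos)
          finally show "eLnorm n p ?S1 (\<lambda>x. \<Sum>i<n. \<bar>pderiv_at i (v k) x\<bar>) \<le> ennreal (\<Sum>i<n. cD i)" .
        qed (use elim in auto)
        also have "\<dots> = ennreal (2 * C1 * (\<Sum>i<n. cD i) + C2 * cU)"
          using C1n C2(1) cpos by (simp add: ennreal_mult[symmetric] ennreal_plus[symmetric] sum_nonneg del: ennreal_plus)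
        finally show "eLnorm n p ?S1 (\<lambda>x. 2 * C1 * (\<Sum>i<n. \<bar>pderiv_at i (v k) x\<bar>) + C2 * \<bar>v k x\<bar>) \<le> ennreal (2 * C1 * (\<Sum>i<n. cD i) + C2 * cU)" .
      qed
      also have "\<dots> = ennreal (cW + (2 * C1 * (\<Sum>i<n. cD i) + C2 * cU))"
        using C1n C2(1) cpos by (intro ennreal_plus[symmetric] add_nonneg_nonneg mult_nonneg_nonneg sum_nonneg) auto
      finally show ?thesis .
    qed
    also have "ennreal (a1 powr (- l)) * ennreal (cW + (2 * C1 * (\<Sum>i<n. cD i) + C2 * cU)) = ennreal M"
      unfolding M_def using C1n C2(1) cpos
      by (intro ennreal_mult[symmetric] add_nonneg_nonneg mult_nonneg_nonneg sum_nonneg) auto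
    finally have b: "eLnorm n p UNIV (\<lambda>x. weight l x * (\<psi> x * lap n (v k) x + comm_lap \<psi> k x)) \<le> ennreal M"
      by (simp add: mult_left_mono)
    have mm: "(\<lambda>x. weight l x * (\<psi> x * v k x)) \<in> borel_measurable (leb n)" using smooth_measurable[OF \<psi>(1)] by measurable
    \<comment> \<open>On the shell the cutoff is one and the weight at least
      \<open>d powr (- l)\<close>, so both can be removed at the price of
      \<open>d powr l\<close>.\<close>
    have "eLnorm n p' (shell n a d) (v k) \<le> ennreal (d powr l) * eLnorm n p' (shell n a d) (\<lambda>x. weight l x * (\<psi> x * v k x))"
    proof (rule eLnorm_bound_mult[OF p(4) mm shell_sets])
      fix x assume x: "x \<in> pts n" "x \<in> shell n a d"
      then have nx: "nnorm n x > 0" "nnorm n x \<le> d" using a by (auto simp: shell_def)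
      have "\<psi> x = 1" unfolding \<psi>_def using x by (intro ring_cut_inside[OF abcd]) (auto simp: shell_def)
      moreover have "1 \<le> d powr l * weight l x"
      proof -
        have "nnorm n x powr l * weight l x = 1" using nx by (simp add: powr_minus)
        moreover have "nnorm n x powr l * weight l x \<le> d powr l * weight l x" using nx lp by (intro mult_right_mono powr_mono2) auto
        ultimately show ?thesis by simp
      qed
      then have "1 * \<bar>v k x\<bar> \<le> d powr l * weight l x * \<bar>v k x\<bar>" by (intro mult_right_mono) auto
      ultimately show "\<bar>v k x\<bar> \<le> d powr l * \<bar>weight l x * (\<psi> x * v k x)\<bar>" by (simp add: abs_mult mult.assoc)
    qed simp
    also have "\<dots> \<le> ennreal (d powr l) * (ennreal \<theta> * ennreal M)"
    proof (rule mult_left_mono)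
      have "eLnorm n p' (shell n a d) (\<lambda>x. weight l x * (\<psi> x * v k x)) \<le> eLnorm n p' UNIV (\<lambda>x. weight l x * (\<psi> x * v k x))"
        by (rule eLnorm_subset_le) (use p in auto)
      also have "\<dots> \<le> ennreal \<theta> * eLnorm n p UNIV (\<lambda>x. weight l x * (\<psi> x * lap n (v k) x + comm_lap \<psi> k x))"
        by (rule carleman_v[OF l \<psi>(1,2) r(1)])
      also have "\<dots> \<le> ennreal \<theta> * ennreal M" by (rule mult_left_mono[OF b]) simp
      finally show "eLnorm n p' (shell n a d) (\<lambda>x. weight l x * (\<psi> x * v k x)) \<le> ennreal \<theta> * ennreal M" .
    qed simp
    also have "\<dots> = ennreal (d powr l * (\<theta> * M))" using theta_pos M by (simp add: ennreal_mult)
    finally show ?case .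
  qed
  have "eLnorm n p' (shell n a d) U \<le> ennreal (d powr l * (\<theta> * M))"
    by (rule eLnorm_limit_le[OF p(3) p(4) _ v_measurable Um shell_sets v_tendsto ev]) (use theta_pos M in auto)
  then show ?thesis by (rule le_less_trans) simp
qed

lemma regularity2:
  assumes "0 < a" "a \<le> d" "d < R"
  shows "eLnorm n 2 (shell n a d) U < \<infinity>"
proof -
  have "eLnorm n 2 (shell n a d) U \<le> ennreal (2 * d) * eLnorm n p' (shell n a d) U"
    by (rule Holder_shell[OF _ _ _ _ _ Um shell_sets subset_refl regularity]) (use assms n3 p exp_p_props[OF n3] in auto)
  also have "\<dots> < \<infinity>" using regularity[OF assms] by (simp add: ennreal_mult_less_top)
  finally show ?thesis .
qed

end

section \<open>The Caccioppoli inequality\<close>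

lemma eLnorm_tendsto_subset:
  assumes "(\<lambda>k. eLnorm n q T (f k)) \<longlonglongrightarrow> 0" "q > 0" "S \<subseteq> T"
  shows "(\<lambda>k. eLnorm n q S (f k)) \<longlonglongrightarrow> 0"
  by (rule tendsto_sandwich[OF _ _ tendsto_const assms(1)]) (use assms in \<open>auto intro!: always_eventually eLnorm_subset_le\<close>)

lemma grad_inner_integrable: "smooth n f \<Longrightarrow> w \<in> test_fun n \<Omega> \<Longrightarrow> integrable (leb n) (grad_inner n f w)"
  unfolding grad_inner_def[abs_def]
  by (rule Bochner_Integration.integrable_sum, rule test_fun_integrable[OF test_fun_mult(1)[OF smooth_pderiv test_fun_pderiv]]) auto

lemma le_of_all_small:
  fixes T A B :: real
  assumes "\<And>\<delta>. \<delta> > 0 \<Longrightarrow> \<delta> \<le> 1 \<Longrightarrow> T \<le> A + B * \<delta>"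
  shows "T \<le> A"
proof (rule field_le_epsilon)
  fix e :: real assume e: "e > 0"
  define \<delta> where "\<delta> = min 1 (e / (\<bar>B\<bar> + 1))"
  have d: "\<delta> > 0" "\<delta> \<le> 1" using e by (auto simp: \<delta>_def)
  have "B * \<delta> \<le> \<bar>B\<bar> * \<delta>" using d by (intro mult_right_mono) auto
  also have "\<dots> \<le> (\<bar>B\<bar> + 1) * \<delta>" using d by (intro mult_right_mono) auto
  also have "\<dots> \<le> (\<bar>B\<bar> + 1) * (e / (\<bar>B\<bar> + 1))" by (intro mult_left_mono) (auto simp: \<delta>_def)
  also have "\<dots> = e" by (simp add: add_nonneg_eq_0_iff)
  finally show "T \<le> A + e" using assms[OF d] by linarith
qed

context weak_solution
begin

lemma fin_annulus:
  assumes "0 < c" "c \<le> d" "d < R"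
  shows "eLnorm n 2 (annulus n c d) U < \<infinity>"
  using eLnorm_subset_le[of 2 "annulus n c d" "shell n c d" n U] regularity2[OF assms] annulus_subset_shell
  by (simp add: le_less_trans)

lemma v_tendsto_shell:
  assumes "0 < c" "c \<le> d" "d < R"
  shows "(\<lambda>k. eLnorm n p' (shell n c d) (\<lambda>x. v k x - U x)) \<longlonglongrightarrow> 0"
    "(\<lambda>k. eLnorm n 2 (shell n c d) (\<lambda>x. v k x - U x)) \<longlonglongrightarrow> 0"
proof -
  have r: "0 < c / 2" "c / 2 \<le> (d + R) / 2" "(d + R) / 2 < R" "c / 2 < c" "d < (d + R) / 2" using assms by auto
  show "(\<lambda>k. eLnorm n p' (shell n c d) (\<lambda>x. v k x - U x)) \<longlonglongrightarrow> 0"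
    by (rule v_tendsto_q[OF p(6) r(4,5) regularity[OF r(1-3)]])
  show "(\<lambda>k. eLnorm n 2 (shell n c d) (\<lambda>x. v k x - U x)) \<longlonglongrightarrow> 0"
    by (rule v_tendsto_q[OF _ r(4,5) regularity2[OF r(1-3)]]) simp
qed

text \<open>The exponents match because \<open>1 / p = 2 / n + 1 / p'\<close>. Both absorptions of
  the potential, in the energy and in the Carleman estimate, go through this bound.\<close>

lemma eLnorm_WU_le:
  assumes f[measurable]: "f \<in> borel_measurable (leb n)" and S[measurable]: "S \<in> sets (leb n)"
    and fin: "eLnorm n p' S f < \<infinity>"
  shows "eLnorm n p S (\<lambda>x. W x * f x) \<le> ennreal \<kappa> * eLnorm n p' S f"
proof -
  have n2: "real n / 2 > 0" using n3 by simp
  have WS: "eLnorm n (real n / 2) S W \<le> ennreal \<kappa>"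
    using eLnorm_subset_le[OF n2, of S UNIV n W] \<kappa>(2) by (meson order_trans subset_UNIV)
  have "eLnorm n p S (\<lambda>x. W x * f x) \<le> eLnorm n (real n / 2) S W * eLnorm n p' S f"
    by (rule eLnorm_Holder) (use p n2 exp_p_props(7)[OF n3] fin le_less_trans[OF WS ennreal_less_top] in auto)
  also have "\<dots> \<le> ennreal \<kappa> * eLnorm n p' S f" by (rule mult_right_mono[OF WS]) simp
  finally show ?thesis .
qed

text \<open>With \<open>X\<close> the left-hand side and \<open>L\<close> the norm of \<open>\<phi> v\<close> with exponent \<open>p'\<close> one has
  \<open>X\<^sup>2 \<le> \<kappa> L\<^sup>2 + (S M)\<^sup>2\<close> up to errors of size \<open>\<delta>\<close>, and \<open>\<kappa> L\<^sup>2 \<le> \<kappa> \<sigma>\<^sup>2 X\<^sup>2 \<le> X\<^sup>2 / 2\<close>.\<close>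

lemma energy_bound:
  assumes \<phi>: "smooth n \<phi>" "\<And>x. x \<in> pts n \<Longrightarrow> x \<notin> shell n c d \<Longrightarrow> \<phi> x = 0" "\<And>x. \<bar>\<phi> x\<bar> \<le> 1"
    and g: "\<And>x. x \<in> pts n \<Longrightarrow> grad_len n \<phi> x \<le> S" "\<And>x. x \<in> pts n \<Longrightarrow> x \<notin> annulus n c d \<Longrightarrow> grad_len n \<phi> x = 0" "S \<ge> 0"
    and cd: "0 < c" "c \<le> d" "d < R" and \<delta>: "\<delta> > 0"
    and e1: "eLnorm n p' (shell n c d) (\<lambda>x. v k x - U x) \<le> ennreal \<delta>"
    and e2: "eLnorm n p (shell n c d) (\<lambda>x. lap n (v k) x - W x * U x) \<le> ennreal \<delta>"
    and e3: "eLnorm n 2 (annulus n c d) (v k) \<le> ennreal M" "M \<ge> 0"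
    and P0: "eLnorm n p' (shell n c d) U \<le> ennreal P0" "P0 \<ge> 0"
  shows "eLnorm n 2 UNIV (grad_len n (\<lambda>x. \<phi> x * v k x)) \<le> ennreal (sqrt (2 * (P0 + \<delta>) * (\<kappa> + 1) * \<delta> + 2 * (S * M)\<^sup>2))"
proof -
  let ?S = "shell n c d"
  define w where "w x = \<phi> x * v k x" for x
  have weight: "w \<in> test_fun n (nball n (origin n) R)"
    unfolding w_def[abs_def] by (rule test_fun_mult(2)[OF smooth_v test_of_shell(2)[OF \<phi>(1,2) cd(3)]])
  have wm[measurable]: "w \<in> borel_measurable (leb n)" by (rule test_fun_measurable[OF weight])
  have \<phi>m[measurable]: "\<phi> \<in> borel_measurable (leb n)" by (rule smooth_measurable[OF \<phi>(1)])
  have ws: "smooth n w" by (rule test_fun_smooth[OF weight])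
  have gwm[measurable]: "grad_len n w \<in> borel_measurable (leb n)" by (rule measurable_grad_len[OF ws])
  have g\<phi>m[measurable]: "grad_len n \<phi> \<in> borel_measurable (leb n)" by (rule measurable_grad_len[OF \<phi>(1)])
  have fx: "eLnorm n 2 UNIV (grad_len n w) < \<infinity>"
    using test_grad_len_finite[OF weight, of 2 "pts n"] sets.top[of "leb n"] by (simp add: eLnorm_pts)
  have fL: "eLnorm n p' UNIV w < \<infinity>" by (rule test_fun_eLnorm_finite[OF weight p(4)])
  define x where "x = Lnorm n 2 UNIV (grad_len n w)"
  define L where "L = Lnorm n p' UNIV w"
  have x: "eLnorm n 2 UNIV (grad_len n w) = ennreal x" "x \<ge> 0" using fx by (auto simp: x_def less_top)
  have L: "eLnorm n p' UNIV w = ennreal L" "L \<ge> 0" using fL by (auto simp: L_def less_top)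
  have Lx: "L \<le> \<sigma> * x"
    using \<sigma>(2)[OF weight] \<sigma>(1) x L by (simp add: ennreal_mult[symmetric])
  have LS: "eLnorm n p' ?S w = ennreal L"
    unfolding L(1)[symmetric] by (rule eLnorm_UNIV_eq) (simp add: w_def \<phi>(2))
  \<comment> \<open>A crude bound of \<open>L\<close> by data of \<open>U\<close>; it only serves to
    keep the factor of \<delta> in the error bounded.\<close>
  have LP: "L \<le> P0 + \<delta>"
  proof -
    have "ennreal L \<le> eLnorm n p' ?S (v k)" unfolding LS[symmetric]
    proof (rule eLnorm_mono[OF p(4)])
      fix y show "y \<in> ?S \<Longrightarrow> y \<in> ?S \<and> \<bar>w y\<bar> \<le> \<bar>v k y\<bar>"
        using mult_right_mono[OF \<phi>(3)[of y], of "\<bar>v k y\<bar>"] by (simp add: w_def abs_mult)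
    qed
    also have "\<dots> \<le> eLnorm n p' ?S U + eLnorm n p' ?S (\<lambda>x. U x - v k x)"
      by (rule eLnorm_triangle_diff[OF p(6)]) auto
    also have "eLnorm n p' ?S (\<lambda>x. U x - v k x) = eLnorm n p' ?S (\<lambda>x. v k x - U x)" by (rule eLnorm_cong) simp
    also have "eLnorm n p' ?S U + \<dots> \<le> ennreal P0 + ennreal \<delta>" by (intro add_mono P0 e1)
    finally show ?thesis using P0 \<delta> by (simp add: ennreal_plus[symmetric] del: ennreal_plus)
  qed
  have mult_le: "eLnorm n q ?S (\<lambda>x. \<phi> x * f x) \<le> eLnorm n q ?S f" if "q > 0" for q f
  proof (rule eLnorm_mono[OF that])
    fix y show "y \<in> ?S \<Longrightarrow> y \<in> ?S \<and> \<bar>\<phi> y * f y\<bar> \<le> \<bar>f y\<bar>"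
      using mult_right_mono[OF \<phi>(3)[of y], of "\<bar>f y\<bar>"] by (simp add: abs_mult)
  qed
  \<comment> \<open>The Laplacian of \<open>v k\<close> approximates \<open>W * U\<close>, not
    \<open>W * v k\<close>; the potential therefore meets \<open>\<phi> * U\<close>, which is
    compared with \<open>w\<close>.\<close>
  have \<phi>U: "eLnorm n p' ?S (\<lambda>x. \<phi> x * U x) \<le> ennreal (L + \<delta>)"
  proof -
    have "eLnorm n p' ?S (\<lambda>x. \<phi> x * U x) \<le> eLnorm n p' ?S w + eLnorm n p' ?S (\<lambda>x. w x - \<phi> x * U x)"
      by (rule eLnorm_triangle_diff[OF p(6)]) auto
    also have "eLnorm n p' ?S (\<lambda>x. w x - \<phi> x * U x) = eLnorm n p' ?S (\<lambda>x. \<phi> x * (v k x - U x))"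
      by (rule eLnorm_cong) (simp add: w_def right_diff_distrib)
    also have "eLnorm n p' ?S w + \<dots> \<le> ennreal L + ennreal \<delta>"
      unfolding LS by (intro add_left_mono order_trans[OF mult_le[OF p(4)] e1])
    finally show ?thesis using L \<delta> by simp
  qed
  have pl: "eLnorm n p UNIV (\<lambda>x. \<phi> x * lap n (v k) x) \<le> ennreal (\<kappa> * (L + \<delta>) + \<delta>)"
  proof -
    have "eLnorm n p UNIV (\<lambda>x. \<phi> x * lap n (v k) x) = eLnorm n p ?S (\<lambda>x. \<phi> x * lap n (v k) x)"
      by (rule eLnorm_UNIV_eq[symmetric]) (simp add: \<phi>(2))
    also have "\<dots> = eLnorm n p ?S (\<lambda>x. W x * (\<phi> x * U x) + \<phi> x * (lap n (v k) x - W x * U x))"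
      by (rule eLnorm_cong) (simp add: algebra_simps)
    also have "\<dots> \<le> eLnorm n p ?S (\<lambda>x. W x * (\<phi> x * U x)) + eLnorm n p ?S (\<lambda>x. \<phi> x * (lap n (v k) x - W x * U x))"
      by (rule eLnorm_triangle[OF p(5)]) auto
    also have "\<dots> \<le> ennreal \<kappa> * ennreal (L + \<delta>) + ennreal \<delta>"
    proof (rule add_mono)
      have "eLnorm n p ?S (\<lambda>x. W x * (\<phi> x * U x)) \<le> ennreal \<kappa> * eLnorm n p' ?S (\<lambda>x. \<phi> x * U x)"
        by (rule eLnorm_WU_le) (use le_less_trans[OF \<phi>U ennreal_less_top] in auto)
      also have "\<dots> \<le> ennreal \<kappa> * ennreal (L + \<delta>)" by (rule mult_left_mono[OF \<phi>U]) simp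
      finally show "eLnorm n p ?S (\<lambda>x. W x * (\<phi> x * U x)) \<le> ennreal \<kappa> * ennreal (L + \<delta>)" .
      show "eLnorm n p ?S (\<lambda>x. \<phi> x * (lap n (v k) x - W x * U x)) \<le> ennreal \<delta>" by (rule order_trans[OF mult_le[OF p(3)] e2])
    qed
    also have "\<dots> = ennreal (\<kappa> * (L + \<delta>) + \<delta>)" using \<kappa>(1) L \<delta> by (simp add: ennreal_mult[symmetric] ennreal_plus[symmetric] del: ennreal_plus)
    finally show ?thesis .
  qed
  define Z where "Z y = (v k y)\<^sup>2 * grad_inner n \<phi> \<phi> y" for y
  \<comment> \<open>The function against which the Laplacian of \<open>v k\<close> is tested. Of its
    two factors \<phi> one goes to \<open>w\<close> and the other to the Laplacian, see
    \<open>Yb\<close>.\<close>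
  define w2 where "w2 y = (\<phi> y * \<phi> y) * v k y" for y
  have w2t: "w2 \<in> test_fun n (nball n (origin n) R)"
  proof -
    have "(\<lambda>y. \<phi> y * w y) \<in> test_fun n (nball n (origin n) R)" by (rule test_fun_mult(1)[OF \<phi>(1) weight])
    moreover have "(\<lambda>y. \<phi> y * w y) = w2" by (simp add: w2_def[abs_def] w_def mult.assoc)
    ultimately show ?thesis by simp
  qed
  have en: "grad_inner n w w y = grad_inner n (v k) w2 y + Z y" if "y \<in> pts n" for y
    using grad_inner_energy[OF \<phi>(1) smooth_v that, of k] by (simp add: w_def[abs_def] w2_def[abs_def] Z_def)
  have iA: "integrable (leb n) (grad_inner n w w)" by (rule grad_inner_integrable[OF ws weight])
  have iB: "integrable (leb n) (grad_inner n (v k) w2)" by (rule grad_inner_integrable[OF smooth_v w2t])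
  have iZ: "integrable (leb n) Z"
    by (rule Bochner_Integration.integrable_cong[THEN iffD1, OF refl _ Bochner_Integration.integrable_diff[OF iA iB]]) (simp add: en)
  have x2: "(LINT y|leb n. grad_inner n w w y) = x\<^sup>2"
  proof -
    have "(LINT y|leb n. grad_inner n w w y) = enn2real (\<integral>\<^sup>+y. ennreal (grad_inner n w w y) \<partial>leb n)"
      by (rule integral_eq_nn_integral) (use iA in \<open>auto simp: grad_len_square[symmetric]\<close>)
    also have "(\<integral>\<^sup>+y. ennreal (grad_inner n w w y) \<partial>leb n) = powr_integral n 2 UNIV (grad_len n w)"
      by (rule nn_integral_cong) (simp add: grad_len_square[symmetric] powr_numeral)
    also have "\<dots> = ennreal (x powr 2)" unfolding x_def by (rule eLnorm_powr[OF _ fx]) simp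
    finally show ?thesis using x by (simp add: powr_numeral)
  qed
  have Zb: "(LINT y|leb n. Z y) \<le> (S * M)\<^sup>2"
  proof -
    have Zeq: "Z y = \<bar>v k y * grad_len n \<phi> y\<bar> powr 2" for y
      by (simp add: Z_def grad_len_square[symmetric] powr_numeral power_mult_distrib)
    have "eLnorm n 2 UNIV (\<lambda>y. v k y * grad_len n \<phi> y) = eLnorm n 2 (annulus n c d) (\<lambda>y. v k y * grad_len n \<phi> y)"
      by (rule eLnorm_UNIV_eq[symmetric]) (simp add: g(2))
    also have "\<dots> \<le> ennreal S * eLnorm n 2 (annulus n c d) (v k)"
    proof (rule eLnorm_bound_mult)
      fix y assume y: "y \<in> pts n"
      show "\<bar>v k y * grad_len n \<phi> y\<bar> \<le> S * \<bar>v k y\<bar>"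
        using mult_right_mono[OF g(1)[OF y], of "\<bar>v k y\<bar>"] by (simp add: abs_mult mult.commute)
    qed (use g(3) in auto)
    also have "\<dots> \<le> ennreal S * ennreal M" by (rule mult_left_mono[OF e3(1)]) simp
    also have "\<dots> = ennreal (S * M)" using g(3) e3 by (simp add: ennreal_mult)
    finally have "powr_integral n 2 UNIV (\<lambda>y. v k y * grad_len n \<phi> y) \<le> ennreal ((S * M) powr 2)"
      using g(3) e3 by (subst eLnorm_le_iff[symmetric]) auto
    moreover have "powr_integral n 2 UNIV (\<lambda>y. v k y * grad_len n \<phi> y) = (\<integral>\<^sup>+y. ennreal (Z y) \<partial>leb n)"
      by (rule nn_integral_cong) (simp add: Zeq)
    ultimately have "(\<integral>\<^sup>+y. ennreal (Z y) \<partial>leb n) \<le> ennreal ((S * M)\<^sup>2)" using g(3) e3 by (simp add: powr_numeral)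
    moreover have "(LINT y|leb n. Z y) = enn2real (\<integral>\<^sup>+y. ennreal (Z y) \<partial>leb n)"
      by (rule integral_eq_nn_integral) (use iZ Zeq in auto)
    ultimately show ?thesis by (simp add: enn2real_leI)
  qed
  have Yb: "\<bar>LINT y|leb n. w2 y * lap n (v k) y\<bar> \<le> L * (\<kappa> * (L + \<delta>) + \<delta>)"
  proof -
    have i: "integrable (leb n) (\<lambda>y. w2 y * lap n (v k) y)"
      by (rule test_fun_integrable[OF test_fun_mult(2)[OF smooth_lap[OF smooth_v] w2t]])
    have "ennreal \<bar>LINT y|leb n. w2 y * lap n (v k) y\<bar> \<le> (\<integral>\<^sup>+y. norm (w2 y * lap n (v k) y) \<partial>leb n)"
      using integral_norm_bound_ennreal[OF i] by simp
    also have "\<dots> = powr_integral n 1 UNIV (\<lambda>y. w y * (\<phi> y * lap n (v k) y))"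
      by (rule nn_integral_cong) (simp add: w2_def w_def abs_mult mult_ac)
    also have "\<dots> \<le> ennreal ((L * (\<kappa> * (L + \<delta>) + \<delta>)) powr 1)"
    proof (subst eLnorm_le_iff[symmetric])
      have "eLnorm n 1 (pts n) (\<lambda>y. w y * (\<phi> y * lap n (v k) y)) \<le> eLnorm n p' (pts n) w * eLnorm n p (pts n) (\<lambda>y. \<phi> y * lap n (v k) y)"
      proof (rule eLnorm_Holder)
        show "1 / 1 = 1 / p' + 1 / p" using exp_p_props(8)[OF n3] by simp
        show "pts n \<in> sets (leb n)" using sets.top[of "leb n"] by simp
        show "eLnorm n p' (pts n) w < \<infinity>" unfolding eLnorm_pts by (rule fL)
        show "eLnorm n p (pts n) (\<lambda>y. \<phi> y * lap n (v k) y) < \<infinity>" unfolding eLnorm_pts by (rule le_less_trans[OF pl]) simp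
      qed (use p in auto)
      also have "\<dots> \<le> ennreal L * ennreal (\<kappa> * (L + \<delta>) + \<delta>)" unfolding eLnorm_pts L(1) by (rule mult_left_mono[OF pl]) simp
      also have "\<dots> = ennreal (L * (\<kappa> * (L + \<delta>) + \<delta>))" using L \<kappa>(1) \<delta> by (intro ennreal_mult[symmetric]) auto
      finally show "eLnorm n 1 UNIV (\<lambda>y. w y * (\<phi> y * lap n (v k) y)) \<le> ennreal (L * (\<kappa> * (L + \<delta>) + \<delta>))" unfolding eLnorm_pts .
    qed (use L \<kappa>(1) \<delta> in auto)
    finally have "ennreal \<bar>LINT y|leb n. w2 y * lap n (v k) y\<bar> \<le> ennreal (L * (\<kappa> * (L + \<delta>) + \<delta>))"
      using L \<kappa>(1) \<delta> by simp
    then show ?thesis using L \<kappa>(1) \<delta> by (subst (asm) ennreal_le_iff) auto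
  qed
  have "x\<^sup>2 = (LINT y|leb n. grad_inner n (v k) w2 y + Z y)"
    unfolding x2[symmetric] by (rule Bochner_Integration.integral_cong) (simp_all add: en)
  also have "\<dots> = - (LINT y|leb n. w2 y * lap n (v k) y) + (LINT y|leb n. Z y)"
    using Bochner_Integration.integral_add[OF iB iZ] integral_grad_inner[OF smooth_v w2t] by simp
  also have "\<dots> \<le> L * (\<kappa> * (L + \<delta>) + \<delta>) + (S * M)\<^sup>2" using Yb Zb by linarith
  also have "L * (\<kappa> * (L + \<delta>) + \<delta>) = \<kappa> * L\<^sup>2 + L * (\<kappa> + 1) * \<delta>" by (simp add: algebra_simps power2_eq_square)
  finally have a: "x\<^sup>2 \<le> \<kappa> * L\<^sup>2 + L * (\<kappa> + 1) * \<delta> + (S * M)\<^sup>2" .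
  have "\<kappa> * L\<^sup>2 \<le> \<kappa> * (\<sigma> * x)\<^sup>2" using Lx L \<kappa>(1) by (intro mult_left_mono power_mono) auto
  also have "\<dots> = (2 * \<sigma>\<^sup>2 * \<kappa>) * (x\<^sup>2 / 2)" by (simp add: power_mult_distrib)
  also have "\<dots> \<le> 1 * (x\<^sup>2 / 2)" using \<kappa>(4) by (intro mult_right_mono) auto
  finally have b: "\<kappa> * L\<^sup>2 \<le> x\<^sup>2 / 2" by simp
  have cc: "L * (\<kappa> + 1) * \<delta> \<le> (P0 + \<delta>) * (\<kappa> + 1) * \<delta>"
    using LP \<kappa>(1) \<delta> by (intro mult_right_mono) auto
  have "x\<^sup>2 \<le> 2 * ((P0 + \<delta>) * (\<kappa> + 1) * \<delta>) + 2 * (S * M)\<^sup>2" using a b cc by linarith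
  then have "x \<le> sqrt (2 * (P0 + \<delta>) * (\<kappa> + 1) * \<delta> + 2 * (S * M)\<^sup>2)"
    by (intro real_le_rsqrt) (simp only: mult.assoc)
  then show ?thesis using x unfolding w_def[abs_def] by (simp add: ennreal_leI)
qed

text \<open>The limit of \<open>energy_bound\<close> as its errors vanish. The factor
  \<open>sqrt 2\<close> is due to the half of the energy that absorbs the potential.\<close>

lemma caccioppoli:
  assumes \<phi>: "smooth n \<phi>" "\<And>x. x \<in> pts n \<Longrightarrow> x \<notin> shell n c d \<Longrightarrow> \<phi> x = 0" "\<And>x. \<bar>\<phi> x\<bar> \<le> 1"
    and g: "\<And>x. x \<in> pts n \<Longrightarrow> grad_len n \<phi> x \<le> S" "\<And>x. x \<in> pts n \<Longrightarrow> x \<notin> annulus n c d \<Longrightarrow> grad_len n \<phi> x = 0" "S \<ge> 0"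
    and cd: "0 < c" "c \<le> d" "d < R" and \<delta>: "\<delta> > 0"
  shows "\<forall>\<^sub>F k in sequentially. eLnorm n 2 UNIV (grad_len n (\<lambda>x. \<phi> x * v k x)) \<le> ennreal (sqrt 2 * S * Lnorm n 2 (annulus n c d) U + \<delta>)"
proof -
  define N where "N = Lnorm n 2 (annulus n c d) U"
  have N: "eLnorm n 2 (annulus n c d) U \<le> ennreal N" "N \<ge> 0"
    unfolding N_def by (rule eLnorm_le_ennreal_Lnorm[OF fin_annulus[OF cd]]) simp
  define P0 where "P0 = Lnorm n p' (shell n c d) U"
  have P0: "eLnorm n p' (shell n c d) U \<le> ennreal P0" "P0 \<ge> 0"
    unfolding P0_def by (rule eLnorm_le_ennreal_Lnorm[OF regularity[OF cd]]) simp
  define t where "t = sqrt 2 * S * N"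
  have t: "t \<ge> 0" "t\<^sup>2 = 2 * (S * N)\<^sup>2" using g(3) N by (auto simp: t_def power_mult_distrib)
  have lim: "((\<lambda>\<delta>1. 2 * (P0 + \<delta>1) * (\<kappa> + 1) * \<delta>1 + 2 * (S * (N + \<delta>1))\<^sup>2) \<longlongrightarrow> 2 * (P0 + 0) * (\<kappa> + 1) * 0 + 2 * (S * (N + 0))\<^sup>2) (at_right 0)"
    by (intro tendsto_intros)
  \<comment> \<open>Strict because \<delta> is positive, also if \<open>t = 0\<close>; this leaves
    room for a positive error \<open>\<delta>1\<close>.\<close>
  have "2 * (P0 + 0) * (\<kappa> + 1) * 0 + 2 * (S * (N + 0))\<^sup>2 < (t + \<delta>)\<^sup>2"
    using t \<delta> power_strict_mono[of t "t + \<delta>" 2] by simp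
  from order_tendstoD(2)[OF lim this]
  have "\<forall>\<^sub>F \<delta>1 in at_right 0. 2 * (P0 + \<delta>1) * (\<kappa> + 1) * \<delta>1 + 2 * (S * (N + \<delta>1))\<^sup>2 < (t + \<delta>)\<^sup>2 \<and> \<delta>1 > 0"
    using eventually_at_right_less[of "0::real"] by eventually_elim auto
  then obtain \<delta>1 where d1: "2 * (P0 + \<delta>1) * (\<kappa> + 1) * \<delta>1 + 2 * (S * (N + \<delta>1))\<^sup>2 < (t + \<delta>)\<^sup>2" "\<delta>1 > 0"
    using eventually_happens'[OF trivial_limit_at_right_real] by blast
  have ev1: "\<forall>\<^sub>F k in sequentially. eLnorm n p' (shell n c d) (\<lambda>x. v k x - U x) \<le> ennreal \<delta>1"
    by (rule ennreal_tendsto_0_eventually_le[OF v_tendsto_shell(1)[OF cd] d1(2)])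
  have ev2: "\<forall>\<^sub>F k in sequentially. eLnorm n p (shell n c d) (\<lambda>x. lap n (v k) x - W x * U x) \<le> ennreal \<delta>1"
    by (rule ennreal_tendsto_0_eventually_le[OF lap_v_tendsto[OF cd(3)] d1(2)])
  have ev3: "\<forall>\<^sub>F k in sequentially. eLnorm n 2 (annulus n c d) (v k) \<le> ennreal (N + \<delta>1)"
    by (rule eventually_eLnorm_le[OF _ v_measurable Um annulus_sets eLnorm_tendsto_subset[OF v_tendsto_shell(2)[OF cd] _ annulus_subset_shell] N d1(2)]) auto
  show ?thesis using ev1 ev2 ev3
  proof eventually_elim
    case (elim k)
    have "eLnorm n 2 UNIV (grad_len n (\<lambda>x. \<phi> x * v k x)) \<le> ennreal (sqrt (2 * (P0 + \<delta>1) * (\<kappa> + 1) * \<delta>1 + 2 * (S * (N + \<delta>1))\<^sup>2))"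
      by (rule energy_bound[OF \<phi> g cd d1(2) elim _ P0]) (use N d1 in auto)
    also have "\<dots> \<le> ennreal (t + \<delta>)"
      using d1(1) t \<delta> by (intro ennreal_leI real_le_lsqrt) auto
    finally show ?case by (simp add: t_def N_def)
  qed
qed

end

section \<open>The doubling estimate\<close>

definition cut_grad :: "real \<Rightarrow> real \<Rightarrow> real" where
  "cut_grad a b = 2 * step_bound * b / (b\<^sup>2 - a\<^sup>2)"

definition cut_lap :: "nat \<Rightarrow> real \<Rightarrow> real \<Rightarrow> real" where
  "cut_lap n a b = 4 * step_bound * b\<^sup>2 / (b\<^sup>2 - a\<^sup>2)\<^sup>2 + 2 * real n * step_bound / (b\<^sup>2 - a\<^sup>2)"

text \<open>The factors in the estimate of the commutator with a cutoff between \<open>a\<close> and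
  \<open>b\<close>: \<open>2 * b\<close> for passing from exponent \<open>2\<close> to
  \<open>p\<close>, \<open>2 * cut_grad a b\<close> for the mixed gradient term,
  \<open>sqrt 2\<close> and the inner bracket for the Caccioppoli inequality between
  \<open>c\<close> and \<open>d\<close>, and \<open>cut_lap\<close> for the term without derivatives
  of the solution.\<close>

definition cutoff_error_const :: "nat \<Rightarrow> real \<Rightarrow> real \<Rightarrow> real \<Rightarrow> real \<Rightarrow> real" where
  "cutoff_error_const n c a b d = 2 * b * (2 * cut_grad a b * (sqrt 2 * (cut_grad c a + cut_grad b d)) + cut_lap n a b)"

lemma cut_grad_nonneg: "0 \<le> a \<Longrightarrow> a < b \<Longrightarrow> cut_grad a b \<ge> 0"
  unfolding cut_grad_def using step_bound(1) by (intro divide_nonneg_nonneg) (auto intro: power_mono)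

lemma cut_lap_nonneg: "0 \<le> a \<Longrightarrow> a < b \<Longrightarrow> cut_lap n a b \<ge> 0"
  unfolding cut_lap_def using step_bound(1) by (intro add_nonneg_nonneg divide_nonneg_nonneg) (auto intro: power_mono)

lemma cutoff_error_const_nonneg: "0 \<le> c \<Longrightarrow> c < a \<Longrightarrow> a < b \<Longrightarrow> b < d \<Longrightarrow> cutoff_error_const n c a b d \<ge> 0"
  unfolding cutoff_error_const_def
  by (intro mult_nonneg_nonneg add_nonneg_nonneg cut_grad_nonneg cut_lap_nonneg) auto

lemma cut_grad_scale: "s > 0 \<Longrightarrow> cut_grad (s * a) (s * b) = cut_grad a b / s"
proof -
  assume s: "s > 0"
  have "(s * b)\<^sup>2 - (s * a)\<^sup>2 = s * (s * (b\<^sup>2 - a\<^sup>2))" by (simp add: algebra_simps power2_eq_square)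
  then show ?thesis using s by (simp add: cut_grad_def mult_ac)
qed

lemma cut_lap_scale: "s > 0 \<Longrightarrow> cut_lap n (s * a) (s * b) = cut_lap n a b / (s * s)"
proof -
  assume s: "s > 0"
  have e: "(s * b)\<^sup>2 - (s * a)\<^sup>2 = s * s * (b\<^sup>2 - a\<^sup>2)" by (simp add: algebra_simps power2_eq_square)
  have "4 * step_bound * (s * b)\<^sup>2 / (s * s * (b\<^sup>2 - a\<^sup>2))\<^sup>2 = 4 * step_bound * b\<^sup>2 / (b\<^sup>2 - a\<^sup>2)\<^sup>2 / (s * s)"
    using s by (simp add: power_mult_distrib power2_eq_square mult_ac)
  moreover have "2 * real n * step_bound / (s * s * (b\<^sup>2 - a\<^sup>2)) = 2 * real n * step_bound / (b\<^sup>2 - a\<^sup>2) / (s * s)"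
    by (simp add: mult.commute)
  ultimately show ?thesis unfolding cut_lap_def e add_divide_distrib by simp
qed

lemma cut_lap_le: "n \<ge> 1 \<Longrightarrow> 0 \<le> a \<Longrightarrow> a < b \<Longrightarrow> cut_lap n a b \<le> real n * cut_lap 1 a b"
proof -
  assume n: "n \<ge> 1" and ab: "0 \<le> a" "a < b"
  have "1 * (4 * step_bound * b\<^sup>2 / (b\<^sup>2 - a\<^sup>2)\<^sup>2) \<le> real n * (4 * step_bound * b\<^sup>2 / (b\<^sup>2 - a\<^sup>2)\<^sup>2)"
    using n step_bound(1) by (intro mult_right_mono) auto
  then show ?thesis by (simp add: cut_lap_def distrib_left mult_ac)
qed

text \<open>Under dilation by \<open>s\<close> the factor \<open>b\<close> gains \<open>s\<close>,
  while the products of gradients and the Laplacian term each gain \<open>1 / s^2\<close>, so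
  \<open>1 / s\<close> is left. The dimension enters through \<open>cut_lap\<close> and at most
  linearly; this permits constants computed in dimension one at fixed radii.\<close>

lemma cutoff_error_const_le:
  assumes n: "n \<ge> 1" and r: "0 \<le> c" "c < a" "a < b" "b < d" and s: "s > 0"
  shows "cutoff_error_const n (s * c) (s * a) (s * b) (s * d) \<le> real n * cutoff_error_const 1 c a b d / s"
proof -
  let ?g = "2 * cut_grad a b * (sqrt 2 * (cut_grad c a + cut_grad b d))"
  have g: "?g \<ge> 0" using r by (intro mult_nonneg_nonneg add_nonneg_nonneg cut_grad_nonneg) auto
  have "cutoff_error_const n (s * c) (s * a) (s * b) (s * d) = 2 * b * (?g + cut_lap n a b) / s"
    using s unfolding cutoff_error_const_def cut_grad_scale[OF s] cut_lap_scale[OF s]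
    by (simp add: field_simps)
  also have "\<dots> \<le> 2 * b * (real n * (?g + cut_lap 1 a b)) / s"
  proof (intro divide_right_mono mult_left_mono)
    have "?g \<le> real n * ?g" using g n mult_right_mono[of 1 "real n" ?g] by simp
    then show "?g + cut_lap n a b \<le> real n * (?g + cut_lap 1 a b)"
      using cut_lap_le[OF n _ r(3)] r unfolding distrib_left by linarith
  qed (use s r in auto)
  also have "\<dots> = real n * cutoff_error_const 1 c a b d / s" by (simp add: cutoff_error_const_def)
  finally show ?thesis .
qed

context weak_solution
begin

text \<open>The derivatives of the cutoff live between \<open>a\<close> and \<open>b\<close>. There
  a ring cutoff is one, so the Caccioppoli inequality for it bounds the gradient by the norm of
  \<open>U\<close> between \<open>c\<close> and \<open>d\<close>. The weight is largest at the inner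
  radius \<open>a\<close>.\<close>

lemma cutoff_error:
  assumes r: "0 < c" "c < a" "a < b" "b < d" "d < R" and l: "l \<in> carleman_exps n" and \<delta>: "\<delta> > 0"
  defines "N \<equiv> Lnorm n 2 (annulus n c d) U"
  shows "\<forall>\<^sub>F k in sequentially. eLnorm n p UNIV (\<lambda>x. weight l x * comm_lap (cut n a b) k x) \<le>
    ennreal (a powr (- l) * (cutoff_error_const n c a b d * N + 2 * b * (2 * cut_grad a b + cut_lap n a b) * \<delta>))"
proof -
  let ?S = "shell n a b"
  let ?\<phi> = "ring_cut n c a b d"
  define S where "S = cut_grad c a + cut_grad b d"
  have cabd: "0 \<le> c" "c < a" "a \<le> b" "b < d" using r by auto
  have cd: "c \<le> d" using r by simp
  have ab: "0 \<le> a" "a < b" using r by auto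
  have lp: "l > 0" by (rule carleman_exps_pos[OF l])
  have N: "eLnorm n 2 (annulus n c d) U \<le> ennreal N" "N \<ge> 0"
    unfolding N_def by (rule eLnorm_le_ennreal_Lnorm[OF fin_annulus[OF r(1) cd r(5)]]) simp
  have g1: "cut_grad a b \<ge> 0" by (rule cut_grad_nonneg[OF ab])
  have g2: "cut_lap n a b \<ge> 0" by (rule cut_lap_nonneg[OF ab])
  have S: "S \<ge> 0" unfolding S_def using r by (intro add_nonneg_nonneg cut_grad_nonneg) auto
  have ev1: "\<forall>\<^sub>F k in sequentially. eLnorm n 2 UNIV (grad_len n (\<lambda>x. ?\<phi> x * v k x)) \<le> ennreal (sqrt 2 * S * N + \<delta>)"
    unfolding N_def
  proof (rule caccioppoli[OF smooth_ring_cut _ abs_ring_cut_le[OF cabd] _ _ S r(1) cd r(5) \<delta>])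
    fix x assume x: "x \<in> pts n"
    show "x \<notin> shell n c d \<Longrightarrow> ?\<phi> x = 0" by (rule ring_cut_outside[OF cabd]) (use x in \<open>simp add: shell_def, linarith\<close>)
    show "grad_len n ?\<phi> x \<le> S" unfolding S_def cut_grad_def by (rule grad_len_ring_cut_le[OF cabd x])
    show "x \<notin> annulus n c d \<Longrightarrow> grad_len n ?\<phi> x = 0"
      by (rule grad_len_ring_cut_outside[OF cabd x]) (use x in \<open>simp add: annulus_def, linarith\<close>)
  qed
  have sub: "annulus n c d \<subseteq> shell n c d" by (rule annulus_subset_shell)
  have Sab: "?S \<subseteq> annulus n c d" by (rule subsetI) (use r in \<open>simp add: annulus_def shell_def\<close>)
  have ev2: "\<forall>\<^sub>F k in sequentially. eLnorm n 2 (annulus n c d) (v k) \<le> ennreal (N + \<delta>)"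
    by (rule eventually_eLnorm_le[OF _ v_measurable Um annulus_sets eLnorm_tendsto_subset[OF v_tendsto_shell(2)[OF r(1) cd r(5)] _ sub] N \<delta>]) auto
  show ?thesis using ev1 ev2
  proof eventually_elim
    case (elim k)
    let ?h = "\<lambda>x. 2 * cut_grad a b * grad_len n (v k) x + cut_lap n a b * \<bar>v k x\<bar>"
    have e1: "eLnorm n 2 ?S (grad_len n (v k)) \<le> ennreal (sqrt 2 * S * N + \<delta>)"
    proof -
      have "eLnorm n 2 ?S (grad_len n (v k)) = eLnorm n 2 ?S (grad_len n (\<lambda>x. ?\<phi> x * v k x))"
      proof (rule eLnorm_cong)
        fix x assume x: "x \<in> pts n" "x \<in> ?S"
        then have i: "a \<le> nnorm n x" "nnorm n x \<le> b" by (simp_all add: shell_def)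
        have "grad_len n (\<lambda>x. ?\<phi> x * v k x) x = grad_len n (v k) x"
          by (rule pderiv_const_mult_inside[OF smooth_ring_cut smooth_v x(1) grad_len_ring_cut_outside[OF cabd x(1)] ring_cut_inside[OF cabd i]]) (use i in simp)
        then show "\<bar>grad_len n (v k) x\<bar> = \<bar>grad_len n (\<lambda>x. ?\<phi> x * v k x) x\<bar>" by simp
      qed
      also have "\<dots> \<le> eLnorm n 2 UNIV (grad_len n (\<lambda>x. ?\<phi> x * v k x))" by (rule eLnorm_subset_le) auto
      finally show ?thesis using elim(1) by (rule order_trans)
    qed
    have e2: "eLnorm n 2 ?S (v k) \<le> ennreal (N + \<delta>)"
      using eLnorm_subset_le[OF _ Sab, of 2 n "v k"] elim(2) by (meson order_trans zero_less_numeral)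
    have h: "eLnorm n 2 ?S ?h \<le> ennreal ((2 * cut_grad a b * (sqrt 2 * S) + cut_lap n a b) * N + (2 * cut_grad a b + cut_lap n a b) * \<delta>)"
    proof -
      have "eLnorm n 2 ?S ?h \<le> eLnorm n 2 ?S (\<lambda>x. 2 * cut_grad a b * grad_len n (v k) x) + eLnorm n 2 ?S (\<lambda>x. cut_lap n a b * \<bar>v k x\<bar>)"
        by (rule eLnorm_triangle) auto
      also have "\<dots> = ennreal (2 * cut_grad a b) * eLnorm n 2 ?S (grad_len n (v k)) + ennreal (cut_lap n a b) * eLnorm n 2 ?S (\<lambda>x. \<bar>v k x\<bar>)"
        by (simp add: eLnorm_cmult[OF _ grad_len_v_measurable shell_sets] eLnorm_cmult[OF _ borel_measurable_abs[OF v_measurable] shell_sets] g1 g2)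
      also have "eLnorm n 2 ?S (\<lambda>x. \<bar>v k x\<bar>) = eLnorm n 2 ?S (v k)" by (rule eLnorm_cong) simp
      also have "ennreal (2 * cut_grad a b) * eLnorm n 2 ?S (grad_len n (v k)) + ennreal (cut_lap n a b) * eLnorm n 2 ?S (v k)
        \<le> ennreal (2 * cut_grad a b) * ennreal (sqrt 2 * S * N + \<delta>) + ennreal (cut_lap n a b) * ennreal (N + \<delta>)"
        by (intro add_mono mult_left_mono e1 e2) auto
      also have "\<dots> = ennreal (2 * cut_grad a b * (sqrt 2 * S * N + \<delta>) + cut_lap n a b * (N + \<delta>))"
        using g1 g2 S N \<delta> by (simp add: ennreal_mult[symmetric] ennreal_plus[symmetric] del: ennreal_plus)
      also have "2 * cut_grad a b * (sqrt 2 * S * N + \<delta>) + cut_lap n a b * (N + \<delta>) = (2 * cut_grad a b * (sqrt 2 * S) + cut_lap n a b) * N + (2 * cut_grad a b + cut_lap n a b) * \<delta>"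
        by (simp add: algebra_simps)
      finally show ?thesis .
    qed
    have hm: "?h \<in> borel_measurable (leb n)" by measurable
    have "eLnorm n p UNIV (\<lambda>x. weight l x * comm_lap (cut n a b) k x) = eLnorm n p ?S (\<lambda>x. weight l x * comm_lap (cut n a b) k x)"
    proof (rule eLnorm_UNIV_eq[symmetric])
      fix x assume x: "x \<in> pts n" "x \<notin> ?S"
      then have o: "\<not> (a < nnorm n x \<and> nnorm n x < b)" by (simp add: shell_def, linarith)
      have "lap n (cut n a b) x = 0" "grad_len n (cut n a b) x = 0" by (rule grad_len_cut_outside[OF ab x(1) o])+
      then have "comm_lap (cut n a b) k x = 0" using abs_grad_inner_le[of n "cut n a b" "v k" x] by (simp add: comm_lap_def)
      then show "weight l x * comm_lap (cut n a b) k x = 0" by simp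
    qed
    also have "\<dots> \<le> ennreal (a powr (- l)) * eLnorm n p ?S ?h"
    proof (rule eLnorm_bound_mult[OF p(3) _ shell_sets])
      fix x assume x: "x \<in> pts n" "x \<in> ?S"
      have e: "\<bar>comm_lap (cut n a b) k x\<bar> \<le> 2 * cut_grad a b * grad_len n (v k) x + cut_lap n a b * \<bar>v k x\<bar>"
      proof -
        have "\<bar>grad_inner n (cut n a b) (v k) x\<bar> \<le> cut_grad a b * grad_len n (v k) x"
          by (rule order_trans[OF abs_grad_inner_le]) (rule mult_right_mono[OF grad_len_cut_le[OF ab x(1), folded cut_grad_def] grad_len_nonneg])
        moreover have "\<bar>v k x * lap n (cut n a b) x\<bar> \<le> cut_lap n a b * \<bar>v k x\<bar>"
          using mult_right_mono[OF lap_cut_le[OF ab x(1)], of "\<bar>v k x\<bar>"] by (simp add: abs_mult mult.commute cut_lap_def)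
        ultimately show ?thesis unfolding comm_lap_def by (simp add: abs_le_iff)
      qed
      have "weight l x \<le> a powr (- l)" by (rule weight_le) (use lp r x in \<open>auto simp: shell_def\<close>)
      then have "weight l x * \<bar>comm_lap (cut n a b) k x\<bar> \<le> a powr (- l) * (2 * cut_grad a b * grad_len n (v k) x + cut_lap n a b * \<bar>v k x\<bar>)"
        using e by (intro mult_mono) auto
      then show "\<bar>weight l x * comm_lap (cut n a b) k x\<bar> \<le> a powr (- l) * \<bar>?h x\<bar>"
        using g1 g2 by (simp add: abs_mult)
    qed auto
    also have "\<dots> \<le> ennreal (a powr (- l)) * (ennreal (2 * b) * ennreal ((2 * cut_grad a b * (sqrt 2 * S) + cut_lap n a b) * N + (2 * cut_grad a b + cut_lap n a b) * \<delta>))"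
    proof (rule mult_left_mono)
      have "eLnorm n p ?S ?h \<le> ennreal (2 * b) * eLnorm n 2 ?S ?h"
        by (rule Holder_shell[OF _ _ _ _ _ hm shell_sets subset_refl le_less_trans[OF h]])
          (use n3 p r exp_p_props(5)[OF n3] in auto)
      also have "\<dots> \<le> ennreal (2 * b) * ennreal ((2 * cut_grad a b * (sqrt 2 * S) + cut_lap n a b) * N + (2 * cut_grad a b + cut_lap n a b) * \<delta>)"
        by (rule mult_left_mono[OF h]) simp
      finally show "eLnorm n p ?S ?h \<le> ennreal (2 * b) * ennreal ((2 * cut_grad a b * (sqrt 2 * S) + cut_lap n a b) * N + (2 * cut_grad a b + cut_lap n a b) * \<delta>)" .
    qed simp
    also have "\<dots> = ennreal (a powr (- l) * (2 * b * ((2 * cut_grad a b * (sqrt 2 * S) + cut_lap n a b) * N + (2 * cut_grad a b + cut_lap n a b) * \<delta>)))"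
      using r S g1 g2 N \<delta> by (simp add: ennreal_mult)
    also have "2 * b * ((2 * cut_grad a b * (sqrt 2 * S) + cut_lap n a b) * N + (2 * cut_grad a b + cut_lap n a b) * \<delta>)
      = cutoff_error_const n c a b d * N + 2 * b * (2 * cut_grad a b + cut_lap n a b) * \<delta>"
      by (simp add: cutoff_error_const_def S_def algebra_simps)
    finally show ?case .
  qed
qed

text \<open>\<open>T\<close> is the norm with exponent \<open>p'\<close> of the weighted function
  \<open>\<psi> * U\<close>. Its finiteness, from \<open>regularity\<close>, is what allows the
  potential term to be subtracted. Between the two transition zones \<psi> is one, and undoing the
  weight there turns \<open>T\<close> into a bound for \<open>U\<close>.\<close>

lemma carleman_shell:
  assumes l: "l \<in> carleman_exps n"
    and r: "0 < g1" "g1 < a1" "a1 < b1" "b1 < d1" "d1 < R" "0 < g2" "g2 < a2" "a2 < b2" "b2 < d2" "d2 < R" "b1 \<le> a2"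
  defines "N1 \<equiv> Lnorm n 2 (annulus n g1 d1) U" and "N2 \<equiv> Lnorm n 2 (annulus n g2 d2) U"
  obtains T where "T \<ge> 0"
    "(1 - \<theta> * \<kappa>) * T \<le> \<theta> * (a1 powr (- l) * cutoff_error_const n g1 a1 b1 d1 * N1 + a2 powr (- l) * cutoff_error_const n g2 a2 b2 d2 * N2)"
    "\<And>\<alpha> \<beta>. b1 \<le> \<alpha> \<Longrightarrow> \<alpha> \<le> \<beta> \<Longrightarrow> \<beta> \<le> a2 \<Longrightarrow> eLnorm n 2 (shell n \<alpha> \<beta>) U \<le> ennreal (2 * \<beta> * \<beta> powr l * T)"
proof -
  let ?S = "shell n a1 b2"
  define \<psi> where "\<psi> = ring_cut n a1 b1 a2 b2"
  have abcd: "0 \<le> a1" "a1 < b1" "b1 \<le> a2" "a2 < b2" using r by auto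
  have abcd': "0 < a1" "a1 \<le> b2" "b2 < R" using r by auto
  have lp: "l > 0" by (rule carleman_exps_pos[OF l])
  have \<psi>s: "smooth n \<psi>" unfolding \<psi>_def by (rule smooth_ring_cut)
  have \<psi>1: "\<bar>\<psi> x\<bar> \<le> 1" for x unfolding \<psi>_def by (rule abs_ring_cut_le[OF abcd])
  have \<psi>0: "\<psi> x = 0" if "x \<in> pts n" "x \<notin> ?S" for x
    unfolding \<psi>_def by (rule ring_cut_outside[OF abcd]) (use that in \<open>simp add: shell_def, linarith\<close>)
  have \<psi>m[measurable]: "\<psi> \<in> borel_measurable (leb n)" by (rule smooth_measurable[OF \<psi>s])
  define w where "w = a1 powr (- l)"
  have w: "w \<ge> 0" by (simp add: w_def)
  have wle: "\<bar>weight l x * (\<psi> x * y)\<bar> \<le> w * \<bar>y\<bar>" if x: "x \<in> ?S" for x y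
  proof -
    have "weight l x \<le> w" unfolding w_def by (rule weight_le) (use lp r x in \<open>auto simp: shell_def\<close>)
    moreover have "\<bar>\<psi> x * y\<bar> \<le> \<bar>y\<bar>" using mult_right_mono[OF \<psi>1[of x], of "\<bar>y\<bar>"] by (simp add: abs_mult)
    ultimately have "weight l x * \<bar>\<psi> x * y\<bar> \<le> w * \<bar>y\<bar>" using w by (intro mult_mono) auto
    then show ?thesis by (simp add: abs_mult)
  qed
  have wE: "eLnorm n q UNIV (\<lambda>x. weight l x * (\<psi> x * f x)) \<le> ennreal w * eLnorm n q ?S f"
    if q: "q > 0" and f: "f \<in> borel_measurable (leb n)" for q f
  proof -
    have "eLnorm n q UNIV (\<lambda>x. weight l x * (\<psi> x * f x)) = eLnorm n q ?S (\<lambda>x. weight l x * (\<psi> x * f x))"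
      by (rule eLnorm_UNIV_eq[symmetric]) (simp add: \<psi>0)
    also have "\<dots> \<le> ennreal w * eLnorm n q ?S f"
      by (rule eLnorm_bound_mult[OF q f shell_sets wle w])
    finally show ?thesis .
  qed
  have fT: "eLnorm n p' UNIV (\<lambda>x. weight l x * (\<psi> x * U x)) < \<infinity>"
    by (rule le_less_trans[OF wE[OF p(4) Um]]) (use regularity[OF abcd'] in \<open>simp add: ennreal_mult_less_top\<close>)
  define T where "T = Lnorm n p' UNIV (\<lambda>x. weight l x * (\<psi> x * U x))"
  have T: "eLnorm n p' UNIV (\<lambda>x. weight l x * (\<psi> x * U x)) = ennreal T" "T \<ge> 0"
    using fT by (auto simp: T_def less_top)
  define e1 where "e1 = a1 powr (- l) * cutoff_error_const n g1 a1 b1 d1 * N1"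
  define e2 where "e2 = a2 powr (- l) * cutoff_error_const n g2 a2 b2 d2 * N2"
  define B1 where "B1 = a1 powr (- l) * (2 * b1 * (2 * cut_grad a1 b1 + cut_lap n a1 b1))"
  define B2 where "B2 = a2 powr (- l) * (2 * b2 * (2 * cut_grad a2 b2 + cut_lap n a2 b2))"
  have pos: "e1 \<ge> 0" "e2 \<ge> 0" "B1 \<ge> 0" "B2 \<ge> 0"
    unfolding e1_def e2_def B1_def B2_def N1_def N2_def using r
    by (auto intro!: mult_nonneg_nonneg add_nonneg_nonneg cutoff_error_const_nonneg cut_grad_nonneg cut_lap_nonneg)
  have split: "comm_lap \<psi> k x = comm_lap (cut n a1 b1) k x - comm_lap (cut n a2 b2) k x" if x: "x \<in> pts n" for k x
    unfolding comm_lap_def \<psi>_def ring_cut_def[abs_def] grad_inner_diff_left[OF smooth_cut smooth_cut x] lap_diff[OF smooth_cut smooth_cut x]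
    by (simp add: algebra_simps)
  have TT: "T - \<theta> * \<kappa> * T \<le> \<theta> * (e1 + e2)"
  proof (rule le_of_all_small)
    fix \<delta> :: real assume \<delta>: "\<delta> > 0"
    have ev1: "\<forall>\<^sub>F k in sequentially. eLnorm n p UNIV (\<lambda>x. weight l x * comm_lap (cut n a1 b1) k x) \<le> ennreal (e1 + B1 * \<delta>)"
      using cutoff_error[OF r(1-5) l \<delta>] by (simp add: e1_def B1_def N1_def algebra_simps)
    have ev2: "\<forall>\<^sub>F k in sequentially. eLnorm n p UNIV (\<lambda>x. weight l x * comm_lap (cut n a2 b2) k x) \<le> ennreal (e2 + B2 * \<delta>)"
      using cutoff_error[OF r(6-10) l \<delta>] by (simp add: e2_def B2_def N2_def algebra_simps)
    have ev3: "\<forall>\<^sub>F k in sequentially. eLnorm n p' ?S (\<lambda>x. v k x - U x) \<le> ennreal \<delta>"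
      by (rule ennreal_tendsto_0_eventually_le[OF v_tendsto_shell(1)[OF abcd'] \<delta>])
    have ev4: "\<forall>\<^sub>F k in sequentially. eLnorm n p ?S (\<lambda>x. lap n (v k) x - W x * U x) \<le> ennreal \<delta>"
      by (rule ennreal_tendsto_0_eventually_le[OF lap_v_tendsto[OF abcd'(3)] \<delta>])
    \<comment> \<open>A single large \<open>k\<close> for each \<delta> is enough, since the
      conclusion \<open>TT\<close> does not mention \<open>k\<close>.\<close>
    from eventually_happens'[OF sequentially_bot eventually_conj[OF eventually_conj[OF ev1 ev2] eventually_conj[OF ev3 ev4]]]
    obtain k where k: "eLnorm n p UNIV (\<lambda>x. weight l x * comm_lap (cut n a1 b1) k x) \<le> ennreal (e1 + B1 * \<delta>)"
      "eLnorm n p UNIV (\<lambda>x. weight l x * comm_lap (cut n a2 b2) k x) \<le> ennreal (e2 + B2 * \<delta>)"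
      "eLnorm n p' ?S (\<lambda>x. v k x - U x) \<le> ennreal \<delta>"
      "eLnorm n p ?S (\<lambda>x. lap n (v k) x - W x * U x) \<le> ennreal \<delta>" by blast
    have Ecm[measurable]: "comm_lap (cut n a b) k \<in> borel_measurable (leb n)" for a b by (rule comm_lap_measurable[OF smooth_cut])
    \<comment> \<open>Weight and cutoff stay with \<open>U\<close> in Hoelder's inequality, so that
      \<open>T\<close> itself reappears, with the factor \<kappa>; this makes the absorption
      possible.\<close>
    have A: "eLnorm n p UNIV (\<lambda>x. weight l x * (\<psi> x * (W x * U x))) \<le> ennreal (\<kappa> * T)"
    proof -
      have "eLnorm n p UNIV (\<lambda>x. weight l x * (\<psi> x * (W x * U x))) = eLnorm n p (pts n) (\<lambda>x. W x * (weight l x * (\<psi> x * U x)))"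
        unfolding eLnorm_pts by (rule eLnorm_cong) (simp add: mult_ac)
      also have "\<dots> \<le> ennreal \<kappa> * eLnorm n p' (pts n) (\<lambda>x. weight l x * (\<psi> x * U x))"
        by (rule eLnorm_WU_le) (use fT sets.top[of "leb n"] in \<open>auto simp: eLnorm_pts\<close>)
      also have "\<dots> = ennreal (\<kappa> * T)" unfolding eLnorm_pts T(1) using \<kappa>(1) T(2) by (simp add: ennreal_mult)
      finally show ?thesis .
    qed
    have "ennreal T \<le> eLnorm n p' UNIV (\<lambda>x. weight l x * (\<psi> x * v k x)) + eLnorm n p' UNIV (\<lambda>x. weight l x * (\<psi> x * v k x) - weight l x * (\<psi> x * U x))"
      unfolding T(1)[symmetric] eLnorm_pts[symmetric] by (rule eLnorm_triangle_diff[OF p(6)]) (use sets.top[of "leb n"] in auto)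
    also have "eLnorm n p' UNIV (\<lambda>x. weight l x * (\<psi> x * v k x) - weight l x * (\<psi> x * U x)) = eLnorm n p' UNIV (\<lambda>x. weight l x * (\<psi> x * (v k x - U x)))"
      by (rule eLnorm_cong) (simp add: right_diff_distrib)
    also have "eLnorm n p' UNIV (\<lambda>x. weight l x * (\<psi> x * v k x)) + eLnorm n p' UNIV (\<lambda>x. weight l x * (\<psi> x * (v k x - U x)))
      \<le> ennreal \<theta> * ennreal (\<kappa> * T + w * \<delta> + (e1 + B1 * \<delta>) + (e2 + B2 * \<delta>)) + ennreal w * ennreal \<delta>"
    proof (rule add_mono)
      show "eLnorm n p' UNIV (\<lambda>x. weight l x * (\<psi> x * (v k x - U x))) \<le> ennreal w * ennreal \<delta>"
        by (rule order_trans[OF wE[OF p(4)] mult_left_mono[OF k(3)]]) auto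
      have "eLnorm n p' UNIV (\<lambda>x. weight l x * (\<psi> x * v k x)) \<le> ennreal \<theta> * eLnorm n p UNIV (\<lambda>x. weight l x * (\<psi> x * lap n (v k) x + comm_lap \<psi> k x))"
        by (rule carleman_v[OF l \<psi>s \<psi>0 abcd'(1)])
      also have "\<dots> \<le> ennreal \<theta> * ennreal (\<kappa> * T + w * \<delta> + (e1 + B1 * \<delta>) + (e2 + B2 * \<delta>))"
      proof (rule mult_left_mono)
        let ?f1 = "\<lambda>x. weight l x * (\<psi> x * (W x * U x))"
        let ?f2 = "\<lambda>x. weight l x * (\<psi> x * (lap n (v k) x - W x * U x))"
        let ?f3 = "\<lambda>x. weight l x * comm_lap (cut n a1 b1) k x"
        let ?f4 = "\<lambda>x. weight l x * comm_lap (cut n a2 b2) k x"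
        have "eLnorm n p UNIV (\<lambda>x. weight l x * (\<psi> x * lap n (v k) x + comm_lap \<psi> k x)) = eLnorm n p (pts n) (\<lambda>x. ?f1 x + ?f2 x + ?f3 x + (- 1) * ?f4 x)"
          unfolding eLnorm_pts by (rule eLnorm_cong) (simp add: split algebra_simps)
        also have "\<dots> \<le> eLnorm n p (pts n) (\<lambda>x. ?f1 x + ?f2 x + ?f3 x) + eLnorm n p (pts n) (\<lambda>x. (- 1) * ?f4 x)"
          by (rule eLnorm_triangle[OF p(5)]) (use sets.top[of "leb n"] in auto)
        also have "\<dots> \<le> (eLnorm n p (pts n) (\<lambda>x. ?f1 x + ?f2 x) + eLnorm n p (pts n) ?f3) + eLnorm n p (pts n) (\<lambda>x. (- 1) * ?f4 x)"
          by (rule add_right_mono[OF eLnorm_triangle[OF p(5)]]) (use sets.top[of "leb n"] in auto)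
        also have "\<dots> \<le> (eLnorm n p (pts n) ?f1 + eLnorm n p (pts n) ?f2 + eLnorm n p (pts n) ?f3) + eLnorm n p (pts n) (\<lambda>x. (- 1) * ?f4 x)"
          by (rule add_right_mono[OF add_right_mono[OF eLnorm_triangle[OF p(5)]]]) (use sets.top[of "leb n"] in auto)
        also have "eLnorm n p (pts n) (\<lambda>x. (- 1) * ?f4 x) = eLnorm n p (pts n) ?f4" by (rule eLnorm_cong) simp
        also have "eLnorm n p (pts n) ?f1 + eLnorm n p (pts n) ?f2 + eLnorm n p (pts n) ?f3 + eLnorm n p (pts n) ?f4
          \<le> ennreal (\<kappa> * T) + ennreal w * ennreal \<delta> + ennreal (e1 + B1 * \<delta>) + ennreal (e2 + B2 * \<delta>)"
          unfolding eLnorm_pts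
          by (intro add_mono A k(1,2) order_trans[OF wE[OF p(3)] mult_left_mono[OF k(4)]]) auto
        also have "\<dots> = ennreal (\<kappa> * T + w * \<delta> + (e1 + B1 * \<delta>) + (e2 + B2 * \<delta>))"
          using \<kappa>(1) T(2) w \<delta> pos by (simp add: ennreal_mult[symmetric] ennreal_plus[symmetric] del: ennreal_plus)
        finally show "eLnorm n p UNIV (\<lambda>x. weight l x * (\<psi> x * lap n (v k) x + comm_lap \<psi> k x)) \<le> ennreal (\<kappa> * T + w * \<delta> + (e1 + B1 * \<delta>) + (e2 + B2 * \<delta>))" .
      qed simp
      finally show "eLnorm n p' UNIV (\<lambda>x. weight l x * (\<psi> x * v k x)) \<le> ennreal \<theta> * ennreal (\<kappa> * T + w * \<delta> + (e1 + B1 * \<delta>) + (e2 + B2 * \<delta>))" .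
    qed
    also have "\<dots> = ennreal (\<theta> * (\<kappa> * T + w * \<delta> + (e1 + B1 * \<delta>) + (e2 + B2 * \<delta>)) + w * \<delta>)"
      using \<kappa>(1) T(2) w \<delta> pos theta_pos by (simp add: ennreal_mult[symmetric] ennreal_plus[symmetric] del: ennreal_plus)
    finally have "T \<le> \<theta> * (\<kappa> * T + w * \<delta> + (e1 + B1 * \<delta>) + (e2 + B2 * \<delta>)) + w * \<delta>"
      using \<kappa>(1) T(2) w \<delta> pos theta_pos by (subst (asm) ennreal_le_iff) auto
    then show "T - \<theta> * \<kappa> * T \<le> \<theta> * (e1 + e2) + (\<theta> * (w + B1 + B2) + w) * \<delta>"
      by (simp add: algebra_simps)
  qed
  show ?thesis
  proof (rule that[OF T(2)])
    show "(1 - \<theta> * \<kappa>) * T \<le> \<theta> * (a1 powr (- l) * cutoff_error_const n g1 a1 b1 d1 * N1 + a2 powr (- l) * cutoff_error_const n g2 a2 b2 d2 * N2)"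
      using TT by (simp add: e1_def e2_def left_diff_distrib)
    fix \<alpha> \<beta> assume ab: "b1 \<le> \<alpha>" "\<alpha> \<le> \<beta>" "\<beta> \<le> a2"
    have p: "0 < \<alpha>" "\<alpha> \<le> \<beta>" "\<beta> < R" "0 < \<beta>" using ab r by linarith+
    have mm: "(\<lambda>x. weight l x * (\<psi> x * U x)) \<in> borel_measurable (leb n)" by measurable
    have "eLnorm n p' (shell n \<alpha> \<beta>) U \<le> ennreal (\<beta> powr l) * eLnorm n p' (shell n \<alpha> \<beta>) (\<lambda>x. weight l x * (\<psi> x * U x))"
    proof (rule eLnorm_bound_mult[OF exp_p_props(4)[OF n3] mm shell_sets])
      fix x assume x: "x \<in> pts n" "x \<in> shell n \<alpha> \<beta>"
      then have nx: "nnorm n x > 0" "nnorm n x \<le> \<beta>" "b1 \<le> nnorm n x" "nnorm n x \<le> a2" using ab p by (auto simp: shell_def)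
      have "\<psi> x = 1" unfolding \<psi>_def by (rule ring_cut_inside[OF abcd nx(3,4)])
      moreover have "1 \<le> \<beta> powr l * weight l x"
      proof -
        have "nnorm n x powr l * weight l x = 1" using nx by (simp add: powr_minus)
        moreover have "nnorm n x powr l * weight l x \<le> \<beta> powr l * weight l x" using nx lp by (intro mult_right_mono powr_mono2) auto
        ultimately show ?thesis by simp
      qed
      then have "1 * \<bar>U x\<bar> \<le> \<beta> powr l * weight l x * \<bar>U x\<bar>" by (intro mult_right_mono) auto
      ultimately show "\<bar>U x\<bar> \<le> \<beta> powr l * \<bar>weight l x * (\<psi> x * U x)\<bar>" by (simp add: abs_mult mult.assoc)
    qed simp
    also have "\<dots> \<le> ennreal (\<beta> powr l) * ennreal T"
      unfolding T(1)[symmetric] by (intro mult_left_mono eLnorm_subset_le exp_p_props(4)[OF n3]) auto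
    finally have u: "eLnorm n p' (shell n \<alpha> \<beta>) U \<le> ennreal (\<beta> powr l) * ennreal T" .
    have "eLnorm n 2 (shell n \<alpha> \<beta>) U \<le> ennreal (2 * \<beta>) * eLnorm n p' (shell n \<alpha> \<beta>) U"
      by (rule Holder_shell[OF _ _ _ _ _ Um shell_sets subset_refl regularity[OF p(1-3)]])
        (use n3 p exp_p_props[OF n3] in auto)
    also have "\<dots> \<le> ennreal (2 * \<beta>) * (ennreal (\<beta> powr l) * ennreal T)" by (rule mult_left_mono[OF u]) simp
    also have "\<dots> = ennreal (2 * \<beta> * \<beta> powr l * T)" using p T(2) by (simp add: ennreal_mult mult.assoc)
    finally show "eLnorm n 2 (shell n \<alpha> \<beta>) U \<le> ennreal (2 * \<beta> * \<beta> powr l * T)" .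
  qed
qed

end

text \<open>The radii are those of the three cutoffs in \<open>doubling\<close>, at unit scale and
  in dimension one: the inner one relative to \<rho>, the outer one relative to \<open>r\<close>,
  and its replacement between \<open>r / 4\<close> and \<open>r / 2\<close> for a vanishing
  denominator. The summand \<open>1\<close> makes the constant at least one.\<close>

definition doubling_const :: real where
  "doubling_const = 1 + cutoff_error_const 1 (1/4) (1/2) (3/4) 1 + cutoff_error_const 1 1 2 3 (13/4) + cutoff_error_const 1 (1/4) (3/10) (2/5) (1/2)"

lemma doubling_const: "doubling_const \<ge> 1" "cutoff_error_const 1 (1/4) (1/2) (3/4) 1 \<le> doubling_const"
  "cutoff_error_const 1 1 2 3 (13/4) \<le> doubling_const"
  using cutoff_error_const_nonneg[of "1/4" "1/2" "3/4" 1 1] cutoff_error_const_nonneg[of 1 2 3 "13/4" 1] cutoff_error_const_nonneg[of "1/4" "3/10" "2/5" "1/2" 1]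
  unfolding doubling_const_def by linarith+

lemma ennreal_enn2real_le: "ennreal (enn2real x) \<le> x"
  by (cases x) auto

text \<open>\<open>4 powr l = (9 / 4) powr l * (16 / 9) powr l\<close>: the first factor dominates the logarithm in \<open>lt\<close>,
  the second one is at least \<open>(4 / 3) ^ (n - 1) \<ge> n / 3\<close>.\<close>

lemma exponent_choice:
  fixes r \<rho> h k Q \<kappa>1 :: real
  assumes n3: "n \<ge> 3" and K: "K \<ge> 1" "k = 6 * K" and h: "h \<ge> 1" and \<kappa>1: "\<kappa>1 \<ge> 0" and Q: "Q \<ge> 0"
    and r: "0 < r" "r < 3 / 4" and \<rho>: "0 < \<rho>" "\<rho> < r / 8"
  defines "lt \<equiv> 1 / ln (9 / 4) * ln (1 + 4 * inverse r * k * h * (1 + \<kappa>1) * Q)"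
  defines "lb \<equiv> 2 + max (lt + 1) (8 + 1 / 2 + (real n - 2) / 2)"
  shows "\<exists>l\<in>carleman_exps n. 2 * h * K * real n * Q \<le> 4 powr l \<and>
     1 + 8 * h * K * real n * 4 powr l \<le> \<rho> powr (- lb) * (k * h * (1 + \<kappa>1) * lb\<^sup>2)"
proof -
  define t where "t = 1 + 4 * inverse r * k * h * (1 + \<kappa>1) * Q"
  have t: "t \<ge> 1 + k * h * Q"
  proof -
    have "1 \<le> 4 * inverse r" using r by (simp add: field_simps)
    then have "1 * (k * h * Q) * 1 \<le> (4 * inverse r) * (k * h * Q) * (1 + \<kappa>1)"
      using K h \<kappa>1 Q r by (intro mult_mono mult_nonneg_nonneg) auto
    then show ?thesis by (simp add: t_def mult_ac)
  qed
  have khQ: "k * h * Q \<ge> 0" using K h Q by simp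
  have lt: "lt \<ge> 0" "(9 / 4) powr lt = t"
  proof -
    have e: "lt = ln t / ln (9 / 4)" by (simp add: lt_def t_def)
    show "lt \<ge> 0" using t khQ unfolding e by (intro divide_nonneg_nonneg ln_ge_zero) auto
    show "(9 / 4) powr lt = t" using t khQ unfolding e powr_def by simp
  qed
  \<comment> \<open>The least natural number for which \<open>l\<close> reaches \<open>lt\<close>.
    Starting at \<open>(n - 1) / 2\<close> keeps \<open>l\<close> admissible and large enough for
    the Bernoulli bound; rounding up adds less than one, which the summands of \<open>lb\<close>
    accommodate.\<close>
  define m where "m = nat \<lceil>max 0 (lt - (real n - 1) / 2)\<rceil>"
  define l where "l = (real n - 1) / 2 + real m"
  have m: "real m \<ge> lt - (real n - 1) / 2" "real m < max 0 (lt - (real n - 1) / 2) + 1"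
    unfolding m_def by linarith+
  have l: "l \<in> carleman_exps n" unfolding l_def by (rule carleman_exps_mem[OF n3])
  have l1: "l \<ge> lt" "l \<ge> (real n - 1) / 2" using m by (auto simp: l_def)
  have l2: "l \<le> lb" using m(2) unfolding l_def lb_def by (simp add: max_def field_simps split: if_splits)
  have four: "4 powr l \<ge> t * (real n / 3)"
  proof -
    have "(16 / 9 :: real) powr ((real n - 1) / 2) = (4 / 3) ^ (n - 1)"
    proof -
      have "(16 / 9 :: real) powr ((real n - 1) / 2) = ((16 / 9) powr (1 / 2)) powr (real (n - 1))"
        using n3 by (simp add: powr_powr of_nat_diff)
      also have "(16 / 9 :: real) powr (1 / 2) = 4 / 3"
        by (simp add: powr_half_sqrt real_sqrt_divide)
      finally show ?thesis by (simp add: powr_realpow)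
    qed
    moreover have "(4 / 3 :: real) ^ (n - 1) \<ge> 1 + real (n - 1) * (1 / 3)"
      using Bernoulli_inequality[of "1/3 :: real" "n - 1"] by simp
    ultimately have a: "(16 / 9 :: real) powr ((real n - 1) / 2) \<ge> real n / 3" using n3 of_nat_diff[of 1 n, where ?'a = real] by linarith
    have "(4::real) powr l = (9 / 4) powr l * (16 / 9) powr l" by (simp add: powr_mult[symmetric])
    also have "\<dots> \<ge> (9 / 4) powr lt * (16 / 9) powr ((real n - 1) / 2)"
      by (intro mult_mono powr_mono l1) auto
    also have "(9 / 4) powr lt * (16 / 9) powr ((real n - 1) / 2) \<ge> t * (real n / 3)"
      unfolding lt(2) using a t khQ by (intro mult_left_mono) auto
    finally show ?thesis .
  qed
  have kdiff: "2 * h * K * real n * Q \<le> 4 powr l"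
  proof -
    \<comment> \<open>This is one origin of \<open>k = 6 * K\<close>: a third of \<open>k\<close> is
      \<open>2 * K\<close>.\<close>
    have "2 * h * K * real n * Q = (k * h * Q) * (real n / 3)" by (simp add: K(2))
    also have "\<dots> \<le> t * (real n / 3)" using t by (intro mult_right_mono) auto
    finally show ?thesis using four by linarith
  qed
  have l4: "(4::real) powr l \<ge> 1" using l by (intro ge_one_powr_ge_zero) (auto simp: carleman_exps_def)
  \<comment> \<open>The square of \<open>lb\<close> pays for the factor \<open>n\<close>: the mixed
    term of \<open>(n / 2 + 9)^2\<close> is already \<open>9 * n\<close>.\<close>
  have lbn: "lb\<^sup>2 \<ge> 2 * real n"
  proof -
    have "lb \<ge> 2 + (8 + 1 / 2 + (real n - 2) / 2)" unfolding lb_def by simp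
    then have b: "lb \<ge> real n / 2 + 9" by (simp add: field_simps)
    then have "(real n / 2 + 9)\<^sup>2 \<le> lb\<^sup>2" by (intro power_mono) auto
    moreover have "(real n / 2 + 9)\<^sup>2 = 9 * real n + 81 + (real n / 2)\<^sup>2" by (simp add: power2_sum)
    ultimately show ?thesis using zero_le_power2[of "real n / 2"] by linarith
  qed
  have lb0: "lb \<ge> 0" using lt by (simp add: lb_def)
  \<comment> \<open>As \<open>\<rho> < 3 / 32\<close>, its reciprocal exceeds four, and
    \<open>l \<le> lb\<close> compares the exponents.\<close>
  have \<rho>4: "\<rho> powr (- lb) \<ge> 4 powr l"
  proof -
    have "4 powr l \<le> (4::real) powr lb" using l2 by (intro powr_mono) auto
    also have "\<dots> \<le> (inverse \<rho>) powr lb"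
    proof (rule powr_mono2[OF lb0])
      have "\<rho> \<le> 1 / 4" using \<rho> r by linarith
      then show "4 \<le> inverse \<rho>" using \<rho> by (simp add: field_simps)
    qed simp
    also have "\<dots> = \<rho> powr (- lb)" using \<rho> by (simp add: powr_minus inverse_powr)
    finally show ?thesis .
  qed
  have "1 + 8 * h * K * real n * 4 powr l \<le> (9 * h * K * real n) * 4 powr l"
  proof -
    have "1 * 1 * 1 * 1 \<le> h * K * real n * 4 powr l" using h K n3 l4 by (intro mult_mono) auto
    then show ?thesis by (simp add: mult_ac)
  qed
  also have "\<dots> \<le> (k * h * (1 + \<kappa>1) * lb\<^sup>2) * \<rho> powr (- lb)"
  proof (rule mult_mono)
    have "(9 / 2 * h * K) * (2 * real n) \<le> (k * h * (1 + \<kappa>1)) * lb\<^sup>2"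
    proof (rule mult_mono[OF _ lbn])
      have "(9 / 2 * h * K) * 1 \<le> (6 * h * K) * (1 + \<kappa>1)" using h K \<kappa>1 by (intro mult_mono) auto
      then show "9 / 2 * h * K \<le> k * h * (1 + \<kappa>1)" by (simp add: K(2) mult_ac)
    qed (use K h \<kappa>1 in auto)
    then show "9 * h * K * real n \<le> k * h * (1 + \<kappa>1) * lb\<^sup>2" by (simp add: mult_ac)
  qed (use \<rho>4 K h \<kappa>1 in auto)
  finally have "1 + 8 * h * K * real n * 4 powr l \<le> \<rho> powr (- lb) * (k * h * (1 + \<kappa>1) * lb\<^sup>2)" by (simp add: mult_ac)
  with l kdiff show ?thesis by blast
qed

context weak_solution
begin

text \<open>If \<open>Q = 0\<close>, where Isabelle's \<open>N / Q\<close> is \<open>0\<close>, the outer edge of the cutoff is placed in the annulus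
  on which \<open>U\<close> vanishes.\<close>

lemma doubling:
  assumes R4: "R = 4 * r" and r: "0 < r" and \<rho>: "0 < \<rho>" "\<rho> < r / 8" and l: "l \<in> carleman_exps n"
  defines "h \<equiv> \<theta> / (1 - \<theta> * \<kappa>)"
    and "N \<equiv> Lnorm n 2 (annulus n r (13 * r / 4)) U" and "Q \<equiv> Lnorm n 2 (annulus n (r / 4) (r / 2)) U"
  assumes big: "2 * h * doubling_const * real n * (N / Q) \<le> 4 powr l"
  shows "eLnorm n 2 (nball n (origin n) (2 * \<rho>)) U
    \<le> ennreal (1 + 8 * h * doubling_const * real n * 4 powr l) * eLnorm n 2 (nball n (origin n) \<rho>) U"
proof -
  let ?K = "doubling_const"
  define A where "A = Lnorm n 2 (annulus n (\<rho> * (1/4)) (\<rho> * 1)) U"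
  have A: "A \<ge> 0" by (simp add: A_def)
  have n1: "n \<ge> 1" using n3 by simp
  have h: "h \<ge> 0" unfolding h_def using theta_pos \<kappa>(3) by simp
  define e where "e = cutoff_error_const n (\<rho> * (1/4)) (\<rho> * (1/2)) (\<rho> * (3/4)) (\<rho> * 1)"
  have e: "e \<le> real n * ?K / \<rho>" "e \<ge> 0"
  proof -
    have "e \<le> real n * cutoff_error_const 1 (1/4) (1/2) (3/4) 1 / \<rho>" unfolding e_def by (rule cutoff_error_const_le) (use n1 \<rho> in auto)
    also have "\<dots> \<le> real n * ?K / \<rho>" using doubling_const(2) \<rho> by (intro divide_right_mono mult_left_mono) auto
    finally show "e \<le> real n * ?K / \<rho>" .
    show "e \<ge> 0" unfolding e_def by (rule cutoff_error_const_nonneg) (use \<rho> in auto)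
  qed
  \<comment> \<open>A bound for the inner error, with its weight at radius \<open>\<rho> / 2\<close>
    and the factor \<open>1 / \<rho>\<close> from scaling; in both cases below \<open>T\<close> is
    at most twice this.\<close>
  define M where "M = h * (real n * ?K / \<rho>) * (\<rho> / 2) powr (- l) * A"
  have M: "M \<ge> 0" unfolding M_def using h \<rho> doubling_const(1) A by (intro mult_nonneg_nonneg) auto
  have ediv: "T \<le> h * s" if "(1 - \<theta> * \<kappa>) * T \<le> \<theta> * s" for T s
    using that \<kappa>(3) unfolding h_def by (simp add: field_simps)
  have eM: "h * ((\<rho> * (1/2)) powr (- l) * e * A) \<le> M"
  proof -
    have "h * ((\<rho> * (1/2)) powr (- l) * e * A) = (h * (\<rho> / 2) powr (- l) * A) * e" by simp
    also have "\<dots> \<le> (h * (\<rho> / 2) powr (- l) * A) * (real n * ?K / \<rho>)" using h A by (intro mult_left_mono e) auto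
    finally show ?thesis by (simp add: M_def mult_ac)
  qed
  have "\<exists>T. 0 \<le> T \<and> T \<le> 2 * M \<and> eLnorm n 2 (shell n \<rho> (2 * \<rho>)) U \<le> ennreal (2 * (2 * \<rho>) * (2 * \<rho>) powr l * T)"
  proof (cases "Q = 0")
    case True
    \<comment> \<open>The radius \<open>r * (3/10)\<close> stays above \<open>2 * \<rho>\<close>,
      which is less than \<open>r / 4\<close>, so the shell between \<rho> and
      \<open>2 * \<rho>\<close> still lies where the cutoff is one.\<close>
    have rr: "0 < \<rho> * (1/4)" "\<rho> * (1/4) < \<rho> * (1/2)" "\<rho> * (1/2) < \<rho> * (3/4)" "\<rho> * (3/4) < \<rho> * 1" "\<rho> * 1 < R"
      "0 < r / 4" "r / 4 < r * (3/10)" "r * (3/10) < r * (2/5)" "r * (2/5) < r / 2" "r / 2 < R" "\<rho> * (3/4) \<le> r * (3/10)"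
      using r \<rho> R4 by auto
    obtain T where T: "T \<ge> 0"
      "(1 - \<theta> * \<kappa>) * T \<le> \<theta> * ((\<rho> * (1/2)) powr (- l) * e * A + (r * (3/10)) powr (- l) * cutoff_error_const n (r / 4) (r * (3/10)) (r * (2/5)) (r / 2) * Q)"
      "\<And>\<alpha> \<beta>. \<rho> * (3/4) \<le> \<alpha> \<Longrightarrow> \<alpha> \<le> \<beta> \<Longrightarrow> \<beta> \<le> r * (3/10) \<Longrightarrow> eLnorm n 2 (shell n \<alpha> \<beta>) U \<le> ennreal (2 * \<beta> * \<beta> powr l * T)"
      by (rule carleman_shell[OF l rr, folded e_def A_def Q_def]) (rule that)
    have "T \<le> h * ((\<rho> * (1/2)) powr (- l) * e * A)" using ediv[OF T(2)] True by simp
    then have "T \<le> 2 * M" using eM M by linarith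
    moreover have "eLnorm n 2 (shell n \<rho> (2 * \<rho>)) U \<le> ennreal (2 * (2 * \<rho>) * (2 * \<rho>) powr l * T)"
      by (rule T(3)) (use \<rho> in auto)
    ultimately show ?thesis using T(1) by blast
  next
    case False
    then have Q: "Q > 0" unfolding Q_def using enn2real_nonneg less_eq_real_def by metis
    have N: "N \<ge> 0" by (simp add: N_def)
    have rr: "0 < \<rho> * (1/4)" "\<rho> * (1/4) < \<rho> * (1/2)" "\<rho> * (1/2) < \<rho> * (3/4)" "\<rho> * (3/4) < \<rho> * 1" "\<rho> * 1 < R"
      "0 < r" "r < 2 * r" "2 * r < 3 * r" "3 * r < 13 * r / 4" "13 * r / 4 < R" "\<rho> * (3/4) \<le> 2 * r"
      using r \<rho> R4 by auto
    define f where "f = cutoff_error_const n r (2 * r) (3 * r) (13 * r / 4)"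
    obtain T where T: "T \<ge> 0"
      "(1 - \<theta> * \<kappa>) * T \<le> \<theta> * ((\<rho> * (1/2)) powr (- l) * e * A + (2 * r) powr (- l) * f * N)"
      "\<And>\<alpha> \<beta>. \<rho> * (3/4) \<le> \<alpha> \<Longrightarrow> \<alpha> \<le> \<beta> \<Longrightarrow> \<beta> \<le> 2 * r \<Longrightarrow> eLnorm n 2 (shell n \<alpha> \<beta>) U \<le> ennreal (2 * \<beta> * \<beta> powr l * T)"
      by (rule carleman_shell[OF l rr, folded e_def A_def N_def f_def]) (rule that)
    have f: "f \<le> real n * ?K / r"
    proof -
      have "f = cutoff_error_const n (r * 1) (r * 2) (r * 3) (r * (13 / 4))" by (simp add: f_def mult.commute)
      also have "\<dots> \<le> real n * cutoff_error_const 1 1 2 3 (13/4) / r" by (rule cutoff_error_const_le) (use n1 r in auto)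
      also have "\<dots> \<le> real n * ?K / r" using doubling_const(3) r by (intro divide_right_mono mult_left_mono) auto
      finally show ?thesis .
    qed
    \<comment> \<open>\<open>T\<close> dominates the denominator \<open>Q\<close>: between
      \<open>r / 4\<close> and \<open>r / 2\<close> the cutoff is one and the weight at least
      \<open>(r / 2) powr (- l)\<close>.\<close>
    have QT: "Q \<le> r * (r / 2) powr l * T"
    proof -
      have "ennreal Q \<le> eLnorm n 2 (annulus n (r / 4) (r / 2)) U" unfolding Q_def by (rule ennreal_enn2real_le)
      also have "\<dots> \<le> eLnorm n 2 (shell n (r / 4) (r / 2)) U" by (rule eLnorm_subset_le[OF _ annulus_subset_shell]) simp
      also have "\<dots> \<le> ennreal (2 * (r / 2) * (r / 2) powr l * T)" by (rule T(3)) (use r \<rho> in auto)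
      finally show ?thesis using r T(1) by (subst (asm) ennreal_le_iff) auto
    qed
    have "2 * (h * ((2 * r) powr (- l) * f * N)) \<le> T"
    proof -
      \<comment> \<open>The quotient of the weights at \<open>r / 2\<close> and \<open>2 * r\<close>
        is exactly the \<open>4 powr l\<close> in \<open>big\<close>; hence the outer error is at
        most half of \<open>T\<close>.\<close>
      have c: "(2 * r) powr (- l) * 4 powr l * (r / 2) powr l = 1"
      proof -
        have "4 powr l * (r / 2) powr l = (2 * r) powr l" using r by (simp add: powr_mult[symmetric])
        then show ?thesis using r by (simp add: powr_minus mult.assoc)
      qed
      have "2 * (h * ((2 * r) powr (- l) * f * N)) = (2 * h * (2 * r) powr (- l) * N) * f" by simp
      also have "\<dots> \<le> (2 * h * (2 * r) powr (- l) * N) * (real n * ?K / r)" using h N by (intro mult_left_mono f) auto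
      also have "\<dots> = ((2 * r) powr (- l) / r) * ((2 * h * ?K * real n * (N / Q)) * Q)" using Q by simp
      also have "\<dots> \<le> ((2 * r) powr (- l) / r) * (4 powr l * (r * (r / 2) powr l * T))"
        by (intro mult_left_mono mult_mono big QT) (use r Q in auto)
      also have "\<dots> = ((2 * r) powr (- l) * 4 powr l * (r / 2) powr l) * T" using r by simp
      finally show ?thesis unfolding c by simp
    qed
    moreover have "T \<le> h * ((\<rho> * (1/2)) powr (- l) * e * A) + h * ((2 * r) powr (- l) * f * N)"
      using ediv[OF T(2)] by (simp only: distrib_left)
    ultimately have "T \<le> 2 * M" using eM by linarith
    moreover have "eLnorm n 2 (shell n \<rho> (2 * \<rho>)) U \<le> ennreal (2 * (2 * \<rho>) * (2 * \<rho>) powr l * T)"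
      by (rule T(3)) (use r \<rho> in auto)
    ultimately show ?thesis using T(1) by blast
  qed
  then obtain T where T: "0 \<le> T" "T \<le> 2 * M" "eLnorm n 2 (shell n \<rho> (2 * \<rho>)) U \<le> ennreal (2 * (2 * \<rho>) * (2 * \<rho>) powr l * T)" by blast
  let ?B = "nball n (origin n)"
  \<comment> \<open>The factors \<open>4 * \<rho>\<close> and \<open>2 * M\<close> make up the
    constant eight, and \<rho> cancels the \<open>1 / \<rho>\<close> in \<open>M\<close>.\<close>
  have "2 * (2 * \<rho>) * (2 * \<rho>) powr l * T \<le> 2 * (2 * \<rho>) * (2 * \<rho>) powr l * (2 * M)"
    using \<rho> T by (intro mult_left_mono) auto
  also have "\<dots> = 8 * h * ?K * real n * ((2 * \<rho>) powr l * (\<rho> / 2) powr (- l)) * A"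
    using \<rho> by (simp add: M_def)
  also have "(2 * \<rho>) powr l * (\<rho> / 2) powr (- l) = 4 powr l"
  proof -
    have "4 powr l * (\<rho> / 2) powr l = (2 * \<rho>) powr l" using \<rho> by (simp add: powr_mult[symmetric])
    then show ?thesis using \<rho> by (simp add: powr_minus field_simps)
  qed
  finally have q: "2 * (2 * \<rho>) * (2 * \<rho>) powr l * T \<le> 8 * h * ?K * real n * 4 powr l * A" .
  have c: "8 * h * ?K * real n * 4 powr l \<ge> 0" using h doubling_const(1) by simp
  have AB: "ennreal A \<le> eLnorm n 2 (?B \<rho>) U"
  proof -
    have "ennreal A \<le> eLnorm n 2 (annulus n (\<rho> * (1/4)) (\<rho> * 1)) U" unfolding A_def by (rule ennreal_enn2real_le)
    also have "\<dots> \<le> eLnorm n 2 (?B \<rho>) U"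
      by (rule eLnorm_subset_le) (simp, rule subsetI, simp add: annulus_def nball_origin)
    finally show ?thesis .
  qed
  \<comment> \<open>The smaller ball contributes the summand \<open>1\<close> of the constant; only
    the shell requires the Carleman inequality.\<close>
  have "?B (2 * \<rho>) \<subseteq> ?B \<rho> \<union> shell n \<rho> (2 * \<rho>)"
    by (rule subsetI) (simp add: nball_origin shell_def, linarith)
  then have "eLnorm n 2 (?B (2 * \<rho>)) U \<le> eLnorm n 2 (?B \<rho> \<union> shell n \<rho> (2 * \<rho>)) U" by (rule eLnorm_subset_le[rotated]) simp
  also have "\<dots> \<le> eLnorm n 2 (?B \<rho>) U + eLnorm n 2 (shell n \<rho> (2 * \<rho>)) U"
    by (rule eLnorm_union_le) auto
  also have "\<dots> \<le> eLnorm n 2 (?B \<rho>) U + ennreal (8 * h * ?K * real n * 4 powr l) * eLnorm n 2 (?B \<rho>) U"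
  proof (rule add_left_mono)
    have "eLnorm n 2 (shell n \<rho> (2 * \<rho>)) U \<le> ennreal (8 * h * ?K * real n * 4 powr l * A)"
      by (rule order_trans[OF T(3) ennreal_leI[OF q]])
    also have "\<dots> = ennreal (8 * h * ?K * real n * 4 powr l) * ennreal A" by (rule ennreal_mult[OF c A])
    also have "\<dots> \<le> ennreal (8 * h * ?K * real n * 4 powr l) * eLnorm n 2 (?B \<rho>) U" by (rule mult_left_mono[OF AB]) simp
    finally show "eLnorm n 2 (shell n \<rho> (2 * \<rho>)) U \<le> ennreal (8 * h * ?K * real n * 4 powr l) * eLnorm n 2 (?B \<rho>) U" .
  qed
  also have "\<dots> = ennreal (1 + 8 * h * ?K * real n * 4 powr l) * eLnorm n 2 (?B \<rho>) U"
    using c by (simp add: ennreal_plus distrib_right)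
  finally show ?thesis .
qed

end

section \<open>Translation to the centre of the balls\<close>

abbreviation neg :: "nat \<Rightarrow> point \<Rightarrow> point" where
  "neg n a \<equiv> reflect n (origin n) a"

lemma shift_neg: "x \<in> pts n \<Longrightarrow> shift n (neg n a) (shift n a x) = x" "x \<in> pts n \<Longrightarrow> shift n a (shift n (neg n a) x) = x"
  by (rule pts_eqI[of _ n]; simp)+

lemma shift_upd: "i < n \<Longrightarrow> x \<in> pts n \<Longrightarrow> shift n a (x(i := t)) = (shift n a x)(i := a i + t)"
  by (rule pts_eqI[of _ n]) simp_all

lemma ndist_shift: "ndist n a (shift n a y) = nnorm n y"
  by (simp add: ndist_def nnorm_def L2_set_def)

lemma continuous_shift: "continuous_map (euc n) (euc n) (shift n a)"
  unfolding shift_def continuous_map_componentwise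
  by (auto intro!: continuous_map_add continuous_coord)

lemma integrable_shift:
  fixes f :: "point \<Rightarrow> real"
  shows "integrable (leb n) f \<Longrightarrow> integrable (leb n) (\<lambda>x. f (shift n a x))"
  using integrable_distr[of "shift n a" "leb n" "leb n" f] by (simp add: distr_shift)

lemma eLnorm_shift:
  assumes f: "f \<in> borel_measurable (leb n)" and S: "S \<in> sets (leb n)"
  shows "eLnorm n q {y \<in> pts n. shift n a y \<in> S} (\<lambda>y. f (shift n a y)) = eLnorm n q S f"
proof -
  have "powr_integral n q {y \<in> pts n. shift n a y \<in> S} (\<lambda>y. f (shift n a y)) = (\<integral>\<^sup>+y. ennreal (\<bar>f (shift n a y)\<bar> powr q) * indicator S (shift n a y) \<partial>leb n)"
    by (rule nn_integral_cong) (simp add: indicator_def)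
  also have "\<dots> = powr_integral n q S f"
    by (rule nn_integral_shift[of "\<lambda>x. ennreal (\<bar>f x\<bar> powr q) * indicator S x"]) (use f S in measurable)
  finally show ?thesis by (simp add: eLnorm_def)
qed

lemma deriv_translate: "deriv (\<lambda>t. f (c + t)) t = deriv f (c + t)" for f :: "real \<Rightarrow> real"
  unfolding deriv_def using DERIV_shift[of f _ t c] by (simp add: add.commute)

lemma iter_pderiv_shift:
  assumes "set is \<subseteq> {..<n}" "x \<in> pts n"
  shows "iter_pderiv is (\<lambda>x. f (shift n a x)) x = iter_pderiv is f (shift n a x)"
  using assms
proof (induction "is" arbitrary: x)
  case (Cons i "is")
  then have i: "i < n" by simp
  have "iter_pderiv (i # is) (\<lambda>x. f (shift n a x)) x = pderiv_at i (\<lambda>x. iter_pderiv is f (shift n a x)) x"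
    unfolding iter_pderiv.simps by (rule pderiv_cong) (use Cons i in auto)
  also have "\<dots> = deriv (\<lambda>t. iter_pderiv is f ((shift n a x)(i := a i + t))) (x i)"
    by (simp add: pderiv_at_def shift_upd[OF i Cons.prems(2)])
  also have "\<dots> = pderiv_at i (iter_pderiv is f) (shift n a x)"
    unfolding pderiv_at_def using deriv_translate[of "\<lambda>s. iter_pderiv is f ((shift n a x)(i := s))" "a i" "x i"] i by simp
  finally show ?case by simp
qed simp

lemma smooth_shift:
  assumes f: "smooth n f"
  shows "smooth n (\<lambda>x. f (shift n a x))"
  unfolding smooth_def
proof (intro allI impI conjI ballI)
  fix "is" :: "nat list" assume s: "set is \<subseteq> {..<n}"
  have f': "continuous_map (euc n) euclideanreal (iter_pderiv is f)"
    "\<And>i x. i < n \<Longrightarrow> x \<in> pts n \<Longrightarrow> (\<lambda>t. iter_pderiv is f (x(i := t))) differentiable at (x i)"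
    using f s unfolding smooth_def by auto
  show "continuous_map (euc n) euclideanreal (iter_pderiv is (\<lambda>x. f (shift n a x)))"
    using continuous_map_compose[OF continuous_shift f'(1), of a] iter_pderiv_shift[OF s, of _ f a]
    by (subst continuous_map_cong_pts[of n _ "iter_pderiv is f \<circ> shift n a"]) simp_all
  fix i x assume i: "i < n" and x: "x \<in> pts n"
  let ?g = "\<lambda>s. iter_pderiv is f ((shift n a x)(i := s))"
  have "?g differentiable at (a i + x i)" using f'(2)[OF i shift_in_pts, of a x] i by simp
  then have "(?g has_real_derivative deriv ?g (a i + x i)) (at (x i + a i))"
    by (simp add: DERIV_deriv_iff_real_differentiable add.commute)
  then have "((\<lambda>t. ?g (t + a i)) has_real_derivative deriv ?g (a i + x i)) (at (x i))" by (simp only: DERIV_shift)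
  then have "(\<lambda>t. ?g (t + a i)) differentiable at (x i)" using real_differentiable_def by blast
  moreover have "(\<lambda>t. iter_pderiv is (\<lambda>x. f (shift n a x)) (x(i := t))) = (\<lambda>t. ?g (t + a i))"
    by (rule ext) (simp add: iter_pderiv_shift[OF s upd_in_pts[OF x i]] shift_upd[OF i x] add.commute)
  ultimately show "(\<lambda>t. iter_pderiv is (\<lambda>x. f (shift n a x)) (x(i := t))) differentiable at (x i)" by simp
qed

lemma test_fun_shift:
  assumes "\<phi> \<in> test_fun n \<Omega>" "\<And>x. x \<in> \<Omega> \<Longrightarrow> shift n a x \<in> \<Omega>'"
  shows "(\<lambda>x. \<phi> (shift n (neg n a) x)) \<in> test_fun n \<Omega>'"
proof -
  obtain K where K: "smooth n \<phi>" "compactin (euc n) K" "K \<subseteq> \<Omega>" "\<And>x. x \<in> pts n \<Longrightarrow> x \<notin> K \<Longrightarrow> \<phi> x = 0"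
    using test_funE[OF assms(1)] by metis
  show ?thesis unfolding test_fun_def
  proof (intro CollectI conjI exI[of _ "shift n a ` K"] ballI)
    show "smooth n (\<lambda>x. \<phi> (shift n (neg n a) x))" by (rule smooth_shift[OF K(1)])
    show "compactin (euc n) (shift n a ` K)" by (rule image_compactin[OF K(2) continuous_shift])
    show "shift n a ` K \<subseteq> \<Omega>'" using K(3) assms(2) by blast
    fix x assume x: "x \<in> pts n - shift n a ` K"
    have "shift n (neg n a) x \<notin> K"
    proof
      assume "shift n (neg n a) x \<in> K"
      then have "shift n a (shift n (neg n a) x) \<in> shift n a ` K" by (rule imageI)
      then show False using x shift_neg(2)[of x n a] by simp
    qed
    then show "\<phi> (shift n (neg n a) x) = 0" by (rule K(4)[OF shift_in_pts])
  qed
qed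

text \<open>A point of the complement at distance less than \<open>R\<close> from \<open>x0\<close>
  would push the infimum in \<open>inner_set\<close> below \<open>R\<close>.\<close>

lemma inner_set_ball:
  assumes "x0 \<in> inner_set n \<Omega> R" "y \<in> nball n (origin n) R"
  shows "shift n x0 y \<in> \<Omega>"
proof (rule ccontr)
  assume o: "shift n x0 y \<notin> \<Omega>"
  have "(INF z\<in>pts n - \<Omega>. ndist n x0 z) \<le> ndist n x0 (shift n x0 y)"
  proof (rule cINF_lower)
    show "bdd_below (ndist n x0 ` (pts n - \<Omega>))"
      by (rule bdd_belowI2[of _ 0]) (simp add: ndist_def L2_set_nonneg)
    show "shift n x0 y \<in> pts n - \<Omega>" using o by simp
  qed
  then show False using assms by (simp add: inner_set_def ndist_shift nball_origin)
qed

text \<open>Unlike \<open>translate\<close> this vanishes off the ball. When the ball around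
  \<open>x0\<close> lies in \<Omega>, it does not depend on the values of \<open>f\<close> outside
  \<Omega> and is a Borel function on the whole space, as mollification requires.\<close>

definition recenter :: "nat \<Rightarrow> point \<Rightarrow> real \<Rightarrow> (point \<Rightarrow> real) \<Rightarrow> point \<Rightarrow> real" where
  "recenter n x0 R f y = indicator (nball n (origin n) R) y * f (shift n x0 y)"

lemma recenter_outside: "x \<in> pts n \<Longrightarrow> nnorm n x \<ge> R \<Longrightarrow> recenter n x0 R f x = 0"
  by (simp add: recenter_def nball_origin)

lemma eLnorm_translate:
  assumes "S \<subseteq> nball n (origin n) R"
  shows "eLnorm n q S (translate n x0 f) = eLnorm n q S (recenter n x0 R f)"
proof (rule eLnorm_cong)
  fix x assume "x \<in> S"
  then have "x \<in> nball n (origin n) R" using assms by (rule rev_subsetD)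
  then show "\<bar>translate n x0 f x\<bar> = \<bar>recenter n x0 R f x\<bar>" by (simp add: recenter_def translate_def shift_def)
qed

context
  fixes n :: nat and \<Omega> :: "point set" and x0 :: point and R :: real
  assumes \<Omega>: "openin (euc n) \<Omega>" and x0: "x0 \<in> inner_set n \<Omega> R"
begin

lemma \<Omega>_sets [measurable]: "\<Omega> \<in> sets (leb n)"
  by (rule openin_sets[OF \<Omega>])

lemma ball_inside: "nnorm n y < R \<Longrightarrow> y \<in> pts n \<Longrightarrow> shift n x0 y \<in> \<Omega>"
  by (rule inner_set_ball[OF x0]) (simp add: nball_origin)

text \<open>The inserted indicator of \<Omega> has the value one on the ball; with it the right-hand
  side is composed of globally measurable functions.\<close>

lemma recenter_eq: "y \<in> pts n \<Longrightarrow> recenter n x0 R f y = indicator (nball n (origin n) R) y * (indicator \<Omega> (shift n x0 y) * f (shift n x0 y))"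
  using ball_inside[of y] by (cases "y \<in> nball n (origin n) R") (auto simp: recenter_def nball_origin)

lemma recenter_measurable:
  assumes "set_borel_measurable (leb n) \<Omega> f"
  shows "recenter n x0 R f \<in> borel_measurable (leb n)"
proof -
  have f[measurable]: "(\<lambda>x. indicator \<Omega> x * f x) \<in> borel_measurable (leb n)" using assms by (simp add: set_borel_measurable_def)
  have [measurable]: "(\<lambda>y. indicator \<Omega> (shift n x0 y) * f (shift n x0 y)) \<in> borel_measurable (leb n)"
    by (rule measurable_compose[OF measurable_shift f])
  have "(\<lambda>y. indicator (nball n (origin n) R) y * (indicator \<Omega> (shift n x0 y) * f (shift n x0 y))) \<in> borel_measurable (leb n)"
    by measurable
  then show ?thesis by (subst measurable_cong[OF recenter_eq]) simp_all
qed

lemma recenter_eLnorm_le: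
  assumes f: "set_borel_measurable (leb n) \<Omega> f" and q: "q > 0"
  shows "eLnorm n q UNIV (recenter n x0 R f) \<le> eLnorm n q \<Omega> f"
proof -
  let ?g = "\<lambda>x. indicator \<Omega> x * f x"
  have m: "?g \<in> borel_measurable (leb n)" using f by (simp add: set_borel_measurable_def)
  have "eLnorm n q UNIV (recenter n x0 R f) \<le> eLnorm n q {y \<in> pts n. shift n x0 y \<in> pts n} (\<lambda>y. ?g (shift n x0 y))"
    by (rule eLnorm_mono[OF q]) (simp add: recenter_eq abs_mult indicator_def)
  also have "\<dots> = eLnorm n q (pts n) ?g" by (rule eLnorm_shift[OF m]) (use sets.top[of "leb n"] in simp)
  also have "\<dots> = eLnorm n q \<Omega> f" unfolding eLnorm_pts by (rule eLnorm_indicator[OF q]) simp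
  finally show ?thesis .
qed

lemma recenter_ball:
  assumes f: "set_borel_measurable (leb n) \<Omega> f" and s: "s \<le> R" and q: "q > 0"
  shows "eLnorm n q (nball n x0 s) f = eLnorm n q (nball n (origin n) s) (recenter n x0 R f)"
proof -
  let ?g = "\<lambda>x. indicator \<Omega> x * f x"
  have m: "?g \<in> borel_measurable (leb n)" using f by (simp add: set_borel_measurable_def)
  have B: "nball n x0 s \<in> sets (leb n)"
  proof -
    have "nball n x0 s = {y \<in> space (leb n). nnorm n (reflect n x0 y) < s}" by (simp add: nball_def ndist_nnorm)
    also have "\<dots> \<in> sets (leb n)" by measurable
    finally show ?thesis .
  qed
  have sub: "x \<in> \<Omega>" if "x \<in> nball n x0 s" for x
  proof -
    have "x \<in> pts n" "ndist n x0 x < s" using that by (simp_all add: nball_def)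
    then have "nnorm n (shift n (neg n x0) x) < R" using ndist_shift[of n x0 "shift n (neg n x0) x"] shift_neg(2)[of x n x0] s by simp
    then have "shift n x0 (shift n (neg n x0) x) \<in> \<Omega>" by (rule ball_inside) simp
    then show ?thesis using shift_neg(2) \<open>x \<in> pts n\<close> by simp
  qed
  have "eLnorm n q (nball n x0 s) f = eLnorm n q (nball n x0 s) ?g" by (rule eLnorm_cong) (simp add: sub)
  also have "\<dots> = eLnorm n q {y \<in> pts n. shift n x0 y \<in> nball n x0 s} (\<lambda>y. ?g (shift n x0 y))"
    by (rule eLnorm_shift[OF m B, symmetric])
  also have "{y \<in> pts n. shift n x0 y \<in> nball n x0 s} = nball n (origin n) s"
    by (simp add: nball_def ndist_shift ndist_origin)
  also have "eLnorm n q (nball n (origin n) s) (\<lambda>y. ?g (shift n x0 y)) = eLnorm n q (nball n (origin n) s) (recenter n x0 R f)"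
    by (rule eLnorm_cong) (use s in \<open>simp add: recenter_eq nball_origin\<close>)
  finally show ?thesis .
qed

lemma recenter_loc_integrable:
  assumes f: "loc_integrable n \<Omega> f"
  shows "loc_integrable n (nball n (origin n) R) (recenter n x0 R f)"
  unfolding loc_integrable_def
proof (intro conjI allI impI)
  have m: "recenter n x0 R f \<in> borel_measurable (leb n)"
    by (rule recenter_measurable) (use f in \<open>simp add: loc_integrable_def\<close>)
  then show "set_borel_measurable (leb n) (nball n (origin n) R) (recenter n x0 R f)"
    unfolding set_borel_measurable_def by measurable
  fix K assume K: "compactin (euc n) K \<and> K \<subseteq> nball n (origin n) R"
  have "compactin (euc n) (shift n x0 ` K)" using K image_compactin[OF _ continuous_shift] by simp
  moreover have "shift n x0 ` K \<subseteq> \<Omega>"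
  proof (rule image_subsetI)
    fix x assume "x \<in> K"
    then have "x \<in> nball n (origin n) R" using K by (meson subsetD)
    then show "shift n x0 x \<in> \<Omega>" by (intro ball_inside) (simp_all add: nball_origin)
  qed
  ultimately have "integrable (leb n) (\<lambda>y. indicator (shift n x0 ` K) y * f y)" by (rule loc_integrable_indicator[OF f])
  from integrable_shift[OF this, of x0]
  have "integrable (leb n) (\<lambda>y. indicator (shift n x0 ` K) (shift n x0 y) * f (shift n x0 y))" .
  moreover have "indicator (shift n x0 ` K) (shift n x0 y) * f (shift n x0 y) = indicator K y *\<^sub>R recenter n x0 R f y" if y: "y \<in> space (leb n)" for y
  proof (cases "y \<in> K")
    case True
    then have "y \<in> nball n (origin n) R" using K by (meson subsetD)
    then show ?thesis using True by (simp add: recenter_def)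
  next
    case False
    have "shift n x0 y \<notin> shift n x0 ` K"
    proof
      assume "shift n x0 y \<in> shift n x0 ` K"
      then obtain z where z: "z \<in> K" "shift n x0 y = shift n x0 z" by (rule imageE)
      have "z \<in> nball n (origin n) R" using K z by (meson subsetD)
      then have "z = shift n (neg n x0) (shift n x0 z)" by (simp add: shift_neg nball_origin)
      also have "\<dots> = y" unfolding z(2)[symmetric] using y by (simp add: shift_neg)
      finally show False using False z by simp
    qed
    then show ?thesis using False by simp
  qed
  ultimately show "set_integrable (leb n) K (recenter n x0 R f)"
    unfolding set_integrable_def by (subst Bochner_Integration.integrable_cong[OF refl]) auto
qed

text \<open>A test function on the ball becomes one on \<Omega> by translation, and its partial
  derivatives are translated along; the claim is then a change of variables in both
  integrals.\<close>

lemma recenter_weak_deriv: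
  assumes w: "has_weak_deriv n \<Omega> is f g" and s: "set is \<subseteq> {..<n}"
  shows "has_weak_deriv n (nball n (origin n) R) is (recenter n x0 R f) (recenter n x0 R g)"
  unfolding has_weak_deriv_def
proof (intro conjI ballI)
  let ?B = "nball n (origin n) R"
  show "loc_integrable n ?B (recenter n x0 R f)" "loc_integrable n ?B (recenter n x0 R g)"
    using w unfolding has_weak_deriv_def by (auto intro: recenter_loc_integrable)
  fix \<phi> assume \<phi>: "\<phi> \<in> test_fun n ?B"
  define \<psi> where "\<psi> x = \<phi> (shift n (neg n x0) x)" for x
  have \<psi>: "\<psi> \<in> test_fun n \<Omega>" unfolding \<psi>_def[abs_def]
    by (rule test_fun_shift[OF \<phi>]) (rule inner_set_ball[OF x0])
  have ti: "set js \<subseteq> {..<n} \<Longrightarrow> iter_pderiv js \<phi> \<in> test_fun n ?B" for js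
    by (induction js) (use \<phi> test_fun_pderiv in auto)
  have tj: "set js \<subseteq> {..<n} \<Longrightarrow> iter_pderiv js \<psi> \<in> test_fun n \<Omega>" for js
    by (induction js) (use \<psi> test_fun_pderiv in auto)
  \<comment> \<open>A single change of variables serves both sides, with \<open>js\<close> equal to
    \<open>is\<close> and to the empty list.\<close>
  have key: "(LINT x:\<Omega>|leb n. h x * iter_pderiv js \<psi> x) = (LINT y:?B|leb n. recenter n x0 R h y * iter_pderiv js \<phi> y)"
    if h: "loc_integrable n \<Omega> h" and js: "set js \<subseteq> {..<n}" for h js
  proof -
    have hm[measurable]: "(\<lambda>x. indicator \<Omega> x * h x) \<in> borel_measurable (leb n)"
      using h by (simp add: loc_integrable_def set_borel_measurable_def)
    have pm[measurable]: "iter_pderiv js \<psi> \<in> borel_measurable (leb n)" by (rule test_fun_measurable[OF tj[OF js]])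
    let ?F = "\<lambda>x. (indicator \<Omega> x * h x) * iter_pderiv js \<psi> x"
    have Fm: "?F \<in> borel_measurable (leb n)" by measurable
    obtain K where K: "K \<subseteq> ?B" "\<And>x. x \<in> pts n \<Longrightarrow> x \<notin> K \<Longrightarrow> iter_pderiv js \<phi> x = 0"
      using test_funE[OF ti[OF js]] by metis
    have "(LINT x:\<Omega>|leb n. h x * iter_pderiv js \<psi> x) = (LINT x|leb n. ?F x)"
      unfolding set_lebesgue_integral_def by (simp add: mult.assoc)
    also have "\<dots> = (LINT y|leb n. ?F (shift n x0 y))" by (rule integral_shift[OF Fm, symmetric])
    also have "\<dots> = (LINT y:?B|leb n. recenter n x0 R h y * iter_pderiv js \<phi> y)"
      unfolding set_lebesgue_integral_def
    proof (rule Bochner_Integration.integral_cong[OF refl])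
      fix y assume "y \<in> space (leb n)"
      then have y: "y \<in> pts n" by simp
      have e: "iter_pderiv js \<psi> (shift n x0 y) = iter_pderiv js \<phi> y"
        unfolding \<psi>_def[abs_def] using iter_pderiv_shift[OF js shift_in_pts, of \<phi> "neg n x0" x0 y] y by (simp add: shift_neg)
      show "?F (shift n x0 y) = indicator ?B y *\<^sub>R (recenter n x0 R h y * iter_pderiv js \<phi> y)"
      proof (cases "y \<in> ?B")
        case True
        then show ?thesis using y by (simp add: e recenter_eq)
      next
        case False
        then have "y \<notin> K" using K(1) by (meson subsetD)
        then show ?thesis using K(2)[OF y] by (simp add: e)
      qed
    qed
    finally show ?thesis .
  qed
  have eq: "(LINT x:\<Omega>|leb n. f x * iter_pderiv is \<psi> x) = (-1) ^ length is * (LINT x:\<Omega>|leb n. g x * \<psi> x)"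
    using w \<psi> unfolding has_weak_deriv_def by blast
  have fg: "loc_integrable n \<Omega> f" "loc_integrable n \<Omega> g" using w by (simp_all add: has_weak_deriv_def)
  show "(LINT x:?B|leb n. recenter n x0 R f x * iter_pderiv is \<phi> x) = (-1) ^ length is * (LINT x:?B|leb n. recenter n x0 R g x * \<phi> x)"
    using eq key[OF fg(1) s] key[OF fg(2), of "[]"] by simp
qed

text \<open>The supremum in \<open>sob_const\<close> is over functions on \<Omega>, so the test
  function is moved there; its norm and that of its gradient are invariant under
  translation.\<close>

lemma sobolev_test_ball:
  assumes n: "n \<ge> 3" and w: "w \<in> test_fun n (nball n (origin n) R)"
  shows "eLnorm n (exp_p' n) UNIV w \<le> ennreal (sob_const n \<Omega>) * eLnorm n 2 UNIV (grad_len n w)"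
proof -
  let ?w = "\<lambda>x. w (shift n (neg n x0) x)"
  have t: "?w \<in> test_fun n \<Omega>" by (rule test_fun_shift[OF w]) (rule inner_set_ball[OF x0])
  have E: "eLnorm n q UNIV (\<lambda>x. f (shift n a x)) = eLnorm n q UNIV f" if "f \<in> borel_measurable (leb n)" for f q a
    using eLnorm_shift[OF that, of "pts n" q a] sets.top[of "leb n"] by (simp add: eLnorm_pts)
  have g: "eLnorm n 2 UNIV (grad_len n ?w) = eLnorm n 2 UNIV (\<lambda>x. grad_len n w (shift n (neg n x0) x))"
  proof (rule eLnorm_cong)
    fix x assume x: "x \<in> pts n"
    have "pderiv_at i ?w x = pderiv_at i w (shift n (neg n x0) x)" if "i \<in> {..<n}" for i
      using iter_pderiv_shift[of "[i]" n x w "neg n x0"] that x by simp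
    then have "grad_len n ?w x = grad_len n w (shift n (neg n x0) x)" unfolding grad_len_def by (rule L2_set_cong[OF refl])
    then show "\<bar>grad_len n ?w x\<bar> = \<bar>grad_len n w (shift n (neg n x0) x)\<bar>" by simp
  qed
  have "eLnorm n (exp_p' n) UNIV w = eLnorm n (exp_p' n) UNIV ?w" by (rule E[OF test_fun_measurable[OF w], symmetric])
  also have "\<dots> \<le> ennreal (sob_const n \<Omega>) * eLnorm n 2 UNIV (grad_len n ?w)" by (rule sobolev_test[OF n \<Omega> t])
  also have "eLnorm n 2 UNIV (grad_len n ?w) = eLnorm n 2 UNIV (grad_len n w)"
    unfolding g by (rule E[OF measurable_grad_len[OF test_fun_smooth[OF w]]])
  finally show ?thesis .
qed

end

lemma recenter_weak_solution:
  assumes n: "n \<ge> 3" and c: "carleman_const n \<theta>" and \<Omega>: "openin (euc n) \<Omega>" and x0: "x0 \<in> inner_set n \<Omega> R" and R: "R > 0"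
    and V: "V \<in> potentials n \<Omega> \<theta>" and u: "u \<in> sobolev n 2 (exp_p n) \<Omega>"
    and eq: "AE x in leb n. x \<in> \<Omega> \<longrightarrow> - laplacian n \<Omega> u x + V x * u x = 0"
  shows "\<exists>D H. weak_solution n \<theta> (sob_const n \<Omega>) (kap n \<Omega> V) R (recenter n x0 R u) (recenter n x0 R V) D H"
proof -
  let ?r = "recenter n x0 R"
  have p: "exp_p n > 0" by (rule exp_p_props(3)[OF n])
  have "\<exists>g\<in>Lspace n (exp_p n) \<Omega>. has_weak_deriv n \<Omega> [i] u g" if "i < n" for i
    using u that unfolding sobolev_def by simp
  then obtain D where D: "D i \<in> Lspace n (exp_p n) \<Omega>" "has_weak_deriv n \<Omega> [i] u (D i)" if "i < n" for i by metis
  have "\<exists>g\<in>Lspace n (exp_p n) \<Omega>. has_weak_deriv n \<Omega> [i, i] u g" if "i < n" for i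
    using u that unfolding sobolev_def by simp
  then obtain H where H: "H i \<in> Lspace n (exp_p n) \<Omega>" "has_weak_deriv n \<Omega> [i, i] u (H i)" if "i < n" for i by metis
  have m: "?r f \<in> borel_measurable (leb n)" if "f \<in> Lspace n q \<Omega>" for f q
    by (rule recenter_measurable[OF \<Omega> x0]) (use that in \<open>simp add: Lspace_def\<close>)
  have b: "eLnorm n q UNIV (?r f) \<le> eLnorm n q \<Omega> f" "eLnorm n q \<Omega> f < \<infinity>" if "f \<in> Lspace n q \<Omega>" "q > 0" for f q
    using recenter_eLnorm_le[OF \<Omega> x0 _ that(2), of f] that(1) by (simp_all add: Lspace_def)
  have fin: "eLnorm n q UNIV (?r f) < \<infinity>" if "f \<in> Lspace n q \<Omega>" "q > 0" for f q
    by (rule le_less_trans[OF b[OF that]])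
  have uL: "u \<in> Lspace n (exp_p n) \<Omega>" using u by (simp add: sobolev_def)
  have VL: "V \<in> Lspace n (real n / 2) \<Omega>" and Vs: "2 * (sob_const n \<Omega>)\<^sup>2 * kap n \<Omega> V < 1" "\<theta> * kap n \<Omega> V < 1"
    using V by (simp_all add: potentials_def)
  have n2: "real n / 2 > 0" using n by simp
  \<comment> \<open>\<open>laplacian\<close> rests on an arbitrary choice of weak derivatives; by
    uniqueness they agree almost everywhere with the representatives \<open>H i\<close> of finite
    norm.\<close>
  have lap: "AE x in leb n. \<forall>i\<in>{..<n}. x \<in> \<Omega> \<longrightarrow> weak_deriv n \<Omega> [i, i] u x = H i x"
  proof (rule AE_finite_allI)
    fix i assume "i \<in> {..<n}"
    then have i: "i < n" by simp
    show "AE x in leb n. x \<in> \<Omega> \<longrightarrow> weak_deriv n \<Omega> [i, i] u x = H i x"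
      unfolding weak_deriv_def by (rule has_weak_deriv_unique[OF \<Omega> someI[of "has_weak_deriv n \<Omega> [i, i] u", OF H(2)[OF i]] H(2)[OF i]])
  qed simp
  have e: "AE x in leb n. x \<in> \<Omega> \<longrightarrow> (\<Sum>i<n. H i x) = V x * u x"
    using lap eq
  proof eventually_elim
    case (elim x)
    then show ?case by (simp add: laplacian_def)
  qed
  have "weak_solution n \<theta> (sob_const n \<Omega>) (kap n \<Omega> V) R (?r u) (?r V) (\<lambda>i. ?r (D i)) (\<lambda>i. ?r (H i))"
  proof unfold_locales
    show "?r u \<in> borel_measurable (leb n)" "?r V \<in> borel_measurable (leb n)" by (rule m[OF uL], rule m[OF VL])
    show "eLnorm n (exp_p n) UNIV (?r u) < \<infinity>" by (rule fin[OF uL p])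
    \<comment> \<open>Translation preserves null sets, so the equation may be evaluated at the
      translate of \<open>x\<close> by \<open>x0\<close>, which lies in \<Omega>.\<close>
    show "AE x in leb n. nnorm n x < R \<longrightarrow> (\<Sum>i<n. ?r (H i) x) = ?r V x * ?r u x"
      using AE_shift[OF e, of x0] AE_space
    proof eventually_elim
      case (elim x)
      then show ?case using ball_inside[OF \<Omega> x0, of x] by (simp add: recenter_def nball_origin)
    qed
    show "kap n \<Omega> V \<ge> 0" by (simp add: kap_def)
    show "eLnorm n (real n / 2) UNIV (?r V) \<le> ennreal (kap n \<Omega> V)"
      using b[OF VL n2] by (simp add: kap_def less_top)
    show "\<And>w. w \<in> test_fun n (nball n (origin n) R) \<Longrightarrow> eLnorm n (exp_p' n) UNIV w \<le> ennreal (sob_const n \<Omega>) * eLnorm n 2 UNIV (grad_len n w)"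
      by (rule sobolev_test_ball[OF \<Omega> x0 n])
    fix i assume i: "i < n"
    show "has_weak_deriv n (nball n (origin n) R) [i] (?r u) (?r (D i))"
      by (rule recenter_weak_deriv[OF \<Omega> x0 D(2)[OF i]]) (use i in simp)
    show "has_weak_deriv n (nball n (origin n) R) [i, i] (?r u) (?r (H i))"
      by (rule recenter_weak_deriv[OF \<Omega> x0 H(2)[OF i]]) (use i in simp)
    show "?r (D i) \<in> borel_measurable (leb n)" "?r (H i) \<in> borel_measurable (leb n)"
      by (rule m[OF D(1)[OF i]], rule m[OF H(1)[OF i]])
    show "eLnorm n (exp_p n) UNIV (?r (D i)) < \<infinity>" "eLnorm n (exp_p n) UNIV (?r (H i)) < \<infinity>"
      by (rule fin[OF D(1)[OF i] p], rule fin[OF H(1)[OF i] p])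
  qed (use n c R Vs sob_const_nonneg recenter_outside in simp_all)
  then show ?thesis by blast
qed

theorem theorem7p1:
  shows "\<exists>k::real. k > 0 \<and>
    (\<forall>(n::nat) \<theta> \<Omega> r0 r x0 V u \<rho>.
       n \<ge> 3 \<longrightarrow>
       carleman_const n \<theta> \<longrightarrow>
       bounded_lipschitz_domain n \<Omega> \<longrightarrow>
       0 < r0 \<longrightarrow> r0 < 3 / 4 \<longrightarrow> inner_set n \<Omega> (4 * r0) \<noteq> {} \<longrightarrow>
       0 < r \<longrightarrow> r < r0 \<longrightarrow> x0 \<in> inner_set n \<Omega> (4 * r) \<longrightarrow>
       V \<in> potentials n \<Omega> \<theta> \<longrightarrow>
       u \<in> sobolev n 2 (exp_p n) \<Omega> \<longrightarrow>
       \<not> (AE x in leb n. x \<in> \<Omega> \<longrightarrow> u x = 0) \<longrightarrow>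
       (AE x in leb n. x \<in> \<Omega> \<longrightarrow> - laplacian n \<Omega> u x + V x * u x = 0) \<longrightarrow>
       0 < \<rho> \<longrightarrow> \<rho> < r / 8 \<longrightarrow>
       eLnorm n 2 (nball n x0 (2 * \<rho>)) u
       \<le> ennreal (\<rho> powr (- lambda_bar k n \<Omega> \<theta> V r x0 u) * M_const k n \<Omega> \<theta> V r x0 u)
          * eLnorm n 2 (nball n x0 \<rho>) u)"
proof (intro exI[of _ "6 * doubling_const"] conjI allI impI)
  \<comment> \<open>The factor six comes from \<open>exponent_choice\<close>, where
    \<open>k = 6 * K\<close>.\<close>
  show "6 * doubling_const > 0" using doubling_const(1) by simp
  fix n :: nat and \<theta> \<Omega> r0 r x0 V u \<rho>
  assume n: "n \<ge> 3" and c: "carleman_const n \<theta>" and \<Omega>: "bounded_lipschitz_domain n \<Omega>"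
    and r0: "r0 < 3 / 4" and r: "0 < r" "r < r0" and x0: "x0 \<in> inner_set n \<Omega> (4 * r)"
    and V: "V \<in> potentials n \<Omega> \<theta>" and u: "u \<in> sobolev n 2 (exp_p n) \<Omega>"
    and eq: "AE x in leb n. x \<in> \<Omega> \<longrightarrow> - laplacian n \<Omega> u x + V x * u x = 0"
    and \<rho>: "0 < \<rho>" "\<rho> < r / 8"
  let ?U = "recenter n x0 (4 * r) u" and ?B = "nball n (origin n)"
  define h where "h = theta_V n \<Omega> \<theta> V"
  define l1 where "l1 = lambda_bar (6 * doubling_const) n \<Omega> \<theta> V r x0 u"
  define N where "N = Lnorm n 2 (annulus n r (13 * r / 4)) ?U"
  define Q where "Q = Lnorm n 2 (annulus n (r / 4) (r / 2)) ?U"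
  have o: "openin (euc n) \<Omega>" using \<Omega> by (simp add: bounded_lipschitz_domain_def)
  have r4: "4 * r > 0" using r by simp
  obtain D H where ws: "weak_solution n \<theta> (sob_const n \<Omega>) (kap n \<Omega> V) (4 * r) ?U (recenter n x0 (4 * r) V) D H"
    using recenter_weak_solution[OF n c o x0 r4 V u eq] by blast
  have um: "set_borel_measurable (leb n) \<Omega> u" using u by (simp add: sobolev_def Lspace_def)
  have k0: "kap n \<Omega> V \<ge> 0" "\<theta> * kap n \<Omega> V < 1" "\<theta> \<ge> 1" using V c by (simp_all add: kap_def potentials_def carleman_const_def)
  \<comment> \<open>The denominator in \<open>theta_V\<close> is positive and at most one, and
    \<theta> is at least one.\<close>
  have h: "h \<ge> 1"
  proof -
    have "1 - \<theta> * kap n \<Omega> V \<le> \<theta>" using k0 mult_nonneg_nonneg[of \<theta> "kap n \<Omega> V"] by linarith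
    then show ?thesis using k0 by (simp add: h_def theta_V_def)
  qed
  have \<kappa>1: "kap1 n \<Omega> V \<ge> 0"
    unfolding kap1_def I_V_def using k0(1) sob_const_nonneg[of n \<Omega>]
    by (intro add_nonneg_nonneg mult_nonneg_nonneg divide_nonneg_nonneg) simp_all
  have NQ: "N / Q \<ge> 0" by (simp add: N_def Q_def)
  have sub: "annulus n a b \<subseteq> ?B (4 * r)" if "b \<le> 4 * r" for a b
    by (rule subsetI) (use that in \<open>simp add: annulus_def nball_origin\<close>)
  \<comment> \<open>Both annuli lie in the ball of radius \<open>4 * r\<close>, since
    \<open>13 / 4 < 4\<close>; there \<open>translate\<close> and \<open>recenter\<close>
    agree.\<close>
  have tl: "eLnorm n 2 (annulus n r (13 * r / 4)) (translate n x0 u) = eLnorm n 2 (annulus n r (13 * r / 4)) ?U"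
    "eLnorm n 2 (annulus n (r / 4) (r / 2)) (translate n x0 u) = eLnorm n 2 (annulus n (r / 4) (r / 2)) ?U"
    by (rule eLnorm_translate[OF sub], use r in simp)+
  have lb: "l1 = 2 + max (1 / ln (9 / 4) * ln (1 + 4 * inverse r * (6 * doubling_const) * h * (1 + kap1 n \<Omega> V) * (N / Q)) + 1) (8 + 1 / 2 + (real n - 2) / 2)"
    unfolding l1_def lambda_bar_def lambda_tilde_def N_def Q_def h_def
    by (simp only: tl)
  have r34: "r < 3 / 4" using r r0 by simp
  obtain l where l: "l \<in> carleman_exps n" "2 * h * doubling_const * real n * (N / Q) \<le> 4 powr l"
    "1 + 8 * h * doubling_const * real n * 4 powr l \<le> \<rho> powr (- l1) * (6 * doubling_const * h * (1 + kap1 n \<Omega> V) * l1\<^sup>2)"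
    using exponent_choice[OF n doubling_const(1) refl h \<kappa>1 NQ r(1) r34 \<rho>, folded lb] by blast
  have "eLnorm n 2 (nball n x0 (2 * \<rho>)) u = eLnorm n 2 (?B (2 * \<rho>)) ?U"
    by (rule recenter_ball[OF o x0 um]) (use \<rho> r in simp_all)
  also have "\<dots> \<le> ennreal (1 + 8 * h * doubling_const * real n * 4 powr l) * eLnorm n 2 (?B \<rho>) ?U"
    unfolding h_def theta_V_def
    by (rule weak_solution.doubling[OF ws refl r(1) \<rho> l(1)]) (use l(2) in \<open>simp only: h_def theta_V_def N_def Q_def\<close>)
  also have "\<dots> \<le> ennreal (\<rho> powr (- l1) * (6 * doubling_const * h * (1 + kap1 n \<Omega> V) * l1\<^sup>2)) * eLnorm n 2 (?B \<rho>) ?U"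
    by (intro mult_right_mono ennreal_leI l(3)) simp
  also have "6 * doubling_const * h * (1 + kap1 n \<Omega> V) * l1\<^sup>2 = M_const (6 * doubling_const) n \<Omega> \<theta> V r x0 u"
    by (simp add: M_const_def h_def l1_def)
  also have "eLnorm n 2 (?B \<rho>) ?U = eLnorm n 2 (nball n x0 \<rho>) u"
    by (rule recenter_ball[OF o x0 um, symmetric]) (use \<rho> r in simp_all)
  finally show "eLnorm n 2 (nball n x0 (2 * \<rho>)) u \<le> ennreal (\<rho> powr (- lambda_bar (6 * doubling_const) n \<Omega> \<theta> V r x0 u)
      * M_const (6 * doubling_const) n \<Omega> \<theta> V r x0 u) * eLnorm n 2 (nball n x0 \<rho>) u"
    by (simp only: l1_def)
qed

end
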